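(* Let $X=\{P_1=\dots=P_c=0\}\subset\mathbf{P}^N$ be a smooth complete intersection of codimension $c$ and multi-degree $\mathbf{d}=(d_1,\dots,d_c)$. The Koszul complex $\mathcal{K}(\alpha(P_1),\dots,\alpha(P_c))$ induced by the multiplication maps $\alpha(P_i)$ on $(\operatorname{Ker}\delta)_{|X}$ provides a locally free bi-graded resolution of $$\bigoplus_{m\ge c,\ n\in\mathbb{Z}}S^m\Omega_X(m+n).$$ That is, for all $m\ge c$ and $n\in\mathbb{Z}$, the complex of vector bundles on $X$ $$0\to\mathcal{K}_c\to\mathcal{K}_{c-1}\to\dots\to\mathcal{K}_1\to\mathcal{K}_0,\qquad \mathcal{K}_k=\bigoplus_{I\subset\{1,\dots,c\},\,|I|=k}\bigl(\operatorname{Ker}\delta_{m-k,\;n-\sum_{i\in I}(d_i-1)}\bigr)_{|X},$$ with the Koszul differentials given (up to the usual Koszul signs) by the maps $\alpha(P_i)$ from the summand indexed by $I\ni i$ to the summand indexed by $I\setminus\{i\}$, is a locally free resolution of $S^m\Omega_X(m+n)$.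
   Context: Throughout $N\ge2$, and everything is over $\mathbb{C}$. $X_0,\dots,X_N$ are the homogeneous coordinates of $\mathbf{P}^N$, $Y=(Y_0,\dots,Y_N)$ are auxiliary variables, $\mathbb{C}[Y]_m$ is the space of homogeneous polynomials of degree $m$ in $Y$ (zero if $m<0$). Set $\delta=\sum_{i=0}^N X_i\frac{\partial}{\partial Y_i}$, and let $\delta_{m,n}:\mathbb{C}[Y]_m\otimes\mathcal{O}_{\mathbf{P}^N}(n)\to\mathbb{C}[Y]_{m-1}\otimes\mathcal{O}_{\mathbf{P}^N}(n+1)$ be its bi-graded component; $\operatorname{Ker}\delta=\bigoplus_{m\in\mathbb{N},n\in\mathbb{Z}}\operatorname{Ker}\delta_{m,n}$, where $\operatorname{Ker}\delta_{m,n}\simeq S^m\Omega_{\mathbf{P}^N}(m+n)$ is locally free. $P_i\in\mathbb{C}[X_0,\dots,X_N]$ is homogeneous of degree $d_i\ge1$. $\alpha(P_i)$ is multiplication by the bi-homogeneous polynomial $\frac{1}{d_i}(\mathrm{d}P_i)_X(Y)=\frac{1}{d_i}\sum_{j=0}^N\frac{\partial P_i}{\partial X_j}(X)\,Y_j$; since $\delta\circ\alpha(P_i)=P_i\cdot+\alpha(P_i)\circ\delta$, it preserves $(\operatorname{Ker}\delta)_{|X}$, shifting the bi-degree by $(1,d_i-1)$. $\Omega_X$ is the cotangent bundle of $X$ and $(k)$ is the twist by $\mathcal{O}_X(k)$. *)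

theory Defs
  imports
    "HOL-Analysis.Function_Topology"
    "HOL-Algebra.QuotRing"
    "HOL-Algebra.Module"
    "HOL-Library.Poly_Mapping"
    "HOL-Library.Multiset"
    "HOL-Computational_Algebra.Fraction_Field"
begin

section \<open>Constructions on modules\<close>

definition span_submodule :: "('a, 'c) ring_scheme \<Rightarrow> ('a, 'b) module \<Rightarrow> 'b set \<Rightarrow> 'b set" where
  "span_submodule R M S = \<Inter>{H. submodule H R M \<and> S \<subseteq> H}"

text \<open>The components \<^const>\<open>monoid.mult\<close> and \<^const>\<open>one\<close> of the record type of modules carry no meaning
  for a module; they are left undefined throughout.\<close>

definition quot_module :: "('a, 'b) module \<Rightarrow> 'b set \<Rightarrow> ('a, 'b set) module" where
  "quot_module M H =
     \<lparr>carrier = a_rcosets\<^bsub>M\<^esub> H, monoid.mult = undefined, one = undefined, zero = H, add = set_add M,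
      smult = (\<lambda>a C. \<Union>x\<in>C. H +>\<^bsub>M\<^esub> (a \<odot>\<^bsub>M\<^esub> x))\<rparr>"

definition free_module :: "('a, 'c) ring_scheme \<Rightarrow> 'b set \<Rightarrow> ('a, 'b \<Rightarrow> 'a) module" where
  "free_module R A =
     \<lparr>carrier = {f. (\<forall>b. f b \<in> carrier R) \<and> finite {b. f b \<noteq> \<zero>\<^bsub>R\<^esub>} \<and> {b. f b \<noteq> \<zero>\<^bsub>R\<^esub>} \<subseteq> A},
      monoid.mult = undefined, one = undefined, zero = (\<lambda>_. \<zero>\<^bsub>R\<^esub>),
      add = (\<lambda>f g b. f b \<oplus>\<^bsub>R\<^esub> g b), smult = (\<lambda>a f b. a \<otimes>\<^bsub>R\<^esub> f b)\<rparr>"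

definition free_gen :: "('a, 'c) ring_scheme \<Rightarrow> 'b \<Rightarrow> ('b \<Rightarrow> 'a)" where
  "free_gen R b = (\<lambda>b'. if b' = b then \<one>\<^bsub>R\<^esub> else \<zero>\<^bsub>R\<^esub>)"

text \<open>Kaehler differentials \<open>\<Omega>\<^bsub>B/k\<^esub>\<close>: the \<open>B\<close>-module generated by symbols \<open>db\<close>, subject to
  additivity, the Leibniz rule and \<open>da = 0\<close> for \<open>a\<close> in the subring \<open>k\<close> of \<open>B\<close>.\<close>

definition kaehler_relations :: "'a ring \<Rightarrow> 'a set \<Rightarrow> ('a \<Rightarrow> 'a) set" where
  "kaehler_relations B k =
     (let F = free_module B (carrier B); D = free_gen B in
        {D (a \<oplus>\<^bsub>B\<^esub> b) \<ominus>\<^bsub>F\<^esub> (D a \<oplus>\<^bsub>F\<^esub> D b) | a b. a \<in> carrier B \<and> b \<in> carrier B}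
      \<union> {D (a \<otimes>\<^bsub>B\<^esub> b) \<ominus>\<^bsub>F\<^esub> (a \<odot>\<^bsub>F\<^esub> D b \<oplus>\<^bsub>F\<^esub> b \<odot>\<^bsub>F\<^esub> D a) | a b. a \<in> carrier B \<and> b \<in> carrier B}
      \<union> {D a | a. a \<in> k})"

definition kaehler_null :: "'a ring \<Rightarrow> 'a set \<Rightarrow> ('a \<Rightarrow> 'a) set" where
  "kaehler_null B k = span_submodule B (free_module B (carrier B)) (kaehler_relations B k)"

definition kaehler :: "'a ring \<Rightarrow> 'a set \<Rightarrow> ('a, ('a \<Rightarrow> 'a) set) module" where
  "kaehler B k = quot_module (free_module B (carrier B)) (kaehler_null B k)"

definition kaehler_d :: "'a ring \<Rightarrow> 'a set \<Rightarrow> 'a \<Rightarrow> ('a \<Rightarrow> 'a) set" where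
  "kaehler_d B k b = kaehler_null B k +>\<^bsub>free_module B (carrier B)\<^esub> free_gen B b"

text \<open>The symmetric power \<open>S\<^sup>m M\<close>: generated by the products \<open>x\<^sub>0 \<cdots> x\<^bsub>m-1\<^esub>\<close> (lists of length \<open>m\<close>
  of elements of \<open>M\<close>), subject to multilinearity and symmetry.  For \<open>m = 0\<close> this is the ring
  itself, generated by the empty list.\<close>

definition sym_gens :: "('a, 'b) module \<Rightarrow> nat \<Rightarrow> 'b list set" where
  "sym_gens M m = {xs. length xs = m \<and> set xs \<subseteq> carrier M}"

definition sym_relations :: "'a ring \<Rightarrow> ('a, 'b) module \<Rightarrow> nat \<Rightarrow> ('b list \<Rightarrow> 'a) set" where
  "sym_relations R M m =
     (let F = free_module R (sym_gens M m); G = free_gen R in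
        {G (xs[i := x \<oplus>\<^bsub>M\<^esub> y]) \<ominus>\<^bsub>F\<^esub> (G (xs[i := x]) \<oplus>\<^bsub>F\<^esub> G (xs[i := y])) | xs i x y.
           xs \<in> sym_gens M m \<and> i < m \<and> x \<in> carrier M \<and> y \<in> carrier M}
      \<union> {G (xs[i := a \<odot>\<^bsub>M\<^esub> x]) \<ominus>\<^bsub>F\<^esub> (a \<odot>\<^bsub>F\<^esub> G (xs[i := x])) | xs i a x.
           xs \<in> sym_gens M m \<and> i < m \<and> a \<in> carrier R \<and> x \<in> carrier M}
      \<union> {G xs \<ominus>\<^bsub>F\<^esub> G ys | xs ys.
           xs \<in> sym_gens M m \<and> ys \<in> sym_gens M m \<and> mset xs = mset ys})"

definition sym_null :: "'a ring \<Rightarrow> ('a, 'b) module \<Rightarrow> nat \<Rightarrow> ('b list \<Rightarrow> 'a) set" where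
  "sym_null R M m = span_submodule R (free_module R (sym_gens M m)) (sym_relations R M m)"

definition sym_module :: "'a ring \<Rightarrow> ('a, 'b) module \<Rightarrow> nat \<Rightarrow> ('a, ('b list \<Rightarrow> 'a) set) module" where
  "sym_module R M m = quot_module (free_module R (sym_gens M m)) (sym_null R M m)"

definition sym_product :: "'a ring \<Rightarrow> ('a, 'b) module \<Rightarrow> nat \<Rightarrow> 'b list \<Rightarrow> ('b list \<Rightarrow> 'a) set" where
  "sym_product R M m xs = sym_null R M m +>\<^bsub>free_module R (sym_gens M m)\<^esub> free_gen R xs"

definition tensor_relations ::
    "'a ring \<Rightarrow> ('a, 'b) module \<Rightarrow> ('a, 'c) module \<Rightarrow> ('b \<times> 'c \<Rightarrow> 'a) set" where
  "tensor_relations R M N =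
     (let F = free_module R (carrier M \<times> carrier N); G = free_gen R in
        {G (x \<oplus>\<^bsub>M\<^esub> x', y) \<ominus>\<^bsub>F\<^esub> (G (x, y) \<oplus>\<^bsub>F\<^esub> G (x', y)) | x x' y.
           x \<in> carrier M \<and> x' \<in> carrier M \<and> y \<in> carrier N}
      \<union> {G (x, y \<oplus>\<^bsub>N\<^esub> y') \<ominus>\<^bsub>F\<^esub> (G (x, y) \<oplus>\<^bsub>F\<^esub> G (x, y')) | x y y'.
           x \<in> carrier M \<and> y \<in> carrier N \<and> y' \<in> carrier N}
      \<union> {G (a \<odot>\<^bsub>M\<^esub> x, y) \<ominus>\<^bsub>F\<^esub> (a \<odot>\<^bsub>F\<^esub> G (x, y)) | a x y.
           a \<in> carrier R \<and> x \<in> carrier M \<and> y \<in> carrier N}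
      \<union> {G (x, a \<odot>\<^bsub>N\<^esub> y) \<ominus>\<^bsub>F\<^esub> (a \<odot>\<^bsub>F\<^esub> G (x, y)) | a x y.
           a \<in> carrier R \<and> x \<in> carrier M \<and> y \<in> carrier N})"

definition tensor_null ::
    "'a ring \<Rightarrow> ('a, 'b) module \<Rightarrow> ('a, 'c) module \<Rightarrow> ('b \<times> 'c \<Rightarrow> 'a) set" where
  "tensor_null R M N =
     span_submodule R (free_module R (carrier M \<times> carrier N)) (tensor_relations R M N)"

definition tensor_module ::
    "'a ring \<Rightarrow> ('a, 'b) module \<Rightarrow> ('a, 'c) module \<Rightarrow> ('a, ('b \<times> 'c \<Rightarrow> 'a) set) module" where
  "tensor_module R M N =
     quot_module (free_module R (carrier M \<times> carrier N)) (tensor_null R M N)"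

definition tensor_elem ::
    "'a ring \<Rightarrow> ('a, 'b) module \<Rightarrow> ('a, 'c) module \<Rightarrow> 'b \<Rightarrow> 'c \<Rightarrow> ('b \<times> 'c \<Rightarrow> 'a) set" where
  "tensor_elem R M N x y =
     tensor_null R M N +>\<^bsub>free_module R (carrier M \<times> carrier N)\<^esub> free_gen R (x, y)"

definition module_hom :: "'a ring \<Rightarrow> ('a, 'b) module \<Rightarrow> ('a, 'c) module \<Rightarrow> ('b \<Rightarrow> 'c) set" where
  "module_hom R M N =
     {h. h \<in> carrier M \<rightarrow> carrier N
       \<and> (\<forall>x\<in>carrier M. \<forall>y\<in>carrier M. h (x \<oplus>\<^bsub>M\<^esub> y) = h x \<oplus>\<^bsub>N\<^esub> h y)
       \<and> (\<forall>a\<in>carrier R. \<forall>x\<in>carrier M. h (a \<odot>\<^bsub>M\<^esub> x) = a \<odot>\<^bsub>N\<^esub> h x)}"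


section \<open>Ringed spaces and sheaves of modules\<close>

text \<open>Sheaves are presented by their etale spaces: a stalk at every point, and for every open set
  the functions into the stalks that are sections.\<close>

record ('p, 'o) ringed_space =
  space_top :: "'p topology"
  str_stalk :: "'p \<Rightarrow> 'o ring"
  str_sections :: "'p set \<Rightarrow> ('p \<Rightarrow> 'o) set"

record ('p, 'o, 'b) mod_sheaf =
  stalk :: "'p \<Rightarrow> ('o, 'b) module"
  sections :: "'p set \<Rightarrow> ('p \<Rightarrow> 'b) set"

definition sheaf_of_modules :: "('p, 'o) ringed_space \<Rightarrow> ('p, 'o, 'b) mod_sheaf \<Rightarrow> bool" where
  "sheaf_of_modules X M \<longleftrightarrow>
     (\<forall>p\<in>topspace (space_top X). Module.module (str_stalk X p) (stalk M p))
   \<and> (\<forall>U. openin (space_top X) U \<longrightarrow>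
        sections M U \<subseteq> (\<Pi>\<^sub>E p\<in>U. carrier (stalk M p))
      \<and> (\<lambda>p\<in>U. \<zero>\<^bsub>stalk M p\<^esub>) \<in> sections M U
      \<and> (\<forall>s\<in>sections M U. \<forall>t\<in>sections M U.
           (\<lambda>p\<in>U. s p \<oplus>\<^bsub>stalk M p\<^esub> t p) \<in> sections M U)
      \<and> (\<forall>a\<in>str_sections X U. \<forall>s\<in>sections M U.
           (\<lambda>p\<in>U. a p \<odot>\<^bsub>stalk M p\<^esub> s p) \<in> sections M U)
      \<and> (\<forall>s\<in>sections M U. \<forall>V. openin (space_top X) V \<and> V \<subseteq> U \<longrightarrow>
           restrict s V \<in> sections M V)
      \<and> (\<forall>s\<in>extensional U.
           (\<forall>p\<in>U. \<exists>V. openin (space_top X) V \<and> p \<in> V \<and> V \<subseteq> U \<and> restrict s V \<in> sections M V)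
           \<longrightarrow> s \<in> sections M U)
      \<and> (\<forall>s\<in>sections M U. \<forall>t\<in>sections M U. \<forall>p\<in>U. s p = t p \<longrightarrow>
           (\<exists>V. openin (space_top X) V \<and> p \<in> V \<and> V \<subseteq> U \<and> (\<forall>q\<in>V. s q = t q))))
   \<and> (\<forall>p\<in>topspace (space_top X). \<forall>x\<in>carrier (stalk M p).
        \<exists>U s. openin (space_top X) U \<and> p \<in> U \<and> s \<in> sections M U \<and> s p = x)"

text \<open>Locally free of finite rank: locally there is a frame \<open>e\<^sub>0, \<dots>, e\<^bsub>r-1\<^esub>\<close>, i.e. an isomorphism
  with \<open>\<O>\<^sup>r\<close>.\<close>

definition locally_free :: "('p, 'o) ringed_space \<Rightarrow> ('p, 'o, 'b) mod_sheaf \<Rightarrow> bool" where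
  "locally_free X M \<longleftrightarrow>
     sheaf_of_modules X M
   \<and> (\<forall>p\<in>topspace (space_top X). \<exists>U (r::nat) e.
        openin (space_top X) U \<and> p \<in> U \<and> (\<forall>j<r. e j \<in> sections M U)
      \<and> (\<forall>q\<in>U. \<forall>x\<in>carrier (stalk M q).
           \<exists>!a. a \<in> (\<Pi>\<^sub>E j\<in>{..<r}. carrier (str_stalk X q))
              \<and> x = (\<Oplus>\<^bsub>stalk M q\<^esub>j\<in>{..<r}. a j \<odot>\<^bsub>stalk M q\<^esub> e j q)))"

definition sheaf_hom ::
    "('p, 'o) ringed_space \<Rightarrow> ('p, 'o, 'b) mod_sheaf \<Rightarrow> ('p, 'o, 'c) mod_sheaf
      \<Rightarrow> ('p \<Rightarrow> 'b \<Rightarrow> 'c) set" where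
  "sheaf_hom X M N =
     {h. (\<forall>p\<in>topspace (space_top X). h p \<in> module_hom (str_stalk X p) (stalk M p) (stalk N p))
       \<and> (\<forall>U. openin (space_top X) U \<longrightarrow>
            (\<forall>s\<in>sections M U. (\<lambda>p\<in>U. h p (s p)) \<in> sections N U))}"

text \<open>\<open>0 \<rightarrow> K\<^sub>c \<rightarrow> \<dots> \<rightarrow> K\<^sub>0 \<rightarrow> E \<rightarrow> 0\<close>, for some augmentation \<open>K\<^sub>0 \<rightarrow> E\<close>, is an exact sequence of sheaves
  and the \<open>K\<^sub>k\<close> are locally free; \<open>D k\<close> is the differential \<open>K\<^sub>k \<rightarrow> K\<^bsub>k-1\<^esub>\<close>.  Exactness of sheaves is
  exactness on stalks.\<close>

definition locally_free_resolution ::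
    "('p, 'o) ringed_space \<Rightarrow> nat \<Rightarrow> (nat \<Rightarrow> ('p, 'o, 'b) mod_sheaf) \<Rightarrow> (nat \<Rightarrow> 'p \<Rightarrow> 'b \<Rightarrow> 'b)
      \<Rightarrow> ('p, 'o, 'c) mod_sheaf \<Rightarrow> bool" where
  "locally_free_resolution X c K D E \<longleftrightarrow>
     (\<forall>k\<le>c. locally_free X (K k))
   \<and> (\<forall>k\<in>{1..c}. D k \<in> sheaf_hom X (K k) (K (k - 1)))
   \<and> (\<exists>\<epsilon>\<in>sheaf_hom X (K 0) E. \<forall>p\<in>topspace (space_top X).
        \<epsilon> p ` carrier (stalk (K 0) p) = carrier (stalk E p)
      \<and> (\<forall>k\<le>c.
           (if k < c then D (Suc k) p ` carrier (stalk (K (Suc k)) p) else {\<zero>\<^bsub>stalk (K k) p\<^esub>})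
         = (if k = 0 then {x\<in>carrier (stalk (K 0) p). \<epsilon> p x = \<zero>\<^bsub>stalk E p\<^esub>}
            else {x\<in>carrier (stalk (K k) p). D k p x = \<zero>\<^bsub>stalk (K (k - 1)) p\<^esub>})))"

text \<open>The sections that are locally finite \<open>\<O>\<close>-linear combinations of the elements of \<open>G V\<close>.
  With the stalks of the presheaf constructions below this is sheafification.\<close>

definition generated_sections ::
    "('p, 'o) ringed_space \<Rightarrow> ('p \<Rightarrow> ('o, 'b) module) \<Rightarrow> ('p set \<Rightarrow> ('p \<Rightarrow> 'b) set)
      \<Rightarrow> 'p set \<Rightarrow> ('p \<Rightarrow> 'b) set" where
  "generated_sections X M G U =
     {s \<in> (\<Pi>\<^sub>E p\<in>U. carrier (M p)). \<forall>p\<in>U. \<exists>V (r::nat) a g.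
        openin (space_top X) V \<and> p \<in> V \<and> V \<subseteq> U
      \<and> (\<forall>j<r. a j \<in> str_sections X V \<and> g j \<in> G V)
      \<and> (\<forall>q\<in>V. s q = (\<Oplus>\<^bsub>M q\<^esub>j\<in>{..<r}. a j q \<odot>\<^bsub>M q\<^esub> g j q))}"

text \<open>\<open>\<Omega>\<^sub>X\<close> relative to a field of constants, given by its image \<open>k p\<close> in each stalk.\<close>

definition cotangent_sheaf ::
    "('p, 'o) ringed_space \<Rightarrow> ('p \<Rightarrow> 'o set) \<Rightarrow> ('p, 'o, ('o \<Rightarrow> 'o) set) mod_sheaf" where
  "cotangent_sheaf X k =
     \<lparr>stalk = (\<lambda>p. kaehler (str_stalk X p) (k p)),
      sections = generated_sections X (\<lambda>p. kaehler (str_stalk X p) (k p))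
        (\<lambda>V. {\<lambda>p\<in>V. kaehler_d (str_stalk X p) (k p) (f p) | f. f \<in> str_sections X V})\<rparr>"

definition sym_power_sheaf ::
    "('p, 'o) ringed_space \<Rightarrow> nat \<Rightarrow> ('p, 'o, 'b) mod_sheaf
      \<Rightarrow> ('p, 'o, ('b list \<Rightarrow> 'o) set) mod_sheaf" where
  "sym_power_sheaf X m M =
     \<lparr>stalk = (\<lambda>p. sym_module (str_stalk X p) (stalk M p) m),
      sections = generated_sections X (\<lambda>p. sym_module (str_stalk X p) (stalk M p) m)
        (\<lambda>V. {\<lambda>p\<in>V. sym_product (str_stalk X p) (stalk M p) m (map (\<lambda>s. s p) ss) | ss.
                length ss = m \<and> set ss \<subseteq> sections M V})\<rparr>"

definition tensor_sheaf ::
    "('p, 'o) ringed_space \<Rightarrow> ('p, 'o, 'b) mod_sheaf \<Rightarrow> ('p, 'o, 'c) mod_sheaf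
      \<Rightarrow> ('p, 'o, ('b \<times> 'c \<Rightarrow> 'o) set) mod_sheaf" where
  "tensor_sheaf X M N =
     \<lparr>stalk = (\<lambda>p. tensor_module (str_stalk X p) (stalk M p) (stalk N p)),
      sections = generated_sections X
        (\<lambda>p. tensor_module (str_stalk X p) (stalk M p) (stalk N p))
        (\<lambda>V. {\<lambda>p\<in>V. tensor_elem (str_stalk X p) (stalk M p) (stalk N p) (s p) (t p) | s t.
                s \<in> sections M V \<and> t \<in> sections N V})\<rparr>"

definition direct_sum_sheaf ::
    "'i set \<Rightarrow> ('i \<Rightarrow> ('p, 'o, 'b) mod_sheaf) \<Rightarrow> ('p, 'o, 'i \<Rightarrow> 'b) mod_sheaf" where
  "direct_sum_sheaf A M =
     \<lparr>stalk = (\<lambda>p. \<lparr>carrier = (\<Pi>\<^sub>E I\<in>A. carrier (stalk (M I) p)), monoid.mult = undefined, one = undefined,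
        zero = (\<lambda>I\<in>A. \<zero>\<^bsub>stalk (M I) p\<^esub>),
        add = (\<lambda>x y. \<lambda>I\<in>A. x I \<oplus>\<^bsub>stalk (M I) p\<^esub> y I),
        smult = (\<lambda>a x. \<lambda>I\<in>A. a \<odot>\<^bsub>stalk (M I) p\<^esub> x I)\<rparr>),
      sections = (\<lambda>U. {s \<in> (\<Pi>\<^sub>E p\<in>U. \<Pi>\<^sub>E I\<in>A. carrier (stalk (M I) p)).
        \<forall>I\<in>A. (\<lambda>p\<in>U. s p I) \<in> sections (M I) U})\<rparr>"

definition subsheaf ::
    "('p, 'o, 'b) mod_sheaf \<Rightarrow> ('p \<Rightarrow> 'b set) \<Rightarrow> ('p, 'o, 'b) mod_sheaf" where
  "subsheaf M S =
     \<lparr>stalk = (\<lambda>p. (stalk M p)\<lparr>carrier := S p\<rparr>),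
      sections = (\<lambda>U. {s \<in> sections M U. \<forall>p\<in>U. s p \<in> S p})\<rparr>"

text \<open>The closed subspace on the closed set \<open>A\<close> cut out by the sheaf of ideals with stalks \<open>J p\<close>,
  and the restriction \<open>M \<mapsto> M/JM\<close> of sheaves of modules to it.\<close>

definition closed_subspace ::
    "('p, 'o) ringed_space \<Rightarrow> 'p set \<Rightarrow> ('p \<Rightarrow> 'o set) \<Rightarrow> ('p, 'o set) ringed_space" where
  "closed_subspace Z A J =
     \<lparr>space_top = subtopology (space_top Z) A,
      str_stalk = (\<lambda>p. str_stalk Z p Quot J p),
      str_sections = (\<lambda>U. {s \<in> extensional U. \<forall>p\<in>U. \<exists>W t.
        openin (space_top Z) W \<and> p \<in> W \<and> W \<inter> A \<subseteq> U \<and> t \<in> str_sections Z W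
      \<and> (\<forall>q\<in>W \<inter> A. s q = J q +>\<^bsub>str_stalk Z q\<^esub> t q)})\<rparr>"

definition ideal_multiple ::
    "('p, 'o) ringed_space \<Rightarrow> ('p \<Rightarrow> 'o set) \<Rightarrow> ('p, 'o, 'b) mod_sheaf \<Rightarrow> 'p \<Rightarrow> 'b set" where
  "ideal_multiple Z J M p =
     span_submodule (str_stalk Z p) (stalk M p)
       {a \<odot>\<^bsub>stalk M p\<^esub> x | a x. a \<in> J p \<and> x \<in> carrier (stalk M p)}"

definition restrict_sheaf ::
    "('p, 'o) ringed_space \<Rightarrow> 'p set \<Rightarrow> ('p \<Rightarrow> 'o set) \<Rightarrow> ('p, 'o, 'b) mod_sheaf
      \<Rightarrow> ('p, 'o set, 'b set) mod_sheaf" where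
  "restrict_sheaf Z A J M =
     \<lparr>stalk = (\<lambda>p. let H = ideal_multiple Z J M p in
        \<lparr>carrier = a_rcosets\<^bsub>stalk M p\<^esub> H, monoid.mult = undefined, one = undefined,
         zero = H, add = set_add (stalk M p),
         smult = (\<lambda>a C. \<Union>b\<in>a. \<Union>x\<in>C. H +>\<^bsub>stalk M p\<^esub> (b \<odot>\<^bsub>stalk M p\<^esub> x))\<rparr>),
      sections = (\<lambda>U. {s \<in> extensional U. \<forall>p\<in>U. \<exists>W t.
        openin (space_top Z) W \<and> p \<in> W \<and> W \<inter> A \<subseteq> U \<and> t \<in> sections M W
      \<and> (\<forall>q\<in>W \<inter> A. s q = ideal_multiple Z J M q +>\<^bsub>stalk M q\<^esub> t q)})\<rparr>"


section \<open>Projective space\<close>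

text \<open>Polynomials in variables indexed by \<open>nat\<close>; a monomial is its exponent function.
  \<open>\<complex>[X\<^sub>0,\<dots>,X\<^sub>N]\<close> consists of the polynomials in which only variables of index at most \<open>N\<close> occur.\<close>

type_synonym 'a mpoly = "(nat \<Rightarrow>\<^sub>0 nat) \<Rightarrow>\<^sub>0 'a"
type_synonym cpoly = "complex mpoly"
type_synonym ratfun = "cpoly fract"

definition mdeg :: "(nat \<Rightarrow>\<^sub>0 nat) \<Rightarrow> nat" where
  "mdeg t = (\<Sum>i\<in>Poly_Mapping.keys t. Poly_Mapping.lookup t i)"

definition var :: "nat \<Rightarrow> 'a::zero_neq_one mpoly" where
  "var i = Poly_Mapping.single (Poly_Mapping.single i 1) 1"

definition partial :: "nat \<Rightarrow> 'a::comm_semiring_1 mpoly \<Rightarrow> 'a mpoly" where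
  "partial i f = (\<Sum>t\<in>Poly_Mapping.keys f.
     Poly_Mapping.single (t - Poly_Mapping.single i 1)
       (of_nat (Poly_Mapping.lookup t i) * Poly_Mapping.lookup f t))"

definition polyring :: "nat \<Rightarrow> cpoly ring" where
  "polyring N =
     \<lparr>carrier = {f. \<forall>t\<in>Poly_Mapping.keys f. Poly_Mapping.keys t \<subseteq> {..N}},
      monoid.mult = (*), one = 1, zero = 0, add = (+)\<rparr>"

definition forms :: "nat \<Rightarrow> int \<Rightarrow> cpoly set" where
  "forms N k = {f \<in> carrier (polyring N). \<forall>t\<in>Poly_Mapping.keys f. int (mdeg t) = k}"

definition hom_component :: "nat \<Rightarrow> cpoly \<Rightarrow> cpoly" where
  "hom_component k f = (\<Sum>t\<in>{t\<in>Poly_Mapping.keys f. mdeg t = k}.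
     Poly_Mapping.single t (Poly_Mapping.lookup f t))"

text \<open>The points of \<open>\<P>\<^sup>N = Proj \<complex>[X\<^sub>0,\<dots>,X\<^sub>N]\<close>: the homogeneous primes not containing all the variables.\<close>

definition proj_points :: "nat \<Rightarrow> cpoly set set" where
  "proj_points N =
     {p. primeideal p (polyring N) \<and> (\<forall>f\<in>p. \<forall>k. hom_component k f \<in> p) \<and> (\<exists>i\<le>N. var i \<notin> p)}"

definition proj_topology :: "nat \<Rightarrow> cpoly set topology" where
  "proj_topology N = topology_generated_by {{p \<in> proj_points N. f \<notin> p} | f. \<exists>k. f \<in> forms N k}"

text \<open>The stalk of \<open>\<O>(n)\<close> at \<open>p\<close>, inside the field of fractions of \<open>\<complex>[X\<^sub>0,\<dots>,X\<^sub>N]\<close>.\<close>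

definition twist_germs :: "nat \<Rightarrow> int \<Rightarrow> cpoly set \<Rightarrow> ratfun set" where
  "twist_germs N n p =
     {Fract f g | f g e. g \<in> forms N (int e) \<and> g \<notin> p \<and> f \<in> forms N (n + int e)}"

text \<open>All the sheaves on \<open>\<P>\<^sup>N\<close> below are subsheaves of constant sheaves, so that germs at
  different points can be compared by equality.\<close>

definition locally_constant_sections ::
    "'p topology \<Rightarrow> ('p \<Rightarrow> 'b set) \<Rightarrow> 'p set \<Rightarrow> ('p \<Rightarrow> 'b) set" where
  "locally_constant_sections T M U =
     {s \<in> (\<Pi>\<^sub>E p\<in>U. M p). \<forall>p\<in>U. \<exists>V x. openin T V \<and> p \<in> V \<and> V \<subseteq> U \<and> (\<forall>q\<in>V. s q = x)}"

definition proj_space :: "nat \<Rightarrow> (cpoly set, ratfun) ringed_space" where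
  "proj_space N =
     \<lparr>space_top = proj_topology N,
      str_stalk = (\<lambda>p. \<lparr>carrier = twist_germs N 0 p, monoid.mult = (*), one = 1, zero = 0, add = (+)\<rparr>),
      str_sections = locally_constant_sections (proj_topology N) (twist_germs N 0)\<rparr>"

definition twisting_sheaf :: "nat \<Rightarrow> int \<Rightarrow> (cpoly set, ratfun, ratfun) mod_sheaf" where
  "twisting_sheaf N n =
     \<lparr>stalk = (\<lambda>p. \<lparr>carrier = twist_germs N n p, monoid.mult = undefined, one = undefined,
        zero = 0, add = (+), smult = (*)\<rparr>),
      sections = locally_constant_sections (proj_topology N) (twist_germs N n)\<rparr>"

text \<open>The sheaf \<open>\<complex>[Y]\<^sub>m \<otimes> \<O>(n)\<close>: homogeneous polynomials of degree \<open>m\<close> in \<open>Y\<^sub>0,\<dots>,Y\<^sub>N\<close> with coefficients in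
  \<open>\<O>(n)\<close>.  \<^term>\<open>Poly_Mapping.single 0 a\<close> is the constant polynomial \<open>a\<close>.\<close>

definition bihom_germs :: "nat \<Rightarrow> nat \<Rightarrow> int \<Rightarrow> cpoly set \<Rightarrow> ratfun mpoly set" where
  "bihom_germs N m n p =
     {F. (\<forall>t\<in>Poly_Mapping.keys F. Poly_Mapping.keys t \<subseteq> {..N} \<and> mdeg t = m)
       \<and> (\<forall>t. Poly_Mapping.lookup F t \<in> twist_germs N n p)}"

definition bihom_sheaf :: "nat \<Rightarrow> nat \<Rightarrow> int \<Rightarrow> (cpoly set, ratfun, ratfun mpoly) mod_sheaf" where
  "bihom_sheaf N m n =
     \<lparr>stalk = (\<lambda>p. \<lparr>carrier = bihom_germs N m n p, monoid.mult = undefined, one = undefined,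
        zero = 0, add = (+), smult = (\<lambda>a F. Poly_Mapping.single 0 a * F)\<rparr>),
      sections = locally_constant_sections (proj_topology N) (bihom_germs N m n)\<rparr>"

definition delta :: "nat \<Rightarrow> ratfun mpoly \<Rightarrow> ratfun mpoly" where
  "delta N F = (\<Sum>i\<le>N. Poly_Mapping.single 0 (Fract (var i) 1) * partial i F)"

definition ker_delta :: "nat \<Rightarrow> nat \<Rightarrow> int \<Rightarrow> cpoly set \<Rightarrow> ratfun mpoly set" where
  "ker_delta N m n p = {F \<in> bihom_germs N m n p. delta N F = 0}"


section \<open>Complete intersections\<close>

definition zero_locus :: "nat \<Rightarrow> nat \<Rightarrow> (nat \<Rightarrow> cpoly) \<Rightarrow> cpoly set set" where
  "zero_locus N c P = {p \<in> proj_points N. \<forall>i\<in>{1..c}. P i \<in> p}"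

text \<open>The ideal sheaf generated by the \<open>P\<^sub>i\<close>, the image of \<open>\<Oplus>\<^sub>i \<O>(-d\<^sub>i) \<rightarrow> \<O>\<close>.\<close>

definition ideal_germs ::
    "nat \<Rightarrow> nat \<Rightarrow> (nat \<Rightarrow> nat) \<Rightarrow> (nat \<Rightarrow> cpoly) \<Rightarrow> cpoly set \<Rightarrow> ratfun set" where
  "ideal_germs N c d P p =
     {(\<Sum>i\<in>{1..c}. a i * Fract (P i) 1) | a. \<forall>i\<in>{1..c}. a i \<in> twist_germs N (- int (d i)) p}"

definition scheme_X ::
    "nat \<Rightarrow> nat \<Rightarrow> (nat \<Rightarrow> nat) \<Rightarrow> (nat \<Rightarrow> cpoly) \<Rightarrow> (cpoly set, ratfun set) ringed_space" where
  "scheme_X N c d P = closed_subspace (proj_space N) (zero_locus N c P) (ideal_germs N c d P)"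

text \<open>Smooth of codimension \<open>c\<close>: at every point \<open>p\<close> the Jacobian matrix of the \<open>c\<close> equations has rank
  \<open>c\<close> over the residue field, i.e. its rows are linearly independent over the fraction field of
  \<open>\<complex>[X\<^sub>0,\<dots>,X\<^sub>N]/p\<close> (with denominators cleared).\<close>

definition smooth_complete_intersection ::
    "nat \<Rightarrow> nat \<Rightarrow> (nat \<Rightarrow> nat) \<Rightarrow> (nat \<Rightarrow> cpoly) \<Rightarrow> bool" where
  "smooth_complete_intersection N c d P \<longleftrightarrow>
     c \<le> N
   \<and> (\<forall>i\<in>{1..c}. 1 \<le> d i \<and> P i \<in> forms N (int (d i)))
   \<and> (\<forall>p\<in>zero_locus N c P. \<forall>a. (\<forall>i\<in>{1..c}. a i \<in> carrier (polyring N))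
        \<and> (\<forall>j\<le>N. (\<Sum>i\<in>{1..c}. a i * partial j (P i)) \<in> p)
        \<longrightarrow> (\<forall>i\<in>{1..c}. a i \<in> p))"

definition restrict_to_X ::
    "nat \<Rightarrow> nat \<Rightarrow> (nat \<Rightarrow> nat) \<Rightarrow> (nat \<Rightarrow> cpoly) \<Rightarrow> (cpoly set, ratfun, 'b) mod_sheaf
      \<Rightarrow> (cpoly set, ratfun set, 'b set) mod_sheaf" where
  "restrict_to_X N c d P =
     restrict_sheaf (proj_space N) (zero_locus N c P) (ideal_germs N c d P)"

definition cotangent_X ::
    "nat \<Rightarrow> nat \<Rightarrow> (nat \<Rightarrow> nat) \<Rightarrow> (nat \<Rightarrow> cpoly)
      \<Rightarrow> (cpoly set, ratfun set, (ratfun set \<Rightarrow> ratfun set) set) mod_sheaf" where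
  "cotangent_X N c d P = cotangent_sheaf (scheme_X N c d P)
     (\<lambda>p. {ideal_germs N c d P p +>\<^bsub>str_stalk (proj_space N) p\<^esub>
              Fract (Poly_Mapping.single 0 z) 1 | z. True})"

definition twist_X ::
    "nat \<Rightarrow> nat \<Rightarrow> (nat \<Rightarrow> nat) \<Rightarrow> (nat \<Rightarrow> cpoly) \<Rightarrow> (cpoly set, ratfun set, 'b) mod_sheaf \<Rightarrow> int
      \<Rightarrow> (cpoly set, ratfun set, ('b \<times> ratfun set \<Rightarrow> ratfun set) set) mod_sheaf" where
  "twist_X N c d P M k =
     tensor_sheaf (scheme_X N c d P) M (restrict_to_X N c d P (twisting_sheaf N k))"


section \<open>The Koszul complex\<close>

definition bihom_ideal ::
    "nat \<Rightarrow> nat \<Rightarrow> (nat \<Rightarrow> nat) \<Rightarrow> (nat \<Rightarrow> cpoly) \<Rightarrow> nat \<Rightarrow> int \<Rightarrow> cpoly set \<Rightarrow> ratfun mpoly set" where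
  "bihom_ideal N c d P m n =
     ideal_multiple (proj_space N) (ideal_germs N c d P) (bihom_sheaf N m n)"

text \<open>\<open>(Ker \<delta>\<^bsub>m,n\<^esub>)|\<^sub>X\<close>, as a subbundle of \<open>(\<complex>[Y]\<^sub>m \<otimes> \<O>(n))|\<^sub>X\<close>: its germs are the restrictions to \<open>X\<close> of the
  germs of \<open>Ker \<delta>\<^bsub>m,n\<^esub>\<close>.  As \<open>Ker \<delta>\<^bsub>m,n\<^esub>\<close> has a locally free cokernel, this is also its
  pullback to \<open>X\<close>.  The ambient bundle is needed since multiplication by \<open>\<alpha>(P\<^sub>i)\<close> does not preserve
  \<open>Ker \<delta>\<close> before restriction to \<open>X\<close>.\<close>

definition ker_delta_X ::
    "nat \<Rightarrow> nat \<Rightarrow> (nat \<Rightarrow> nat) \<Rightarrow> (nat \<Rightarrow> cpoly) \<Rightarrow> nat \<Rightarrow> int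
      \<Rightarrow> (cpoly set, ratfun set, ratfun mpoly set) mod_sheaf" where
  "ker_delta_X N c d P m n =
     subsheaf (restrict_to_X N c d P (bihom_sheaf N m n))
       (\<lambda>p. {bihom_ideal N c d P m n p +>\<^bsub>stalk (bihom_sheaf N m n) p\<^esub> F | F. F \<in> ker_delta N m n p})"

definition alpha_poly :: "nat \<Rightarrow> nat \<Rightarrow> cpoly \<Rightarrow> ratfun mpoly" where
  "alpha_poly N e Q =
     (\<Sum>j\<le>N. Poly_Mapping.single 0 (Fract (partial j Q) 1 / of_nat e) * var j)"

text \<open>The map \<open>F \<mapsto> A F\<close> on restrictions to \<open>X\<close>, with values in bi-degree \<open>(m, n)\<close>.\<close>

definition mult_X ::
    "nat \<Rightarrow> nat \<Rightarrow> (nat \<Rightarrow> nat) \<Rightarrow> (nat \<Rightarrow> cpoly) \<Rightarrow> nat \<Rightarrow> int \<Rightarrow> ratfun mpoly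
      \<Rightarrow> cpoly set \<Rightarrow> ratfun mpoly set \<Rightarrow> ratfun mpoly set" where
  "mult_X N c d P m n A p C =
     (\<Union>F\<in>C. bihom_ideal N c d P m n p +>\<^bsub>stalk (bihom_sheaf N m n) p\<^esub> (A * F))"

definition koszul_index :: "nat \<Rightarrow> nat \<Rightarrow> nat set set" where
  "koszul_index c k = {I. I \<subseteq> {1..c} \<and> card I = k}"

definition koszul_shift :: "(nat \<Rightarrow> nat) \<Rightarrow> int \<Rightarrow> nat set \<Rightarrow> int" where
  "koszul_shift d n I = n - (\<Sum>i\<in>I. int (d i) - 1)"

definition koszul_term ::
    "nat \<Rightarrow> nat \<Rightarrow> (nat \<Rightarrow> nat) \<Rightarrow> (nat \<Rightarrow> cpoly) \<Rightarrow> nat \<Rightarrow> int \<Rightarrow> nat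
      \<Rightarrow> (cpoly set, ratfun set, nat set \<Rightarrow> ratfun mpoly set) mod_sheaf" where
  "koszul_term N c d P m n k =
     direct_sum_sheaf (koszul_index c k) (\<lambda>I. ker_delta_X N c d P (m - k) (koszul_shift d n I))"

text \<open>The component from the summand \<open>I = J \<union> {i}\<close> to the summand \<open>J\<close> is \<open>\<alpha>(P\<^sub>i)\<close> up to the sign
  \<open>(-1)\<^bsup>r\<^esup>\<close>, where \<open>r\<close> is the number of elements of \<open>I\<close> that are smaller than \<open>i\<close>.\<close>

definition koszul_diff ::
    "nat \<Rightarrow> nat \<Rightarrow> (nat \<Rightarrow> nat) \<Rightarrow> (nat \<Rightarrow> cpoly) \<Rightarrow> nat \<Rightarrow> int \<Rightarrow> nat
      \<Rightarrow> cpoly set \<Rightarrow> (nat set \<Rightarrow> ratfun mpoly set) \<Rightarrow> (nat set \<Rightarrow> ratfun mpoly set)" where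
  "koszul_diff N c d P m n k p s =
     (\<lambda>J\<in>koszul_index c (k - 1).
        \<Oplus>\<^bsub>stalk (ker_delta_X N c d P (m - (k - 1)) (koszul_shift d n J)) p\<^esub>i\<in>{1..c} - J.
          mult_X N c d P (m - (k - 1)) (koszul_shift d n J)
            ((-1) ^ card {j\<in>J. j < i} * alpha_poly N (d i) (P i)) p (s (insert i J)))"

end

theory Submission imports Defs
begin

text \<open>Where \<open>X\<^sub>r\<close> is invertible put \<open>z\<^sub>j = Y\<^sub>j - (X\<^sub>j/X\<^sub>r) Y\<^sub>r\<close>, a germ of \<open>Ker \<delta>\<close>.  For \<open>F\<close> in \<open>Ker \<delta>\<close> the
  difference \<open>F(Y) - F(z)\<close> is a multiple of \<open>Y\<^sub>r\<close> in \<open>Ker \<delta>\<close>, hence zero; so \<open>Ker \<delta>\<close> is the polynomial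
  algebra on the \<open>z\<^sub>j\<close>, \<open>j \<noteq> r\<close>.  Modulo the ideal of \<open>X\<close>, \<open>\<alpha>(P\<^sub>i)\<close> is, up to a unit, a linear form
  \<open>l\<^sub>i\<close> in them, and smoothness provides constant vector fields \<open>D\<^sub>i\<close> with \<open>D\<^sub>i(l\<^sub>k) = \<delta>\<^bsub>ik\<^esub>\<close>.  The relations
  \<open>[D\<^sub>i, l\<^sub>k] = \<delta>\<^bsub>ik\<^esub>\<close> give a homotopy which, in characteristic \<open>0\<close>, shows that the Koszul complex is exact in
  positive degrees.  In degree \<open>0\<close> the augmentation sends \<open>z\<^sub>j\<close> to \<open>X\<^sub>r d(X\<^sub>j/X\<^sub>r)\<close>.  It kills the image of
  \<open>\<alpha>(P\<^sub>i)\<close>, since this corresponds to \<open>d(P\<^sub>i/X\<^sub>r\<^sup>d)\<close> with \<open>d = d\<^sub>i\<close>, and the map induced on the cokernel is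
  inverse to \<open>df \<mapsto> \<Sum>\<^sub>j (\<partial>f/\<partial>X\<^sub>j) Y\<^sub>j\<close>, which does not depend on \<open>r\<close>.\<close>

section \<open>Polynomials and their derivatives\<close>

text \<open>Since \<open>delta\<close> maps \<alpha>(P_i) to P_i, multiplication by \<alpha>(P_i)
  leaves Ker delta off X. In a chart it is replaced by \<alpha>(P_i) - (P_i/X_r) Y_r, which lies in
  Ker delta exactly and differs from \<alpha>(P_i) by an element of the ideal. The commutation
  relations then hold on the nose, and the ideal enters only as the subgroup modulo which cycles and
  boundaries are read. In degree k the homotopy equals E + k, with E the Euler operator of the l_i.
  The l_i are only part of a coordinate system, so E is not multiplication by the degree; it is not
  diagonalised either. Instead E (E - 1) ... (E - m) kills polynomials of degree m, and one divides
  in turn by the numbers k + s with s at most m, which are nonzero because k is at least 1. The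
  augmentation is written down with a chart, yet it has to be one map of sheaves. It is therefore
  characterised through its inverse, whose values on generators mention no chart. The condition that
  c is at most m keeps every degree m - k free of truncation.\<close>

lemma mpoly_expand:
  "f = (\<Sum>t\<in>Poly_Mapping.keys f. Poly_Mapping.single t (Poly_Mapping.lookup f t))"
  by (rule poly_mapping_eqI)
    (auto simp: lookup_sum lookup_single when_def in_keys_iff sum.delta')

lemma mpoly_induct [case_names zero single add]:
  assumes "P 0" "\<And>t a. P (Poly_Mapping.single t a)" "\<And>f g. P f \<Longrightarrow> P g \<Longrightarrow> P (f + g)"
  shows "P (f :: 'a \<Rightarrow>\<^sub>0 'b::comm_monoid_add)"
proof -
  have "P (\<Sum>t\<in>A. Poly_Mapping.single t (Poly_Mapping.lookup f t))" if "finite A" for A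
    using that by induction (auto intro: assms)
  then show ?thesis
    by (subst mpoly_expand) simp
qed

text \<open>Subtraction of exponents truncates at zero, so \<open>t - s\<close> is the right
  exponent only when \<open>s\<close> divides \<open>t\<close>; otherwise the coefficient is
  zero.\<close>

lemma lookup_single_mult:
  fixes f :: "'a::comm_ring_1 mpoly"
  shows "Poly_Mapping.lookup (Poly_Mapping.single s a * f) t
    = (if \<forall>i. Poly_Mapping.lookup s i \<le> Poly_Mapping.lookup t i
       then a * Poly_Mapping.lookup f (t - s) else 0)"
proof (induction f rule: mpoly_induct)
  case (single u b)
  have "s + u = t \<longleftrightarrow> (\<forall>i. Poly_Mapping.lookup s i \<le> Poly_Mapping.lookup t i) \<and> u = t - s"
    by (auto simp: poly_mapping_eq_iff fun_eq_iff lookup_add lookup_minus) (metis le_add1, metis diff_add_inverse)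
  then show ?case
    by (auto simp: mult_single lookup_single when_def)
qed (auto simp: lookup_add algebra_simps)

lemma lookup_const_mult [simp]:
  fixes f :: "'a::comm_ring_1 mpoly"
  shows "Poly_Mapping.lookup (Poly_Mapping.single 0 a * f) t = a * Poly_Mapping.lookup f t"
  by (simp add: lookup_single_mult)

lemma lookup_var_mult:
  fixes f :: "'a::comm_ring_1 mpoly"
  shows "Poly_Mapping.lookup (var i * f) t
    = (if Poly_Mapping.lookup t i = 0 then 0 else Poly_Mapping.lookup f (t - Poly_Mapping.single i 1))"
  unfolding var_def lookup_single_mult
  by (auto simp: lookup_single when_def)

lemma lookup_partial:
  fixes f :: "'a::comm_ring_1 mpoly"
  shows "Poly_Mapping.lookup (partial i f) t
    = of_nat (Suc (Poly_Mapping.lookup t i)) * Poly_Mapping.lookup f (t + Poly_Mapping.single i 1)"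
proof -
  have "(of_nat (Poly_Mapping.lookup s i) * Poly_Mapping.lookup f s when s - Poly_Mapping.single i 1 = t)
     = (if s = t + Poly_Mapping.single i 1
        then of_nat (Suc (Poly_Mapping.lookup t i)) * Poly_Mapping.lookup f s else 0)" for s
  \<comment> \<open>If variable i does not occur in \<open>s\<close>, truncated subtraction returns
    \<open>s\<close> itself. This spurious exponent is harmless, because the factor
    \<open>of_nat 0\<close> kills the term.\<close>
  proof (cases "Poly_Mapping.lookup s i = 0")
    case True
    then have "s \<noteq> t + Poly_Mapping.single i 1"
      by (metis add_eq_0_iff_both_eq_0 lookup_add lookup_single_eq one_neq_zero)
    with True show ?thesis by (simp add: when_def)
  next
    case False
    then have *: "s - Poly_Mapping.single i 1 = t \<longleftrightarrow> s = t + Poly_Mapping.single i 1"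
      by (auto simp: poly_mapping_eq_iff fun_eq_iff lookup_add lookup_minus lookup_single when_def)
    show ?thesis
      unfolding * by (auto simp: when_def lookup_add)
  qed
  then have "Poly_Mapping.lookup (partial i f) t
    = (\<Sum>s\<in>Poly_Mapping.keys f. if s = t + Poly_Mapping.single i 1
        then of_nat (Suc (Poly_Mapping.lookup t i)) * Poly_Mapping.lookup f s else 0)"
    unfolding partial_def lookup_sum lookup_single by (intro sum.cong) auto
  also have "\<dots> = of_nat (Suc (Poly_Mapping.lookup t i)) * Poly_Mapping.lookup f (t + Poly_Mapping.single i 1)"
    by (auto simp: in_keys_iff)
  finally show ?thesis .
qed

lemma partial_0 [simp]: "partial i (0 :: 'a::comm_ring_1 mpoly) = 0"
  by (simp add: partial_def)

lemma partial_add: "partial i (f + g :: 'a::comm_ring_1 mpoly) = partial i f + partial i g"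
  by (rule poly_mapping_eqI) (simp add: lookup_partial lookup_add algebra_simps)

lemma partial_uminus: "partial i (- f :: 'a::comm_ring_1 mpoly) = - partial i f"
  by (rule poly_mapping_eqI) (simp add: lookup_partial)

lemma partial_sum: "partial i (sum f A :: 'a::comm_ring_1 mpoly) = (\<Sum>a\<in>A. partial i (f a))"
  by (induction A rule: infinite_finite_induct) (auto simp: partial_add)

lemma partial_const_mult:
  "partial i (Poly_Mapping.single 0 a * f :: 'a::comm_ring_1 mpoly) = Poly_Mapping.single 0 a * partial i f"
  by (rule poly_mapping_eqI) (simp add: lookup_partial mult.left_commute)

lemma partial_commute: "partial i (partial j f :: 'a::comm_ring_1 mpoly) = partial j (partial i f)"
  by (rule poly_mapping_eqI)
    (auto simp: lookup_partial lookup_add lookup_single when_def algebra_simps)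

lemma partial_single:
  "partial i (Poly_Mapping.single t a :: 'a::comm_ring_1 mpoly)
    = Poly_Mapping.single (t - Poly_Mapping.single i 1) (of_nat (Poly_Mapping.lookup t i) * a)"
  by (auto simp: partial_def)

lemma partial_const [simp]: "partial i (Poly_Mapping.single 0 a :: 'a::comm_ring_1 mpoly) = 0"
  by (simp add: partial_single)

lemma partial_1 [simp]: "partial i (1 :: 'a::comm_ring_1 mpoly) = 0"
  using partial_const[of i 1] by simp

lemma partial_var: "partial i (var j :: 'a::comm_ring_1 mpoly) = (if i = j then 1 else 0)"
  by (auto simp: var_def partial_single lookup_single when_def)

lemma partial_mult:
  "partial i (f * g :: 'a::comm_ring_1 mpoly) = partial i f * g + f * partial i g"
proof (induction f rule: mpoly_induct)
  case (single s a)
  show ?case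
  proof (induction g rule: mpoly_induct)
    case (single t b)
    \<comment> \<open>Lowering an exponent is compatible with adding exponents only where the
      variable occurs; in the remaining cases the derivative of that factor is zero.\<close>
    have 1: "s - Poly_Mapping.single i 1 + t = s + t - Poly_Mapping.single i 1"
      if "Poly_Mapping.lookup s i \<noteq> 0"
      using that by (auto simp: poly_mapping_eq_iff fun_eq_iff lookup_add lookup_minus lookup_single when_def)
    have 2: "s + (t - Poly_Mapping.single i 1) = s + t - Poly_Mapping.single i 1"
      if "Poly_Mapping.lookup t i \<noteq> 0"
      using that by (auto simp: poly_mapping_eq_iff fun_eq_iff lookup_add lookup_minus lookup_single when_def)
    show ?case
      using 1 2
      by (cases "Poly_Mapping.lookup s i = 0"; cases "Poly_Mapping.lookup t i = 0")
        (auto simp: mult_single partial_single lookup_add simp flip: single_add intro!: arg_cong2[where f = Poly_Mapping.single] simp: algebra_simps)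
  qed (auto simp: partial_add algebra_simps)
qed (auto simp: partial_add algebra_simps)

section \<open>Degrees of monomials and homogeneous polynomials\<close>

lemma mdeg_superset:
  assumes "finite A" "Poly_Mapping.keys t \<subseteq> A"
  shows "mdeg t = (\<Sum>i\<in>A. Poly_Mapping.lookup t i)"
  unfolding mdeg_def using assms by (intro sum.mono_neutral_left) (auto simp: in_keys_iff)

lemma mdeg_add: "mdeg (s + t) = mdeg s + mdeg t"
proof -
  let ?A = "Poly_Mapping.keys s \<union> Poly_Mapping.keys t"
  have "mdeg (s + t) = (\<Sum>i\<in>?A. Poly_Mapping.lookup (s + t) i)"
    by (intro mdeg_superset) (auto simp: Poly_Mapping.keys_add)
  also have "\<dots> = mdeg s + mdeg t"
    using mdeg_superset[of ?A s] mdeg_superset[of ?A t] by (simp add: lookup_add sum.distrib)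
  finally show ?thesis .
qed

lemma mdeg_0 [simp]: "mdeg 0 = 0"
  by (simp add: mdeg_def)

lemma mdeg_single [simp]: "mdeg (Poly_Mapping.single i k) = k"
  by (simp add: mdeg_def)

text \<open>The homogeneity condition shared by \<open>forms\<close> (complex coefficients,
  variables X) and \<open>bihom_germs\<close> (rational functions as coefficients, variables Y). The
  zero polynomial belongs to every degree.\<close>

definition hpoly :: "nat \<Rightarrow> nat \<Rightarrow> 'a::zero mpoly set" where
  "hpoly N m = {F. \<forall>t\<in>Poly_Mapping.keys F. Poly_Mapping.keys t \<subseteq> {..N} \<and> mdeg t = m}"

lemma hpolyD: "F \<in> hpoly N m \<Longrightarrow> Poly_Mapping.lookup F t \<noteq> 0 \<Longrightarrow> Poly_Mapping.keys t \<subseteq> {..N} \<and> mdeg t = m"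
  by (auto simp: hpoly_def in_keys_iff)

lemma hpolyI: "(\<And>t. Poly_Mapping.lookup F t \<noteq> 0 \<Longrightarrow> Poly_Mapping.keys t \<subseteq> {..N} \<and> mdeg t = m) \<Longrightarrow> F \<in> hpoly N m"
  by (auto simp: hpoly_def in_keys_iff)

lemma hpoly_0 [simp]: "0 \<in> hpoly N m"
  by (simp add: hpoly_def)

lemma hpoly_add: "f \<in> hpoly N m \<Longrightarrow> g \<in> hpoly N m \<Longrightarrow> f + g \<in> hpoly N m"
  using Poly_Mapping.keys_add[of f g] by (fastforce simp: hpoly_def)

lemma hpoly_uminus [simp]: "- f \<in> hpoly N m \<longleftrightarrow> (f :: 'a::comm_ring_1 mpoly) \<in> hpoly N m"
  by (auto simp: hpoly_def in_keys_iff)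

lemma hpoly_single: "Poly_Mapping.keys t \<subseteq> {..N} \<Longrightarrow> mdeg t = m \<Longrightarrow> Poly_Mapping.single t a \<in> hpoly N m"
  by (auto simp: hpoly_def)

lemma hpoly_const [simp]: "Poly_Mapping.single 0 a \<in> hpoly N 0"
  by (auto simp: hpoly_def)

lemma hpoly_var: "i \<le> N \<Longrightarrow> var i \<in> hpoly N 1"
  by (auto simp: hpoly_def var_def)

lemma hpoly_mult:
  fixes f g :: "'a::comm_ring_1 mpoly"
  assumes "f \<in> hpoly N m" "g \<in> hpoly N k"
  shows "f * g \<in> hpoly N (m + k)"
  unfolding hpoly_def
proof safe
  fix t assume "t \<in> Poly_Mapping.keys (f * g)"
  then obtain a b where t: "t = a + b" and ab: "a \<in> Poly_Mapping.keys f" "b \<in> Poly_Mapping.keys g"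
    using Poly_Mapping.keys_mult[of f g] by blast
  with assms have "Poly_Mapping.keys a \<subseteq> {..N}" "Poly_Mapping.keys b \<subseteq> {..N}" "mdeg a = m" "mdeg b = k"
    by (auto simp: hpoly_def)
  then show "mdeg t = m + k" "\<And>x. x \<in> Poly_Mapping.keys t \<Longrightarrow> x \<le> N"
    using Poly_Mapping.keys_add[of a b] by (auto simp: t mdeg_add)
qed

lemma hpoly_partial:
  assumes "(f :: 'a::comm_ring_1 mpoly) \<in> hpoly N (Suc m)"
  shows "partial i f \<in> hpoly N m"
proof (rule hpolyI)
  fix t assume "Poly_Mapping.lookup (partial i f) t \<noteq> 0"
  then have "Poly_Mapping.lookup f (t + Poly_Mapping.single i 1) \<noteq> 0"
    by (auto simp: lookup_partial)
  from hpolyD[OF assms this] have *: "Poly_Mapping.keys (t + Poly_Mapping.single i 1) \<subseteq> {..N}"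
    "mdeg (t + Poly_Mapping.single i 1) = Suc m" by auto
  moreover have "Poly_Mapping.keys t \<subseteq> Poly_Mapping.keys (t + Poly_Mapping.single i 1)"
    by (auto simp: in_keys_iff lookup_add)
  ultimately show "Poly_Mapping.keys t \<subseteq> {..N} \<and> mdeg t = m"
    by (auto simp: mdeg_add)
qed

text \<open>Degree 0 is separate, since truncated subtraction would give degree 0 again for the
  derivative.\<close>

lemma hpoly_0_partial: "f \<in> hpoly N 0 \<Longrightarrow> partial i (f :: 'a::comm_ring_1 mpoly) = 0"
proof (rule poly_mapping_eqI)
  fix t assume "f \<in> hpoly N 0"
  then have "Poly_Mapping.lookup f (t + Poly_Mapping.single i 1) = 0"
    using hpolyD[of f N 0 "t + Poly_Mapping.single i 1"] by (auto simp: mdeg_add)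
  then show "Poly_Mapping.lookup (partial i f) t = Poly_Mapping.lookup 0 t"
    by (simp add: lookup_partial)
qed

text \<open>Each operator \<open>var j * partial j\<close> is diagonal on monomials, the eigenvalue
  being the exponent of variable j, and the exponents of a monomial add up to
  \<open>m\<close>.\<close>

lemma euler:
  assumes "(f :: 'a::comm_ring_1 mpoly) \<in> hpoly N m"
  shows "(\<Sum>j\<le>N. var j * partial j f) = of_nat m * f"
proof (rule poly_mapping_eqI)
  fix t
  have "Poly_Mapping.lookup (var j * partial j f) t = of_nat (Poly_Mapping.lookup t j) * Poly_Mapping.lookup f t" for j
  proof (cases "Poly_Mapping.lookup t j = 0")
    case False
    then have "t - Poly_Mapping.single j 1 + Poly_Mapping.single j 1 = t"
      by (auto simp: poly_mapping_eq_iff fun_eq_iff lookup_add lookup_minus lookup_single when_def)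
    with False show ?thesis
      by (auto simp: lookup_var_mult lookup_partial lookup_minus simp flip: of_nat_Suc)
  qed (simp add: lookup_var_mult)
  then have "Poly_Mapping.lookup (\<Sum>j\<le>N. var j * partial j f) t
     = of_nat (\<Sum>j\<le>N. Poly_Mapping.lookup t j) * Poly_Mapping.lookup f t"
    by (simp add: lookup_sum sum_distrib_right)
  also have "\<dots> = of_nat m * Poly_Mapping.lookup f t"
    using hpolyD[OF assms, of t] mdeg_superset[of "{..N}" t] by (cases "Poly_Mapping.lookup f t = 0") auto
  also have "\<dots> = Poly_Mapping.lookup (of_nat m * f) t"
    by (simp flip: single_of_nat)
  finally show "Poly_Mapping.lookup (\<Sum>j\<le>N. var j * partial j f) t = Poly_Mapping.lookup (of_nat m * f) t" .
qed

section \<open>Partial derivatives of rational functions\<close>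

definition rderiv :: "nat \<Rightarrow> ratfun \<Rightarrow> ratfun" where
  "rderiv j q = (SOME y. \<exists>f g. g \<noteq> 0 \<and> q = Fract f g
     \<and> y = Fract (partial j f * g - f * partial j g) (g * g))"

text \<open>\<open>rderiv\<close> picks a representative of a fraction by choice. Two
  representatives satisfy f g' = f' g, and differentiating this relation gives the second
  hypothesis; the quotient rule then has the same value for both.\<close>

lemma quotient_rule_well_defined:
  fixes f g f' g' df dg df' dg' :: "'a::idom"
  assumes "f * g' = f' * g" "df * g' + f * dg' = df' * g + f' * dg"
  shows "(df' * g' - f' * dg') * (g * g) = (df * g - f * dg) * (g' * g')"
proof -
  have "(df' * g' - f' * dg') * (g * g) = g * g' * (df' * g) - (f' * g) * dg' * g"
    by (simp add: algebra_simps)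
  also have "g * g' * (df' * g) - (f' * g) * dg' * g = g * g' * (df' * g - f * dg')"
    unfolding assms(1)[symmetric] by (simp add: algebra_simps)
  also have "df' * g - f * dg' = df * g' - f' * dg"
    using assms(2) by (simp add: algebra_simps)
  also have "g * g' * (df * g' - f' * dg) = g' * (df * g * g' - (f' * g) * dg)"
    by (simp add: algebra_simps)
  also have "\<dots> = (df * g - f * dg) * (g' * g')"
    unfolding assms(1)[symmetric] by (simp add: algebra_simps)
  finally show ?thesis .
qed

lemma rderiv_Fract:
  assumes "g \<noteq> 0"
  shows "rderiv j (Fract f g) = Fract (partial j f * g - f * partial j g) (g * g)"
proof -
  have "\<exists>y f' g'. g' \<noteq> 0 \<and> Fract f g = Fract f' g'
     \<and> y = Fract (partial j f' * g' - f' * partial j g') (g' * g')" using assms by blast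
  from someI_ex[OF this, folded rderiv_def] obtain f' g' where g': "g' \<noteq> 0" and "Fract f g = Fract f' g'"
    and y: "rderiv j (Fract f g) = Fract (partial j f' * g' - f' * partial j g') (g' * g')" by blast
  then have eq: "f * g' = f' * g" using assms by (simp add: eq_fract)
  then have "partial j f * g' + f * partial j g' = partial j f' * g + f' * partial j g"
    by (metis partial_mult)
  with eq have "(partial j f' * g' - f' * partial j g') * (g * g) = (partial j f * g - f * partial j g) * (g' * g')"
    by (rule quotient_rule_well_defined)
  then show ?thesis
    unfolding y using assms g' by (simp add: eq_fract)
qed

lemma rderiv_add: "rderiv j (a + b) = rderiv j a + rderiv j b"
proof -
  obtain f g where a: "a = Fract f g" "g \<noteq> 0" by (cases a)
  obtain f' g' where b: "b = Fract f' g'" "g' \<noteq> 0" by (cases b)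
  show ?thesis
    using a(2) b(2) unfolding a(1) b(1)
    by (simp add: rderiv_Fract eq_fract partial_mult partial_add) (simp add: algebra_simps)
qed

lemma rderiv_mult: "rderiv j (a * b) = rderiv j a * b + a * rderiv j b"
proof -
  obtain f g where a: "a = Fract f g" "g \<noteq> 0" by (cases a)
  obtain f' g' where b: "b = Fract f' g'" "g' \<noteq> 0" by (cases b)
  show ?thesis
    using a(2) b(2) unfolding a(1) b(1)
    by (simp add: rderiv_Fract eq_fract partial_mult partial_add) (simp add: algebra_simps)
qed

lemma rderiv_poly: "rderiv j (Fract f 1) = Fract (partial j f) 1"
  by (simp add: rderiv_Fract)

lemma rderiv_0 [simp]: "rderiv j 0 = 0"
  using rderiv_add[of j 0 0] by (metis add.right_neutral add_cancel_left_right)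

lemma rderiv_1 [simp]: "rderiv j 1 = 0"
  using rderiv_mult[of j 1 1] by (metis add_cancel_left_right mult.left_neutral mult.right_neutral)

section \<open>Germs of the twisting sheaves\<close>

abbreviation cst :: "'a \<Rightarrow> 'a::zero mpoly" where "cst a \<equiv> Poly_Mapping.single 0 a"
definition fr :: "cpoly \<Rightarrow> ratfun" where "fr f = Fract f 1"

lemma cst_mult: "cst (a * b) = cst a * cst (b :: 'a::comm_ring_1)"
  by (simp add: mult_single)

lemma cst_sum: "cst (sum f A) = (\<Sum>a\<in>A. cst (f a :: 'a::comm_ring_1))"
  by (induction A rule: infinite_finite_induct) (auto simp: single_add)

lemma fr_mult: "fr (f * g) = fr f * fr g"
  by (simp add: fr_def)

lemma fr_add: "fr (f + g) = fr f + fr g"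
  by (simp add: fr_def)

lemma fr_0 [simp]: "fr 0 = 0"
  by (simp add: fr_def Zero_fract_def)

lemma fr_1 [simp]: "fr 1 = 1"
  by (simp add: fr_def One_fract_def)

lemma fr_uminus: "fr (- f) = - fr f"
  by (simp add: fr_def)

lemma fr_diff: "fr (f - g) = fr f - fr g"
  by (simp add: fr_def)

lemma fr_of_nat [simp]: "fr (of_nat k) = of_nat k"
  by (simp add: fr_def of_nat_fract)

lemma fr_of_int [simp]: "fr (of_int k) = of_int k"
  by (cases k rule: int_cases2) (auto simp: fr_uminus)

lemma fr_sum: "fr (sum f A) = (\<Sum>a\<in>A. fr (f a))"
  by (induction A rule: infinite_finite_induct) (auto simp: fr_add)

lemma fr_power: "fr (f ^ k) = fr f ^ k"
  by (induction k) (auto simp: fr_mult)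

lemma fr_eq_iff [simp]: "fr f = fr g \<longleftrightarrow> f = g"
  by (simp add: fr_def eq_fract)

lemma fr_eq_0 [simp]: "fr f = 0 \<longleftrightarrow> f = 0"
  using fr_eq_iff[of f 0] by (simp del: fr_eq_iff)

lemma Fract_fr: "Fract f g = fr f / fr g"
  by (simp add: fr_def)

lemma rderiv_fr: "rderiv j (fr f) = fr (partial j f)"
  by (simp add: fr_def rderiv_poly)

section \<open>Forms of integer degree, the numerators and denominators of germs\<close>

lemma polyring_simps [simp]:
  "monoid.mult (polyring N) = (*)" "one (polyring N) = 1" "zero (polyring N) = 0" "add (polyring N) = (+)"
  by (simp_all add: polyring_def)

lemma forms_hpoly: "forms N (int k) = hpoly N k"
  by (auto simp: forms_def hpoly_def polyring_def)

lemma forms_neg: "k < 0 \<Longrightarrow> forms N k = {0}"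
  by (auto simp: forms_def polyring_def)

text \<open>Negative degrees do occur, for instance for O(-d_i), and contain only the zero form; in
  the other degrees the facts on \<open>hpoly\<close> apply.\<close>

lemma forms_cases:
  assumes "f \<in> forms N k"
  obtains "k < 0" "f = 0" | l where "k = int l" "f \<in> hpoly N l"
proof (cases "k < 0")
  case True
  with assms that(1) show ?thesis by (simp add: forms_neg)
next
  case False
  then obtain l where "k = int l" by (metis leI nonneg_int_cases)
  with assms that(2) show ?thesis by (simp add: forms_hpoly)
qed

lemma forms_carrier: "f \<in> forms N k \<Longrightarrow> f \<in> carrier (polyring N)"
  by (simp add: forms_def)

lemma forms_0 [simp]: "0 \<in> forms N k"
  by (simp add: forms_def polyring_def)

lemma forms_add: "f \<in> forms N k \<Longrightarrow> g \<in> forms N k \<Longrightarrow> f + g \<in> forms N k"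
  by (elim forms_cases) (auto simp: hpoly_add forms_hpoly)

lemma forms_uminus: "f \<in> forms N k \<Longrightarrow> - f \<in> forms N k"
  by (elim forms_cases) (auto simp: forms_hpoly)

lemma forms_diff: "f \<in> forms N k \<Longrightarrow> g \<in> forms N k \<Longrightarrow> f - g \<in> forms N k"
  using forms_add[OF _ forms_uminus, of f N k g] by simp

lemma forms_mult: "f \<in> forms N k \<Longrightarrow> g \<in> forms N l \<Longrightarrow> f * g \<in> forms N (k + l)"
  by (elim forms_cases) (auto simp: hpoly_mult forms_hpoly simp flip: of_nat_add)

lemma forms_const [simp]: "cst a \<in> forms N 0"
  using forms_hpoly[of N 0] by simp

lemma forms_1 [simp]: "1 \<in> forms N 0"
  using forms_const[of 1] by simp

lemma forms_var: "i \<le> N \<Longrightarrow> var i \<in> forms N 1"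
  using forms_hpoly[of N 1] hpoly_var[of i N] by simp

lemma forms_power: "f \<in> forms N k \<Longrightarrow> f ^ e \<in> forms N (int e * k)"
  by (induction e) (auto intro!: forms_mult simp: algebra_simps)

lemma forms_partial: "f \<in> forms N k \<Longrightarrow> partial j f \<in> forms N (k - 1)"
proof (elim forms_cases)
  fix l assume "k = int l" "f \<in> hpoly N l"
  then show ?thesis
    using forms_hpoly[of N "l - 1"] by (cases l) (auto simp: hpoly_0_partial hpoly_partial)
qed auto

lemma euler_forms: "f \<in> forms N k \<Longrightarrow> (\<Sum>j\<le>N. var j * partial j f) = of_int k * f"
  by (elim forms_cases) (auto simp: euler)

lemma cring_polyring: "cring (polyring N)"
proof -
  have C: "f \<in> carrier (polyring N) \<longleftrightarrow> (\<forall>t\<in>Poly_Mapping.keys f. Poly_Mapping.keys t \<subseteq> {..N})" for f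
    by (simp add: polyring_def)
  have m: "f * g \<in> carrier (polyring N)" if fg: "f \<in> carrier (polyring N)" "g \<in> carrier (polyring N)" for f g
    unfolding C
  proof
    fix t assume "t \<in> Poly_Mapping.keys (f * g)"
    then obtain u v where t: "t = u + v" "u \<in> Poly_Mapping.keys f" "v \<in> Poly_Mapping.keys g"
      using Poly_Mapping.keys_mult[of f g] by blast
    then have "Poly_Mapping.keys u \<subseteq> {..N}" "Poly_Mapping.keys v \<subseteq> {..N}"
      using fg unfolding C by blast+
    then show "Poly_Mapping.keys t \<subseteq> {..N}"
      unfolding t(1) using Poly_Mapping.keys_add[of u v] by blast
  qed
  have a: "f + g \<in> carrier (polyring N)" if "f \<in> carrier (polyring N)" "g \<in> carrier (polyring N)" for f g
    unfolding C using that[unfolded C] Poly_Mapping.keys_add[of f g] by blast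
  have u: "- f \<in> carrier (polyring N)" if "f \<in> carrier (polyring N)" for f
    using that by (auto simp: polyring_def in_keys_iff)
  have z: "0 \<in> carrier (polyring N)" "1 \<in> carrier (polyring N)"
    by (auto simp: polyring_def)
  show ?thesis
  proof (intro cringI abelian_groupI comm_monoidI)
    show "\<exists>y\<in>carrier (polyring N). y \<oplus>\<^bsub>polyring N\<^esub> x = \<zero>\<^bsub>polyring N\<^esub>" if "x \<in> carrier (polyring N)" for x
      using u[OF that] by (intro bexI[of _ "- x"]) simp_all
  qed (use m a z in \<open>simp_all add: algebra_simps\<close>)
qed

section \<open>Properties that hold on a Zariski neighbourhood of a point\<close>

definition nearby :: "nat \<Rightarrow> cpoly set \<Rightarrow> (cpoly set \<Rightarrow> bool) \<Rightarrow> bool" where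
  "nearby N p Q \<longleftrightarrow> (\<exists>U. openin (proj_topology N) U \<and> p \<in> U \<and> (\<forall>q\<in>U. Q q))"

lemma topspace_proj: "topspace (proj_topology N) = proj_points N"
proof -
  have "\<Union>{{p \<in> proj_points N. f \<notin> p} |f. \<exists>k. f \<in> forms N k} = proj_points N" (is "\<Union>?S = _")
  proof (rule equalityI)
    show "\<Union>?S \<subseteq> proj_points N"
      by (rule Union_least) fastforce
    show "proj_points N \<subseteq> \<Union>?S"
    proof
      fix p assume p: "p \<in> proj_points N"
      then obtain i where i: "i \<le> N" "var i \<notin> p"
        by (auto simp: proj_points_def)
      have "{p \<in> proj_points N. var i \<notin> p} \<in> ?S"
        using forms_var[OF i(1)] by blast
      then show "p \<in> \<Union>?S" by (rule UnionI) (use p i in simp)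
    qed
  qed
  then show ?thesis
    by (simp only: proj_topology_def topology_generated_by_topspace)
qed

lemma openin_basic: "f \<in> forms N k \<Longrightarrow> openin (proj_topology N) {p \<in> proj_points N. f \<notin> p}"
  unfolding proj_topology_def by (rule topology_generated_by_Basis) blast

lemma nearby_basic: "f \<in> forms N k \<Longrightarrow> p \<in> proj_points N \<Longrightarrow> f \<notin> p \<Longrightarrow> nearby N p (\<lambda>q. q \<in> proj_points N \<and> f \<notin> q)"
  unfolding nearby_def using openin_basic[of f N k] by (intro exI[of _ "{q \<in> proj_points N. f \<notin> q}"]) simp

lemma nearby_mono:
  assumes "nearby N p Q" and *: "\<And>q. q \<in> proj_points N \<Longrightarrow> Q q \<Longrightarrow> R q"
  shows "nearby N p R"
proof -
  from assms(1) obtain U where U: "openin (proj_topology N) U" "p \<in> U" "\<forall>q\<in>U. Q q"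
    by (auto simp: nearby_def)
  then have "U \<subseteq> proj_points N"
    using openin_subset topspace_proj by metis
  with U * show ?thesis
    unfolding nearby_def by (intro exI[of _ U]) auto
qed

lemma nearby_conj:
  assumes "nearby N p Q" "nearby N p R"
  shows "nearby N p (\<lambda>q. Q q \<and> R q)"
proof -
  from assms obtain U V where "openin (proj_topology N) U" "p \<in> U" "\<forall>q\<in>U. Q q"
    "openin (proj_topology N) V" "p \<in> V" "\<forall>q\<in>V. R q"
    by (auto simp: nearby_def)
  then show ?thesis
    unfolding nearby_def by (intro exI[of _ "U \<inter> V"]) auto
qed

lemma nearby_True: "p \<in> proj_points N \<Longrightarrow> nearby N p (\<lambda>q. True)"
  unfolding nearby_def using topspace_proj openin_topspace[of "proj_topology N"] by auto

text \<open>Finitely many neighbourhoods can be intersected. This is applied to the nonzero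
  coefficients of a polynomial and to the index sets of the Koszul complex.\<close>

lemma nearby_ball:
  "finite A \<Longrightarrow> p \<in> proj_points N \<Longrightarrow> (\<And>a. a \<in> A \<Longrightarrow> nearby N p (Q a)) \<Longrightarrow> nearby N p (\<lambda>q. \<forall>a\<in>A. Q a q)"
proof (induction A rule: finite_induct)
  case empty
  then show ?case by (simp add: nearby_True)
next
  case (insert x F)
  then have "nearby N p (\<lambda>q. Q x q \<and> (\<forall>a\<in>F. Q a q))"
    by (intro nearby_conj) auto
  then show ?case by (rule nearby_mono) auto
qed

lemma nearby_at: "nearby N p Q \<Longrightarrow> Q p"
  by (auto simp: nearby_def)

section \<open>The local ring at a point and the stalks of the twisting sheaves\<close>

locale proj_point =
  fixes N :: nat and p :: "cpoly set"
  assumes p: "p \<in> proj_points N"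
begin

lemma prime: "primeideal p (polyring N)"
  using p by (simp add: proj_points_def)

lemma p_0 [simp]: "0 \<in> p"
proof -
  interpret primeideal p "polyring N" by (rule prime)
  show ?thesis using additive_subgroup.zero_closed[OF additive_subgroup_axioms] by simp
qed

lemma p_add: "f \<in> p \<Longrightarrow> g \<in> p \<Longrightarrow> f + g \<in> p"
proof -
  interpret primeideal p "polyring N" by (rule prime)
  show "f \<in> p \<Longrightarrow> g \<in> p \<Longrightarrow> f + g \<in> p" using additive_subgroup.a_closed[OF additive_subgroup_axioms, of f g] by simp
qed

lemma p_mult: "f \<in> p \<Longrightarrow> g \<in> carrier (polyring N) \<Longrightarrow> f * g \<in> p"
proof -
  interpret primeideal p "polyring N" by (rule prime)
  show "f \<in> p \<Longrightarrow> g \<in> carrier (polyring N) \<Longrightarrow> f * g \<in> p" using I_r_closed[of f g] by simp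
qed

lemma p_prime: "f \<in> carrier (polyring N) \<Longrightarrow> g \<in> carrier (polyring N) \<Longrightarrow> f * g \<in> p \<Longrightarrow> f \<in> p \<or> g \<in> p"
proof -
  interpret primeideal p "polyring N" by (rule prime)
  show "f \<in> carrier (polyring N) \<Longrightarrow> g \<in> carrier (polyring N) \<Longrightarrow> f * g \<in> p \<Longrightarrow> f \<in> p \<or> g \<in> p"
    using I_prime[of f g] by simp
qed

lemma p_1: "1 \<notin> p"
proof
  interpret primeideal p "polyring N" by (rule prime)
  assume "1 \<in> p"
  then have "carrier (polyring N) = p"
    using one_imp_carrier by simp
  with I_notcarr show False by simp
qed

lemma notin_p_mult: "f \<in> forms N k \<Longrightarrow> g \<in> forms N l \<Longrightarrow> f \<notin> p \<Longrightarrow> g \<notin> p \<Longrightarrow> f * g \<notin> p"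
  using p_prime[of f g] by (auto dest: forms_carrier)

lemma notin_p_nz: "f \<notin> p \<Longrightarrow> f \<noteq> 0"
  by auto

lemma notin_p_power: "f \<in> forms N k \<Longrightarrow> f \<notin> p \<Longrightarrow> f ^ e \<notin> p"
  by (induction e) (auto simp: p_1 dest: notin_p_mult[OF _ forms_power])

abbreviation germs :: "int \<Rightarrow> ratfun set" where "germs n \<equiv> twist_germs N n p"

lemma germsI: "g \<in> forms N (int e) \<Longrightarrow> g \<notin> p \<Longrightarrow> f \<in> forms N (n + int e) \<Longrightarrow> Fract f g \<in> germs n"
  unfolding twist_germs_def by blast

lemma germsE:
  assumes "a \<in> germs n"
  obtains f g e where "a = Fract f g" "g \<in> forms N (int e)" "g \<notin> p" "g \<noteq> 0" "f \<in> forms N (n + int e)"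
  using assms unfolding twist_germs_def by (auto dest: notin_p_nz)

lemma germs_poly: "f \<in> forms N n \<Longrightarrow> fr f \<in> germs n"
  using germsI[of 1 0 f n] by (simp add: p_1 fr_def)

lemma germs_0 [simp]: "0 \<in> germs n"
  using germs_poly[of 0 n] by simp

lemma germs_1 [simp]: "1 \<in> germs 0"
  using germs_poly[of 1 0] by simp

lemma germs_const [simp]: "fr (cst z) \<in> germs 0"
  by (rule germs_poly) simp

lemma germs_mult:
  assumes "a \<in> germs n" "b \<in> germs k"
  shows "a * b \<in> germs (n + k)"
  using assms
proof (elim germsE)
  fix f g e f' g' e'
  assume "a = Fract f g" "g \<in> forms N (int e)" "g \<notin> p" "f \<in> forms N (n + int e)"
    and "b = Fract f' g'" "g' \<in> forms N (int e')" "g' \<notin> p" "f' \<in> forms N (k + int e')"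
  then show ?thesis
    using germsI[of "g * g'" "e + e'" "f * f'" "n + k"] forms_mult[of g N "int e" g' "int e'"]
      forms_mult[of f N "n + int e" f' "k + int e'"] notin_p_mult[of g "int e" g' "int e'"]
    by (simp add: algebra_simps)
qed

lemma germs_add:
  assumes "a \<in> germs n" "b \<in> germs n"
  shows "a + b \<in> germs n"
  using assms
proof (elim germsE)
  fix f g e f' g' e'
  assume *: "a = Fract f g" "g \<in> forms N (int e)" "g \<notin> p" "f \<in> forms N (n + int e)" "g \<noteq> 0"
    and **: "b = Fract f' g'" "g' \<in> forms N (int e')" "g' \<notin> p" "f' \<in> forms N (n + int e')" "g' \<noteq> 0"
  have "f * g' + f' * g \<in> forms N (n + int (e + e'))"
    using forms_mult[OF *(4) **(2)] forms_mult[OF **(4) *(2)] by (auto intro!: forms_add simp: algebra_simps)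
  then show ?thesis
    using * ** germsI[of "g * g'" "e + e'" "f * g' + f' * g" n] forms_mult[of g N "int e" g' "int e'"]
      notin_p_mult[of g "int e" g' "int e'"]
    by simp
qed

lemma germs_uminus: "a \<in> germs n \<Longrightarrow> - a \<in> germs n"
  using germs_mult[of "fr (cst (-1))" 0 a n] germs_const[of "-1"] by (simp add: single_uminus fr_uminus)

lemma germs_diff: "a \<in> germs n \<Longrightarrow> b \<in> germs n \<Longrightarrow> a - b \<in> germs n"
  using germs_add[OF _ germs_uminus, of a n b] by simp

lemma germs_sum: "(\<And>x. x \<in> A \<Longrightarrow> f x \<in> germs n) \<Longrightarrow> sum f A \<in> germs n"
  by (induction A rule: infinite_finite_induct) (auto intro: germs_add)

lemma germs_mult0: "a \<in> germs 0 \<Longrightarrow> b \<in> germs n \<Longrightarrow> a * b \<in> germs n"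
  using germs_mult[of a 0 b n] by simp

lemma of_nat_ratfun: "(of_nat k :: ratfun) = fr (cst (of_nat k))"
  by simp

lemma germs_of_nat [simp]: "of_nat k \<in> germs 0"
  using germs_const[of "of_nat k"] by simp

lemma of_nat_ratfun_nz: "k > 0 \<Longrightarrow> (of_nat k :: ratfun) \<noteq> 0"
  by (metis fr_eq_0 fr_of_nat not_gr_zero of_nat_eq_0_iff)

text \<open>The inverse of a positive integer is again a complex constant, hence a germ at every
  point. For \<open>k = 0\<close> both sides are zero by convention.\<close>

lemma inverse_of_nat_ratfun: "inverse (of_nat k :: ratfun) = fr (cst (inverse (of_nat k)))"
proof (cases "k = 0")
  case False
  have "(of_nat k :: ratfun) * fr (cst (inverse (of_nat k))) = fr (cst (of_nat k * inverse (of_nat k)))"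
    unfolding of_nat_ratfun by (simp only: cst_mult fr_mult)
  also have "\<dots> = 1" using False by simp
  finally show ?thesis by (rule inverse_unique)
qed simp

lemma germs_inverse_of_nat [simp]: "inverse (of_nat k) \<in> germs 0"
  unfolding inverse_of_nat_ratfun by simp

lemma rderiv_germs:
  assumes "a \<in> germs n" shows "rderiv j a \<in> germs (n - 1)"
  using assms
proof (elim germsE)
  fix f g e
  assume *: "a = Fract f g" "g \<in> forms N (int e)" "g \<notin> p" "g \<noteq> 0" "f \<in> forms N (n + int e)"
  have "partial j f * g - f * partial j g \<in> forms N (n - 1 + int (e + e))"
    using forms_mult[OF forms_partial[OF *(5)] *(2)] forms_mult[OF *(5) forms_partial[OF *(2)]]
    by (intro forms_diff) (auto simp: algebra_simps)
  then show ?thesis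
    using * germsI[of "g * g" "e + e"] forms_mult[OF *(2) *(2)] notin_p_mult[OF *(2) *(2) *(3) *(3)]
    by (simp add: rderiv_Fract)
qed

text \<open>The quotient rule reduces this to Euler's relation for numerator and denominator, whose
  degrees subtract. Degree 0 is the case that places differentials of functions in Ker
  delta.\<close>

lemma euler_germs:
  assumes "a \<in> germs n" shows "(\<Sum>j\<le>N. fr (var j) * rderiv j a) = of_int n * a"
  using assms
proof (elim germsE)
  fix f g e
  assume *: "a = Fract f g" "g \<in> forms N (int e)" "g \<notin> p" "g \<noteq> 0" "f \<in> forms N (n + int e)"
  have "rderiv j a = (fr (partial j f) * fr g - fr f * fr (partial j g)) / (fr g * fr g)" for j
    using *(1,4) by (simp add: rderiv_Fract) (simp add: Fract_fr fr_diff fr_mult)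
  then have "fr (var j) * rderiv j a
     = (fr (var j * partial j f) * fr g - fr f * fr (var j * partial j g)) / (fr g * fr g)" for j
    by (simp add: fr_mult algebra_simps)
  then have "(\<Sum>j\<le>N. fr (var j) * rderiv j a)
     = (fr (\<Sum>j\<le>N. var j * partial j f) * fr g - fr f * fr (\<Sum>j\<le>N. var j * partial j g)) / (fr g * fr g)"
    by (simp only: fr_sum sum_distrib_left sum_distrib_right sum_subtractf sum_divide_distrib[symmetric])
  also have "\<dots> = of_int n * a"
    unfolding euler_forms[OF *(2)] euler_forms[OF *(5)] fr_mult fr_of_int Fract_fr *(1) using *(4)
    by (simp add: divide_simps) (simp add: algebra_simps)
  finally show ?thesis .
qed

text \<open>A denominator that works at \<open>p\<close> works wherever it does not vanish.\<close>

lemma germs_nearby: "a \<in> germs n \<Longrightarrow> nearby N p (\<lambda>q. a \<in> twist_germs N n q)"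
proof (elim germsE)
  fix f g e
  assume *: "a = Fract f g" "g \<in> forms N (int e)" "g \<notin> p" "g \<noteq> 0" "f \<in> forms N (n + int e)"
  have "nearby N p (\<lambda>q. q \<in> proj_points N \<and> g \<notin> q)"
    using nearby_basic *(2,3) p by blast
  then show ?thesis
    by (rule nearby_mono) (use * in \<open>auto simp: twist_germs_def\<close>)
qed

text \<open>The maximal ideal of the local ring of projective space at \<open>p\<close>.\<close>

definition nonunits :: "ratfun set" where
  "nonunits = {Fract f g | f g e. f \<in> forms N (int e) \<and> g \<in> forms N (int e) \<and> f \<in> p \<and> g \<notin> p}"

lemma one_unit: "1 \<notin> nonunits"
proof
  assume "1 \<in> nonunits"
  then obtain f g e where *: "1 = Fract f g" "f \<in> p" "g \<notin> p" unfolding nonunits_def by blast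
  then have "f = g" by (auto simp: Fract_fr divide_eq_1_iff dest: sym)
  with * show False by simp
qed

lemma germs_inverse: "a \<in> germs 0 \<Longrightarrow> a \<notin> nonunits \<Longrightarrow> inverse a \<in> germs 0"
proof (elim germsE)
  fix f g e
  assume *: "a = Fract f g" "g \<in> forms N (int e)" "g \<notin> p" "f \<in> forms N (0 + int e)" "a \<notin> nonunits"
  then have "f \<notin> p" unfolding nonunits_def by auto
  then show ?thesis using germsI[of f e g 0] * by simp
qed

end

locale chart = proj_point +
  fixes r :: nat
  assumes r: "r \<le> N" "var r \<notin> p"
begin

abbreviation X :: ratfun where "X \<equiv> fr (var r)"

lemma var_r_nz [simp]: "var r \<noteq> (0 :: cpoly)"
  using notin_p_nz[OF r(2)] .

lemma X_nz: "X \<noteq> 0"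
  by simp

text \<open>Integer powers of X_r trivialise all the O(k) on the chart; multiplication by them moves
  every stalk to twist 0 and back.\<close>

lemma X_power: "X powi k \<in> germs k"
proof (cases k rule: int_cases2)
  case (nonneg e)
  have "X ^ e \<in> germs (int e)"
  proof (induction e)
    case (Suc e)
    then show ?case using germs_mult[OF germs_poly[OF forms_var[OF r(1)]] Suc] by simp
  qed simp
  with nonneg show ?thesis by (simp add: power_int_def)
next
  case (nonpos e)
  have 1: "inverse X \<in> germs (-1)"
    using germsI[of "var r" 1 1 "-1"] r forms_var[OF r(1)] by (simp add: Fract_fr field_simps)
  have "inverse X ^ e \<in> germs (- int e)"
  proof (induction e)
    case (Suc e)
    then show ?case using germs_mult[OF 1 Suc] by (simp add: algebra_simps)
  qed simp
  with nonpos show ?thesis by (simp add: power_int_minus power_inverse)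
qed

lemma X_power_cancel: "X powi k * X powi (- k) = 1" "X powi (-k) * X powi k = 1"
  using power_int_add[of X k "-k"] power_int_add[of X "-k" k] by simp_all

lemma chart_nearby: "nearby N p (\<lambda>q. chart N q r)"
proof -
  have "nearby N p (\<lambda>q. q \<in> proj_points N \<and> var r \<notin> q)"
    using nearby_basic[OF forms_var[OF r(1)] p r(2)] .
  then show ?thesis
    by (rule nearby_mono) (use r in \<open>auto simp: chart_def proj_point_def chart_axioms_def\<close>)
qed

end

lemma (in proj_point) ex_chart: "\<exists>r. chart N p r"
  using p by (auto simp: chart_def proj_point_def chart_axioms_def proj_points_def)

section \<open>Modules of cosets\<close>

definition conc_ring :: "'a::comm_ring_1 set \<Rightarrow> 'a ring" where
  "conc_ring A = \<lparr>carrier = A, monoid.mult = (*), one = 1, zero = 0, add = (+)\<rparr>"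

definition conc_mod :: "'b::ab_group_add set \<Rightarrow> ('a \<Rightarrow> 'b \<Rightarrow> 'b) \<Rightarrow> ('a, 'b) module" where
  "conc_mod C sm = \<lparr>carrier = C, monoid.mult = undefined, one = undefined, zero = 0, add = (+), smult = sm\<rparr>"

definition addsub :: "'b::ab_group_add set \<Rightarrow> bool" where
  "addsub H \<longleftrightarrow> 0 \<in> H \<and> (\<forall>x\<in>H. \<forall>y\<in>H. x + y \<in> H) \<and> (\<forall>x\<in>H. - x \<in> H)"

definition cs :: "'b::ab_group_add set \<Rightarrow> 'b \<Rightarrow> 'b set" where
  "cs H x = (\<lambda>h. h + x) ` H"

text \<open>The image of \<open>V\<close> among the cosets of \<open>H\<close>. It is not assumed
  that \<open>H\<close> lies in \<open>V\<close>: for Ker delta, \<open>H\<close> is the ideal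
  multiple of the whole bundle of polynomials. The scalars are themselves cosets, so multiplication
  is a union over representatives, as in \<open>restrict_sheaf\<close>.\<close>

definition cosmod :: "'b::ab_group_add set \<Rightarrow> 'b set \<Rightarrow> ('a \<Rightarrow> 'b \<Rightarrow> 'b) \<Rightarrow> ('a set, 'b set) module" where
  "cosmod V H sm = \<lparr>carrier = cs H ` V, monoid.mult = undefined, one = undefined, zero = H,
     add = (\<lambda>A B. \<Union>a\<in>A. \<Union>b\<in>B. {a + b}), smult = (\<lambda>a C. \<Union>b\<in>a. \<Union>x\<in>C. cs H (sm b x))\<rparr>"

lemma conc_simps [simp]:
  "carrier (conc_ring A) = A" "monoid.mult (conc_ring A) = (*)" "one (conc_ring A) = 1"
  "zero (conc_ring A) = 0" "add (conc_ring A) = (+)"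
  "carrier (conc_mod C sm) = C" "zero (conc_mod C sm) = 0"
  "add (conc_mod C sm) = (+)" "smult (conc_mod C sm) = sm"
  by (simp_all add: conc_ring_def conc_mod_def)

lemma cosmod_simps [simp]:
  "carrier (cosmod V H sm) = cs H ` V" "zero (cosmod V H sm) = H"
  by (simp_all add: cosmod_def)

lemma addsubD:
  assumes "addsub H"
  shows "0 \<in> H" "x \<in> H \<Longrightarrow> y \<in> H \<Longrightarrow> x + y \<in> H" "x \<in> H \<Longrightarrow> - x \<in> H" "x \<in> H \<Longrightarrow> y \<in> H \<Longrightarrow> x - y \<in> H"
proof -
  show "0 \<in> H" "x \<in> H \<Longrightarrow> y \<in> H \<Longrightarrow> x + y \<in> H" "x \<in> H \<Longrightarrow> - x \<in> H"
    using assms by (auto simp: addsub_def)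
  show "x \<in> H \<Longrightarrow> y \<in> H \<Longrightarrow> x - y \<in> H"
    using assms unfolding addsub_def by (metis diff_conv_add_uminus)
qed

lemma addsub_sum: "addsub H \<Longrightarrow> (\<And>x. x \<in> A \<Longrightarrow> f x \<in> H) \<Longrightarrow> sum f A \<in> H"
  by (induction A rule: infinite_finite_induct) (auto simp: addsubD)

lemma mem_cs: "y \<in> cs H x \<longleftrightarrow> y - x \<in> H"
proof
  assume "y - x \<in> H"
  then have "y - x + x \<in> cs H x" unfolding cs_def by (rule imageI)
  then show "y \<in> cs H x" by simp
qed (auto simp: cs_def)

lemma cs_eq_iff:
  assumes "addsub H"
  shows "cs H x = cs H y \<longleftrightarrow> x - y \<in> H"
proof
  assume "cs H x = cs H y"
  moreover have "x \<in> cs H x" using addsubD(1)[OF assms] by (simp add: mem_cs)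
  ultimately show "x - y \<in> H" by (simp add: mem_cs)
next
  assume *: "x - y \<in> H"
  show "cs H x = cs H y"
  proof (rule Set.set_eqI)
    fix z show "z \<in> cs H x \<longleftrightarrow> z \<in> cs H y"
      using addsubD(2)[OF assms _ *, of "z - x"] addsubD(4)[OF assms _ *, of "z - y"]
      by (auto simp: mem_cs algebra_simps)
  qed
qed

lemma cs_self: "addsub H \<Longrightarrow> x \<in> cs H x"
  by (simp add: mem_cs addsubD)

lemma cs_0 [simp]: "cs H 0 = H"
  by (simp add: cs_def)

lemma cs_eq_self: "addsub H \<Longrightarrow> cs H x = H \<longleftrightarrow> x \<in> H"
  using cs_eq_iff[of H x 0] by simp

lemma rcos_plus: "add M = (+) \<Longrightarrow> H +>\<^bsub>M\<^esub> x = cs H x"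
  by (auto simp: a_r_coset_def r_coset_def cs_def)

lemma cs_add:
  assumes "addsub H"
  shows "(\<Union>a\<in>cs H x. \<Union>b\<in>cs H y. {a + b}) = cs H (x + y)"
proof (intro equalityI subsetI)
  fix z assume "z \<in> (\<Union>a\<in>cs H x. \<Union>b\<in>cs H y. {a + b})"
  then obtain a b where "a - x \<in> H" "b - y \<in> H" "z = a + b" by (auto simp: mem_cs)
  then show "z \<in> cs H (x + y)"
    using addsubD(2)[OF assms, of "a - x" "b - y"] by (simp add: mem_cs algebra_simps)
next
  fix z assume "z \<in> cs H (x + y)"
  then have "z - y \<in> cs H x" by (simp add: mem_cs algebra_simps)
  moreover have "y \<in> cs H y" using assms by (rule cs_self)
  moreover have "z = (z - y) + y" by simp
  ultimately show "z \<in> (\<Union>a\<in>cs H x. \<Union>b\<in>cs H y. {a + b})" by blast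
qed

lemma cosmod_add: "addsub H \<Longrightarrow> cs H x \<oplus>\<^bsub>cosmod V H sm\<^esub> cs H y = cs H (x + y)"
  by (simp add: cosmod_def cs_add)

locale coset_ring =
  fixes A J :: "'a::comm_ring_1 set"
  assumes A: "addsub A" "1 \<in> A" "\<And>x y. x \<in> A \<Longrightarrow> y \<in> A \<Longrightarrow> x * y \<in> A"
    and J: "addsub J" "J \<subseteq> A" "\<And>x y. x \<in> A \<Longrightarrow> y \<in> J \<Longrightarrow> x * y \<in> J"
begin

abbreviation "B \<equiv> conc_ring A Quot J"

lemma cring_conc: "cring (conc_ring A)"
proof (intro cringI abelian_groupI comm_monoidI)
  show "\<exists>y\<in>carrier (conc_ring A). y \<oplus>\<^bsub>conc_ring A\<^esub> x = \<zero>\<^bsub>conc_ring A\<^esub>" if "x \<in> carrier (conc_ring A)" for x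
    using that addsubD(3)[OF A(1)] by (intro bexI[of _ "- x"]) simp_all
qed (use A addsubD[OF A(1)] in \<open>simp_all add: algebra_simps\<close>)

lemma a_inv_conc: "x \<in> A \<Longrightarrow> \<ominus>\<^bsub>conc_ring A\<^esub> x = - x"
proof -
  interpret cring "conc_ring A" by (rule cring_conc)
  show "x \<in> A \<Longrightarrow> \<ominus>\<^bsub>conc_ring A\<^esub> x = - x"
    using minus_equality[of "-x" x] addsubD(3)[OF A(1)] by simp
qed

lemma ideal_J: "ideal J (conc_ring A)"
proof -
  have J_r: "y * x \<in> J" if "x \<in> A" "y \<in> J" for x y
    using J(3)[OF that] by (simp add: mult.commute)
  interpret cring "conc_ring A" by (rule cring_conc)
  show ?thesis
  proof (rule idealI)
    show "subgroup J (add_monoid (conc_ring A))"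
      by (rule add.subgroupI) (use J addsubD[OF J(1)] a_inv_conc in \<open>auto simp flip: a_inv_def\<close>)
  qed (use J A in \<open>auto simp: ring_axioms intro: J_r\<close>)
qed

lemma cring_B: "cring B"
  using ideal.quotient_is_cring[OF ideal_J cring_conc] .

lemma B_carrier: "carrier B = cs J ` A"
  by (auto simp: FactRing_def A_RCOSETS_def RCOSETS_def r_coset_def cs_def)

lemma B_zero: "\<zero>\<^bsub>B\<^esub> = J"
  by (simp add: FactRing_def)

lemma B_one: "\<one>\<^bsub>B\<^esub> = cs J 1"
  by (simp add: FactRing_def rcos_plus)

lemma B_add: "cs J x \<oplus>\<^bsub>B\<^esub> cs J y = cs J (x + y)"
  using cs_add[OF J(1)] by (simp add: FactRing_def set_add_def set_mult_def)

lemma B_mult: "x \<in> A \<Longrightarrow> y \<in> A \<Longrightarrow> cs J x \<otimes>\<^bsub>B\<^esub> cs J y = cs J (x * y)"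
  using ideal.rcoset_mult_add[OF ideal_J, of x y] by (simp add: FactRing_def rcos_plus)

end

locale coset_module = coset_ring A J for A J :: "'a::comm_ring_1 set" +
  fixes V H :: "'b::ab_group_add set" and sm :: "'a \<Rightarrow> 'b \<Rightarrow> 'b"
  assumes V: "addsub V" "\<And>a x. a \<in> A \<Longrightarrow> x \<in> V \<Longrightarrow> sm a x \<in> V"
    and H: "addsub H" "\<And>a x. a \<in> A \<Longrightarrow> x \<in> H \<Longrightarrow> sm a x \<in> H" "\<And>a x. a \<in> J \<Longrightarrow> x \<in> V \<Longrightarrow> sm a x \<in> H"
    and sm: "\<And>a b x. sm (a + b) x = sm a x + sm b x" "\<And>a x y. sm a (x + y) = sm a x + sm a y"
      "\<And>a b x. sm (a * b) x = sm a (sm b x)" "\<And>x. sm 1 x = x"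
begin

abbreviation "Q \<equiv> cosmod V H sm"

lemma smult_cs:
  assumes "a \<in> A" "x \<in> V"
  shows "cs J a \<odot>\<^bsub>Q\<^esub> cs H x = cs H (sm a x)"
proof -
  have "cs H (sm b y) = cs H (sm a x)" if "b \<in> cs J a" "y \<in> cs H x" for b y
  proof -
    from that have b: "b - a \<in> J" and y: "y - x \<in> H" by (auto simp: mem_cs)
    have "b - a + a \<in> A" using b J(2) assms(1) addsubD(2)[OF A(1)] by blast
    then have bA: "b \<in> A" by simp
    have "sm b y = sm b (y - x + x)" by simp
    also have "\<dots> = sm b (y - x) + sm (b - a + a) x" unfolding sm(2) by simp
    also have "\<dots> = sm b (y - x) + sm (b - a) x + sm a x" unfolding sm(1) by (simp only: add.assoc)
    finally have "sm b y - sm a x = sm b (y - x) + sm (b - a) x" by simp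
    also have "\<dots> \<in> H" using H bA b y assms by (intro addsubD(2)) auto
    finally show ?thesis by (simp add: cs_eq_iff[OF H(1)])
  qed
  then have "(\<Union>b\<in>cs J a. \<Union>y\<in>cs H x. cs H (sm b y)) = (\<Union>b\<in>cs J a. \<Union>y\<in>cs H x. cs H (sm a x))"
    by (intro SUP_cong refl)
  also have "\<dots> = cs H (sm a x)"
    using cs_self[OF J(1), of a] cs_self[OF H(1), of x] by blast
  finally show ?thesis
    by (simp add: cosmod_def)
qed

lemma Q_add: "cs H x \<oplus>\<^bsub>Q\<^esub> cs H y = cs H (x + y)"
  by (rule cosmod_add[OF H(1)])

lemma module_Q: "Module.module B Q"
proof (rule moduleI)
  show "abelian_group Q"
  proof (rule abelian_groupI)
    show "\<exists>y\<in>carrier Q. y \<oplus>\<^bsub>Q\<^esub> x = \<zero>\<^bsub>Q\<^esub>" if x: "x \<in> carrier Q" for x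
    proof -
      from x obtain v where "v \<in> V" "x = cs H v" by auto
      then show ?thesis
        using Q_add[of "-v" v] addsubD(3)[OF V(1)] by (intro bexI[of _ "cs H (- v)"]) auto
    qed
    show "\<zero>\<^bsub>Q\<^esub> \<in> carrier Q"
      using imageI[OF addsubD(1)[OF V(1)], of "cs H"] by simp
    show "\<zero>\<^bsub>Q\<^esub> \<oplus>\<^bsub>Q\<^esub> x = x" if "x \<in> carrier Q" for x
      using that Q_add[of 0] by auto
  qed (auto simp: Q_add addsubD[OF V(1)] algebra_simps)
qed (auto simp: B_carrier cring_B B_add B_one B_mult smult_cs Q_add addsubD[OF V(1)] addsubD[OF A(1)] V A sm)

lemma finsum_Q: "(\<And>i. i \<in> S \<Longrightarrow> f i \<in> V) \<Longrightarrow> (\<Oplus>\<^bsub>Q\<^esub>i\<in>S. cs H (f i)) = cs H (sum f S)"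
proof (induction S rule: infinite_finite_induct)
  interpret Module.module B Q by (rule module_Q)
  {
    \<comment> \<open>By convention both sums over an infinite set are zero, and the zero coset is
      \<open>H\<close>.\<close>
    case (infinite S)
    then show ?case by (simp add: finsum_def finprod_def)
  next
    case empty
    then show ?case by simp
  next
    case (insert x F)
    then have "(\<Oplus>\<^bsub>Q\<^esub>i\<in>insert x F. cs H (f i)) = cs H (f x) \<oplus>\<^bsub>Q\<^esub> (\<Oplus>\<^bsub>Q\<^esub>i\<in>F. cs H (f i))"
      by (intro M.finsum_insert) auto
    with insert show ?case by (simp add: Q_add)
  }
qed

end

section \<open>Germs of polynomials in \<open>Y\<close> with twisted coefficients\<close>

lemma mpoly_mult_expand:
  fixes F G :: "'a::comm_ring_1 mpoly"
  shows "F * G = (\<Sum>s\<in>Poly_Mapping.keys F. \<Sum>u\<in>Poly_Mapping.keys G.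
    Poly_Mapping.single (s + u) (Poly_Mapping.lookup F s * Poly_Mapping.lookup G u))"
  by (subst mpoly_expand[of F], subst mpoly_expand[of G]) (simp add: sum_product mult_single)

lemma lookup_mult_in:
  fixes F G :: "'a::comm_ring_1 mpoly"
  assumes "addsub U" "\<And>t u. Poly_Mapping.lookup F t * Poly_Mapping.lookup G u \<in> U"
  shows "Poly_Mapping.lookup (F * G) t \<in> U"
  unfolding mpoly_mult_expand lookup_sum lookup_single
  using assms by (intro addsub_sum) (auto simp: when_def addsubD)

lemma delta_add: "delta N (F + G) = delta N F + delta N G"
  by (simp add: delta_def partial_add algebra_simps sum.distrib)

lemma delta_uminus: "delta N (- F) = - delta N F"
  by (simp add: delta_def partial_uminus sum_negf)

lemma delta_diff: "delta N (F - G) = delta N F - delta N G"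
  using delta_add[of N F "- G"] by (simp add: delta_uminus)

lemma delta_0 [simp]: "delta N 0 = 0"
  by (simp add: delta_def)

lemma delta_sum: "delta N (sum f A) = (\<Sum>a\<in>A. delta N (f a))"
  by (induction A rule: infinite_finite_induct) (auto simp: delta_add)

lemma delta_mult: "delta N (F * G) = delta N F * G + F * delta N G"
  by (simp add: delta_def partial_mult algebra_simps sum.distrib sum_distrib_left)

lemma delta_cst [simp]: "delta N (cst a) = 0"
  by (simp add: delta_def)

lemma delta_cst_mult: "delta N (cst a * F) = cst a * delta N F"
  by (simp add: delta_mult)

lemma delta_var: "j \<le> N \<Longrightarrow> delta N (var j) = cst (fr (var j))"
  unfolding delta_def partial_var
  by (subst sum.mono_neutral_right[of "{..N}" "{j}"]) (auto simp: fr_def)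

text \<open>The coefficients X_i of \<open>delta\<close> do not involve Y, so it commutes with
  differentiation in Y. Hence vector fields with coefficients free of Y preserve its kernel.\<close>

lemma delta_partial: "delta N (partial j F) = partial j (delta N F)"
  by (simp add: delta_def partial_sum partial_const_mult partial_commute[of j])

context proj_point
begin

abbreviation bihom :: "nat \<Rightarrow> int \<Rightarrow> ratfun mpoly set" where "bihom m n \<equiv> bihom_germs N m n p"
abbreviation kd :: "nat \<Rightarrow> int \<Rightarrow> ratfun mpoly set" where "kd m n \<equiv> ker_delta N m n p"

lemma addsub_germs: "addsub (germs n)"
  by (auto simp: addsub_def germs_add germs_uminus)

lemma bihom_iff: "F \<in> bihom m n \<longleftrightarrow> F \<in> hpoly N m \<and> (\<forall>t. Poly_Mapping.lookup F t \<in> germs n)"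
  by (simp add: bihom_germs_def hpoly_def)

lemma addsub_bihom: "addsub (bihom m n)"
  by (auto simp: addsub_def bihom_iff hpoly_add lookup_add germs_add germs_uminus)

lemmas bihom_closed [simp] = addsubD[OF addsub_bihom]

lemma bihom_sum: "(\<And>x. x \<in> A \<Longrightarrow> f x \<in> bihom m n) \<Longrightarrow> sum f A \<in> bihom m n"
  by (rule addsub_sum[OF addsub_bihom])

lemma bihom_mult:
  assumes "F \<in> bihom m n" "G \<in> bihom m' n'"
  shows "F * G \<in> bihom (m + m') (n + n')"
  using assms unfolding bihom_iff
  by (auto simp: hpoly_mult intro!: lookup_mult_in addsub_germs germs_mult)

lemma bihom_single:
  "a \<in> germs n \<Longrightarrow> Poly_Mapping.keys t \<subseteq> {..N} \<Longrightarrow> mdeg t = m \<Longrightarrow> Poly_Mapping.single t a \<in> bihom m n"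
  by (auto simp: bihom_iff hpoly_single lookup_single when_def)

lemma bihom_cst: "a \<in> germs n \<Longrightarrow> cst a \<in> bihom 0 n"
  by (rule bihom_single) auto

lemma bihom_cst_mult: "a \<in> germs k \<Longrightarrow> F \<in> bihom m n \<Longrightarrow> cst a * F \<in> bihom m (k + n)"
  using bihom_mult[OF bihom_cst] by fastforce

lemma bihom_var: "i \<le> N \<Longrightarrow> var i \<in> bihom 1 0"
  unfolding var_def by (rule bihom_single) auto

lemma bihom_partial: "F \<in> bihom (Suc m) n \<Longrightarrow> partial j F \<in> bihom m n"
  by (auto simp: bihom_iff hpoly_partial lookup_partial intro!: germs_mult0 simp del: of_nat_Suc)

lemma bihom_0_partial: "F \<in> bihom 0 n \<Longrightarrow> partial j F = 0"
  using hpoly_0_partial[of F N] by (simp add: bihom_iff)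

lemma addsub_kd: "addsub (kd m n)"
  by (auto simp: addsub_def ker_delta_def delta_add delta_uminus)

lemma kd_bihom: "F \<in> kd m n \<Longrightarrow> F \<in> bihom m n"
  by (simp add: ker_delta_def)

lemma kd_mult: "F \<in> kd m n \<Longrightarrow> G \<in> kd m' n' \<Longrightarrow> F * G \<in> kd (m + m') (n + n')"
  by (auto simp: ker_delta_def delta_mult intro: bihom_mult)

lemma kd_cst: "a \<in> germs n \<Longrightarrow> cst a \<in> kd 0 n"
  by (auto simp: ker_delta_def bihom_cst)

lemma kd_cst_mult: "a \<in> germs k \<Longrightarrow> F \<in> kd m n \<Longrightarrow> cst a * F \<in> kd m (k + n)"
  using kd_mult[OF kd_cst] by fastforce

lemma kd_partial: "F \<in> kd (Suc m) n \<Longrightarrow> partial j F \<in> kd m n"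
  by (auto simp: ker_delta_def bihom_partial delta_partial)

lemma bihom_nearby:
  assumes "F \<in> bihom m n" shows "nearby N p (\<lambda>q. F \<in> bihom_germs N m n q)"
proof -
  have "nearby N p (\<lambda>q. \<forall>t\<in>Poly_Mapping.keys F. Poly_Mapping.lookup F t \<in> twist_germs N n q)"
    using assms by (intro nearby_ball p germs_nearby) (auto simp: bihom_iff)
  then show ?thesis
  proof (rule nearby_mono)
    fix q assume "q \<in> proj_points N" and *: "\<forall>t\<in>Poly_Mapping.keys F. Poly_Mapping.lookup F t \<in> twist_germs N n q"
    then interpret q: proj_point N q by unfold_locales
    have "Poly_Mapping.lookup F t \<in> twist_germs N n q" for t
      using * by (cases "t \<in> Poly_Mapping.keys F") (auto simp: in_keys_iff)
    then show "F \<in> bihom_germs N m n q"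
      using assms unfolding bihom_iff q.bihom_iff by blast
  qed
qed

end

text \<open>The stalk of the twisted ideal sheaf I_X(n), again inside the field of fractions. For
  \<open>n = 0\<close> it is \<open>ideal_germs\<close>.\<close>

definition J_germs :: "nat \<Rightarrow> nat \<Rightarrow> (nat \<Rightarrow> nat) \<Rightarrow> (nat \<Rightarrow> cpoly) \<Rightarrow> int \<Rightarrow> cpoly set \<Rightarrow> ratfun set" where
  "J_germs N c d P n p =
     {(\<Sum>i\<in>{1..c}. a i * fr (P i)) | a. \<forall>i\<in>{1..c}. a i \<in> twist_germs N (n - int (d i)) p}"

locale ci =
  fixes N c :: nat and d :: "nat \<Rightarrow> nat" and P :: "nat \<Rightarrow> cpoly"
  assumes sci: "smooth_complete_intersection N c d P"

locale ci_point = ci N c d P + proj_point N p for N c d P p +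
  assumes PX: "\<And>i. i \<in> {1..c} \<Longrightarrow> P i \<in> p"
begin

lemma P_form: "i \<in> {1..c} \<Longrightarrow> P i \<in> forms N (int (d i))" and d_pos: "i \<in> {1..c} \<Longrightarrow> 1 \<le> d i"
  using sci by (auto simp: smooth_complete_intersection_def)

abbreviation J :: "int \<Rightarrow> ratfun set" where "J n \<equiv> J_germs N c d P n p"

lemma J_ideal_germs: "ideal_germs N c d P p = J 0"
  by (simp add: ideal_germs_def J_germs_def fr_def)

lemma addsub_J: "addsub (J n)"
  unfolding addsub_def
proof (intro conjI ballI)
  show "0 \<in> J n"
    unfolding J_germs_def by (intro CollectI exI[of _ "\<lambda>_. 0"]) simp
  fix x assume "x \<in> J n"
  then obtain a where a: "x = (\<Sum>i\<in>{1..c}. a i * fr (P i))" "\<forall>i\<in>{1..c}. a i \<in> germs (n - int (d i))"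
    unfolding J_germs_def by blast
  then show "- x \<in> J n"
    unfolding J_germs_def by (intro CollectI exI[of _ "\<lambda>i. - a i"]) (auto simp: sum_negf germs_uminus)
  fix y assume "y \<in> J n"
  then obtain b where "y = (\<Sum>i\<in>{1..c}. b i * fr (P i))" "\<forall>i\<in>{1..c}. b i \<in> germs (n - int (d i))"
    unfolding J_germs_def by blast
  with a show "x + y \<in> J n"
    unfolding J_germs_def by (intro CollectI exI[of _ "\<lambda>i. a i + b i"]) (auto simp: sum.distrib algebra_simps germs_add)
qed

lemma J_mult:
  assumes "x \<in> germs k" "y \<in> J n"
  shows "x * y \<in> J (k + n)"
proof -
  from assms(2) obtain a where a: "y = (\<Sum>i\<in>{1..c}. a i * fr (P i))" "\<forall>i\<in>{1..c}. a i \<in> germs (n - int (d i))"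
    unfolding J_germs_def by blast
  have "x * a i \<in> germs (k + n - int (d i))" if "i \<in> {1..c}" for i
    using germs_mult[OF assms(1), of "a i" "n - int (d i)"] a(2) that by (simp add: add_diff_eq)
  with a(1) show ?thesis
    unfolding J_germs_def by (intro CollectI exI[of _ "\<lambda>i. x * a i"]) (auto simp: sum_distrib_left mult.assoc)
qed

lemma J_mult_right: "x \<in> J n \<Longrightarrow> y \<in> germs k \<Longrightarrow> x * y \<in> J (n + k)"
  using J_mult[of y k x n] by (simp add: mult.commute add.commute)

lemma J_subset: "J n \<subseteq> germs n"
proof
  fix x assume "x \<in> J n"
  then obtain a where a: "x = (\<Sum>i\<in>{1..c}. a i * fr (P i))" "\<forall>i\<in>{1..c}. a i \<in> germs (n - int (d i))"
    unfolding J_germs_def by blast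
  have "a i * fr (P i) \<in> germs n" if "i \<in> {1..c}" for i
    using germs_mult[OF a(2)[rule_format, OF that] germs_poly[OF P_form[OF that]]] by simp
  then show "x \<in> germs n" unfolding a(1) by (rule germs_sum)
qed

lemma P_J:
  assumes "i \<in> {1..c}" shows "fr (P i) \<in> J (int (d i))"
proof -
  have "fr (P i) = (\<Sum>k\<in>{1..c}. (if k = i then 1 else 0) * fr (P k))"
    using assms by (simp add: if_distrib[of "\<lambda>x. x * _"] cong: if_cong)
  then show ?thesis
    unfolding J_germs_def by (intro CollectI exI[of _ "\<lambda>k. if k = i then 1 else 0"]) auto
qed

lemma J_nearby: "x \<in> J n \<Longrightarrow> nearby N p (\<lambda>q. x \<in> J_germs N c d P n q)"
proof -
  assume "x \<in> J n"
  then obtain a where a: "x = (\<Sum>i\<in>{1..c}. a i * fr (P i))" "\<forall>i\<in>{1..c}. a i \<in> germs (n - int (d i))"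
    unfolding J_germs_def by blast
  have "nearby N p (\<lambda>q. \<forall>i\<in>{1..c}. a i \<in> twist_germs N (n - int (d i)) q)"
    using a(2) by (intro nearby_ball p germs_nearby) auto
  then show ?thesis
    by (rule nearby_mono) (use a(1) in \<open>auto simp: J_germs_def\<close>)
qed

abbreviation H :: "nat \<Rightarrow> int \<Rightarrow> ratfun mpoly set" where "H m n \<equiv> bihom_ideal N c d P m n p"

lemma str_stalk_proj: "str_stalk (proj_space N) p = conc_ring (germs 0)"
  by (simp add: proj_space_def conc_ring_def)

lemma stalk_twist: "stalk (twisting_sheaf N n) p = conc_mod (germs n) (*)"
  by (simp add: twisting_sheaf_def conc_mod_def)

lemma stalk_bihom: "stalk (bihom_sheaf N m n) p = conc_mod (bihom m n) (\<lambda>a F. cst a * F)"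
  by (simp add: bihom_sheaf_def conc_mod_def)

sublocale coset_ring "germs 0" "J 0"
  by unfold_locales (auto simp: addsub_germs addsub_J J_subset[THEN subsetD] germs_mult0 intro: J_mult[of _ 0 _ 0, simplified])

end

lemma submodule_conc:
  assumes "addsub C" "addsub H" "H \<subseteq> C" "\<And>a x. a \<in> carrier R \<Longrightarrow> x \<in> H \<Longrightarrow> sm a x \<in> H"
  shows "submodule H R (conc_mod C sm)"
proof -
  have "abelian_group (conc_mod C sm)"
  proof (rule abelian_groupI)
    show "\<exists>y\<in>carrier (conc_mod C sm). y \<oplus>\<^bsub>conc_mod C sm\<^esub> x = \<zero>\<^bsub>conc_mod C sm\<^esub>" if "x \<in> carrier (conc_mod C sm)" for x
      using that addsubD(3)[OF assms(1)] by (intro bexI[of _ "- x"]) simp_all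
  qed (use addsubD[OF assms(1)] in \<open>simp_all add: algebra_simps\<close>)
  then interpret abelian_group "conc_mod C sm" .
  have "\<ominus>\<^bsub>conc_mod C sm\<^esub> x = - x" if "x \<in> C" for x
    using that minus_equality[of "-x" x] addsubD(3)[OF assms(1)] by simp
  then have "subgroup H (add_monoid (conc_mod C sm))"
    by (intro add.subgroupI) (use assms addsubD[OF assms(2)] in \<open>auto simp flip: a_inv_def\<close>)
  then show ?thesis
    by (rule submodule.intro) (use assms(4) in \<open>simp add: submodule_axioms_def\<close>)
qed

lemma submodule_concD:
  assumes "submodule H R (conc_mod C sm)"
  shows "0 \<in> H" "x \<in> H \<Longrightarrow> y \<in> H \<Longrightarrow> x + y \<in> H"
proof -
  interpret submodule H R "conc_mod C sm" by fact
  show "0 \<in> H" "x \<in> H \<Longrightarrow> y \<in> H \<Longrightarrow> x + y \<in> H"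
    using one_closed m_closed[of x y] by auto
qed

lemma submodule_conc_sum:
  assumes "submodule H R (conc_mod C sm)" "\<And>i. i \<in> S \<Longrightarrow> f i \<in> H"
  shows "sum f S \<in> H"
  using assms(2) by (induction S rule: infinite_finite_induct) (auto simp: submodule_concD[OF assms(1)])

context ci_point
begin

lemma ex_X: obtains r where "chart N p r"
  using ex_chart by blast

text \<open>The ideal multiple is defined as a span; it becomes a condition on coefficients because,
  in a chart, a monomial with coefficient a in \<open>J n\<close> is the product of a X_r^(-n), an
  element of \<open>J 0\<close>, and the germ X_r^n Y^t.\<close>

lemma bihom_ideal_eq: "H m n = {F \<in> bihom m n. \<forall>t. Poly_Mapping.lookup F t \<in> J n}"
proof -
  obtain r where "chart N p r" by (rule ex_X)
  then interpret chart N p r .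
  let ?M = "conc_mod (bihom m n) (\<lambda>a F. cst a * F)"
  let ?S = "{a \<odot>\<^bsub>?M\<^esub> x |a x. a \<in> J 0 \<and> x \<in> carrier ?M}"
  let ?H = "{F \<in> bihom m n. \<forall>t. Poly_Mapping.lookup F t \<in> J n}"
  have addsub: "addsub ?H"
    using addsub_J[of n] by (auto simp: addsub_def lookup_add)
  have "submodule ?H (conc_ring (germs 0)) ?M"
    by (rule submodule_conc[OF addsub_bihom addsub])
      (use bihom_cst_mult[of _ 0] J_mult[of _ 0] in auto)
  moreover have "?S \<subseteq> ?H"
    using bihom_cst_mult[of _ 0 _ m n] J_mult_right[of _ 0] J_subset[of 0] by (auto simp: bihom_iff)
  moreover have "?H \<subseteq> H'" if H': "submodule H' (conc_ring (germs 0)) ?M" "?S \<subseteq> H'" for H'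
  proof
    fix F assume F: "F \<in> ?H"
    have "Poly_Mapping.single t (Poly_Mapping.lookup F t) \<in> H'" if t: "t \<in> Poly_Mapping.keys F" for t
    proof -
      have "Poly_Mapping.lookup F t \<in> J n" using F by blast
      from J_mult_right[OF this X_power[of "-n"]]
      have 1: "Poly_Mapping.lookup F t * X powi (-n) \<in> J 0" by simp
      have 2: "Poly_Mapping.single t (X powi n) \<in> bihom m n"
        using F t by (intro bihom_single X_power) (auto simp: bihom_germs_def)
      have "Poly_Mapping.single t (Poly_Mapping.lookup F t)
          = cst (Poly_Mapping.lookup F t * X powi (-n)) * Poly_Mapping.single t (X powi n)"
        by (simp add: mult_single mult.assoc X_power_cancel)
      also have "\<dots> \<in> ?S" using 1 2 by auto
      finally show ?thesis using H'(2) by blast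
    qed
    then show "F \<in> H'"
      by (subst mpoly_expand) (rule submodule_conc_sum[OF H'(1)])
  qed
  ultimately show ?thesis
    unfolding bihom_ideal_def ideal_multiple_def span_submodule_def str_stalk_proj stalk_bihom J_ideal_germs
    by blast
qed

lemma twist_ideal_eq: "ideal_multiple (proj_space N) (ideal_germs N c d P) (twisting_sheaf N n) p = J n"
proof -
  obtain r where "chart N p r" by (rule ex_X)
  then interpret chart N p r .
  let ?M = "conc_mod (germs n) (*)"
  let ?S = "{a \<odot>\<^bsub>?M\<^esub> x |a x. a \<in> J 0 \<and> x \<in> carrier ?M}"
  have "submodule (J n) (conc_ring (germs 0)) ?M"
    by (rule submodule_conc[OF addsub_germs addsub_J J_subset]) (use J_mult[of _ 0] in auto)
  moreover have "?S \<subseteq> J n"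
    using J_mult_right[of _ 0] by auto
  moreover have "J n \<subseteq> H'" if H': "submodule H' (conc_ring (germs 0)) ?M" "?S \<subseteq> H'" for H'
  proof
    fix x assume x: "x \<in> J n"
    from J_mult_right[OF this X_power[of "-n"]]
    have 1: "x * X powi (-n) \<in> J 0" by simp
    have "x = (x * X powi (-n)) * X powi n"
      by (simp add: mult.assoc X_power_cancel)
    also have "\<dots> \<in> ?S" using 1 X_power by auto
    finally show "x \<in> H'" using H'(2) by blast
  qed
  ultimately show ?thesis
    unfolding ideal_multiple_def span_submodule_def str_stalk_proj stalk_twist J_ideal_germs
    by blast
qed

lemma H_D: "F \<in> H m n \<Longrightarrow> F \<in> bihom m n" "F \<in> H m n \<Longrightarrow> Poly_Mapping.lookup F t \<in> J n"
  by (auto simp: bihom_ideal_eq)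

lemma addsub_H: "addsub (H m n)"
  unfolding bihom_ideal_eq using addsub_J[of n] by (auto simp: addsub_def lookup_add)

lemma H_mult:
  assumes "F \<in> bihom m n" "G \<in> H m' n'"
  shows "F * G \<in> H (m + m') (n + n')"
  using assms unfolding bihom_ideal_eq
  by (auto simp: bihom_mult intro!: lookup_mult_in addsub_J J_mult) (auto simp: bihom_iff)

lemma H_mult_right: "G \<in> H m' n' \<Longrightarrow> F \<in> bihom m n \<Longrightarrow> G * F \<in> H (m' + m) (n' + n)"
  using H_mult[of F m n G m' n'] by (simp add: mult.commute add.commute)

lemma H_cst: "a \<in> J n \<Longrightarrow> cst a \<in> H 0 n"
  using J_subset[of n] by (auto simp: bihom_ideal_eq bihom_cst lookup_single when_def addsubD[OF addsub_J])

lemma H_nearby: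
  assumes "F \<in> H m n"
  shows "nearby N p (\<lambda>q. F \<in> bihom_germs N m n q \<and> (\<forall>t. Poly_Mapping.lookup F t \<in> J_germs N c d P n q))"
proof -
  have "nearby N p (\<lambda>q. F \<in> bihom_germs N m n q \<and> (\<forall>t\<in>Poly_Mapping.keys F. Poly_Mapping.lookup F t \<in> J_germs N c d P n q))"
    using assms by (intro nearby_conj bihom_nearby nearby_ball p J_nearby) (auto simp: bihom_ideal_eq)
  then show ?thesis
  proof (rule nearby_mono)
    fix q assume "q \<in> proj_points N" and *: "F \<in> bihom_germs N m n q \<and> (\<forall>t\<in>Poly_Mapping.keys F. Poly_Mapping.lookup F t \<in> J_germs N c d P n q)"
    then interpret q: proj_point N q by unfold_locales
    have "0 \<in> J_germs N c d P n q"
      unfolding J_germs_def by (intro CollectI exI[of _ "\<lambda>_. 0"]) simp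
    then have "Poly_Mapping.lookup F t \<in> J_germs N c d P n q" for t
      using * by (cases "t \<in> Poly_Mapping.keys F") (auto simp: in_keys_iff)
    with * show "F \<in> bihom_germs N m n q \<and> (\<forall>t. Poly_Mapping.lookup F t \<in> J_germs N c d P n q)"
      by blast
  qed
qed

end

section \<open>The Koszul complex of a Weyl algebra action\<close>

text \<open>The sign of moving the basis vector e_i of an exterior algebra to its sorted place among
  the e_j with j in \<open>J\<close>.\<close>

definition koszul_sign :: "nat \<Rightarrow> nat set \<Rightarrow> 'v::comm_ring_1" where
  "koszul_sign i J = (-1) ^ card {j\<in>J. j < i}"

text \<open>A chain is a family indexed by sets. In a given degree only its values on sets of one
  size matter, so the degree is not recorded.\<close>

definition koszul_map :: "nat \<Rightarrow> (nat \<Rightarrow> 'v) \<Rightarrow> (nat set \<Rightarrow> 'v::comm_ring_1) \<Rightarrow> nat set \<Rightarrow> 'v" where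
  "koszul_map c l x J = (\<Sum>i\<in>{1..c} - J. koszul_sign i J * (l i * x (insert i J)))"

lemma koszul_sign_cases: "koszul_sign i J = (1 :: 'v::comm_ring_1) \<or> koszul_sign i J = (- 1 :: 'v)"
  unfolding koszul_sign_def by (metis neg_one_even_power neg_one_odd_power)

lemma koszul_sign_closed: "addsub S \<Longrightarrow> (f :: 'v::comm_ring_1) \<in> S \<Longrightarrow> koszul_sign i J * f \<in> S"
  using koszul_sign_cases[of i J, where 'v = 'v] by (elim disjE) (simp_all add: addsubD)

text \<open>The double sum runs over ordered pairs of distinct indices outside \<open>J\<close>, and
  exchanging the two indices changes the sign.\<close>

lemma koszul_map_twice:
  fixes l :: "nat \<Rightarrow> 'v::comm_ring_1"
  assumes "J \<subseteq> {1..c}"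
  shows "koszul_map c l (koszul_map c l x) J = 0"
proof -
  have fin: "finite J" using assms finite_subset by blast
  let ?C = "{1..c} - J"
  let ?t = "\<lambda>i a. koszul_sign i J * (l i * (koszul_sign a (insert i J) * (l a * x (insert a (insert i J)))))"
  have anti: "?t i a = - ?t a i" if "i \<in> ?C" "a \<in> ?C" "i \<noteq> a" for i a
  proof -
    have "{j \<in> insert i J. j < a} = (if i < a then insert i {j \<in> J. j < a} else {j \<in> J. j < a})" for i a :: nat
      by auto
    then have "(koszul_sign a (insert i J) :: 'v) = (if i < a then - koszul_sign a J else koszul_sign a J)" if "i \<notin> J" for i a
      using fin that unfolding koszul_sign_def by auto
    then show ?thesis
      using that by (auto simp: insert_commute algebra_simps)
  qed
  have "koszul_map c l (koszul_map c l x) J = (\<Sum>i\<in>?C. \<Sum>a\<in>?C - {i}. ?t i a)"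
    unfolding koszul_map_def[of c l "koszul_map c l x"]
  proof (rule sum.cong[OF refl])
    fix i
    have "{1..c} - insert i J = {1..c} - J - {i}" by auto
    then show "koszul_sign i J * (l i * koszul_map c l x (insert i J)) = (\<Sum>a\<in>?C - {i}. ?t i a)"
      by (simp only: koszul_map_def sum_distrib_left)
  qed
  \<comment> \<open>Split by the order of the two indices; interchanging the summations then turns
    one half into the negative of the other.\<close>
  also have "\<dots> = (\<Sum>i\<in>?C. \<Sum>a\<in>?C. if i < a then ?t i a else 0) + (\<Sum>i\<in>?C. \<Sum>a\<in>?C. if a < i then ?t i a else 0)"
    unfolding sum.distrib[symmetric]
  proof (rule sum.cong[OF refl])
    fix i assume "i \<in> ?C"
    have "(\<Sum>a\<in>?C - {i}. ?t i a) = (\<Sum>a\<in>?C. if a \<noteq> i then ?t i a else 0)"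
      by (rule sum.mono_neutral_cong_left) auto
    also have "\<dots> = (\<Sum>a\<in>?C. (if i < a then ?t i a else 0) + (if a < i then ?t i a else 0))"
      by (rule sum.cong) auto
    finally show "(\<Sum>a\<in>?C - {i}. ?t i a) = (\<Sum>a\<in>?C. (if i < a then ?t i a else 0) + (if a < i then ?t i a else 0))" .
  qed
  also have "(\<Sum>i\<in>?C. \<Sum>a\<in>?C. if a < i then ?t i a else 0) = (\<Sum>a\<in>?C. \<Sum>i\<in>?C. if a < i then ?t i a else 0)"
    by (rule sum.swap)
  also have "\<dots> = (\<Sum>a\<in>?C. \<Sum>i\<in>?C. - (if a < i then ?t a i else 0))"
  proof (intro sum.cong refl)
    fix a i assume ai: "a \<in> ?C" "i \<in> ?C"
    show "(if a < i then ?t i a else 0) = - (if a < i then ?t a i else 0)"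
    proof (cases "a < i")
      case True
      with anti[OF ai(2,1)] show ?thesis by (simp only: if_True)
    qed (simp only: if_False minus_zero)
  qed
  finally show ?thesis by (simp only: sum_negf right_minus)
qed

text \<open>The Weyl relations are required exactly, and \<open>Z\<close> is the subgroup modulo
  which exactness is claimed. For X, \<open>W m\<close> is Ker delta in degree m and twist 0, and
  \<open>Z\<close> consists of the polynomials with coefficients in the ideal. The assumption
  \<open>inv\<close> is where characteristic 0 enters.\<close>

locale weyl_action =
  fixes c :: nat and l :: "nat \<Rightarrow> 'v::comm_ring_1" and D :: "nat \<Rightarrow> 'v \<Rightarrow> 'v"
    and W :: "nat \<Rightarrow> 'v set" and Z :: "'v set"
  assumes W: "addsub (W m)" and Z: "addsub Z"
    and l_W: "i \<in> {1..c} \<Longrightarrow> f \<in> W m \<Longrightarrow> l i * f \<in> W (Suc m)"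
    and D_W: "i \<in> {1..c} \<Longrightarrow> f \<in> W (Suc m) \<Longrightarrow> D i f \<in> W m"
    and D_W0: "i \<in> {1..c} \<Longrightarrow> f \<in> W 0 \<Longrightarrow> D i f = 0"
    and l_Z: "i \<in> {1..c} \<Longrightarrow> f \<in> Z \<Longrightarrow> l i * f \<in> Z"
    and D_Z: "i \<in> {1..c} \<Longrightarrow> f \<in> Z \<Longrightarrow> D i f \<in> Z"
    and D_add: "D i (f + g) = D i f + D i g"
    and D_l: "i \<in> {1..c} \<Longrightarrow> j \<in> {1..c} \<Longrightarrow> D i (l j * f) = (if i = j then f else 0) + l j * D i f"
    and D_comm: "D i (D j f) = D j (D i f)"
    and inv: "\<exists>q. of_nat (Suc a) * q = 1 \<and> (\<forall>m. \<forall>f\<in>W m. q * f \<in> W m) \<and> (\<forall>f\<in>Z. q * f \<in> Z)"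
begin

lemma D_0 [simp]: "D i 0 = 0"
  using D_add[of i 0 0] by (metis add.right_neutral add_cancel_left_right)

lemma D_uminus: "D i (- f) = - D i f"
  using D_add[of i f "- f"] by (simp add: eq_neg_iff_add_eq_0 add.commute)

lemma D_diff: "D i (f - g) = D i f - D i g"
  using D_add[of i f "- g"] by (simp add: D_uminus)

lemma D_sum: "D i (sum f S) = (\<Sum>a\<in>S. D i (f a))"
  by (induction S rule: infinite_finite_induct) (auto simp: D_add)

lemma D_of_nat: "D i (of_nat k * f) = of_nat k * D i f"
  by (induction k) (auto simp: D_add algebra_simps)

abbreviation "sg \<equiv> koszul_sign :: nat \<Rightarrow> nat set \<Rightarrow> 'v"
abbreviation "dd \<equiv> koszul_map c l"

lemma sg_sq: "sg i J * (sg i J * f) = f"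
  using koszul_sign_cases[of i J, where 'v = 'v] by auto

lemma D_sg: "D a (sg i J * f) = sg i J * D a f"
  using koszul_sign_cases[of i J, where 'v = 'v] by (auto simp: D_uminus)

text \<open>The homotopy: exterior multiplication by the D_a, opposite to the contraction with the
  l_i.\<close>

definition hh :: "(nat set \<Rightarrow> 'v) \<Rightarrow> nat set \<Rightarrow> 'v" where
  "hh x I = (\<Sum>a\<in>I. sg a (I - {a}) * D a (x (I - {a})))"

text \<open>The Euler operator of the l_i. It counts only the degree in the l_i, so it can have
  several eigenvalues on a single \<open>W m\<close>.\<close>

definition E :: "'v \<Rightarrow> 'v" where "E f = (\<Sum>i\<in>{1..c}. l i * D i f)"

lemma E_add: "E (f + g) = E f + E g"
  by (simp add: E_def D_add algebra_simps sum.distrib)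

lemma E_0 [simp]: "E 0 = 0"
  by (simp add: E_def)

lemma E_diff: "E (f - g) = E f - E g"
  by (simp add: E_def D_diff algebra_simps sum_subtractf)

lemma E_sum: "E (sum f S) = (\<Sum>a\<in>S. E (f a))"
  by (induction S rule: infinite_finite_induct) (auto simp: E_add)

lemma E_of_nat: "E (of_nat k * f) = of_nat k * E f"
  by (simp add: E_def D_of_nat sum_distrib_left mult.left_commute)

lemma E_sg: "E (sg i J * f) = sg i J * E f"
  by (simp add: E_def D_sg sum_distrib_left mult.left_commute)

text \<open>By the Weyl relations, multiplication by l_j raises the eigenvalues of \<open>E\<close>
  by one.\<close>

lemma E_l: "j \<in> {1..c} \<Longrightarrow> E (l j * f) = l j * f + l j * E f"
proof -
  assume j: "j \<in> {1..c}"
  have "E (l j * f) = (\<Sum>i\<in>{1..c}. (if i = j then l i * f else 0) + l j * (l i * D i f))"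
    unfolding E_def using j by (intro sum.cong refl) (simp add: D_l distrib_left mult.left_commute del: atLeastAtMost_iff)
  also have "\<dots> = l j * f + l j * E f"
    using j by (simp add: sum.distrib E_def sum_distrib_left)
  finally show ?thesis .
qed

text \<open>The counterpart of \<open>E_l\<close>: applying D_i lowers the eigenvalues of
  \<open>E\<close> by one.\<close>

lemma D_E: "i \<in> {1..c} \<Longrightarrow> D i (E f) = D i f + E (D i f)"
proof -
  assume i: "i \<in> {1..c}"
  have "D i (E f) = (\<Sum>j\<in>{1..c}. (if j = i then D j f else 0) + l j * D j (D i f))"
    unfolding E_def D_sum using i by (intro sum.cong) (auto simp: D_l D_comm[of i])
  also have "\<dots> = D i f + E (D i f)"
    using i by (simp add: sum.distrib E_def)
  finally show ?thesis .
qed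

lemma E_W: "f \<in> W m \<Longrightarrow> E f \<in> W m"
  unfolding E_def
proof (intro addsub_sum[OF W])
  fix i assume "i \<in> {1..c}" "f \<in> W m"
  then show "l i * D i f \<in> W m"
    using D_W0[of i f] D_W[of i f] l_W[of i "D i f"] addsubD(1)[OF W] by (cases m) simp_all
qed

lemma E_Z: "f \<in> Z \<Longrightarrow> E f \<in> Z"
  unfolding E_def by (intro addsub_sum[OF Z] l_Z D_Z) auto

text \<open>Inserting \<open>i\<close> and removing \<open>a\<close> in the two possible orders
  gives opposite signs, which makes the mixed terms of the homotopy cancel.\<close>

lemma koszul_signs:
  assumes "finite J" "i \<notin> J" "a \<in> J"
  shows "sg i J * sg a (insert i J - {a}) = - (sg a (J - {a}) * sg i (J - {a}))"
proof -
  have "{j \<in> J. j < i} = (if a < i then insert a {j \<in> J - {a}. j < i} else {j \<in> J - {a}. j < i})"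
    using assms by auto
  then have 1: "sg i J = (if a < i then - sg i (J - {a}) else sg i (J - {a}))"
    using assms unfolding koszul_sign_def by auto
  have "{j \<in> insert i J - {a}. j < a} = (if i < a then insert i {j \<in> J - {a}. j < a} else {j \<in> J - {a}. j < a})"
    using assms by auto
  then have 2: "sg a (insert i J - {a}) = (if i < a then - sg a (J - {a}) else sg a (J - {a}))"
    using assms unfolding koszul_sign_def by auto
  have "i \<noteq> a" using assms by auto
  then show ?thesis unfolding 1 2 by (auto simp: mult.commute)
qed

text \<open>The terms with i outside and a inside \<open>J\<close> cancel by
  \<open>koszul_signs\<close>. The diagonal terms are l_i D_i for i outside \<open>J\<close>, and
  D_a l_a = 1 + l_a D_a for a in \<open>J\<close>; together they give \<open>E\<close> plus the
  cardinality of \<open>J\<close>.\<close>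

lemma koszul_homotopy:
  assumes J: "J \<in> koszul_index c k"
  shows "dd (hh x) J + hh (dd x) J = E (x J) + of_nat k * x J"
proof -
  from J have J: "J \<subseteq> {1..c}" "card J = k" and fin: "finite J"
    by (auto simp: koszul_index_def intro: finite_subset)
  let ?t = "\<lambda>i a. sg a (J - {a}) * (sg i (J - {a}) * (l i * D a (x (insert i (J - {a})))))"
  have "dd (hh x) J = (\<Sum>i\<in>{1..c} - J. l i * D i (x J) - (\<Sum>a\<in>J. ?t i a))"
    unfolding koszul_map_def
  proof (rule sum.cong[OF refl])
    fix i assume i: "i \<in> {1..c} - J"
    have "sg i J * (l i * (sg a (insert i J - {a}) * D a (x (insert i J - {a})))) = - ?t i a" if a: "a \<in> J" for a
    proof -
      have eq: "insert i J - {a} = insert i (J - {a})" using i a by auto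
      have "sg i J * (l i * (sg a (insert i J - {a}) * D a (x (insert i J - {a}))))
        = (sg i J * sg a (insert i J - {a})) * (l i * D a (x (insert i J - {a})))"
        by (simp only: ac_simps)
      also have "\<dots> = - ?t i a"
        using i a by (subst koszul_signs[OF fin]) (simp_all add: eq mult.assoc)
      finally show ?thesis .
    qed
    moreover have "hh x (insert i J) = sg i J * D i (x J) + (\<Sum>a\<in>J. sg a (insert i J - {a}) * D a (x (insert i J - {a})))"
      unfolding hh_def using i fin by (subst sum.insert) auto
    ultimately show "sg i J * (l i * hh x (insert i J)) = l i * D i (x J) - (\<Sum>a\<in>J. ?t i a)"
      by (simp add: distrib_left sum_distrib_left sum_negf mult.left_commute[of "l i" "sg i J"] sg_sq)
  qed
  moreover have "hh (dd x) J = (\<Sum>a\<in>J. x J + l a * D a (x J) + (\<Sum>i\<in>{1..c} - J. ?t i a))"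
    unfolding hh_def
  proof (rule sum.cong[OF refl])
    fix a assume a: "a \<in> J"
    have "{1..c} - (J - {a}) = insert a ({1..c} - J)" using a J(1) by auto
    then have "dd x (J - {a}) = sg a (J - {a}) * (l a * x J)
        + (\<Sum>i\<in>{1..c} - J. sg i (J - {a}) * (l i * x (insert i (J - {a}))))"
      unfolding koszul_map_def using a by (simp add: insert_absorb)
    moreover have "D a (l i * f) = l i * D a f" if "i \<in> {1..c} - J" for i f
      using that a J(1) by (subst D_l) auto
    moreover have "D a (l a * x J) = x J + l a * D a (x J)"
      using a J(1) by (subst D_l) auto
    ultimately show "sg a (J - {a}) * D a (dd x (J - {a})) = x J + l a * D a (x J) + (\<Sum>i\<in>{1..c} - J. ?t i a)"
      by (simp add: D_add D_sum D_sg sg_sq distrib_left sum_distrib_left)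
  qed
  moreover have "(\<Sum>i\<in>{1..c} - J. \<Sum>a\<in>J. ?t i a) = (\<Sum>a\<in>J. \<Sum>i\<in>{1..c} - J. ?t i a)"
    by (rule sum.swap)
  moreover have "E (x J) = (\<Sum>i\<in>{1..c} - J. l i * D i (x J)) + (\<Sum>i\<in>J. l i * D i (x J))"
    unfolding E_def by (rule sum.subset_diff[OF J(1)]) simp
  ultimately show ?thesis
    using J(2) by (simp add: sum.distrib sum_subtractf)
qed

text \<open>The differential multiplies by one l_i in each term and therefore shifts
  \<open>E\<close> by one.\<close>

lemma dd_E: "dd (\<lambda>I. E (x I)) J = E (dd x J) - dd x J"
proof -
  have "E (sg i J * (l i * f)) = sg i J * (l i * f) + sg i J * (l i * E f)" if "i \<in> {1..c}" for i f
    using that by (simp add: E_sg E_l distrib_left)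
  then show ?thesis
    unfolding koszul_map_def E_sum by (simp add: sum.distrib)
qed

lemma dd_diff: "dd (\<lambda>I. x I - y I) J = dd x J - dd y J"
  by (simp add: koszul_map_def algebra_simps sum_subtractf)

lemma dd_mult: "dd (\<lambda>I. q * x I) J = q * dd x J"
  by (simp add: koszul_map_def sum_distrib_left algebra_simps)

text \<open>The product (E - b)(E - b - 1)...(E - b - s + 1) applied to \<open>f\<close>. The offset
  \<open>b\<close> is a parameter because moving a D_i through the product lowers it by one.\<close>

fun Es :: "nat \<Rightarrow> nat \<Rightarrow> 'v \<Rightarrow> 'v" where
  "Es b 0 f = f"
| "Es b (Suc s) f = E (Es b s f) - of_nat (b + s) * Es b s f"

lemma D_Es: "i \<in> {1..c} \<Longrightarrow> D i (Es (Suc b) s f) = Es b s (D i f)"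
  by (induction s) (auto simp: D_diff D_E D_add D_of_nat distrib_right)

lemma Es_E: "Es b s (E f) = E (Es b s f)"
proof (induction s)
  case (Suc s)
  then show ?case using E_of_nat[of "b + s"] by (simp add: E_diff del: of_nat_add)
qed simp

lemma Es_Suc': "Es b (Suc s) f = Es (Suc b) s (E f - of_nat b * f)"
proof (induction s)
  case (Suc s)
  have "Es b (Suc (Suc s)) f = E (Es b (Suc s) f) - of_nat (b + Suc s) * Es b (Suc s) f" by simp
  also have "\<dots> = Es (Suc b) (Suc s) (E f - of_nat b * f)"
    unfolding Suc by simp
  finally show ?case .
qed simp

text \<open>In degree m + 1 pull out the factor \<open>E\<close>, the sum of the l_i D_i, and move
  each D_i through the remaining (E - 1)...(E - m - 1). This becomes E (E - 1)...(E - m) applied to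
  D_i f, which has degree m, and induction applies.\<close>

lemma Es_nilpotent: "f \<in> W m \<Longrightarrow> Es 0 (Suc m) f = 0"
proof (induction m arbitrary: f)
  case 0
  then show ?case by (simp add: E_def D_W0)
next
  case (Suc m)
  have "Es 0 (Suc (Suc m)) f = E (Es 1 (Suc m) f)"
    using Es_Suc'[of 0 "Suc m" f] Es_E[of 1 "Suc m" f] by simp
  also have "\<dots> = (\<Sum>i\<in>{1..c}. l i * Es 0 (Suc m) (D i f))"
    unfolding E_def using D_Es[of _ 0 "Suc m" f] by (intro sum.cong) auto
  also have "\<dots> = 0"
    using Suc.IH[OF D_W[OF _ Suc.prems]] by (intro sum.neutral) auto
  finally show ?case .
qed

lemma Es_W: "f \<in> W m \<Longrightarrow> Es b s f \<in> W m"
proof (induction s)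
  case (Suc s)
  have "of_nat k * g \<in> W m" if "g \<in> W m" for k g
    using that by (induction k) (auto simp: addsubD[OF W] distrib_right)
  with Suc show ?case
    by (auto simp: E_W simp del: of_nat_add intro: addsubD(4)[OF W])
qed simp

text \<open>Let x_s be E (E - 1)...(E - s + 1) x. By the homotopy, E x_s + k x_s is a boundary
  modulo \<open>Z\<close>, and E x_s = x_(s+1) + s x_s. Hence (k + s) x_s is a boundary as soon as
  x_(s+1) is, and k + s is invertible. Since x_(m+1) = 0, descending to s = 0 reaches x
  itself.\<close>

theorem koszul_exact:
  assumes k: "1 \<le> k" and x: "\<And>I. I \<in> koszul_index c k \<Longrightarrow> x I \<in> W m"
    and cycle: "\<And>J. J \<in> koszul_index c (k - 1) \<Longrightarrow> dd x J \<in> Z"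
  shows "\<exists>y. (\<forall>I\<in>koszul_index c (Suc k). y I \<in> W (m - 1)) \<and> (\<forall>J\<in>koszul_index c k. x J - dd y J \<in> Z)"
proof -
  let ?bd = "\<lambda>x. \<exists>y. (\<forall>I\<in>koszul_index c (Suc k). y I \<in> W (m - 1)) \<and> (\<forall>J\<in>koszul_index c k. x J - dd y J \<in> Z)"
  let ?x = "\<lambda>s I. Es 0 s (x I)"
  have of_nat_Z: "of_nat j * g \<in> Z" if "g \<in> Z" for j g
    using that by (induction j) (auto simp: addsubD[OF Z] distrib_right)
  \<comment> \<open>The x_s remain cycles, because the differential commutes with \<open>E\<close>
    up to a shift by one.\<close>
  have cyc: "dd (?x s) J \<in> Z" if "J \<in> koszul_index c (k - 1)" for s J
  proof (induction s)
    case (Suc s)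
    have "dd (?x (Suc s)) J = E (dd (?x s) J) - dd (?x s) J - of_nat s * dd (?x s) J"
      by (simp add: dd_diff dd_E dd_mult)
    then show ?case using Suc by (auto intro!: addsubD(4)[OF Z] E_Z of_nat_Z)
  qed (use cycle that in simp)
  have step: "?bd (?x s)" if bd: "?bd (?x (Suc s))" for s
  proof -
    from bd obtain y where yW: "\<And>I. I \<in> koszul_index c (Suc k) \<Longrightarrow> y I \<in> W (m - 1)"
      and y: "\<And>J. J \<in> koszul_index c k \<Longrightarrow> ?x (Suc s) J - dd y J \<in> Z" by blast
    obtain q where q: "of_nat (Suc (k + s - 1)) * q = 1" "\<And>m f. f \<in> W m \<Longrightarrow> q * f \<in> W m" "\<And>f. f \<in> Z \<Longrightarrow> q * f \<in> Z"
      using inv[of "k + s - 1"] by blast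
    \<comment> \<open>Positive since \<open>k\<close> is; written as a successor to match the
      assumption \<open>inv\<close>.\<close>
    have ks: "Suc (k + s - 1) = k + s" using k by simp
    let ?y = "\<lambda>I. q * (hh (?x s) I - y I)"
    have "?y I \<in> W (m - 1)" if I: "I \<in> koszul_index c (Suc k)" for I
    proof -
      have "hh (?x s) I \<in> W (m - 1)"
        unfolding hh_def
      proof (intro addsub_sum[OF W] koszul_sign_closed[OF W])
        fix a assume a: "a \<in> I"
        with I have "I - {a} \<in> koszul_index c k" "a \<in> {1..c}"
          by (auto simp: koszul_index_def card_Diff_singleton)
        then have "Es 0 s (x (I - {a})) \<in> W m" using Es_W x by blast
        \<comment> \<open>For \<open>m = 0\<close> the truncated degree is 0 again, which is correct
          because D_a vanishes on \<open>W 0\<close>.\<close>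
        then show "D a (Es 0 s (x (I - {a}))) \<in> W (m - 1)"
          using \<open>a \<in> {1..c}\<close> by (cases m) (auto simp: D_W0 addsubD[OF W] intro: D_W)
      qed
      then show ?thesis using yW[OF I] by (intro q addsubD(4)[OF W])
    qed
    moreover have "?x s J - dd ?y J \<in> Z" if J: "J \<in> koszul_index c k" for J
    proof -
      have hZ: "hh (dd (?x s)) J \<in> Z"
        unfolding hh_def
      proof (intro addsub_sum[OF Z] koszul_sign_closed[OF Z])
        fix a assume a: "a \<in> J"
        with J have "J - {a} \<in> koszul_index c (k - 1)" "a \<in> {1..c}"
          by (auto simp: koszul_index_def card_Diff_singleton)
        then show "D a (dd (?x s) (J - {a})) \<in> Z"
          by (intro D_Z cyc)
      qed
      have "?x s J - dd ?y J = q * (of_nat (Suc (k + s - 1)) * ?x s J - (dd (hh (?x s)) J - dd y J))"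
      proof -
        have "q * (of_nat (Suc (k + s - 1)) * ?x s J) = ?x s J"
          unfolding mult.assoc[symmetric] mult.commute[of q] q(1) by simp
        then show ?thesis
          by (simp only: dd_mult dd_diff right_diff_distrib[of q "of_nat (Suc (k + s - 1)) * ?x s J"])
      qed
      also have "of_nat (Suc (k + s - 1)) * ?x s J - (dd (hh (?x s)) J - dd y J)
          = hh (dd (?x s)) J - (?x (Suc s) J - dd y J)"
        using koszul_homotopy[OF J, of "?x s"] unfolding ks by (simp add: algebra_simps)
      finally have "?x s J - dd ?y J = q * (hh (dd (?x s)) J - (?x (Suc s) J - dd y J))" .
      also have "\<dots> \<in> Z"
        by (intro q(3) addsubD(4)[OF Z hZ y[OF J]])
      finally show ?thesis .
    qed
    ultimately show ?thesis by (intro exI[of _ ?y]) blast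
  qed
  have start: "?bd (?x (Suc m))"
  proof (intro exI[of _ "\<lambda>_. 0"] conjI ballI)
    fix J assume "J \<in> koszul_index c k"
    then have "?x (Suc m) J = 0" by (intro Es_nilpotent x)
    then show "?x (Suc m) J - dd (\<lambda>_. 0) J \<in> Z"
      by (simp add: koszul_map_def addsubD[OF Z] del: Es.simps)
  qed (simp add: addsubD[OF W])
  have "?bd (?x (Suc m - s))" if "s \<le> Suc m" for s
    using that
  proof (induction s)
    case 0
    show ?case using start by (simp del: Es.simps)
  next
    case (Suc s)
    have eq: "Suc m - s = Suc (Suc m - Suc s)" using Suc.prems by simp
    have "?bd (?x (Suc m - s))" by (rule Suc.IH) (use Suc.prems in linarith)
    then show ?case unfolding eq by (rule step)
  qed
  from this[of "Suc m"] show ?thesis by simp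
qed

end

text \<open>\<open>A\<close> plays the role of a local ring with nonunits \<open>U\<close>, and the
  rows of \<open>L\<close> are independent modulo \<open>U\<close>. Row by row, the earlier rows are
  projected out of the new one; what remains must have a unit entry, and this entry provides the
  next dual vector.\<close>

lemma dual_vectors:
  fixes L :: "nat \<Rightarrow> nat \<Rightarrow> 'k::field"
  assumes A: "addsub A" "1 \<in> A" "\<And>x y. x \<in> A \<Longrightarrow> y \<in> A \<Longrightarrow> x * y \<in> A"
    and U: "1 \<notin> U" "\<And>a. a \<in> A \<Longrightarrow> a \<notin> U \<Longrightarrow> a \<noteq> 0 \<and> inverse a \<in> A"
    and S: "finite S" and L: "\<And>i j. i \<in> {1..c} \<Longrightarrow> L i j \<in> A"
    and indep: "\<And>a. (\<And>i. i \<in> {1..c} \<Longrightarrow> a i \<in> A) \<Longrightarrow> (\<And>j. j \<in> S \<Longrightarrow> (\<Sum>i\<in>{1..c}. a i * L i j) \<in> U)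
      \<Longrightarrow> (\<And>i. i \<in> {1..c} \<Longrightarrow> a i \<in> U)"
  shows "\<exists>v. (\<forall>i j. v i j \<in> A) \<and> (\<forall>i\<in>{1..c}. \<forall>k\<in>{1..c}. (\<Sum>j\<in>S. v i j * L k j) = (if i = k then 1 else 0))"
proof -
  have "\<exists>v. (\<forall>i j. v i j \<in> A) \<and> (\<forall>i\<in>{1..b}. \<forall>k\<in>{1..b}. (\<Sum>j\<in>S. v i j * L k j) = (if i = k then 1 else 0))"
    if "b \<le> c" for b
    using that
  proof (induction b)
    case 0
    show ?case using addsubD(1)[OF A(1)] by (intro exI[of _ "\<lambda>_ _. 0"]) auto
  next
    case (Suc b)
    then have "b \<le> c" by simp
    from Suc.IH[OF this] obtain v where "\<forall>i j. v i j \<in> A"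
      and "\<forall>i\<in>{1..b}. \<forall>k\<in>{1..b}. (\<Sum>j\<in>S. v i j * L k j) = (if i = k then 1 else 0)" by blast
    then have vA: "\<And>i j. v i j \<in> A"
      and v: "\<And>i k. i \<in> {1..b} \<Longrightarrow> k \<in> {1..b} \<Longrightarrow> (\<Sum>j\<in>S. v i j * L k j) = (if i = k then 1 else 0)"
      by blast+
    let ?n = "Suc b"
    have n: "?n \<in> {1..c}" using Suc by auto
    define t where "t i = (\<Sum>j\<in>S. v i j * L ?n j)" for i
    have tA: "t i \<in> A" for i
      unfolding t_def by (intro addsub_sum[OF A(1)] A(3) vA L n)
    \<comment> \<open>The new row minus its components along the earlier rows, as measured by the
      vectors already found.\<close>
    define M where "M j = L ?n j - (\<Sum>i\<in>{1..b}. t i * L i j)" for j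
    have LA: "L i j \<in> A" if "i \<in> {1..b}" for i j using that Suc by (intro L) auto
    have MA: "M j \<in> A" for j
      unfolding M_def by (intro addsubD(4)[OF A(1)] L n addsub_sum[OF A(1)] A(3) tA LA)
    have "\<exists>j\<in>S. M j \<notin> U"
    proof (rule ccontr)
      assume *: "\<not> (\<exists>j\<in>S. M j \<notin> U)"
      \<comment> \<open>If no entry of \<open>M\<close> were a unit, \<open>M\<close> would be a
        combination of the rows that vanishes modulo \<open>U\<close> and has coefficient 1 at the
        new row.\<close>
      define a where "a i = (if i = ?n then 1 else if i \<in> {1..b} then - t i else 0)" for i
      have "(\<Sum>i\<in>{1..c}. a i * L i j) = M j" for j
      proof -
        have "(\<Sum>i\<in>{1..c}. a i * L i j) = (\<Sum>i\<in>insert ?n {1..b}. a i * L i j)"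
          using Suc by (intro sum.mono_neutral_right) (auto simp: a_def)
        also have "\<dots> = L ?n j + (\<Sum>i\<in>{1..b}. - t i * L i j)"
          by (subst sum.insert) (auto simp: a_def intro!: sum.cong)
        finally show ?thesis by (simp add: M_def sum_negf)
      qed
      then have sums: "(\<Sum>i\<in>{1..c}. a i * L i j) \<in> U" if "j \<in> S" for j
        using * that by simp
      have "a i \<in> A" for i
        by (simp add: a_def A addsubD[OF A(1)] tA)
      then have "a ?n \<in> U"
        by (rule indep[OF _ sums n])
      with U(1) show False by (simp add: a_def)
    qed
    then obtain j0 where j0: "j0 \<in> S" "M j0 \<notin> U" by blast
    define u where "u = inverse (M j0)"
    have u: "u \<in> A" "u * M j0 = 1" using U(2)[OF MA j0(2)] by (auto simp: u_def)
    \<comment> \<open>The coordinate vector at j0, made orthogonal to the earlier rows and scaled to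
      pair to 1 with the new one.\<close>
    define w where "w j = u * ((if j = j0 then 1 else 0) - (\<Sum>i\<in>{1..b}. L i j0 * v i j))" for j
    have wA: "w j \<in> A" for j
      unfolding w_def using A(2) addsubD(1)[OF A(1)]
      by (intro A(3) u addsubD(4)[OF A(1)] addsub_sum[OF A(1)] LA vA) auto
    have w: "(\<Sum>j\<in>S. w j * L k j) = u * (L k j0 - (\<Sum>i\<in>{1..b}. L i j0 * (\<Sum>j\<in>S. v i j * L k j)))" for k
    proof -
      have "(\<Sum>j\<in>S. w j * L k j) = u * ((\<Sum>j\<in>S. if j = j0 then L k j else 0) - (\<Sum>j\<in>S. \<Sum>i\<in>{1..b}. L i j0 * (v i j * L k j)))"
        unfolding w_def sum_distrib_left sum_subtractf[symmetric]
        by (intro sum.cong refl) (auto simp: left_diff_distrib right_diff_distrib sum_distrib_right sum_distrib_left mult.assoc)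
      also have "(\<Sum>j\<in>S. \<Sum>i\<in>{1..b}. L i j0 * (v i j * L k j)) = (\<Sum>i\<in>{1..b}. L i j0 * (\<Sum>j\<in>S. v i j * L k j))"
        by (subst sum.swap) (simp add: sum_distrib_left)
      finally show ?thesis using S j0(1) by simp
    qed
    have w1: "(\<Sum>j\<in>S. w j * L k j) = 0" if k: "k \<in> {1..b}" for k
    proof -
      have "(\<Sum>i\<in>{1..b}. L i j0 * (\<Sum>j\<in>S. v i j * L k j)) = (\<Sum>i\<in>{1..b}. if i = k then L i j0 else 0)"
        using k by (intro sum.cong) (auto simp: v)
      then show ?thesis unfolding w using k by simp
    qed
    have w2: "(\<Sum>j\<in>S. w j * L ?n j) = 1"
      unfolding w u(2)[symmetric] M_def t_def by (simp add: mult.commute)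
    \<comment> \<open>Subtracting multiples of \<open>w\<close> makes the old vectors vanish on the
      new row and leaves their values on the old rows unchanged.\<close>
    define v' where "v' i j = (if i = ?n then w j else v i j - t i * w j)" for i j
    have "v' i j \<in> A" for i j
      unfolding v'_def by (auto intro!: wA vA addsubD(4)[OF A(1)] A(3) tA)
    moreover have "(\<Sum>j\<in>S. v' i j * L k j) = (if i = k then 1 else 0)" if "i \<in> {1..?n}" "k \<in> {1..?n}" for i k
    proof (cases "i = ?n")
      case True
      then show ?thesis using that w1 w2 by (cases "k = ?n") (auto simp: v'_def)
    next
      case False
      then have "(\<Sum>j\<in>S. v' i j * L k j) = (\<Sum>j\<in>S. v i j * L k j) - t i * (\<Sum>j\<in>S. w j * L k j)"
        by (simp add: v'_def left_diff_distrib sum_subtractf sum_distrib_left mult.assoc)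
      then show ?thesis
        using False that w1 w2 v by (cases "k = ?n") (auto simp: t_def)
    qed
    ultimately show ?case by (intro exI[of _ v']) blast
  qed
  from this[of c] show ?thesis by simp
qed

section \<open>Monomials and the Taylor expansion of elements of the kernel of \<open>\<delta>\<close>\<close>

definition expo :: "nat list \<Rightarrow> (nat \<Rightarrow>\<^sub>0 nat)" where
  "expo js = (\<Sum>j\<leftarrow>js. Poly_Mapping.single j 1)"

text \<open>Some list of the variables with multiplicity. Only its multiset is determined, which
  suffices for products of polynomials and for symmetric products.\<close>

definition mlist :: "(nat \<Rightarrow>\<^sub>0 nat) \<Rightarrow> nat list" where
  "mlist t = (SOME js. mset js = Abs_multiset (Poly_Mapping.lookup t))"

lemma count_mlist: "count (mset (mlist t)) j = Poly_Mapping.lookup t j"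
proof -
  have "mset (mlist t) = Abs_multiset (Poly_Mapping.lookup t)"
    unfolding mlist_def by (rule someI_ex[OF ex_mset])
  then show ?thesis
    by (simp add: count_Abs_multiset)
qed

lemma lookup_expo: "Poly_Mapping.lookup (expo js) j = count (mset js) j"
  by (induction js) (auto simp: expo_def lookup_add lookup_single when_def)

lemma expo_mlist: "expo (mlist t) = t"
  by (rule poly_mapping_eqI) (simp add: lookup_expo count_mlist)

lemma mset_mlist_expo: "mset (mlist (expo js)) = mset js"
  by (rule multiset_eqI) (simp add: count_mlist lookup_expo)

lemma set_mlist: "set (mlist t) = Poly_Mapping.keys t"
proof -
  have "j \<in> set (mlist t) \<longleftrightarrow> count (mset (mlist t)) j \<noteq> 0" for j
    by (metis count_eq_zero_iff set_mset_mset)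
  then show ?thesis by (auto simp: count_mlist in_keys_iff)
qed

lemma length_mlist: "length (mlist t) = mdeg t"
  by (simp add: mdeg_def size_multiset_overloaded_eq count_mlist set_mlist flip: size_mset)

lemma expo_Cons: "expo (j # js) = Poly_Mapping.single j 1 + expo js"
  by (simp add: expo_def)

lemma mdeg_expo: "mdeg (expo js) = length js"
  by (induction js) (simp_all add: expo_Cons mdeg_add, simp add: expo_def)

lemma keys_expo: "Poly_Mapping.keys (expo js) = set js"
proof -
  have "Poly_Mapping.keys (expo js) = set (mlist (expo js))"
    by (simp add: set_mlist)
  also have "\<dots> = set js"
    by (metis mset_mlist_expo set_mset_mset)
  finally show ?thesis .
qed

lemma prod_list_var: "prod_list (map var js) = (Poly_Mapping.single (expo js) 1 :: 'a::comm_ring_1 mpoly)"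
  by (induction js) (auto simp: expo_def var_def mult_single)

definition mons :: "nat \<Rightarrow> nat \<Rightarrow> (nat \<Rightarrow>\<^sub>0 nat) set" where
  "mons N m = {t. Poly_Mapping.keys t \<subseteq> {..N} \<and> mdeg t = m}"

lemma finite_mons: "finite (mons N m)"
proof (rule finite_imageD)
  have "Poly_Mapping.lookup t i \<le> m" if t: "t \<in> mons N m" for t i
  proof (cases "i \<in> Poly_Mapping.keys t")
    case True
    then show ?thesis
      using t member_le_sum[of i "Poly_Mapping.keys t" "Poly_Mapping.lookup t"] by (simp add: mons_def mdeg_def)
  qed (simp add: in_keys_iff)
  then have "(\<lambda>t. restrict (Poly_Mapping.lookup t) {..N}) ` mons N m \<subseteq> (\<Pi>\<^sub>E i\<in>{..N}. {..m})"
    by (intro image_subsetI) (simp only: restrict_PiE_iff atMost_iff, blast)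
  then show "finite ((\<lambda>t. restrict (Poly_Mapping.lookup t) {..N}) ` mons N m)"
    by (rule finite_subset) (intro finite_PiE finite_atMost)
  show "inj_on (\<lambda>t. restrict (Poly_Mapping.lookup t) {..N}) (mons N m)"
  proof (rule inj_onI)
    fix s t assume s: "s \<in> mons N m" and t: "t \<in> mons N m"
      and eq: "restrict (Poly_Mapping.lookup s) {..N} = restrict (Poly_Mapping.lookup t) {..N}"
    show "s = t"
    proof (rule poly_mapping_eqI)
      fix i
      show "Poly_Mapping.lookup s i = Poly_Mapping.lookup t i"
      proof (cases "i \<le> N")
        case True
        then show ?thesis using fun_cong[OF eq, of i] by simp
      next
        case False
        then have "i \<notin> Poly_Mapping.keys s" "i \<notin> Poly_Mapping.keys t"
          using s t by (auto simp: mons_def)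
        then show ?thesis by (simp add: in_keys_iff)
      qed
    qed
  qed
qed

definition zv :: "nat \<Rightarrow> nat \<Rightarrow> ratfun mpoly" where
  "zv r j = var j - cst (fr (var j) / fr (var r)) * var r"

definition zpow :: "nat \<Rightarrow> (nat \<Rightarrow>\<^sub>0 nat) \<Rightarrow> ratfun mpoly" where
  "zpow r t = prod_list (map (zv r) (mlist t))"

lemma var_dvd_lookup:
  assumes "var r dvd (F :: 'a::comm_ring_1 mpoly)" "Poly_Mapping.lookup t r = 0"
  shows "Poly_Mapping.lookup F t = 0"
  using assms by (elim dvdE) (simp add: lookup_var_mult)

lemma zv_dvd: "var r dvd zv r j - var j"
  by (simp add: zv_def)

text \<open>Modulo Y_r each z_j is congruent to Y_j, hence so are the products.\<close>

lemma zprod_dvd: "var r dvd prod_list (map (zv r) js) - Poly_Mapping.single (expo js) 1"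
proof (induction js)
  case Nil
  then show ?case by (simp add: expo_def)
next
  case (Cons j js)
  have "prod_list (map (zv r) (j # js)) - Poly_Mapping.single (expo (j # js)) 1
    = zv r j * (prod_list (map (zv r) js) - Poly_Mapping.single (expo js) 1)
      + (zv r j - var j) * Poly_Mapping.single (expo js) 1"
    by (simp add: expo_Cons algebra_simps) (simp add: var_def mult_single add.commute)
  then show ?case
    using Cons zv_dvd[of r j] by simp
qed

lemma zpow_dvd: "var r dvd zpow r t - Poly_Mapping.single t 1"
  using zprod_dvd[of r "mlist t"] by (simp add: zpow_def expo_mlist)

lemma zpow_zero: assumes "Poly_Mapping.lookup t r \<noteq> 0" "var r \<noteq> (0 :: cpoly)" shows "zpow r t = 0"
proof -
  have "zv r r = 0" using assms(2) by (simp add: zv_def)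
  moreover have "r \<in> set (mlist t)" using assms(1) by (simp add: set_mlist in_keys_iff)
  ultimately have "0 \<in> set (map (zv r) (mlist t))" by force
  then show ?thesis unfolding zpow_def by (simp add: prod_list_zero_iff)
qed

text \<open>The substitution of z_j for Y_j. Only monomials of degree \<open>m\<close> are read, so
  the index set does not depend on F.\<close>

definition zsubst :: "nat \<Rightarrow> nat \<Rightarrow> nat \<Rightarrow> ratfun mpoly \<Rightarrow> ratfun mpoly" where
  "zsubst N r m F = (\<Sum>t\<in>mons N m. cst (Poly_Mapping.lookup F t) * zpow r t)"

lemma hpoly_expand:
  assumes "F \<in> hpoly N m"
  shows "F = (\<Sum>t\<in>mons N m. Poly_Mapping.single t (Poly_Mapping.lookup F t))"
proof -
  have "Poly_Mapping.keys F \<subseteq> mons N m"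
    using assms by (auto simp: hpoly_def mons_def)
  then have "(\<Sum>t\<in>Poly_Mapping.keys F. Poly_Mapping.single t (Poly_Mapping.lookup F t))
    = (\<Sum>t\<in>mons N m. Poly_Mapping.single t (Poly_Mapping.lookup F t))"
    by (rule sum.mono_neutral_left[OF finite_mons]) (simp add: in_keys_iff)
  then show ?thesis using mpoly_expand[of F] by simp
qed

lemma zsubst_dvd:
  assumes "F \<in> hpoly N m"
  shows "var r dvd zsubst N r m F - F"
proof -
  have "zsubst N r m F - F = (\<Sum>t\<in>mons N m. cst (Poly_Mapping.lookup F t) * (zpow r t - Poly_Mapping.single t 1))"
    by (subst (2) hpoly_expand[OF assms])
      (simp add: zsubst_def sum_subtractf[symmetric] right_diff_distrib mult_single)
  also have "var r dvd \<dots>"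
    by (intro dvd_sum dvd_mult zpow_dvd)
  finally show ?thesis .
qed

lemma keys_delta_mdeg:
  assumes "\<And>t. Poly_Mapping.lookup G t \<noteq> 0 \<Longrightarrow> mdeg t \<le> Suc M"
    and "Poly_Mapping.lookup (delta N G) t \<noteq> 0"
  shows "mdeg t \<le> M"
proof -
  have "\<exists>i. Poly_Mapping.lookup G (t + Poly_Mapping.single i 1) \<noteq> 0"
  proof (rule ccontr)
    assume "\<not> ?thesis"
    then have "Poly_Mapping.lookup (delta N G) t = 0"
      by (auto simp: delta_def lookup_sum lookup_partial)
    with assms(2) show False by simp
  qed
  then obtain i where "Poly_Mapping.lookup G (t + Poly_Mapping.single i 1) \<noteq> 0" by blast
  from assms(1)[OF this] show ?thesis by (simp add: mdeg_add)
qed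

lemma var_mult_cancel: "var r * (F :: ratfun mpoly) = 0 \<Longrightarrow> F = 0"
proof -
  have "var r \<noteq> (0 :: ratfun mpoly)"
    by (metis lookup_single_eq lookup_zero var_def zero_neq_one)
  then show "var r * F = 0 \<Longrightarrow> F = 0" by simp
qed

text \<open>The equation expresses that Y_r^a G lies in the kernel of \<open>delta\<close>. It
  forces G = Y_r G1 with G1 proportional to \<open>delta N G\<close>, and G1 satisfies the same
  equation with a + 1 in place of a. As \<open>delta\<close> lowers the degree in Y, induction on a
  degree bound applies; a > 0 keeps the coefficient a X_r invertible.\<close>

lemma var_multiple_in_kernel:
  assumes X: "var r \<noteq> (0 :: cpoly)" and a: "a > 0"
    and deg: "\<And>t. Poly_Mapping.lookup G t \<noteq> 0 \<Longrightarrow> mdeg t \<le> M" and r: "r \<le> N"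
    and eq: "cst (of_nat a * fr (var r)) * G + var r * delta N G = 0"
  shows "G = 0"
  using a deg eq
proof (induction M arbitrary: a G)
  case 0
  have "partial i G = 0" for i
  proof (rule poly_mapping_eqI)
    fix t show "Poly_Mapping.lookup (partial i G) t = Poly_Mapping.lookup 0 t"
      using 0(2)[of "t + Poly_Mapping.single i 1"] by (cases "Poly_Mapping.lookup G (t + Poly_Mapping.single i 1) = 0") (auto simp: lookup_partial mdeg_add)
  qed
  then have "cst (of_nat a * fr (var r)) * G = 0"
    using 0(3) by (simp add: delta_def)
  then have "of_nat a * fr (var r) * Poly_Mapping.lookup G t = 0" for t
    by (metis lookup_const_mult lookup_zero)
  moreover have "(of_nat a * fr (var r)) \<noteq> 0"
    using X 0(1) by (metis fr_eq_0 fr_of_nat mult_eq_0_iff neq0_conv of_nat_eq_0_iff)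
  ultimately show ?case by (intro poly_mapping_eqI) auto
next
  case (Suc M)
  define u where "u = of_nat a * fr (var r)"
  have u: "u \<noteq> 0"
    using X Suc.prems(1) unfolding u_def by (metis fr_eq_0 fr_of_nat mult_eq_0_iff neq0_conv of_nat_eq_0_iff)
  define G1 where "G1 = cst (- inverse u) * delta N G"
  have uu: "cst (inverse u) * cst u = 1" using u by (simp add: mult_single)
  have "cst u * G = - (var r * delta N G)"
    using Suc.prems(3) unfolding u_def by (simp add: eq_neg_iff_add_eq_0)
  then have "cst (inverse u) * (cst u * G) = var r * G1"
    unfolding G1_def by (simp add: single_uminus)
  then have G: "G = var r * G1"
    by (simp add: mult.assoc[symmetric] uu)
  have dG: "delta N G = cst (fr (var r)) * G1 + var r * delta N G1"
    unfolding G by (simp add: delta_mult delta_var[OF r])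
  \<comment> \<open>Inserting G = Y_r G1 and cancelling one factor Y_r raises a by one, the extra
    summand X_r G1 coming from \<open>delta\<close> of Y_r.\<close>
  have "var r * (cst u * G1 + delta N G) = cst u * (var r * G1) + var r * delta N G"
    by (simp add: algebra_simps)
  then have "var r * (cst u * G1 + (cst (fr (var r)) * G1 + var r * delta N G1)) = cst u * G + var r * delta N G"
    unfolding dG[symmetric] G[symmetric] .
  also have "\<dots> = 0" using Suc.prems(3) unfolding u_def .
  finally have "cst u * G1 + (cst (fr (var r)) * G1 + var r * delta N G1) = 0"
    by (rule var_mult_cancel)
  moreover have "cst (of_nat (Suc a) * fr (var r)) = cst u + cst (fr (var r))"
    by (simp add: u_def single_add distrib_right add.commute)
  ultimately have eq1: "cst (of_nat (Suc a) * fr (var r)) * G1 + var r * delta N G1 = 0"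
    by (simp only: distrib_right add.assoc)
  have deg1: "mdeg t \<le> M" if "Poly_Mapping.lookup G1 t \<noteq> 0" for t
  proof (rule keys_delta_mdeg[OF Suc.prems(2)])
    show "Poly_Mapping.lookup (delta N G) t \<noteq> 0"
      using that unfolding G1_def by auto
  qed
  have "G1 = 0" by (rule Suc.IH[OF _ deg1 eq1]) simp
  then show ?case by (simp add: G)
qed

context chart
begin

abbreviation "x_germ j \<equiv> fr (var j) / fr (var r)"

lemma x_germ: "j \<le> N \<Longrightarrow> x_germ j \<in> germs 0"
  using germs_mult[OF germs_poly[OF forms_var] X_power[of "-1"], of j]
  by (simp add: divide_inverse power_int_minus)

lemma zv_kd:
  assumes "j \<le> N" shows "zv r j \<in> kd 1 0"
proof -
  have "cst (x_germ j) * var r \<in> bihom 1 0"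
    using bihom_cst_mult[OF x_germ[OF assms] bihom_var[OF r(1)]] by simp
  then have "zv r j \<in> bihom 1 0"
    unfolding zv_def by (intro bihom_closed bihom_var assms)
  moreover have "delta N (zv r j) = 0"
    unfolding zv_def delta_diff delta_cst_mult delta_var[OF assms] delta_var[OF r(1)]
    by (simp add: mult_single)
  ultimately show ?thesis by (simp add: ker_delta_def)
qed

lemma zprod_kd: "set js \<subseteq> {..N} \<Longrightarrow> prod_list (map (zv r) js) \<in> kd (length js) 0"
proof (induction js)
  case Nil
  then show ?case using kd_cst[of 1 0] by simp
next
  case (Cons j js)
  then show ?case using kd_mult[OF zv_kd, of j "prod_list (map (zv r) js)" "length js" 0] by simp
qed

lemma zpow_kd: "t \<in> mons N m \<Longrightarrow> zpow r t \<in> kd m 0"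
  using zprod_kd[of "mlist t"] by (auto simp: zpow_def mons_def set_mlist length_mlist)

lemma zsubst_kd:
  assumes "\<And>t. Poly_Mapping.lookup F t \<in> germs n"
  shows "zsubst N r m F \<in> kd m n"
  unfolding zsubst_def using kd_cst_mult[OF assms zpow_kd]
  by (intro addsub_sum[OF addsub_kd]) simp

lemma taylor:
  assumes "F \<in> kd m n"
  shows "zsubst N r m F = F"
proof -
  have Fb: "F \<in> bihom m n" using assms by (rule kd_bihom)
  then obtain G where G: "zsubst N r m F - F = var r * G"
    using zsubst_dvd[of F N m r] by (auto simp: bihom_iff dvd_def)
  have "delta N (zsubst N r m F - F) = 0"
    using zsubst_kd[of F n m] assms Fb by (auto simp: ker_delta_def delta_diff bihom_iff)
  \<comment> \<open>This is \<open>delta\<close> of Y_r G, with \<open>delta\<close> of Y_r equal to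
    X_r: the case a = 1.\<close>
  then have "cst (of_nat 1 * fr (var r)) * G + var r * delta N G = 0"
    unfolding G by (simp add: delta_mult delta_var[OF r(1)])
  moreover obtain M where "\<And>t. Poly_Mapping.lookup G t \<noteq> 0 \<Longrightarrow> mdeg t \<le> M"
  proof -
    have "mdeg t \<le> Max (mdeg ` Poly_Mapping.keys G)" if "Poly_Mapping.lookup G t \<noteq> 0" for t
      using that by (intro Max_ge) (auto simp: in_keys_iff)
    then show ?thesis using that by blast
  qed
  ultimately have "G = 0"
    by (intro var_multiple_in_kernel[of r 1 G M N] var_r_nz r) auto
  with G show ?thesis by simp
qed

text \<open>Since z_r = 0, only the monomials free of Y_r index a basis of Ker delta.\<close>

definition "mons0 m = {t \<in> mons N m. Poly_Mapping.lookup t r = 0}"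

lemma finite_mons0: "finite (mons0 m)"
  unfolding mons0_def using finite_mons by simp

lemma zsubst_mons0: "zsubst N r m F = (\<Sum>t\<in>mons0 m. cst (Poly_Mapping.lookup F t) * zpow r t)"
  unfolding zsubst_def mons0_def
  by (rule sum.mono_neutral_right) (auto simp: finite_mons zpow_zero)

text \<open>Modulo Y_r the product z^t is Y^t, so the coefficients of a combination can be read off
  at the monomials free of Y_r. This gives uniqueness of the expansion.\<close>

lemma lookup_zpow_comb:
  assumes "s \<in> mons0 m"
  shows "Poly_Mapping.lookup (\<Sum>t\<in>mons0 m. cst (a t) * zpow r t) s = a s"
proof -
  have *: "Poly_Mapping.lookup (zpow r t) s = (if t = s then 1 else 0)" for t
  proof -
    have "Poly_Mapping.lookup (zpow r t - Poly_Mapping.single t 1) s = 0"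
      using assms by (intro var_dvd_lookup[OF zpow_dvd]) (simp add: mons0_def)
    then show ?thesis by (simp add: lookup_minus lookup_single when_def)
  qed
  have "Poly_Mapping.lookup (\<Sum>t\<in>mons0 m. cst (a t) * zpow r t) s = (\<Sum>t\<in>mons0 m. if t = s then a t else 0)"
    unfolding lookup_sum by (intro sum.cong) (simp_all add: *)
  then show ?thesis
    using assms finite_mons0 by simp
qed

end

section \<open>Exactness of the Koszul complex on stalks\<close>

context proj_point
begin

lemma nonunits_iff: "a \<in> nonunits \<longleftrightarrow> (\<exists>f g e. a = fr f / fr g \<and> f \<in> forms N (int e) \<and> g \<in> forms N (int e) \<and> f \<in> p \<and> g \<notin> p)"
  unfolding nonunits_def by (simp add: Fract_fr)

lemma nonunits_add:
  assumes "a \<in> nonunits" "b \<in> nonunits" shows "a + b \<in> nonunits"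
proof -
  from assms obtain f g e f' g' e' where
    *: "a = fr f / fr g" "f \<in> forms N (int e)" "g \<in> forms N (int e)" "f \<in> p" "g \<notin> p"
    "b = fr f' / fr g'" "f' \<in> forms N (int e')" "g' \<in> forms N (int e')" "f' \<in> p" "g' \<notin> p"
    unfolding nonunits_iff by blast
  have "f * g' + f' * g \<in> p"
    using * by (intro p_add p_mult) (auto intro: forms_carrier)
  moreover have "f * g' + f' * g \<in> forms N (int (e + e'))" "g * g' \<in> forms N (int (e + e'))"
    using forms_mult[OF *(2,8)] forms_mult[OF *(7,3)] forms_mult[OF *(3,8)] by (auto intro!: forms_add simp: add.commute)
  moreover have "g * g' \<notin> p" using notin_p_mult * by blast
  moreover have "a + b = fr (f * g' + f' * g) / fr (g * g')"
    using notin_p_nz[OF *(5)] notin_p_nz[OF *(10)] unfolding *(1,6) by (simp add: fr_add fr_mult field_simps)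
  ultimately show ?thesis unfolding nonunits_iff by blast
qed

lemma nonunits_0: "0 \<in> nonunits"
  unfolding nonunits_iff using p_1 forms_1 by (intro exI[of _ 0] exI[of _ 1] exI[of _ "0::nat"]) auto

lemma nonunits_sum: "(\<And>x. x \<in> S \<Longrightarrow> f x \<in> nonunits) \<Longrightarrow> sum f S \<in> nonunits"
  by (induction S rule: infinite_finite_induct) (auto intro: nonunits_add nonunits_0)

text \<open>The way back from the local ring to the homogeneous prime: a polynomial multiple of a
  nonunit that is itself a polynomial lies in \<open>p\<close>, because the denominator does
  not.\<close>

lemma nonunits_form:
  assumes "fr h = fr u * w" "w \<in> nonunits" "u \<in> carrier (polyring N)" "h \<in> carrier (polyring N)"
  shows "h \<in> p"
proof -
  from assms(2) obtain f g e where *: "w = fr f / fr g" "g \<in> forms N (int e)" "f \<in> p" "g \<notin> p"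
    unfolding nonunits_iff by blast
  then have "fr (h * g) = fr (f * u)"
    using assms(1) notin_p_nz[OF *(4)] by (simp add: fr_mult field_simps)
  then have "h * g \<in> p" using p_mult[OF *(3) assms(3)] by simp
  then show ?thesis using p_prime[OF assms(4) forms_carrier[OF *(2)]] *(4) by blast
qed

lemma common_denominator:
  assumes "finite S" "\<And>i. i \<in> S \<Longrightarrow> a i \<in> germs n"
  obtains g e f where "g \<in> forms N (int e)" "g \<notin> p"
    "\<And>i. i \<in> S \<Longrightarrow> f i \<in> forms N (n + int e) \<and> a i = fr (f i) / fr g"
proof -
  have "\<exists>g e f. g \<in> forms N (int e) \<and> g \<notin> p \<and> (\<forall>i\<in>S. f i \<in> forms N (n + int e) \<and> a i = fr (f i) / fr g)"
    using assms
  proof (induction S)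
    case empty
    show ?case using p_1 forms_1 by (intro exI[of _ 1] exI[of _ "0::nat"]) auto
  next
    case (insert x S)
    have "\<exists>g e f. g \<in> forms N (int e) \<and> g \<notin> p \<and> (\<forall>i\<in>S. f i \<in> forms N (n + int e) \<and> a i = fr (f i) / fr g)"
      by (rule insert.IH) (use insert.prems in simp)
    then obtain g e f where g: "g \<in> forms N (int e)" "g \<notin> p"
      and f: "\<And>i. i \<in> S \<Longrightarrow> f i \<in> forms N (n + int e) \<and> a i = fr (f i) / fr g" by blast
    obtain f' g' e' where *: "a x = Fract f' g'" "g' \<in> forms N (int e')" "g' \<notin> p" "f' \<in> forms N (n + int e')"
      using insert.prems[of x] by (auto elim: germsE)
    let ?f = "\<lambda>i. if i = x then f' * g else f i * g'"
    have "?f i \<in> forms N (n + int (e + e')) \<and> a i = fr (?f i) / fr (g * g')" if "i \<in> insert x S" for i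
    proof (cases "i = x")
      case True
      then show ?thesis
        using forms_mult[OF *(4) g(1)] *(1) notin_p_nz[OF g(2)] by (simp add: Fract_fr fr_mult algebra_simps)
    next
      case False
      with that have i: "i \<in> S" by simp
      then have "f i * g' \<in> forms N ((n + int e) + int e')" using f *(2) by (intro forms_mult) auto
      with i False f[of i] notin_p_nz[OF *(3)] show ?thesis by (simp add: fr_mult algebra_simps)
    qed
    moreover have "g * g' \<in> forms N (int (e + e'))" "g * g' \<notin> p"
      using forms_mult[OF g(1) *(2)] notin_p_mult[OF g(1) *(2) g(2) *(3)] by auto
    ultimately show ?case
      by (intro exI[of _ "g * g'"] exI[of _ "e + e'"] exI[of _ ?f]) blast
  qed
  then show ?thesis using that by blast
qed

end

lemma koszul_shift_insert:
  assumes "finite J" "i \<notin> J"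
  shows "koszul_shift d n (insert i J) = koszul_shift d n J - (int (d i) - 1)"
  using assms by (simp add: koszul_shift_def)

context ci_point
begin

abbreviation "al i \<equiv> alpha_poly N (d i) (P i)"

lemma al_eq: "al i = (\<Sum>j\<le>N. cst (fr (partial j (P i)) / of_nat (d i)) * var j)"
  by (simp add: alpha_poly_def fr_def)

lemma al_coeff: "i \<in> {1..c} \<Longrightarrow> fr (partial j (P i)) / of_nat (d i) \<in> germs (int (d i) - 1)"
  using germs_mult[OF germs_poly[OF forms_partial[OF P_form]] germs_inverse_of_nat[of "d i"], of i j]
  by (simp add: divide_inverse)

lemma al_bihom: "i \<in> {1..c} \<Longrightarrow> al i \<in> bihom 1 (int (d i) - 1)"
  unfolding al_eq using bihom_cst_mult[OF al_coeff bihom_var] by (intro bihom_sum) auto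

text \<open>Euler's relation; the factor 1/d_i in \<alpha>(P_i) cancels the degree. The value
  vanishes only on X, which is why \<alpha>(P_i) acts on Ker delta after restriction.\<close>

lemma delta_al:
  assumes "i \<in> {1..c}" shows "delta N (al i) = cst (fr (P i))"
proof -
  have "delta N (al i) = (\<Sum>j\<le>N. cst (fr (partial j (P i)) / of_nat (d i) * fr (var j)))"
    unfolding al_eq delta_sum delta_cst_mult by (intro sum.cong refl) (simp add: delta_var mult_single)
  also have "\<dots> = cst (fr (\<Sum>j\<le>N. var j * partial j (P i)) / of_nat (d i))"
    unfolding cst_sum[symmetric] fr_sum sum_divide_distrib fr_mult by (simp add: mult.commute)
  also have "(\<Sum>j\<le>N. var j * partial j (P i)) = of_nat (d i) * P i"
    using euler_forms[OF P_form[OF assms]] by simp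
  also have "fr (of_nat (d i) * P i) / of_nat (d i) = fr (P i)"
    using of_nat_ratfun_nz[of "d i"] d_pos[OF assms] by (simp add: fr_mult)
  finally show ?thesis .
qed

abbreviation kos :: "(nat set \<Rightarrow> ratfun mpoly) \<Rightarrow> nat set \<Rightarrow> ratfun mpoly" where
  "kos \<equiv> koszul_map c al"

text \<open>The P_i vanish at \<open>p\<close>, so the ideal of X is contained in the maximal
  ideal.\<close>

lemma J_nonunits: "J 0 \<subseteq> nonunits"
proof
  fix x assume "x \<in> J 0"
  then obtain a where a: "x = (\<Sum>i\<in>{1..c}. a i * fr (P i))" "\<forall>i\<in>{1..c}. a i \<in> germs (0 - int (d i))"
    unfolding J_germs_def by blast
  have "a i * fr (P i) \<in> nonunits" if i: "i \<in> {1..c}" for i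
  proof -
    obtain f g e where *: "a i = Fract f g" "g \<in> forms N (int e)" "g \<notin> p" "f \<in> forms N (0 - int (d i) + int e)"
      using germsE[OF a(2)[rule_format, OF i]] by blast
    have "f * P i \<in> forms N (int e)" using forms_mult[OF *(4) P_form[OF i]] by simp
    moreover have "f * P i \<in> p"
      using p_mult[OF PX[OF i] forms_carrier[OF *(4)]] by (simp add: mult.commute)
    ultimately show ?thesis
      unfolding nonunits_iff using * by (intro exI[of _ "f * P i"] exI[of _ g] exI[of _ e]) (simp add: Fract_fr fr_mult)
  qed
  then show "x \<in> nonunits" unfolding a(1) by (rule nonunits_sum)
qed

end

locale ci_chart = ci_point N c d P p + chart N p r for N c d P p r
begin

text \<open>As \<open>delta\<close> takes \<alpha>(P_i) to P_i and Y_r to X_r, subtracting (P_i/X_r)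
  Y_r puts \<alpha>(P_i) into Ker delta. The coefficient of the correction lies in the twisted ideal
  of X.\<close>

definition ak :: "nat \<Rightarrow> ratfun mpoly" where
  "ak i = al i - cst (fr (P i) / X) * var r"

lemma PX_germ: "i \<in> {1..c} \<Longrightarrow> fr (P i) / X \<in> J (int (d i) - 1)"
  using J_mult_right[OF P_J X_power[of "-1"], of i] by (simp add: divide_inverse power_int_minus)

lemma ak_kd:
  assumes "i \<in> {1..c}" shows "ak i \<in> kd 1 (int (d i) - 1)"
proof -
  have "cst (fr (P i) / X) * var r \<in> bihom 1 (int (d i) - 1)"
    using bihom_cst_mult[OF _ bihom_var[OF r(1)]] PX_germ[OF assms] J_subset by fastforce
  then have "ak i \<in> bihom 1 (int (d i) - 1)"
    unfolding ak_def by (intro bihom_closed al_bihom assms)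
  then show ?thesis
    by (simp add: ker_delta_def ak_def delta_diff delta_cst_mult delta_var[OF r(1)] delta_al[OF assms] mult_single)
qed

lemma al_ak:
  assumes "i \<in> {1..c}" "F \<in> bihom m n"
  shows "al i * F - ak i * F \<in> H (Suc m) (n + (int (d i) - 1))"
proof -
  have "al i * F - ak i * F = cst (fr (P i) / X) * (var r * F)"
    by (simp add: ak_def algebra_simps)
  moreover have "var r * F \<in> bihom (Suc m) n"
    using bihom_mult[OF bihom_var[OF r(1)] assms(2)] by simp
  ultimately show ?thesis
    using H_mult_right[OF H_cst[OF PX_germ[OF assms(1)]], of "var r * F" "Suc m" n] by (simp add: add.commute)
qed

text \<open>The coefficients of \<open>ak i\<close> in Y, moved to twist 0 by the power of X_r that
  compensates the degree d_i - 1.\<close>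

definition lin :: "nat \<Rightarrow> nat \<Rightarrow> ratfun" where
  "lin i j = X powi (1 - int (d i)) * (fr (partial j (P i)) / of_nat (d i) - (if j = r then fr (P i) / X else 0))"

definition lk :: "nat \<Rightarrow> ratfun mpoly" where
  "lk i = cst (X powi (1 - int (d i))) * ak i"

lemma lk_eq: "lk i = (\<Sum>j\<le>N. cst (lin i j) * var j)"
proof -
  have "ak i = (\<Sum>j\<le>N. cst (fr (partial j (P i)) / of_nat (d i)) * var j) - (\<Sum>j\<le>N. (if j = r then cst (fr (P i) / X) * var j else 0))"
    unfolding ak_def al_eq using r(1) by simp
  also have "\<dots> = (\<Sum>j\<le>N. cst (fr (partial j (P i)) / of_nat (d i) - (if j = r then fr (P i) / X else 0)) * var j)"
    unfolding sum_subtractf[symmetric] by (intro sum.cong) (auto simp: single_diff algebra_simps)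
  finally show ?thesis
    unfolding lk_def lin_def cst_mult by (simp add: sum_distrib_left mult.assoc)
qed

lemma lk_kd: "i \<in> {1..c} \<Longrightarrow> lk i \<in> kd 1 0"
  unfolding lk_def using kd_cst_mult[OF X_power ak_kd, of i "1 - int (d i)"] by simp

lemma lin_germ: "i \<in> {1..c} \<Longrightarrow> lin i j \<in> germs 0"
proof -
  assume i: "i \<in> {1..c}"
  have "fr (partial j (P i)) / of_nat (d i) - (if j = r then fr (P i) / X else 0) \<in> germs (int (d i) - 1)"
    using al_coeff[OF i] PX_germ[OF i] J_subset by (intro germs_diff) auto
  from germs_mult[OF X_power this, of "1 - int (d i)"] show ?thesis by (simp add: lin_def)
qed

text \<open>Clearing denominators turns a relation modulo the maximal ideal into a polynomial
  relation among the rows of the Jacobian matrix modulo \<open>p\<close>, to which smoothness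
  applies.\<close>

lemma lin_indep:
  assumes a: "\<And>i. i \<in> {1..c} \<Longrightarrow> a i \<in> germs 0"
    and rel: "\<And>j. j \<in> {..N} \<Longrightarrow> (\<Sum>i\<in>{1..c}. a i * lin i j) \<in> nonunits"
    and i: "i \<in> {1..c}"
  shows "a i \<in> nonunits"
proof -
  obtain g e f where g: "g \<in> forms N (int e)" "g \<notin> p"
    and f: "\<And>i. i \<in> {1..c} \<Longrightarrow> f i \<in> forms N (0 + int e) \<and> a i = fr (f i) / fr g"
    using common_denominator[of "{1..c}" a 0] a by (metis finite_atLeastAtMost)
  \<comment> \<open>A common upper bound of the degrees, which makes the exponents
    \<open>D - d i\<close> free of truncation.\<close>
  define D where "D = (\<Sum>i\<in>{1..c}. d i)"
  have dD: "d i \<le> D" if "i \<in> {1..c}" for i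
    unfolding D_def using that by (intro member_le_sum) auto
  have D1: "1 \<le> D" using dD[OF i] d_pos[OF i] by simp
  \<comment> \<open>The numerator of a_i, times X_r^(D - d_i) to absorb the factor X_r^(1 - d_i) of
    \<open>lin\<close>, times the 1/d_i contained in \<alpha>(P_i).\<close>
  define b where "b i = f i * var r ^ (D - d i) * cst (inverse (of_nat (d i)))" for i
  have X_sum: "X powi (1 - int (d i)) * X ^ (D - 1) = X ^ (D - d i)" if "i \<in> {1..c}" for i
  proof -
    have "X powi (1 - int (d i)) * X powi int (D - 1) = X powi (1 - int (d i) + int (D - 1))"
      by (rule power_int_add[symmetric]) simp
    also have "1 - int (d i) + int (D - 1) = int (D - d i)"
      using dD[OF that] D1 by simp
    finally show ?thesis by simp
  qed
  have rel': "(\<Sum>i\<in>{1..c}. b i * partial j (P i)) \<in> p" if j: "j \<le> N" for j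
  proof -
    define w where "w = (\<Sum>i\<in>{1..c}. a i * (X powi (1 - int (d i)) * (fr (partial j (P i)) / of_nat (d i))))"
    \<comment> \<open>At j = r the entries of \<open>lin\<close> contain an additional multiple of
      P_i/X_r. It lies in the ideal of X, hence among the nonunits, and may be dropped.\<close>
    have "w = (\<Sum>i\<in>{1..c}. a i * lin i j) + (\<Sum>i\<in>{1..c}. if j = r then a i * (X powi (1 - int (d i)) * (fr (P i) / X)) else 0)"
      unfolding w_def lin_def sum.distrib[symmetric] by (intro sum.cong) (auto simp: algebra_simps)
    moreover have "a i * (X powi (1 - int (d i)) * (fr (P i) / X)) \<in> nonunits" if "i \<in> {1..c}" for i
      using J_mult[OF a J_mult[OF X_power PX_germ], of i i "1 - int (d i)"] that J_nonunits by auto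
    ultimately have w: "w \<in> nonunits"
      using rel[of j] j by (auto intro!: nonunits_add nonunits_sum nonunits_0)
    have eqn: "fr (\<Sum>i\<in>{1..c}. b i * partial j (P i)) = fr (g * var r ^ (D - 1)) * w"
    proof -
      have "fr (b i * partial j (P i)) = fr (g * var r ^ (D - 1)) * (a i * (X powi (1 - int (d i)) * (fr (partial j (P i)) / of_nat (d i))))"
        if i: "i \<in> {1..c}" for i
      proof -
        have "fr (g * var r ^ (D - 1)) * (a i * (X powi (1 - int (d i)) * (fr (partial j (P i)) / of_nat (d i))))
          = (fr g * a i) * (X powi (1 - int (d i)) * X ^ (D - 1)) * (fr (partial j (P i)) / of_nat (d i))"
          by (simp only: fr_mult fr_power ac_simps)
        also have "fr g * a i = fr (f i)" using f[OF i] notin_p_nz[OF g(2)] by simp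
        also have "X powi (1 - int (d i)) * X ^ (D - 1) = X ^ (D - d i)" by (rule X_sum[OF i])
        finally have "fr (g * var r ^ (D - 1)) * (a i * (X powi (1 - int (d i)) * (fr (partial j (P i)) / of_nat (d i))))
          = fr (f i) * X ^ (D - d i) * (fr (partial j (P i)) / of_nat (d i))" .
        moreover have "fr (b i * partial j (P i)) = fr (f i) * X ^ (D - d i) * (fr (partial j (P i)) / of_nat (d i))"
          by (simp add: b_def fr_mult fr_power inverse_of_nat_ratfun[symmetric] divide_inverse)
        ultimately show ?thesis by (simp only:)
      qed
      then show ?thesis unfolding fr_sum w_def sum_distrib_left by (intro sum.cong) auto
    qed
    have C: "f \<in> carrier (polyring N) \<Longrightarrow> g \<in> carrier (polyring N) \<Longrightarrow> f * g \<in> carrier (polyring N)" for f g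
      using cring.axioms(1)[OF cring_polyring] monoid.m_closed[of "polyring N" f g] ring.is_monoid[of "polyring N"] by fastforce
    have bc: "b i * partial j (P i) \<in> carrier (polyring N)" if i: "i \<in> {1..c}" for i
      unfolding b_def using f[OF i] forms_power[OF forms_var[OF r(1)]] forms_partial[OF P_form[OF i]]
      by (intro C) (auto intro: forms_carrier[OF forms_const] dest: forms_carrier)
    have sumc: "sum h S \<in> carrier (polyring N)" if "\<And>i. i \<in> S \<Longrightarrow> h i \<in> carrier (polyring N)" for h and S :: "nat set"
      using that
    proof (induction S rule: infinite_finite_induct)
      case (insert x S)
      interpret cring "polyring N" by (rule cring_polyring)
      show ?case using insert a_closed[of "h x" "sum h S"] by simp
    qed (auto intro: forms_carrier[OF forms_0])
    have sc: "(\<Sum>i\<in>{1..c}. b i * partial j (P i)) \<in> carrier (polyring N)"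
      by (rule sumc, rule bc)
    have "g * var r ^ (D - 1) \<in> carrier (polyring N)"
      using forms_carrier[OF forms_mult[OF g(1) forms_power[OF forms_var[OF r(1)]]]] .
    from nonunits_form[OF eqn w this sc] show ?thesis .
  qed
  have bf: "b i \<in> forms N (int e + int (D - d i) * 1 + 0)" if "i \<in> {1..c}" for i
    unfolding b_def using f[OF that] by (intro forms_mult forms_power forms_var r forms_const) simp
  have zl: "p \<in> zero_locus N c P" using p PX by (auto simp: zero_locus_def)
  have "\<forall>i\<in>{1..c}. b i \<in> p"
  proof (rule sci[unfolded smooth_complete_intersection_def, THEN conjunct2, THEN conjunct2, THEN bspec, OF zl, THEN spec, THEN mp], intro conjI ballI allI impI)
    show "b i \<in> carrier (polyring N)" if "i \<in> {1..c}" for i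
      by (rule forms_carrier[OF bf[OF that]])
  qed (rule rel')
  then have bp: "b i \<in> p" using i by blast
  \<comment> \<open>Neither a power of X_r nor a nonzero constant lies in the prime
    \<open>p\<close>, so b_i in \<open>p\<close> forces f_i in \<open>p\<close>.\<close>
  have "f i \<in> p"
  proof (rule ccontr)
    assume fp: "f i \<notin> p"
    have cp: "cst (inverse (of_nat (d i))) \<notin> p"
    proof
      assume "cst (inverse (of_nat (d i))) \<in> p"
      then have "cst (inverse (of_nat (d i))) * cst (of_nat (d i)) \<in> p"
        by (rule p_mult) (rule forms_carrier[OF forms_const])
      moreover have "cst (inverse (of_nat (d i))) * cst (of_nat (d i)) = (1 :: cpoly)"
        using d_pos[OF i] by (simp add: mult_single del: single_of_nat)
      ultimately show False using p_1 by simp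
    qed
    have v: "var r ^ (D - d i) \<notin> p" by (rule notin_p_power[OF forms_var[OF r(1)] r(2)])
    have "f i * var r ^ (D - d i) \<notin> p"
      using f[OF i] by (intro notin_p_mult[OF _ forms_power[OF forms_var[OF r(1)]] fp v]) auto
    then have "b i \<notin> p"
      unfolding b_def using f[OF i]
      by (intro notin_p_mult[OF forms_mult[OF _ forms_power[OF forms_var[OF r(1)]]] forms_const _ cp]) auto
    with bp show False by simp
  qed
  with f[OF i] g show ?thesis unfolding nonunits_iff by auto
qed

text \<open>Independence modulo the maximal ideal gives vectors dual to the l_i, and the derivatives
  along them act on Ker delta. The Weyl argument applies once every summand has been moved to twist
  0 and \<alpha>(P_i) replaced by \<open>lk i\<close>.\<close>

theorem koszul_stalk:
  assumes k: "1 \<le> k" "k \<le> c" "c \<le> m"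
    and x: "\<And>I. I \<in> koszul_index c k \<Longrightarrow> x I \<in> kd (m - k) (koszul_shift d n I)"
    and cycle: "\<And>J. J \<in> koszul_index c (k - 1) \<Longrightarrow> kos x J \<in> H (m - (k - 1)) (koszul_shift d n J)"
  shows "\<exists>y. (\<forall>I\<in>koszul_index c (Suc k). y I \<in> kd (m - Suc k) (koszul_shift d n I))
    \<and> (\<forall>J\<in>koszul_index c k. x J - kos y J \<in> H (m - k) (koszul_shift d n J))"
proof -
  obtain v where v: "\<And>i j. v i j \<in> germs 0"
    and dual: "\<And>i k. i \<in> {1..c} \<Longrightarrow> k \<in> {1..c} \<Longrightarrow> (\<Sum>j\<in>{..N}. v i j * lin k j) = (if i = k then 1 else 0)"
  proof -
    have "\<exists>v. (\<forall>i j. v i j \<in> germs 0) \<and> (\<forall>i\<in>{1..c}. \<forall>k\<in>{1..c}. (\<Sum>j\<in>{..N}. v i j * lin k j) = (if i = k then 1 else 0))"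
    proof (rule dual_vectors[where U = nonunits])
      show "a \<noteq> 0 \<and> inverse a \<in> germs 0" if "a \<in> germs 0" "a \<notin> nonunits" for a
        using that germs_inverse nonunits_0 by blast
      show "a i \<in> nonunits" if "\<And>i. i \<in> {1..c} \<Longrightarrow> a i \<in> germs 0"
        "\<And>j. j \<in> {..N} \<Longrightarrow> (\<Sum>i\<in>{1..c}. a i * lin i j) \<in> nonunits" "i \<in> {1..c}" for a i
        by (rule lin_indep[OF that])
    qed (auto simp: addsub_germs one_unit germs_mult0 lin_germ)
    then show ?thesis using that by blast
  qed
  define D where "D i F = (\<Sum>j\<le>N. cst (v i j) * partial j F)" for i and F :: "ratfun mpoly"
  \<comment> \<open>Membership in the ideal is asked of the coefficients only, with no condition on
    degree or \<open>delta\<close>; this set is stable under all the operators.\<close>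
  let ?Z = "{F :: ratfun mpoly. \<forall>t. Poly_Mapping.lookup F t \<in> J 0}"
  have Zadd: "addsub ?Z" using addsub_J[of 0] by (auto simp: addsub_def lookup_add)
  have Zmult: "F * G \<in> ?Z" if "\<And>t. Poly_Mapping.lookup F t \<in> germs 0" "G \<in> ?Z" for F G
    using that J_mult[of _ 0 _ 0] by (auto intro!: lookup_mult_in addsub_J)
  interpret weyl_action c lk D "\<lambda>m. kd m 0" ?Z
  proof
    show "lk i * f \<in> kd (Suc m) 0" if "i \<in> {1..c}" "f \<in> kd m 0" for i f m
      using kd_mult[OF lk_kd[OF that(1)] that(2)] by simp
    show "D i f \<in> kd m 0" if "f \<in> kd (Suc m) 0" for i f m
      unfolding D_def using kd_cst_mult[OF v kd_partial[OF that]] by (intro addsub_sum[OF addsub_kd]) simp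
    show "D i f = 0" if "f \<in> kd 0 0" for i f
      using that unfolding D_def by (simp add: bihom_0_partial[OF kd_bihom])
    show "lk i * f \<in> ?Z" if "i \<in> {1..c}" "f \<in> ?Z" for i f
      using kd_bihom[OF lk_kd[OF that(1)]] that(2) by (intro Zmult) (auto simp: bihom_iff)
    show "D i f \<in> ?Z" if "f \<in> ?Z" for i f
    proof -
      have "partial j f \<in> ?Z" for j
        using that J_mult[OF germs_of_nat, of _ 0] by (auto simp: lookup_partial simp del: of_nat_Suc)
      then have "cst (v i j) * partial j f \<in> ?Z" for j
        using v[of i j] by (intro Zmult) (auto simp: lookup_single when_def)
      then show ?thesis unfolding D_def by (intro addsub_sum[OF Zadd])
    qed
    show "D i (f + g) = D i f + D i g" for i f g
      by (simp add: D_def partial_add distrib_left sum.distrib)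
    show "D i (lk j * f) = (if i = j then f else 0) + lk j * D i f" if ij: "i \<in> {1..c}" "j \<in> {1..c}" for i j f
    proof -
      have "partial a (lk j) = cst (lin j a)" if "a \<le> N" for a
      proof -
        have "partial a (lk j) = (\<Sum>b\<le>N. if b = a then cst (lin j b) else 0)"
          unfolding lk_eq partial_sum partial_const_mult partial_var by (intro sum.cong) auto
        then show ?thesis using that by simp
      qed
      \<comment> \<open>By the Leibniz rule the extra term is the pairing of v_i with the
        coefficients of l_j, which is 1 or 0 by duality.\<close>
      then have "D i (lk j * f) = (\<Sum>a\<le>N. cst (v i a * lin j a) * f + lk j * (cst (v i a) * partial a f))"
        unfolding D_def by (intro sum.cong refl) (simp add: partial_mult cst_mult algebra_simps)
      also have "\<dots> = cst (\<Sum>a\<le>N. v i a * lin j a) * f + lk j * D i f"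
        by (simp only: D_def sum.distrib sum_distrib_left sum_distrib_right cst_sum)
      finally show ?thesis using dual[OF ij] by simp
    qed
    show "D i (D j f) = D j (D i f)" for i j f
    proof -
      have dd2: "D i (D j f) = (\<Sum>a\<le>N. \<Sum>b\<le>N. cst (v i a) * (cst (v j b) * partial a (partial b f)))" for i j
        by (simp add: D_def partial_sum partial_const_mult sum_distrib_left)
      then show ?thesis
        by (subst dd2[of i j], subst dd2[of j i], subst sum.swap) (simp only: mult.left_commute[of "cst (v i _)"] partial_commute)
    qed
    show "\<exists>q. of_nat (Suc a) * q = 1 \<and> (\<forall>m. \<forall>f\<in>kd m 0. q * f \<in> kd m 0) \<and> (\<forall>f\<in>?Z. q * f \<in> ?Z)" for a
    proof (intro exI[of _ "cst (inverse (of_nat (Suc a)))"] conjI allI ballI)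
      show "of_nat (Suc a) * cst (inverse (of_nat (Suc a))) = (1 :: ratfun mpoly)"
        using of_nat_ratfun_nz[of "Suc a"]
        by (subst single_of_nat[symmetric]) (simp add: mult_single del: single_of_nat of_nat_Suc)
      show "cst (inverse (of_nat (Suc a))) * f \<in> kd m 0" if "f \<in> kd m 0" for f m
        using kd_cst_mult[OF germs_inverse_of_nat[of "Suc a"] that] by (simp del: of_nat_Suc)
      show "cst (inverse (of_nat (Suc a))) * f \<in> ?Z" if "f \<in> ?Z" for f
        using that germs_inverse_of_nat by (intro Zmult) (auto simp: lookup_single when_def simp del: of_nat_Suc)
    qed
  qed (auto simp: addsub_kd Zadd)
  define s where "s = koszul_shift d n"
  have s_ins: "s (insert i K) = s K - (int (d i) - 1)" if "i \<in> {1..c} - K" "finite K" for i K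
    using that koszul_shift_insert[of K i d n] by (simp add: s_def)
  have fin: "finite K" if "K \<in> koszul_index c q" for K q
    using that finite_subset by (auto simp: koszul_index_def)
  have ins: "insert i K \<in> koszul_index c (Suc q)" if "K \<in> koszul_index c q" "i \<in> {1..c} - K" for i K q
    using that fin[OF that(1)] by (auto simp: koszul_index_def)
  text \<open>Multiplication by powers of \<open>X\<^sub>r\<close> moves everything to twist \<open>0\<close>.\<close>
  have compare: "dd (\<lambda>I. cst (X powi (- s I)) * u I) K - cst (X powi (- s K)) * kos u K \<in> ?Z"
    if K: "K \<in> koszul_index c q" and u: "\<And>I. I \<in> koszul_index c (Suc q) \<Longrightarrow> u I \<in> bihom (m' :: nat) (s I)" for u K q m'
  proof -
    have "dd (\<lambda>I. cst (X powi (- s I)) * u I) K - cst (X powi (- s K)) * kos u K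
      = (\<Sum>i\<in>{1..c} - K. koszul_sign i K * (cst (X powi (- s K)) * (ak i * u (insert i K) - al i * u (insert i K))))"
      unfolding koszul_map_def sum_distrib_left sum_subtractf[symmetric]
    proof (rule sum.cong[OF refl])
      fix i assume i: "i \<in> {1..c} - K"
      have "X powi (1 - int (d i)) * X powi (- s (insert i K)) = X powi (- s K)"
        using s_ins[OF i fin[OF K]] by (subst power_int_add[symmetric]) auto
      then have eq: "cst (X powi (1 - int (d i))) * cst (X powi (- s (insert i K))) = cst (X powi (- s K))"
        by (simp add: mult_single)
      have "lk i * (cst (X powi (- s (insert i K))) * u (insert i K))
        = (cst (X powi (1 - int (d i))) * cst (X powi (- s (insert i K)))) * (ak i * u (insert i K))"
        by (simp only: lk_def ac_simps)
      then have "lk i * (cst (X powi (- s (insert i K))) * u (insert i K)) = cst (X powi (- s K)) * (ak i * u (insert i K))"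
        by (simp only: eq)
      then show "koszul_sign i K * (lk i * (cst (X powi (- s (insert i K))) * u (insert i K)))
         - cst (X powi (- s K)) * (koszul_sign i K * (al i * u (insert i K)))
        = koszul_sign i K * (cst (X powi (- s K)) * (ak i * u (insert i K) - al i * u (insert i K)))"
        by (simp add: right_diff_distrib mult.left_commute)
    qed
    also have "\<dots> \<in> ?Z"
    proof (intro addsub_sum[OF Zadd] koszul_sign_closed[OF Zadd])
      fix i assume i: "i \<in> {1..c} - K"
      have "al i * u (insert i K) - ak i * u (insert i K) \<in> H (Suc m') (s (insert i K) + (int (d i) - 1))"
        using i by (intro al_ak u ins[OF K]) auto
      then have "ak i * u (insert i K) - al i * u (insert i K) \<in> H (Suc m') (s K)"
        using addsubD(3)[OF addsub_H] s_ins[OF i fin[OF K]] by fastforce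
      then have "Poly_Mapping.lookup (ak i * u (insert i K) - al i * u (insert i K)) t \<in> J (s K)" for t
        by (rule H_D)
      then show "cst (X powi (- s K)) * (ak i * u (insert i K) - al i * u (insert i K)) \<in> ?Z"
        using J_mult[OF X_power[of "- s K"], of _ "s K"] by simp
    qed
    finally show ?thesis .
  qed
  define x' where "x' I = cst (X powi (- s I)) * x I" for I
  have "\<exists>y. (\<forall>I\<in>koszul_index c (Suc k). y I \<in> kd (m - k - 1) 0) \<and> (\<forall>J\<in>koszul_index c k. x' J - dd y J \<in> ?Z)"
  proof (rule koszul_exact[OF k(1)])
    show "x' I \<in> kd (m - k) 0" if "I \<in> koszul_index c k" for I
      using kd_cst_mult[OF X_power x[OF that], of "- s I"] by (simp add: x'_def s_def)
    fix K assume K: "K \<in> koszul_index c (k - 1)"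
    have "dd x' K - cst (X powi (- s K)) * kos x K \<in> ?Z"
      unfolding x'_def using k x by (intro compare[OF K, where m' = "m - k"]) (auto simp: s_def dest: kd_bihom)
    moreover have "cst (X powi (- s K)) * kos x K \<in> ?Z"
      using H_D(2)[OF cycle[OF K]] J_mult[OF X_power[of "- s K"], of _ "s K"] by (simp add: s_def)
    ultimately show "dd x' K \<in> ?Z" using addsubD(2)[OF Zadd] by fastforce
  qed
  then obtain y' where y': "\<And>I. I \<in> koszul_index c (Suc k) \<Longrightarrow> y' I \<in> kd (m - k - 1) 0"
    and hom: "\<And>J. J \<in> koszul_index c k \<Longrightarrow> x' J - dd y' J \<in> ?Z" by blast
  \<comment> \<open>The chain found in twist 0 is moved back to the twist of each summand.\<close>
  define y where "y I = cst (X powi (s I)) * y' I" for I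
  have yk: "y I \<in> kd (m - Suc k) (s I)" if "I \<in> koszul_index c (Suc k)" for I
    using kd_cst_mult[OF X_power y'[OF that], of "s I"] by (simp add: y_def)
  have y'y: "cst (X powi (- s I)) * y I = y' I" for I
    unfolding y_def mult.assoc[symmetric] by (simp add: mult_single X_power_cancel)
  have "x K - kos y K \<in> H (m - k) (s K)" if K: "K \<in> koszul_index c k" for K
  proof -
    have "dd y' K - cst (X powi (- s K)) * kos y K \<in> ?Z"
      using compare[OF K, where m' = "m - Suc k" and u = y] kd_bihom[OF yk] unfolding y'y by blast
    from addsubD(2)[OF Zadd this hom[OF K]]
    have "cst (X powi (- s K)) * (x K - kos y K) \<in> ?Z"
      by (simp add: x'_def algebra_simps)
    then have Jl: "X powi (- s K) * Poly_Mapping.lookup (x K - kos y K) t \<in> J 0" for t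
      by simp
    have "Poly_Mapping.lookup (x K - kos y K) t \<in> J (s K)" for t
      using J_mult[OF X_power[of "s K"] Jl[of t]] by (simp add: mult.assoc[symmetric] X_power_cancel)
    moreover have "x K - kos y K \<in> bihom (m - k) (s K)"
    proof (intro bihom_closed)
      show "x K \<in> bihom (m - k) (s K)" using kd_bihom[OF x[OF K]] by (simp add: s_def)
      show "kos y K \<in> bihom (m - k) (s K)"
        unfolding koszul_map_def
      proof (intro addsub_sum[OF addsub_bihom] koszul_sign_closed[OF addsub_bihom])
        fix i assume i: "i \<in> {1..c} - K"
        \<comment> \<open>An index outside K forces k < c, hence k < m, so that
          \<open>1 + (m - Suc k)\<close> really equals \<open>m - k\<close>.\<close>
        then have "card K < card {1..c}"
          using K by (intro psubset_card_mono) (auto simp: koszul_index_def)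
        then have "k < c" using K by (simp add: koszul_index_def)
        have "al i * y (insert i K) \<in> bihom (1 + (m - Suc k)) (int (d i) - 1 + s (insert i K))"
          using i by (intro bihom_mult al_bihom kd_bihom[OF yk] ins[OF K]) auto
        then show "al i * y (insert i K) \<in> bihom (m - k) (s K)"
          using s_ins[OF i fin[OF K]] k \<open>k < c\<close> by (simp add: Suc_diff_Suc)
      qed
    qed
    ultimately show ?thesis by (simp add: bihom_ideal_eq)
  qed
  with yk show ?thesis unfolding s_def by blast
qed

end

section \<open>Sheaves of cosets on \<open>X\<close>\<close>

text \<open>Germs at different points lie in one common group, so near a point a section is the
  family of cosets of one fixed element F. Points off \<open>Z\<close> are left unconstrained, which
  allows neighbourhoods in projective space.\<close>

definition coset_sections ::
    "nat \<Rightarrow> cpoly set set \<Rightarrow> (cpoly set \<Rightarrow> 'b::ab_group_add set) \<Rightarrow> (cpoly set \<Rightarrow> 'b set)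
      \<Rightarrow> cpoly set set \<Rightarrow> (cpoly set \<Rightarrow> 'b set) set" where
  "coset_sections N Z V H U = {s \<in> extensional U. \<forall>p\<in>U. \<exists>F.
     nearby N p (\<lambda>q. q \<in> Z \<longrightarrow> q \<in> U \<and> F \<in> V q \<and> s q = cs (H q) F)}"

lemma coset_sectionsD:
  "s \<in> coset_sections N Z V H U \<Longrightarrow> p \<in> U \<Longrightarrow>
     \<exists>F. nearby N p (\<lambda>q. q \<in> Z \<longrightarrow> q \<in> U \<and> F \<in> V q \<and> s q = cs (H q) F)"
  "s \<in> coset_sections N Z V H U \<Longrightarrow> s \<in> extensional U"
  by (simp_all add: coset_sections_def)

lemma coset_sectionsI:
  assumes "s \<in> extensional U"
    "\<And>p. p \<in> U \<Longrightarrow> \<exists>F. nearby N p (\<lambda>q. q \<in> Z \<longrightarrow> q \<in> U \<and> F \<in> V q \<and> s q = cs (H q) F)"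
  shows "s \<in> coset_sections N Z V H U"
  using assms by (simp add: coset_sections_def)

lemma nearbyI: "openin (proj_topology N) W \<Longrightarrow> p \<in> W \<Longrightarrow> (\<And>q. q \<in> W \<Longrightarrow> Q q) \<Longrightarrow> nearby N p Q"
  unfolding nearby_def by blast

lemma set_add_plus: "add M = (+) \<Longrightarrow> set_add M = (\<lambda>A B. \<Union>a\<in>A. \<Union>b\<in>B. {a + b})"
  by (simp add: set_add_def set_mult_def fun_eq_iff)

lemma proj_space_simps:
  "space_top (proj_space N) = proj_topology N"
  "str_sections (proj_space N) = locally_constant_sections (proj_topology N) (twist_germs N 0)"
  by (simp_all add: proj_space_def)

lemma nearby_mono2:
  assumes "nearby N p Q" "nearby N p R" "\<And>q. q \<in> proj_points N \<Longrightarrow> Q q \<Longrightarrow> R q \<Longrightarrow> S q"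
  shows "nearby N p S"
  using nearby_conj[OF assms(1,2)] by (rule nearby_mono) (use assms(3) in blast)

context ci
begin

abbreviation "Zl \<equiv> zero_locus N c P"
abbreviation "XX \<equiv> scheme_X N c d P"

lemma Zl_proj: "p \<in> Zl \<Longrightarrow> p \<in> proj_points N"
  by (simp add: zero_locus_def)

lemma ci_point: "p \<in> Zl \<Longrightarrow> ci_point N c d P p"
  by unfold_locales (auto simp: zero_locus_def)

lemma ci_chart: "p \<in> Zl \<Longrightarrow> chart N p r \<Longrightarrow> ci_chart N c d P p r"
  by (simp add: ci_chart_def ci_point)

lemma ex_ci_chart: "p \<in> Zl \<Longrightarrow> \<exists>r. ci_chart N c d P p r"
  using ci_chart proj_point.ex_chart[of N p] Zl_proj by (auto simp: proj_point_def)

lemma top_X: "space_top XX = subtopology (proj_topology N) Zl"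
  by (simp add: scheme_X_def closed_subspace_def proj_space_def)

lemma topspace_X: "topspace (space_top XX) = Zl"
  using Zl_proj by (auto simp: top_X topspace_proj)

lemma openin_X_subset: "openin (space_top XX) U \<Longrightarrow> U \<subseteq> Zl"
  using openin_subset topspace_X by metis

lemma openin_X_nearby:
  assumes "openin (space_top XX) U" "p \<in> U"
  shows "nearby N p (\<lambda>q. q \<in> Zl \<longrightarrow> q \<in> U)"
proof -
  from assms(1) obtain W where "openin (proj_topology N) W" "U = W \<inter> Zl"
    by (auto simp: top_X openin_subtopology)
  with assms(2) show ?thesis by (intro nearbyI[of N W]) auto
qed

lemma nearby_openin_X:
  assumes "nearby N p Q" "p \<in> Zl"
  shows "\<exists>V. openin (space_top XX) V \<and> p \<in> V \<and> (\<forall>q\<in>V. Q q)"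
proof -
  from assms(1) obtain W where "openin (proj_topology N) W" "p \<in> W" "\<forall>q\<in>W. Q q"
    unfolding nearby_def by blast
  with assms(2) show ?thesis
    by (intro exI[of _ "W \<inter> Zl"]) (auto simp: top_X openin_subtopology)
qed

text \<open>A section of a subsheaf of a constant sheaf is locally one element. Conversely, an
  element of \<open>V p\<close> belongs to \<open>V q\<close> for all q near \<open>p\<close>, also
  off X, and so defines a section on an open set of projective space.\<close>

lemma coset_sections_eq:
  assumes U: "U \<subseteq> Zl"
    and V_near: "\<And>p F. p \<in> Zl \<Longrightarrow> F \<in> V p \<Longrightarrow> nearby N p (\<lambda>q. F \<in> V q)"
  shows "{s \<in> extensional U. \<forall>p\<in>U. \<exists>W t. openin (proj_topology N) W \<and> p \<in> W \<and> W \<inter> Zl \<subseteq> U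
      \<and> t \<in> locally_constant_sections (proj_topology N) V W \<and> (\<forall>q\<in>W \<inter> Zl. s q = cs (H q) (t q))}
    = coset_sections N Zl V H U"
  unfolding coset_sections_def
proof (intro Collect_cong conj_cong refl ball_cong)
  fix s :: "cpoly set \<Rightarrow> 'a set" and p assume p: "p \<in> U"
  show "(\<exists>W t. openin (proj_topology N) W \<and> p \<in> W \<and> W \<inter> Zl \<subseteq> U
      \<and> t \<in> locally_constant_sections (proj_topology N) V W \<and> (\<forall>q\<in>W \<inter> Zl. s q = cs (H q) (t q)))
    \<longleftrightarrow> (\<exists>F. nearby N p (\<lambda>q. q \<in> Zl \<longrightarrow> q \<in> U \<and> F \<in> V q \<and> s q = cs (H q) F))" (is "?L \<longleftrightarrow> ?R")
  proof
    assume ?L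
    then obtain W t where W: "openin (proj_topology N) W" "p \<in> W" "W \<inter> Zl \<subseteq> U"
      and t: "t \<in> locally_constant_sections (proj_topology N) V W" and s: "\<And>q. q \<in> W \<inter> Zl \<Longrightarrow> s q = cs (H q) (t q)"
      by blast
    from t have tP: "t \<in> (\<Pi>\<^sub>E p\<in>W. V p)"
      and tl: "\<forall>p\<in>W. \<exists>V x. openin (proj_topology N) V \<and> p \<in> V \<and> V \<subseteq> W \<and> (\<forall>q\<in>V. t q = x)"
      by (simp_all add: locally_constant_sections_def)
    from bspec[OF tl W(2)] obtain V' x where V': "openin (proj_topology N) V'" "p \<in> V'" "V' \<subseteq> W" "\<And>q. q \<in> V' \<Longrightarrow> t q = x"
      by blast
    have "x \<in> V q" if "q \<in> V'" for q
      using PiE_mem[OF tP, of q] V'(3,4) that by auto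
    then have "nearby N p (\<lambda>q. q \<in> Zl \<longrightarrow> q \<in> U \<and> x \<in> V q \<and> s q = cs (H q) x)"
      using V' W s by (intro nearbyI[OF V'(1,2)]) auto
    then show ?R by blast
  next
    assume ?R
    then obtain F where F: "nearby N p (\<lambda>q. q \<in> Zl \<longrightarrow> q \<in> U \<and> F \<in> V q \<and> s q = cs (H q) F)" by blast
    from nearby_at[OF F] p U have "F \<in> V p" "p \<in> Zl" by auto
    from nearby_conj[OF F V_near[OF this(2,1)]]
    obtain W where W: "openin (proj_topology N) W" "p \<in> W"
      "\<And>q. q \<in> W \<Longrightarrow> (q \<in> Zl \<longrightarrow> q \<in> U \<and> F \<in> V q \<and> s q = cs (H q) F) \<and> F \<in> V q"
      unfolding nearby_def by blast
    have "(\<lambda>q\<in>W. F) \<in> locally_constant_sections (proj_topology N) V W"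
      unfolding locally_constant_sections_def using W by auto
    then show ?L
      using W by (intro exI[of _ W] exI[of _ "\<lambda>q\<in>W. F"]) auto
  qed
qed

lemma str_stalk_X: "p \<in> Zl \<Longrightarrow> str_stalk XX p = conc_ring (twist_germs N 0 p) Quot J_germs N c d P 0 p"
proof -
  assume "p \<in> Zl"
  then interpret ci_point N c d P p by (rule ci_point)
  show ?thesis
    by (simp add: scheme_X_def closed_subspace_def str_stalk_proj J_ideal_germs)
qed

lemma twist_near: "p \<in> Zl \<Longrightarrow> x \<in> twist_germs N n p \<Longrightarrow> nearby N p (\<lambda>q. x \<in> twist_germs N n q)"
  using proj_point.germs_nearby[of N p] Zl_proj by (auto simp: proj_point_def)

lemma bihom_near: "p \<in> Zl \<Longrightarrow> F \<in> bihom_germs N m n p \<Longrightarrow> nearby N p (\<lambda>q. F \<in> bihom_germs N m n q)"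
  using proj_point.bihom_nearby[of N p] Zl_proj by (auto simp: proj_point_def)

lemma kd_near: "p \<in> Zl \<Longrightarrow> F \<in> ker_delta N m n p \<Longrightarrow> nearby N p (\<lambda>q. F \<in> ker_delta N m n q)"
  using bihom_near[of p F m n] by (auto simp: ker_delta_def)

lemma H_near:
  assumes "p \<in> Zl" "F \<in> bihom_ideal N c d P m n p"
  shows "nearby N p (\<lambda>q. q \<in> Zl \<longrightarrow> F \<in> bihom_ideal N c d P m n q)"
proof -
  interpret ci_point N c d P p by (rule ci_point) fact
  from H_nearby[OF assms(2)] show ?thesis
  proof (rule nearby_mono)
    fix q assume *: "F \<in> bihom_germs N m n q \<and> (\<forall>t. Poly_Mapping.lookup F t \<in> J_germs N c d P n q)"
    show "q \<in> Zl \<longrightarrow> F \<in> bihom_ideal N c d P m n q"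
      using * ci_point.bihom_ideal_eq[OF ci_point] by blast
  qed
qed

lemma str_sections_X:
  assumes "openin (space_top XX) U"
  shows "str_sections XX U = coset_sections N Zl (twist_germs N 0) (J_germs N c d P 0) U"
proof -
  have U: "U \<subseteq> Zl" using openin_X_subset[OF assms] .
  have eq: "ideal_germs N c d P q +>\<^bsub>str_stalk (proj_space N) q\<^esub> x = cs (J_germs N c d P 0 q) x" for q x
    by (simp add: rcos_plus proj_space_def ideal_germs_def J_germs_def fr_def)
  show ?thesis
    by (rule trans[OF _ coset_sections_eq[OF U twist_near]])
      (simp only: scheme_X_def closed_subspace_def ringed_space.select_convs eq proj_space_simps)
qed

lemma sections_twist:
  assumes "U \<subseteq> Zl"
  shows "sections (restrict_to_X N c d P (twisting_sheaf N n)) U = coset_sections N Zl (twist_germs N n) (J_germs N c d P n) U"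
proof -
  have eq: "ideal_multiple (proj_space N) (ideal_germs N c d P) (twisting_sheaf N n) q +>\<^bsub>stalk (twisting_sheaf N n) q\<^esub> x
     = cs (J_germs N c d P n q) x" if "q \<in> Zl" for q x
    using ci_point.twist_ideal_eq[OF ci_point[OF that], of n] by (simp add: rcos_plus twisting_sheaf_def)
  have ball: "(\<forall>q\<in>W \<inter> Zl. s q = ideal_multiple (proj_space N) (ideal_germs N c d P) (twisting_sheaf N n) q +>\<^bsub>stalk (twisting_sheaf N n) q\<^esub> t q)
     \<longleftrightarrow> (\<forall>q\<in>W \<inter> Zl. s q = cs (J_germs N c d P n q) (t q))" for W s t
    by (intro ball_cong) (auto simp: eq)
  have sec: "sections (twisting_sheaf N n) = locally_constant_sections (proj_topology N) (twist_germs N n)"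
    by (simp add: twisting_sheaf_def)
  show ?thesis
    by (rule trans[OF _ coset_sections_eq[OF assms twist_near]])
      (simp only: restrict_to_X_def restrict_sheaf_def mod_sheaf.select_convs ball proj_space_simps sec)
qed

lemma stalk_twist_X:
  assumes "p \<in> Zl"
  shows "stalk (restrict_to_X N c d P (twisting_sheaf N n)) p = cosmod (twist_germs N n p) (J_germs N c d P n p) (*)"
proof -
  interpret ci_point N c d P p by (rule ci_point) fact
  have 1: "conc_mod (germs n) (*) = stalk (twisting_sheaf N n) p" by (simp add: stalk_twist)
  show ?thesis
    unfolding restrict_to_X_def restrict_sheaf_def cosmod_def
    by (simp add: twist_ideal_eq Let_def stalk_twist rcos_plus A_RCOSETS_def RCOSETS_def set_add_plus)
      (auto simp: r_coset_def cs_def)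
qed

lemma stalk_ker_X:
  assumes "p \<in> Zl"
  shows "stalk (ker_delta_X N c d P m n) p
    = cosmod (ker_delta N m n p) (bihom_ideal N c d P m n p) (\<lambda>a F. cst a * F)"
proof -
  interpret ci_point N c d P p by (rule ci_point) fact
  have "ideal_multiple (proj_space N) (ideal_germs N c d P) (bihom_sheaf N m n) p = H m n"
    by (simp add: bihom_ideal_def)
  then show ?thesis
    unfolding ker_delta_X_def subsheaf_def restrict_to_X_def restrict_sheaf_def cosmod_def
    by (simp add: Let_def stalk_bihom rcos_plus set_add_plus) (auto simp: cs_def)
qed

text \<open>By definition each germ of such a section comes from Ker delta, point by point, while
  the local representative F need not lie there. A kernel element G with the same coset at
  \<open>p\<close> works nearby as well: F - G lies in the ideal multiple at \<open>p\<close>, hence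
  near \<open>p\<close>.\<close>

lemma sections_ker_X:
  assumes "U \<subseteq> Zl"
  shows "sections (ker_delta_X N c d P m n) U
    = coset_sections N Zl (ker_delta N m n) (bihom_ideal N c d P m n) U"
proof -
  have eq: "bihom_ideal N c d P m n q +>\<^bsub>stalk (bihom_sheaf N m n) q\<^esub> x = cs (bihom_ideal N c d P m n q) x" for q x
    by (simp add: rcos_plus bihom_sheaf_def)
  have secs: "sections (restrict_to_X N c d P (bihom_sheaf N m n)) U
     = coset_sections N Zl (bihom_germs N m n) (bihom_ideal N c d P m n) U"
  proof -
    have sec: "sections (bihom_sheaf N m n) = locally_constant_sections (proj_topology N) (bihom_germs N m n)"
      by (simp add: bihom_sheaf_def)
    show ?thesis
      by (rule trans[OF _ coset_sections_eq[OF assms bihom_near]])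
        (simp only: restrict_to_X_def restrict_sheaf_def mod_sheaf.select_convs bihom_ideal_def[symmetric] eq proj_space_simps sec)
  qed
  have "sections (ker_delta_X N c d P m n) U
    = {s \<in> coset_sections N Zl (bihom_germs N m n) (bihom_ideal N c d P m n) U.
        \<forall>p\<in>U. s p \<in> {cs (bihom_ideal N c d P m n p) F |F. F \<in> ker_delta N m n p}}"
    by (simp add: ker_delta_X_def subsheaf_def secs eq)
  also have "\<dots> = coset_sections N Zl (ker_delta N m n) (bihom_ideal N c d P m n) U"
  proof (rule equalityI; rule subsetI)
    fix s assume s: "s \<in> coset_sections N Zl (ker_delta N m n) (bihom_ideal N c d P m n) U"
    have a1: "\<exists>F. nearby N p (\<lambda>q. q \<in> Zl \<longrightarrow> q \<in> U \<and> F \<in> bihom_germs N m n q \<and> s q = cs (bihom_ideal N c d P m n q) F)"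
      and a2: "s p \<in> {cs (bihom_ideal N c d P m n p) F |F. F \<in> ker_delta N m n p}" if p: "p \<in> U" for p
    proof -
      from coset_sectionsD(1)[OF s p] obtain F
        where F: "nearby N p (\<lambda>q. q \<in> Zl \<longrightarrow> q \<in> U \<and> F \<in> ker_delta N m n q \<and> s q = cs (bihom_ideal N c d P m n q) F)" ..
      show "\<exists>F. nearby N p (\<lambda>q. q \<in> Zl \<longrightarrow> q \<in> U \<and> F \<in> bihom_germs N m n q \<and> s q = cs (bihom_ideal N c d P m n q) F)"
        using nearby_mono[OF F] by (intro exI[of _ F]) (auto simp: ker_delta_def)
      show "s p \<in> {cs (bihom_ideal N c d P m n p) F |F. F \<in> ker_delta N m n p}"
        using nearby_at[OF F] p assms by blast
    qed
    show "s \<in> {s \<in> coset_sections N Zl (bihom_germs N m n) (bihom_ideal N c d P m n) U.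
        \<forall>p\<in>U. s p \<in> {cs (bihom_ideal N c d P m n p) F |F. F \<in> ker_delta N m n p}}"
      by (rule CollectI, rule conjI, rule coset_sectionsI, rule coset_sectionsD(2)[OF s], erule a1, rule ballI, erule a2)
  next
    fix s assume "s \<in> {s \<in> coset_sections N Zl (bihom_germs N m n) (bihom_ideal N c d P m n) U.
        \<forall>p\<in>U. s p \<in> {cs (bihom_ideal N c d P m n p) F |F. F \<in> ker_delta N m n p}}"
    then have s: "s \<in> coset_sections N Zl (bihom_germs N m n) (bihom_ideal N c d P m n) U"
      and sk: "\<forall>p\<in>U. s p \<in> {cs (bihom_ideal N c d P m n p) F |F. F \<in> ker_delta N m n p}"
      by simp_all
    have "\<exists>F. nearby N p (\<lambda>q. q \<in> Zl \<longrightarrow> q \<in> U \<and> F \<in> ker_delta N m n q \<and> s q = cs (bihom_ideal N c d P m n q) F)" if pU: "p \<in> U" for p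
    proof -
      have pZ: "p \<in> Zl" using pU assms by blast
      interpret ci_point N c d P p by (rule ci_point) fact
      from coset_sectionsD(1)[OF s pU] obtain F
        where F: "nearby N p (\<lambda>q. q \<in> Zl \<longrightarrow> q \<in> U \<and> F \<in> bihom_germs N m n q \<and> s q = cs (bihom_ideal N c d P m n q) F)" ..
      from bspec[OF sk pU] obtain G where G: "G \<in> kd m n" "s p = cs (H m n) G" by blast
      with nearby_at[OF F] pZ have "cs (H m n) F = cs (H m n) G" by simp
      then have "F - G \<in> H m n" by (simp add: cs_eq_iff[OF addsub_H])
      from nearby_conj[OF H_near[OF pZ this] kd_near[OF pZ G(1)]] F
      have "nearby N p (\<lambda>q. q \<in> Zl \<longrightarrow> q \<in> U \<and> G \<in> ker_delta N m n q \<and> s q = cs (bihom_ideal N c d P m n q) G)"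
      proof (rule nearby_mono2)
        fix q assume 1: "(q \<in> Zl \<longrightarrow> F - G \<in> bihom_ideal N c d P m n q) \<and> G \<in> ker_delta N m n q"
          and 2: "q \<in> Zl \<longrightarrow> q \<in> U \<and> F \<in> bihom_germs N m n q \<and> s q = cs (bihom_ideal N c d P m n q) F"
        show "q \<in> Zl \<longrightarrow> q \<in> U \<and> G \<in> ker_delta N m n q \<and> s q = cs (bihom_ideal N c d P m n q) G"
        proof
          assume q: "q \<in> Zl"
          interpret q: ci_point N c d P q by (rule ci_point) fact
          show "q \<in> U \<and> G \<in> ker_delta N m n q \<and> s q = cs (bihom_ideal N c d P m n q) G"
            using 1 2 q by (simp add: cs_eq_iff[OF q.addsub_H])
        qed
      qed
      then show ?thesis by blast
    qed
    then show "s \<in> coset_sections N Zl (ker_delta N m n) (bihom_ideal N c d P m n) U"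
      using coset_sectionsD(2)[OF s] by (intro coset_sectionsI)
  qed
  finally show ?thesis .
qed

lemma coset_module_ker:
  assumes "p \<in> Zl"
  shows "coset_module (twist_germs N 0 p) (J_germs N c d P 0 p) (ker_delta N m n p) (bihom_ideal N c d P m n p) (\<lambda>a F. cst a * F)"
proof -
  interpret ci_point N c d P p by (rule ci_point) fact
  show ?thesis
  proof unfold_locales
    show "cst a * x \<in> kd m n" if "a \<in> germs 0" "x \<in> kd m n" for a x
      using kd_cst_mult[OF that] by simp
    show "cst a * x \<in> H m n" if "a \<in> germs 0" "x \<in> H m n" for a x
      using H_mult[OF bihom_cst[OF that(1)] that(2)] by simp
    show "cst a * x \<in> H m n" if "a \<in> J 0" "x \<in> kd m n" for a x
      using H_mult_right[OF H_cst[OF that(1)] kd_bihom[OF that(2)]] by simp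
  qed (auto simp: addsub_kd addsub_H single_add cst_mult algebra_simps)
qed

text \<open>The sheaf axioms rest on two openness conditions: that of \<open>V\<close> extends germs
  to sections, and that of \<open>H\<close> makes two sections with the same germ at a point agree
  nearby.\<close>

lemma sheaf_of_modules_cosets:
  fixes V H :: "cpoly set \<Rightarrow> 'b::ab_group_add set" and sm :: "ratfun \<Rightarrow> 'b \<Rightarrow> 'b"
  assumes cm: "\<And>p. p \<in> Zl \<Longrightarrow> coset_module (twist_germs N 0 p) (J_germs N c d P 0 p) (V p) (H p) sm"
    and V_near: "\<And>p F. p \<in> Zl \<Longrightarrow> F \<in> V p \<Longrightarrow> nearby N p (\<lambda>q. F \<in> V q)"
    and H_near: "\<And>p F. p \<in> Zl \<Longrightarrow> F \<in> H p \<Longrightarrow> nearby N p (\<lambda>q. q \<in> Zl \<longrightarrow> F \<in> H q)"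
    and stalk: "\<And>p. p \<in> Zl \<Longrightarrow> stalk M p = cosmod (V p) (H p) sm"
    and secs: "\<And>U. openin (space_top XX) U \<Longrightarrow> sections M U = coset_sections N Zl V H U"
  shows "sheaf_of_modules XX M"
proof -
  note Hs = coset_module.H(1)[OF cm] and Vs = coset_module.V(1)[OF cm]
  have sec_nearby: "\<exists>F. nearby N p (\<lambda>q. q \<in> Zl \<longrightarrow> q \<in> U \<and> F \<in> V q \<and> s q = cs (H q) F)"
    if "openin (space_top XX) U" "s \<in> sections M U" "p \<in> U" for s U p
    using coset_sectionsD(1)[OF that(2)[unfolded secs[OF that(1)]] that(3)] .
  have secI: "s \<in> sections M U" if "openin (space_top XX) U" "s \<in> extensional U"
    "\<And>p. p \<in> U \<Longrightarrow> \<exists>F. nearby N p (\<lambda>q. q \<in> Zl \<longrightarrow> q \<in> U \<and> F \<in> V q \<and> s q = cs (H q) F)" for s U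
    unfolding secs[OF that(1)] by (intro coset_sectionsI that(2,3))
  show ?thesis
    unfolding sheaf_of_modules_def topspace_X
  proof (intro conjI ballI allI impI)
    fix p assume p: "p \<in> Zl"
    show "Module.module (str_stalk XX p) (stalk M p)"
      using coset_module.module_Q[OF cm[OF p]] by (simp add: stalk[OF p] str_stalk_X[OF p])
    fix x assume "x \<in> carrier (stalk M p)"
    then obtain F where F: "F \<in> V p" "x = cs (H p) F" using stalk[OF p] by auto
    from nearby_openin_X[OF V_near[OF p F(1)] p]
    obtain U where U: "openin (space_top XX) U" "p \<in> U" "\<And>q. q \<in> U \<Longrightarrow> F \<in> V q"
      by blast
    have "(\<lambda>q\<in>U. cs (H q) F) \<in> sections M U"
    proof (rule secI[OF U(1)])
      fix q assume q: "q \<in> U"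
      show "\<exists>F'. nearby N q (\<lambda>q. q \<in> Zl \<longrightarrow> q \<in> U \<and> F' \<in> V q \<and> (\<lambda>q\<in>U. cs (H q) F) q = cs (H q) F')"
        by (rule exI[of _ F], rule nearby_mono[OF openin_X_nearby[OF U(1) q]]) (use U(3) in auto)
    qed simp
    then show "\<exists>U s. openin (space_top XX) U \<and> p \<in> U \<and> s \<in> sections M U \<and> s p = x"
      using U F by (intro exI[of _ U] exI[of _ "\<lambda>q\<in>U. cs (H q) F"]) auto
  next
    fix U assume U: "openin (space_top XX) U"
    note UZ = openin_X_subset[OF U, THEN subsetD]
    show "sections M U \<subseteq> (\<Pi>\<^sub>E p\<in>U. carrier (stalk M p))"
    proof (rule subsetI, rule PiE_I)
      fix s p assume s: "s \<in> sections M U" and p: "p \<in> U"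
      from sec_nearby[OF U s p] show "s p \<in> carrier (stalk M p)"
        using UZ[OF p] p by (auto simp: stalk dest: nearby_at)
    next
      fix s p assume "s \<in> sections M U" "p \<notin> U"
      then show "s p = undefined" using U by (auto simp: secs coset_sections_def extensional_def)
    qed
    show "(\<lambda>p\<in>U. \<zero>\<^bsub>stalk M p\<^esub>) \<in> sections M U"
    proof (rule secI[OF U])
      fix p assume p: "p \<in> U"
      have z0: "0 \<in> V q" if "q \<in> Zl" for q using addsubD(1)[OF Vs[OF that]] .
      show "\<exists>F. nearby N p (\<lambda>q. q \<in> Zl \<longrightarrow> q \<in> U \<and> F \<in> V q \<and> (\<lambda>p\<in>U. \<zero>\<^bsub>stalk M p\<^esub>) q = cs (H q) F)"
        by (rule exI[of _ 0], rule nearby_mono[OF openin_X_nearby[OF U p]]) (auto simp: stalk z0)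
    qed simp
    fix s assume s: "s \<in> sections M U"
    {
      fix t assume t: "t \<in> sections M U"
      show "(\<lambda>p\<in>U. s p \<oplus>\<^bsub>stalk M p\<^esub> t p) \<in> sections M U"
      proof (rule secI[OF U])
        fix p assume p: "p \<in> U"
        from sec_nearby[OF U s p] sec_nearby[OF U t p] obtain F G
          where "nearby N p (\<lambda>q. q \<in> Zl \<longrightarrow> q \<in> U \<and> F \<in> V q \<and> s q = cs (H q) F)"
            "nearby N p (\<lambda>q. q \<in> Zl \<longrightarrow> q \<in> U \<and> G \<in> V q \<and> t q = cs (H q) G)" by blast
        then have "nearby N p (\<lambda>q. q \<in> Zl \<longrightarrow> q \<in> U \<and> F + G \<in> V q \<and> (\<lambda>p\<in>U. s p \<oplus>\<^bsub>stalk M p\<^esub> t p) q = cs (H q) (F + G))"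
          by (rule nearby_mono2) (auto simp: stalk cosmod_add[OF Hs] addsubD[OF Vs])
        then show "\<exists>F. nearby N p (\<lambda>q. q \<in> Zl \<longrightarrow> q \<in> U \<and> F \<in> V q \<and> (\<lambda>p\<in>U. s p \<oplus>\<^bsub>stalk M p\<^esub> t p) q = cs (H q) F)" ..
      qed simp
      fix p assume p: "p \<in> U" and eq: "s p = t p"
      have pZ: "p \<in> Zl" using UZ p .
      from sec_nearby[OF U s p] sec_nearby[OF U t p] obtain F G
        where FG: "nearby N p (\<lambda>q. q \<in> Zl \<longrightarrow> q \<in> U \<and> F \<in> V q \<and> s q = cs (H q) F)"
          "nearby N p (\<lambda>q. q \<in> Zl \<longrightarrow> q \<in> U \<and> G \<in> V q \<and> t q = cs (H q) G)" by blast
      from FG[THEN nearby_at] eq pZ have "cs (H p) F = cs (H p) G" by simp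
      then have "F - G \<in> H p" by (simp add: cs_eq_iff[OF Hs[OF pZ]])
      from nearby_conj[OF H_near[OF pZ this] FG(1)] FG(2)
      have "nearby N p (\<lambda>q. q \<in> Zl \<longrightarrow> q \<in> U \<and> s q = t q)"
        by (rule nearby_mono2) (auto simp: cs_eq_iff[OF Hs])
      from nearby_openin_X[OF this pZ]
      obtain W where "openin (space_top XX) W" "p \<in> W" "\<And>q. q \<in> W \<Longrightarrow> q \<in> Zl \<longrightarrow> q \<in> U \<and> s q = t q"
        by blast
      then show "\<exists>V. openin (space_top XX) V \<and> p \<in> V \<and> V \<subseteq> U \<and> (\<forall>q\<in>V. s q = t q)"
        using openin_X_subset by (intro exI[of _ W]) blast
    }
    {
      fix a assume a: "a \<in> str_sections XX U"
      show "(\<lambda>p\<in>U. a p \<odot>\<^bsub>stalk M p\<^esub> s p) \<in> sections M U"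
      proof (rule secI[OF U])
        fix p assume p: "p \<in> U"
        from coset_sectionsD(1)[OF a[unfolded str_sections_X[OF U]] p] obtain b
          where b: "nearby N p (\<lambda>q. q \<in> Zl \<longrightarrow> q \<in> U \<and> b \<in> twist_germs N 0 q \<and> a q = cs (J_germs N c d P 0 q) b)" ..
        from sec_nearby[OF U s p] obtain F
          where "nearby N p (\<lambda>q. q \<in> Zl \<longrightarrow> q \<in> U \<and> F \<in> V q \<and> s q = cs (H q) F)" by blast
        with b have "nearby N p (\<lambda>q. q \<in> Zl \<longrightarrow> q \<in> U \<and> sm b F \<in> V q \<and> (\<lambda>p\<in>U. a p \<odot>\<^bsub>stalk M p\<^esub> s p) q = cs (H q) (sm b F))"
          by (rule nearby_mono2) (auto simp: stalk coset_module.smult_cs[OF cm] coset_module.V(2)[OF cm])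
        then show "\<exists>F. nearby N p (\<lambda>q. q \<in> Zl \<longrightarrow> q \<in> U \<and> F \<in> V q \<and> (\<lambda>p\<in>U. a p \<odot>\<^bsub>stalk M p\<^esub> s p) q = cs (H q) F)" ..
      qed simp
    }
    {
      fix W assume W: "openin (space_top XX) W \<and> W \<subseteq> U"
      show "restrict s W \<in> sections M W"
      proof (rule secI)
        show "openin (space_top XX) W" using W by blast
        fix p assume p: "p \<in> W"
        with W have "p \<in> U" by blast
        from sec_nearby[OF U s this] obtain F
          where F: "nearby N p (\<lambda>q. q \<in> Zl \<longrightarrow> q \<in> U \<and> F \<in> V q \<and> s q = cs (H q) F)" by blast
        have "nearby N p (\<lambda>q. q \<in> Zl \<longrightarrow> q \<in> W \<and> F \<in> V q \<and> restrict s W q = cs (H q) F)"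
          using F openin_X_nearby[OF conjunct1[OF W] p] by (rule nearby_mono2) auto
        then show "\<exists>F. nearby N p (\<lambda>q. q \<in> Zl \<longrightarrow> q \<in> W \<and> F \<in> V q \<and> restrict s W q = cs (H q) F)" ..
      qed simp
    }
  next
    fix U s assume U: "openin (space_top XX) U" and s: "s \<in> extensional U"
      and loc: "\<forall>p\<in>U. \<exists>V. openin (space_top XX) V \<and> p \<in> V \<and> V \<subseteq> U \<and> restrict s V \<in> sections M V"
    show "s \<in> sections M U"
    proof (rule secI[OF U s])
      fix p assume p: "p \<in> U"
      with loc obtain W where W: "openin (space_top XX) W" "p \<in> W" "W \<subseteq> U" "restrict s W \<in> sections M W" by blast
      from sec_nearby[OF W(1,4,2)] obtain F
        where F: "nearby N p (\<lambda>q. q \<in> Zl \<longrightarrow> q \<in> W \<and> F \<in> V q \<and> restrict s W q = cs (H q) F)" by blast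
      then have "nearby N p (\<lambda>q. q \<in> Zl \<longrightarrow> q \<in> U \<and> F \<in> V q \<and> s q = cs (H q) F)"
        by (rule nearby_mono) (use W(3) in auto)
      then show "\<exists>F. nearby N p (\<lambda>q. q \<in> Zl \<longrightarrow> q \<in> U \<and> F \<in> V q \<and> s q = cs (H q) F)" ..
    qed
  qed
qed

lemma sheaf_ker_X: "sheaf_of_modules XX (ker_delta_X N c d P m n)"
  by (rule sheaf_of_modules_cosets[OF coset_module_ker kd_near H_near stalk_ker_X sections_ker_X[OF openin_X_subset]])

end

section \<open>Local frames and direct sums\<close>

text \<open>Frames with an arbitrary index set, since the bases below are indexed by monomials and
  by pairs of a set and a monomial; \<open>locally_freeI\<close> renumbers them.\<close>

definition frame_on :: "('p, 'o) ringed_space \<Rightarrow> ('p, 'o, 'b) mod_sheaf \<Rightarrow> 'p set \<Rightarrow> 't set \<Rightarrow> ('t \<Rightarrow> 'p \<Rightarrow> 'b) \<Rightarrow> bool" where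
  "frame_on X M U T e \<longleftrightarrow> (\<forall>t\<in>T. e t \<in> sections M U)
     \<and> (\<forall>q\<in>U. \<forall>x\<in>carrier (stalk M q). \<exists>!a. a \<in> (\<Pi>\<^sub>E t\<in>T. carrier (str_stalk X q))
          \<and> x = (\<Oplus>\<^bsub>stalk M q\<^esub>t\<in>T. a t \<odot>\<^bsub>stalk M q\<^esub> e t q))"

lemma frame_onD:
  assumes "frame_on X M U T e"
  shows "t \<in> T \<Longrightarrow> e t \<in> sections M U"
    and "q \<in> U \<Longrightarrow> x \<in> carrier (stalk M q) \<Longrightarrow> \<exists>!a. a \<in> (\<Pi>\<^sub>E t\<in>T. carrier (str_stalk X q))
          \<and> x = (\<Oplus>\<^bsub>stalk M q\<^esub>t\<in>T. a t \<odot>\<^bsub>stalk M q\<^esub> e t q)"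
  using assms by (simp_all add: frame_on_def)

lemma sheaf_of_modulesD:
  assumes "sheaf_of_modules X M"
  shows "p \<in> topspace (space_top X) \<Longrightarrow> Module.module (str_stalk X p) (stalk M p)"
    and "openin (space_top X) U \<Longrightarrow> s \<in> sections M U \<Longrightarrow> s \<in> (\<Pi>\<^sub>E p\<in>U. carrier (stalk M p))"
    and "openin (space_top X) U \<Longrightarrow> (\<lambda>p\<in>U. \<zero>\<^bsub>stalk M p\<^esub>) \<in> sections M U"
    and "openin (space_top X) U \<Longrightarrow> s \<in> sections M U \<Longrightarrow> t \<in> sections M U \<Longrightarrow> (\<lambda>p\<in>U. s p \<oplus>\<^bsub>stalk M p\<^esub> t p) \<in> sections M U"
    and "openin (space_top X) U \<Longrightarrow> a \<in> str_sections X U \<Longrightarrow> s \<in> sections M U \<Longrightarrow> (\<lambda>p\<in>U. a p \<odot>\<^bsub>stalk M p\<^esub> s p) \<in> sections M U"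
    and "openin (space_top X) U \<Longrightarrow> s \<in> sections M U \<Longrightarrow> openin (space_top X) V \<Longrightarrow> V \<subseteq> U \<Longrightarrow> restrict s V \<in> sections M V"
    and "openin (space_top X) U \<Longrightarrow> s \<in> extensional U \<Longrightarrow>
      (\<And>p. p \<in> U \<Longrightarrow> \<exists>V. openin (space_top X) V \<and> p \<in> V \<and> V \<subseteq> U \<and> restrict s V \<in> sections M V) \<Longrightarrow> s \<in> sections M U"
    and "openin (space_top X) U \<Longrightarrow> s \<in> sections M U \<Longrightarrow> t \<in> sections M U \<Longrightarrow> p \<in> U \<Longrightarrow> s p = t p \<Longrightarrow>
      \<exists>V. openin (space_top X) V \<and> p \<in> V \<and> V \<subseteq> U \<and> (\<forall>q\<in>V. s q = t q)"
    and "p \<in> topspace (space_top X) \<Longrightarrow> x \<in> carrier (stalk M p) \<Longrightarrow>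
      \<exists>U s. openin (space_top X) U \<and> p \<in> U \<and> s \<in> sections M U \<and> s p = x"
  using assms unfolding sheaf_of_modules_def by (simp_all add: subset_iff)

lemma locally_freeI:
  fixes M :: "('p, 'o, 'b) mod_sheaf"
  assumes sh: "sheaf_of_modules X M"
    and fr: "\<And>p. p \<in> topspace (space_top X) \<Longrightarrow> \<exists>U (T :: 't set) e. finite T \<and> openin (space_top X) U \<and> p \<in> U \<and> frame_on X M U T e"
  shows "locally_free X M"
  unfolding locally_free_def
proof (intro conjI sh ballI)
  fix p assume "p \<in> topspace (space_top X)"
  from fr[OF this] obtain U and T :: "'t set" and e where T: "finite T" and U: "openin (space_top X) U" "p \<in> U"
    and fr: "frame_on X M U T e"
    by blast
  note e = frame_onD(1)[OF fr] and ex1 = frame_onD(2)[OF fr]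
  obtain h where "bij_betw h {0..<card T} T" using ex_bij_betw_nat_finite[OF T] ..
  then have h: "bij_betw h {..<card T} T" by (simp add: lessThan_atLeast0)
  then have hT: "h j \<in> T" if "j < card T" for j using that by (auto simp: bij_betw_def)
  have inj: "inj_on h {..<card T}" and img: "h ` {..<card T} = T" using h by (auto simp: bij_betw_def)
  show "\<exists>U (r::nat) e. openin (space_top X) U \<and> p \<in> U \<and> (\<forall>j<r. e j \<in> sections M U)
      \<and> (\<forall>q\<in>U. \<forall>x\<in>carrier (stalk M q). \<exists>!a. a \<in> (\<Pi>\<^sub>E j\<in>{..<r}. carrier (str_stalk X q))
              \<and> x = (\<Oplus>\<^bsub>stalk M q\<^esub>j\<in>{..<r}. a j \<odot>\<^bsub>stalk M q\<^esub> e j q))"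
  proof (intro exI[of _ U] exI[of _ "card T"] exI[of _ "\<lambda>j. e (h j)"] conjI U allI impI ballI)
    show "e (h j) \<in> sections M U" if "j < card T" for j using e hT[OF that] .
    fix q x assume q: "q \<in> U" and x: "x \<in> carrier (stalk M q)"
    have "q \<in> topspace (space_top X)" using openin_subset[OF U(1)] q by blast
    then interpret Module.module "str_stalk X q" "stalk M q" by (rule sheaf_of_modulesD(1)[OF sh])
    have eq: "e t q \<in> carrier (stalk M q)" if "t \<in> T" for t
      using PiE_mem[OF sheaf_of_modulesD(2)[OF sh U(1) e[OF that]] q] .
    have reindex: "(\<Oplus>\<^bsub>stalk M q\<^esub>j\<in>{..<card T}. a (h j) \<odot>\<^bsub>stalk M q\<^esub> e (h j) q) = (\<Oplus>\<^bsub>stalk M q\<^esub>t\<in>T. a t \<odot>\<^bsub>stalk M q\<^esub> e t q)"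
      if "\<And>t. t \<in> T \<Longrightarrow> a t \<in> carrier (str_stalk X q)" for a
      using M.finsum_reindex[of "\<lambda>t. a t \<odot>\<^bsub>stalk M q\<^esub> e t q" h "{..<card T}"] inj that eq by (auto simp: img)
    from ex1[OF q x] obtain a where a: "a \<in> (\<Pi>\<^sub>E t\<in>T. carrier (str_stalk X q))"
      "x = (\<Oplus>\<^bsub>stalk M q\<^esub>t\<in>T. a t \<odot>\<^bsub>stalk M q\<^esub> e t q)" by blast
    show "\<exists>!a. a \<in> (\<Pi>\<^sub>E j\<in>{..<card T}. carrier (str_stalk X q))
              \<and> x = (\<Oplus>\<^bsub>stalk M q\<^esub>j\<in>{..<card T}. a j \<odot>\<^bsub>stalk M q\<^esub> e (h j) q)"
    proof (rule ex1I[of _ "\<lambda>j\<in>{..<card T}. a (h j)"])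
      have "(\<Oplus>\<^bsub>stalk M q\<^esub>j\<in>{..<card T}. (\<lambda>j\<in>{..<card T}. a (h j)) j \<odot>\<^bsub>stalk M q\<^esub> e (h j) q)
         = (\<Oplus>\<^bsub>stalk M q\<^esub>j\<in>{..<card T}. a (h j) \<odot>\<^bsub>stalk M q\<^esub> e (h j) q)"
        using a(1) hT eq by (intro M.finsum_cong') auto
      also have "\<dots> = x" using reindex[of a] a by auto
      finally show "(\<lambda>j\<in>{..<card T}. a (h j)) \<in> (\<Pi>\<^sub>E j\<in>{..<card T}. carrier (str_stalk X q))
         \<and> x = (\<Oplus>\<^bsub>stalk M q\<^esub>j\<in>{..<card T}. (\<lambda>j\<in>{..<card T}. a (h j)) j \<odot>\<^bsub>stalk M q\<^esub> e (h j) q)"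
        using a(1) hT by auto
      fix b assume b: "b \<in> (\<Pi>\<^sub>E j\<in>{..<card T}. carrier (str_stalk X q))
         \<and> x = (\<Oplus>\<^bsub>stalk M q\<^esub>j\<in>{..<card T}. b j \<odot>\<^bsub>stalk M q\<^esub> e (h j) q)"
      define g where "g = inv_into {..<card T} h"
      have gh: "g (h j) = j" if "j < card T" for j
        unfolding g_def using inj that by (simp add: inv_into_f_f)
      have gT: "g t < card T" if "t \<in> T" for t
        using inv_into_into[of t h "{..<card T}"] that img by (simp add: g_def)
      let ?a = "\<lambda>t\<in>T. b (g t)"
      have bc: "b j \<in> carrier (str_stalk X q)" if "j < card T" for j using b that by blast
      have aP: "?a \<in> (\<Pi>\<^sub>E t\<in>T. carrier (str_stalk X q))" using bc gT by auto
      have "(\<Oplus>\<^bsub>stalk M q\<^esub>t\<in>T. ?a t \<odot>\<^bsub>stalk M q\<^esub> e t q) = (\<Oplus>\<^bsub>stalk M q\<^esub>j\<in>{..<card T}. ?a (h j) \<odot>\<^bsub>stalk M q\<^esub> e (h j) q)"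
        using aP by (intro reindex[symmetric]) auto
      also have "\<dots> = (\<Oplus>\<^bsub>stalk M q\<^esub>j\<in>{..<card T}. b j \<odot>\<^bsub>stalk M q\<^esub> e (h j) q)"
        using bc hT gh eq by (intro M.finsum_cong') auto
      finally have "?a = a" using ex1[OF q x] a aP b by metis
      then have "b j = a (h j)" if "j < card T" for j
        using hT[OF that] gh[OF that] by (auto simp del: restrict_apply simp: restrict_apply')
      then show "b = (\<lambda>j\<in>{..<card T}. a (h j))"
        using b by (intro extensionalityI[of _ "{..<card T}"]) (auto simp: PiE_def)
    qed
  qed
qed

section \<open>Finite direct sums of modules and of sheaves\<close>

definition dsum :: "'i set \<Rightarrow> ('i \<Rightarrow> ('a, 'b) module) \<Rightarrow> ('a, 'i \<Rightarrow> 'b) module" where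
  "dsum A N = \<lparr>carrier = (\<Pi>\<^sub>E I\<in>A. carrier (N I)), monoid.mult = undefined, one = undefined,
     zero = (\<lambda>I\<in>A. \<zero>\<^bsub>N I\<^esub>), add = (\<lambda>x y. \<lambda>I\<in>A. x I \<oplus>\<^bsub>N I\<^esub> y I),
     smult = (\<lambda>a x. \<lambda>I\<in>A. a \<odot>\<^bsub>N I\<^esub> x I)\<rparr>"

lemma dsum_simps [simp]:
  "carrier (dsum A N) = (\<Pi>\<^sub>E I\<in>A. carrier (N I))" "\<zero>\<^bsub>dsum A N\<^esub> = (\<lambda>I\<in>A. \<zero>\<^bsub>N I\<^esub>)"
  "x \<oplus>\<^bsub>dsum A N\<^esub> y = (\<lambda>I\<in>A. x I \<oplus>\<^bsub>N I\<^esub> y I)" "a \<odot>\<^bsub>dsum A N\<^esub> x = (\<lambda>I\<in>A. a \<odot>\<^bsub>N I\<^esub> x I)"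
  by (simp_all add: dsum_def)

lemma stalk_direct_sum: "stalk (direct_sum_sheaf A M) p = dsum A (\<lambda>I. stalk (M I) p)"
  by (simp add: direct_sum_sheaf_def dsum_def)

lemma sections_direct_sum:
  "sections (direct_sum_sheaf A M) U = {s \<in> (\<Pi>\<^sub>E p\<in>U. carrier (stalk (direct_sum_sheaf A M) p)).
     \<forall>I\<in>A. (\<lambda>p\<in>U. s p I) \<in> sections (M I) U}"
  by (simp add: direct_sum_sheaf_def)

lemma module_dsum:
  assumes "cring R" and N: "\<And>I. I \<in> A \<Longrightarrow> Module.module R (N I)"
  shows "Module.module R (dsum A N)"
proof (rule moduleI)
  note mods = module.axioms(2)[OF N]
  note ag = abelian_group.axioms(1)[OF mods, THEN abelian_monoid.a_closed]
  have add: "x I \<oplus>\<^bsub>N I\<^esub> y I \<in> carrier (N I)" if "x \<in> carrier (dsum A N)" "y \<in> carrier (dsum A N)" "I \<in> A" for x y I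
  proof -
    interpret Module.module R "N I" by (rule N[OF that(3)])
    show ?thesis using that by (intro M.a_closed) auto
  qed
  show "abelian_group (dsum A N)"
  proof (rule abelian_groupI)
    fix x y z assume x: "x \<in> carrier (dsum A N)" and y: "y \<in> carrier (dsum A N)" and z: "z \<in> carrier (dsum A N)"
    show "x \<oplus>\<^bsub>dsum A N\<^esub> y \<in> carrier (dsum A N)" using add x y by auto
    show "x \<oplus>\<^bsub>dsum A N\<^esub> y \<oplus>\<^bsub>dsum A N\<^esub> z = x \<oplus>\<^bsub>dsum A N\<^esub> (y \<oplus>\<^bsub>dsum A N\<^esub> z)"
    proof -
      have "x I \<oplus>\<^bsub>N I\<^esub> y I \<oplus>\<^bsub>N I\<^esub> z I = x I \<oplus>\<^bsub>N I\<^esub> (y I \<oplus>\<^bsub>N I\<^esub> z I)" if "I \<in> A" for I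
      proof -
        interpret Module.module R "N I" by (rule N[OF that])
        show ?thesis using x y z that by (intro M.a_assoc) auto
      qed
      then show ?thesis by (auto intro!: restrict_ext)
    qed
    show "x \<oplus>\<^bsub>dsum A N\<^esub> y = y \<oplus>\<^bsub>dsum A N\<^esub> x"
    proof -
      have "x I \<oplus>\<^bsub>N I\<^esub> y I = y I \<oplus>\<^bsub>N I\<^esub> x I" if "I \<in> A" for I
      proof -
        interpret Module.module R "N I" by (rule N[OF that])
        show ?thesis using x y that by (intro M.a_comm) auto
      qed
      then show ?thesis by (auto intro!: restrict_ext)
    qed
  next
    have "\<zero>\<^bsub>N I\<^esub> \<in> carrier (N I)" if "I \<in> A" for I
    proof -
      interpret Module.module R "N I" by (rule N[OF that])
      show ?thesis by simp
    qed
    then show "\<zero>\<^bsub>dsum A N\<^esub> \<in> carrier (dsum A N)" by auto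
    fix x assume x: "x \<in> carrier (dsum A N)"
    have z: "\<zero>\<^bsub>N I\<^esub> \<oplus>\<^bsub>N I\<^esub> x I = x I" "\<ominus>\<^bsub>N I\<^esub> x I \<oplus>\<^bsub>N I\<^esub> x I = \<zero>\<^bsub>N I\<^esub>" "\<ominus>\<^bsub>N I\<^esub> x I \<in> carrier (N I)" if "I \<in> A" for I
    proof -
      interpret Module.module R "N I" by (rule N[OF that])
      have "x I \<in> carrier (N I)" using x that by auto
      then show "\<zero>\<^bsub>N I\<^esub> \<oplus>\<^bsub>N I\<^esub> x I = x I" "\<ominus>\<^bsub>N I\<^esub> x I \<oplus>\<^bsub>N I\<^esub> x I = \<zero>\<^bsub>N I\<^esub>" "\<ominus>\<^bsub>N I\<^esub> x I \<in> carrier (N I)"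
        by (simp_all add: M.l_neg)
    qed
    show "\<zero>\<^bsub>dsum A N\<^esub> \<oplus>\<^bsub>dsum A N\<^esub> x = x"
      using x z(1) by (intro extensionalityI[of _ A]) (auto simp: PiE_def)
    show "\<exists>y\<in>carrier (dsum A N). y \<oplus>\<^bsub>dsum A N\<^esub> x = \<zero>\<^bsub>dsum A N\<^esub>"
      using z by (intro bexI[of _ "\<lambda>I\<in>A. \<ominus>\<^bsub>N I\<^esub> x I"]) (auto intro!: restrict_ext)
  qed
  fix a b x y assume a: "a \<in> carrier R" and b: "b \<in> carrier R" and x: "x \<in> carrier (dsum A N)" and y: "y \<in> carrier (dsum A N)"
  have "a \<odot>\<^bsub>N I\<^esub> x I \<in> carrier (N I)
      \<and> (a \<oplus>\<^bsub>R\<^esub> b) \<odot>\<^bsub>N I\<^esub> x I = a \<odot>\<^bsub>N I\<^esub> x I \<oplus>\<^bsub>N I\<^esub> b \<odot>\<^bsub>N I\<^esub> x I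
      \<and> a \<odot>\<^bsub>N I\<^esub> (x I \<oplus>\<^bsub>N I\<^esub> y I) = a \<odot>\<^bsub>N I\<^esub> x I \<oplus>\<^bsub>N I\<^esub> a \<odot>\<^bsub>N I\<^esub> y I
      \<and> (a \<otimes>\<^bsub>R\<^esub> b) \<odot>\<^bsub>N I\<^esub> x I = a \<odot>\<^bsub>N I\<^esub> (b \<odot>\<^bsub>N I\<^esub> x I)" if "I \<in> A" for I
  proof -
    interpret Module.module R "N I" by (rule N[OF that])
    have "x I \<in> carrier (N I)" "y I \<in> carrier (N I)" using x y that by auto
    with a b show ?thesis by (simp add: smult_l_distr smult_r_distr smult_assoc1)
  qed
  then show "a \<odot>\<^bsub>dsum A N\<^esub> x \<in> carrier (dsum A N)"
    "(a \<oplus>\<^bsub>R\<^esub> b) \<odot>\<^bsub>dsum A N\<^esub> x = a \<odot>\<^bsub>dsum A N\<^esub> x \<oplus>\<^bsub>dsum A N\<^esub> b \<odot>\<^bsub>dsum A N\<^esub> x"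
    "a \<odot>\<^bsub>dsum A N\<^esub> (x \<oplus>\<^bsub>dsum A N\<^esub> y) = a \<odot>\<^bsub>dsum A N\<^esub> x \<oplus>\<^bsub>dsum A N\<^esub> a \<odot>\<^bsub>dsum A N\<^esub> y"
    "(a \<otimes>\<^bsub>R\<^esub> b) \<odot>\<^bsub>dsum A N\<^esub> x = a \<odot>\<^bsub>dsum A N\<^esub> (b \<odot>\<^bsub>dsum A N\<^esub> x)"
    by (auto intro!: restrict_ext)
next
  fix x assume x: "x \<in> carrier (dsum A N)"
  have "\<one>\<^bsub>R\<^esub> \<odot>\<^bsub>N I\<^esub> x I = x I" if "I \<in> A" for I
  proof -
    interpret Module.module R "N I" by (rule N[OF that])
    have "x I \<in> carrier (N I)" using x that by auto
    then show ?thesis by simp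
  qed
  then show "\<one>\<^bsub>R\<^esub> \<odot>\<^bsub>dsum A N\<^esub> x = x"
    using x by (intro extensionalityI[of _ A]) (auto simp: PiE_def)
qed (rule assms(1))

lemma finsum_dsum:
  assumes "cring R" and N: "\<And>I. I \<in> A \<Longrightarrow> Module.module R (N I)" and "finite T"
    and f: "\<And>t. t \<in> T \<Longrightarrow> f t \<in> carrier (dsum A N)" and I: "I \<in> A"
  shows "(\<Oplus>\<^bsub>dsum A N\<^esub>t\<in>T. f t) I = (\<Oplus>\<^bsub>N I\<^esub>t\<in>T. f t I)"
  using assms(3) f
proof (induction T)
  interpret Module.module R "dsum A N" by (rule module_dsum[OF assms(1) N])
  interpret NI: Module.module R "N I" by (rule N[OF I])
  {
    case empty
    then show ?case using I by simp
  next
    case (insert t T)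
    have "(\<Oplus>\<^bsub>dsum A N\<^esub>t\<in>insert t T. f t) = f t \<oplus>\<^bsub>dsum A N\<^esub> (\<Oplus>\<^bsub>dsum A N\<^esub>t\<in>T. f t)"
      using insert by (intro M.finsum_insert) auto
    moreover have "(\<Oplus>\<^bsub>N I\<^esub>t\<in>insert t T. f t I) = f t I \<oplus>\<^bsub>N I\<^esub> (\<Oplus>\<^bsub>N I\<^esub>t\<in>T. f t I)"
      using insert I by (intro NI.M.finsum_insert) (auto simp: PiE_def Pi_def)
    ultimately show ?case using insert I by simp
  }
qed

text \<open>Finitely many local properties that pass to smaller neighbourhoods hold on a common one.
  Finiteness of the direct sum enters here.\<close>

lemma openin_finite_Inter:
  assumes "finite A" "openin X U" "p \<in> U" "\<And>I. I \<in> A \<Longrightarrow> \<exists>V. openin X V \<and> p \<in> V \<and> V \<subseteq> U \<and> Q I V"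
    and mono: "\<And>I V W. I \<in> A \<Longrightarrow> openin X W \<Longrightarrow> openin X V \<Longrightarrow> W \<subseteq> V \<Longrightarrow> p \<in> W \<Longrightarrow> Q I V \<Longrightarrow> Q I W"
  shows "\<exists>V. openin X V \<and> p \<in> V \<and> V \<subseteq> U \<and> (\<forall>I\<in>A. Q I V)"
  using assms(1,4,5)
proof (induction A)
  case empty
  then show ?case using assms(2,3) by blast
next
  case (insert x A)
  have "\<exists>V. openin X V \<and> p \<in> V \<and> V \<subseteq> U \<and> (\<forall>I\<in>A. Q I V)"
    by (rule insert.IH) (use insert.prems in blast)+
  then obtain V where V: "openin X V" "p \<in> V" "V \<subseteq> U" "\<forall>I\<in>A. Q I V" by blast
  obtain W where W: "openin X W" "p \<in> W" "W \<subseteq> U" "Q x W" using insert.prems(1)[of x] by blast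
  have "Q I (V \<inter> W)" if "I \<in> insert x A" for I
  proof (cases "I = x")
    case True
    then show ?thesis using insert.prems(2)[of x "V \<inter> W" W] V W by auto
  next
    case False
    then show ?thesis using insert.prems(2)[of I "V \<inter> W" V] that V W by auto
  qed
  then show ?case using V W by (intro exI[of _ "V \<inter> W"]) auto
qed

lemma sections_direct_sumI:
  assumes M: "\<forall>I\<in>A. sheaf_of_modules X (M I)" and U: "openin (space_top X) U"
    and s: "s \<in> extensional U" "\<And>p. p \<in> U \<Longrightarrow> s p \<in> extensional A"
      "\<And>I. I \<in> A \<Longrightarrow> (\<lambda>p\<in>U. s p I) \<in> sections (M I) U"
  shows "s \<in> sections (direct_sum_sheaf A M) U"
proof -
  have "s p I \<in> carrier (stalk (M I) p)" if "p \<in> U" "I \<in> A" for p I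
    using PiE_mem[OF sheaf_of_modulesD(2)[OF bspec[OF M that(2)] U s(3)[OF that(2)]] that(1)] that(1) by simp
  then show ?thesis using s by (auto simp: sections_direct_sum stalk_direct_sum PiE_def)
qed

lemma sheaf_direct_sum:
  assumes cr: "\<And>p. p \<in> topspace (space_top X) \<Longrightarrow> cring (str_stalk X p)"
    and A: "finite A" and M: "\<And>I. I \<in> A \<Longrightarrow> sheaf_of_modules X (M I)"
  shows "sheaf_of_modules X (direct_sum_sheaf A M)"
proof -
  let ?D = "direct_sum_sheaf A M"
  have mod: "Module.module (str_stalk X p) (stalk ?D p)" if "p \<in> topspace (space_top X)" for p
    unfolding stalk_direct_sum by (rule module_dsum[OF cr[OF that] sheaf_of_modulesD(1)[OF M that]])
  have secD: "s p \<in> carrier (stalk ?D p)" "(\<lambda>p\<in>U. s p I) \<in> sections (M I) U" "s \<in> extensional U"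
    if "s \<in> sections ?D U" "p \<in> U" "I \<in> A" for s p U I
    using that by (auto simp: sections_direct_sum PiE_def)
  have secE: "s \<in> extensional U" if "s \<in> sections ?D U" for s U
    using that by (auto simp: sections_direct_sum PiE_def)
  have secC: "s p \<in> carrier (stalk ?D p)" if "s \<in> sections ?D U" "p \<in> U" for s p U
    using that by (auto simp: sections_direct_sum PiE_def)
  have "\<forall>I\<in>A. sheaf_of_modules X (M I)" using M by simp
  note secI = sections_direct_sumI[OF this]
  have ext_eq: "(\<lambda>p\<in>U. f p) = (\<lambda>p\<in>U. g p)" if "\<And>p. p \<in> U \<Longrightarrow> f p = g p" for U :: "'a set" and f g :: "'a \<Rightarrow> 'd"
    using that by (rule restrict_ext)
  show ?thesis
    unfolding sheaf_of_modules_def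
  proof (intro conjI ballI allI impI)
    fix p assume p: "p \<in> topspace (space_top X)"
    show "Module.module (str_stalk X p) (stalk ?D p)" by (rule mod[OF p])
    fix x assume "x \<in> carrier (stalk ?D p)"
    then have x: "x \<in> (\<Pi>\<^sub>E I\<in>A. carrier (stalk (M I) p))" by (simp add: stalk_direct_sum)
    have "\<exists>V. openin (space_top X) V \<and> p \<in> V \<and> V \<subseteq> topspace (space_top X) \<and> (\<forall>I\<in>A. \<exists>s\<in>sections (M I) V. s p = x I)"
    proof (rule openin_finite_Inter[OF A openin_topspace p])
      fix I assume I: "I \<in> A"
      with x have "x I \<in> carrier (stalk (M I) p)" by auto
      from sheaf_of_modulesD(9)[OF M[OF I] p this]
      obtain U s where "openin (space_top X) U" "p \<in> U" "s \<in> sections (M I) U" "s p = x I" by blast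
      then show "\<exists>V. openin (space_top X) V \<and> p \<in> V \<and> V \<subseteq> topspace (space_top X) \<and> (\<exists>s\<in>sections (M I) V. s p = x I)"
        using openin_subset by (intro exI[of _ U]) blast
    next
      fix I V W assume I: "I \<in> A" and W: "openin (space_top X) W" "p \<in> W" and V: "openin (space_top X) V" "W \<subseteq> V"
        and "\<exists>s\<in>sections (M I) V. s p = x I"
      then obtain s where s: "s \<in> sections (M I) V" "s p = x I" by blast
      show "\<exists>s\<in>sections (M I) W. s p = x I"
        using sheaf_of_modulesD(6)[OF M[OF I] V(1) s(1) W(1) V(2)] s(2) W(2)
        by (intro bexI[of _ "restrict s W"]) auto
    qed
    then obtain V where V: "openin (space_top X) V" "p \<in> V"
      and ex0: "\<forall>I\<in>A. \<exists>s\<in>sections (M I) V. s p = x I" by (elim exE conjE) (rule that)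
    from ex0 have ex: "\<forall>I\<in>A. \<exists>s. s \<in> sections (M I) V \<and> s p = x I" by (simp only: Bex_def)
    from bchoice[OF ex] obtain \<sigma> where \<sigma>: "\<forall>I\<in>A. \<sigma> I \<in> sections (M I) V \<and> \<sigma> I p = x I" ..
    have "(\<lambda>q\<in>V. \<lambda>I\<in>A. \<sigma> I q) \<in> sections ?D V"
    proof (rule secI[OF V(1)])
      fix I assume I: "I \<in> A"
      then have "\<sigma> I \<in> extensional V"
        using sheaf_of_modulesD(2)[OF M[OF I] V(1)] \<sigma> by (auto simp: PiE_def)
      then have "(\<lambda>q\<in>V. (\<lambda>q\<in>V. \<lambda>I\<in>A. \<sigma> I q) q I) = \<sigma> I"
        using I by (intro extensionalityI[of _ V]) auto
      then show "(\<lambda>q\<in>V. (\<lambda>q\<in>V. \<lambda>I\<in>A. \<sigma> I q) q I) \<in> sections (M I) V"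
        using \<sigma> I by simp
    qed auto
    moreover have "(\<lambda>q\<in>V. \<lambda>I\<in>A. \<sigma> I q) p = x"
      using x V(2) \<sigma> by (intro extensionalityI[of _ A]) (auto simp: PiE_def)
    ultimately show "\<exists>U s. openin (space_top X) U \<and> p \<in> U \<and> s \<in> sections ?D U \<and> s p = x"
      using V by (intro exI[of _ V] exI[of _ "\<lambda>q\<in>V. \<lambda>I\<in>A. \<sigma> I q"] conjI)
  next
    fix U assume U: "openin (space_top X) U"
    note UX = openin_subset[OF U, THEN subsetD]
    show "sections ?D U \<subseteq> (\<Pi>\<^sub>E p\<in>U. carrier (stalk ?D p))"
      by (auto simp: sections_direct_sum)
    show "(\<lambda>p\<in>U. \<zero>\<^bsub>stalk ?D p\<^esub>) \<in> sections ?D U"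
    proof (rule secI[OF U])
      fix I assume I: "I \<in> A"
      have "(\<lambda>p\<in>U. (\<lambda>p\<in>U. \<zero>\<^bsub>stalk ?D p\<^esub>) p I) = (\<lambda>p\<in>U. \<zero>\<^bsub>stalk (M I) p\<^esub>)"
        using I by (intro ext_eq) (simp add: stalk_direct_sum)
      then show "(\<lambda>p\<in>U. (\<lambda>p\<in>U. \<zero>\<^bsub>stalk ?D p\<^esub>) p I) \<in> sections (M I) U"
        using sheaf_of_modulesD(3)[OF M[OF I] U] by simp
    qed (auto simp: stalk_direct_sum)
    fix s assume s: "s \<in> sections ?D U"
    {
      fix t assume t: "t \<in> sections ?D U"
      show "(\<lambda>p\<in>U. s p \<oplus>\<^bsub>stalk ?D p\<^esub> t p) \<in> sections ?D U"
      proof (rule secI[OF U])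
        fix I assume I: "I \<in> A"
        have sI: "(\<lambda>p\<in>U. s p I) \<in> sections (M I) U" "(\<lambda>p\<in>U. t p I) \<in> sections (M I) U"
          using s t I by (auto simp: sections_direct_sum)
        have "(\<lambda>p\<in>U. (\<lambda>p\<in>U. s p \<oplus>\<^bsub>stalk ?D p\<^esub> t p) p I) = (\<lambda>p\<in>U. (\<lambda>p\<in>U. s p I) p \<oplus>\<^bsub>stalk (M I) p\<^esub> (\<lambda>p\<in>U. t p I) p)"
          using I by (intro ext_eq) (simp add: stalk_direct_sum)
        then show "(\<lambda>p\<in>U. (\<lambda>p\<in>U. s p \<oplus>\<^bsub>stalk ?D p\<^esub> t p) p I) \<in> sections (M I) U"
          using sheaf_of_modulesD(4)[OF M[OF I] U sI] by simp
      qed (auto simp: stalk_direct_sum)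
      fix p assume p: "p \<in> U" and eq: "s p = t p"
      have "\<exists>V. openin (space_top X) V \<and> p \<in> V \<and> V \<subseteq> U \<and> (\<forall>I\<in>A. \<forall>q\<in>V. (\<lambda>p\<in>U. s p I) q = (\<lambda>p\<in>U. t p I) q)"
      proof (rule openin_finite_Inter[OF A U p])
        fix I assume I: "I \<in> A"
        show "\<exists>V. openin (space_top X) V \<and> p \<in> V \<and> V \<subseteq> U \<and> (\<forall>q\<in>V. (\<lambda>p\<in>U. s p I) q = (\<lambda>p\<in>U. t p I) q)"
          by (rule sheaf_of_modulesD(8)[OF M[OF I] U secD(2)[OF s p I] secD(2)[OF t p I] p]) (use eq in simp)
      qed blast
      then obtain V where V: "openin (space_top X) V" "p \<in> V" "V \<subseteq> U"
        and e: "\<forall>I\<in>A. \<forall>q\<in>V. (\<lambda>p\<in>U. s p I) q = (\<lambda>p\<in>U. t p I) q" by blast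
      have "s q = t q" if q: "q \<in> V" for q
      proof (rule extensionalityI[of _ A])
        show "s q \<in> extensional A" "t q \<in> extensional A"
          using secC[OF s, of q] secC[OF t, of q] q V by (auto simp: stalk_direct_sum PiE_def)
        show "s q I = t q I" if "I \<in> A" for I
          using bspec[OF bspec[OF e that] q] q V by auto
      qed
      with V show "\<exists>V. openin (space_top X) V \<and> p \<in> V \<and> V \<subseteq> U \<and> (\<forall>q\<in>V. s q = t q)" by blast
    }
    {
      fix a assume a: "a \<in> str_sections X U"
      show "(\<lambda>p\<in>U. a p \<odot>\<^bsub>stalk ?D p\<^esub> s p) \<in> sections ?D U"
      proof (rule secI[OF U])
        fix I assume I: "I \<in> A"
        have sI: "(\<lambda>p\<in>U. s p I) \<in> sections (M I) U"
          using s I by (auto simp: sections_direct_sum)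
        have "(\<lambda>p\<in>U. (\<lambda>p\<in>U. a p \<odot>\<^bsub>stalk ?D p\<^esub> s p) p I) = (\<lambda>p\<in>U. a p \<odot>\<^bsub>stalk (M I) p\<^esub> (\<lambda>p\<in>U. s p I) p)"
          using I by (intro ext_eq) (simp add: stalk_direct_sum)
        then show "(\<lambda>p\<in>U. (\<lambda>p\<in>U. a p \<odot>\<^bsub>stalk ?D p\<^esub> s p) p I) \<in> sections (M I) U"
          using sheaf_of_modulesD(5)[OF M[OF I] U a sI] by simp
      qed (auto simp: stalk_direct_sum)
    }
    {
      fix V assume "openin (space_top X) V \<and> V \<subseteq> U"
      then have V: "openin (space_top X) V" "V \<subseteq> U" by auto
      show "restrict s V \<in> sections ?D V"
      proof (rule secI[OF V(1)])
        fix I assume I: "I \<in> A"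
        have sI: "(\<lambda>p\<in>U. s p I) \<in> sections (M I) U"
          using s I by (auto simp: sections_direct_sum)
        have "(\<lambda>p\<in>V. restrict s V p I) = restrict (\<lambda>p\<in>U. s p I) V"
          using V(2) by (intro ext_eq) auto
        then show "(\<lambda>p\<in>V. restrict s V p I) \<in> sections (M I) V"
          using sheaf_of_modulesD(6)[OF M[OF I] U sI V] by simp
      next
        fix p assume p: "p \<in> V"
        then show "restrict s V p \<in> extensional A"
          using secC[OF s, of p] V by (auto simp: stalk_direct_sum PiE_def)
      qed auto
    }
  next
    fix U s assume U: "openin (space_top X) U" and s: "s \<in> extensional U"
      and loc: "\<forall>p\<in>U. \<exists>V. openin (space_top X) V \<and> p \<in> V \<and> V \<subseteq> U \<and> restrict s V \<in> sections ?D V"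
    show "s \<in> sections ?D U"
    proof (rule secI[OF U s])
      fix p assume p: "p \<in> U"
      with loc obtain V where V: "openin (space_top X) V" "p \<in> V" "V \<subseteq> U" "restrict s V \<in> sections ?D V" by blast
      then show "s p \<in> extensional A" using secC[OF V(4,2)] by (auto simp: stalk_direct_sum PiE_def)
    next
      fix I assume I: "I \<in> A"
      show "(\<lambda>p\<in>U. s p I) \<in> sections (M I) U"
      proof (rule sheaf_of_modulesD(7)[OF M[OF I] U])
        fix p assume p: "p \<in> U"
        with loc obtain V where V: "openin (space_top X) V" "p \<in> V" "V \<subseteq> U" "restrict s V \<in> sections ?D V" by blast
        then have "(\<lambda>p\<in>V. restrict s V p I) \<in> sections (M I) V"
          using I by (auto simp: sections_direct_sum)
        moreover have "(\<lambda>p\<in>V. restrict s V p I) = restrict (\<lambda>p\<in>U. s p I) V"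
          using V(3) by (intro ext_eq) auto
        ultimately show "\<exists>V. openin (space_top X) V \<and> p \<in> V \<and> V \<subseteq> U \<and> restrict (\<lambda>p\<in>U. s p I) V \<in> sections (M I) V"
          using V by auto
      qed simp
    qed
  qed
qed

text \<open>The frames of the summands are put together, each vector extended by zero in the other
  components.\<close>

lemma frame_direct_sum:
  assumes cr: "\<And>p. p \<in> topspace (space_top X) \<Longrightarrow> cring (str_stalk X p)"
    and A: "finite A" and M: "\<And>I. I \<in> A \<Longrightarrow> sheaf_of_modules X (M I)"
    and U: "openin (space_top X) U" and T: "finite T"
    and fr: "\<And>I. I \<in> A \<Longrightarrow> frame_on X (M I) U T (e I)"
  shows "frame_on X (direct_sum_sheaf A M) U (A \<times> T)
    (\<lambda>(I, t). \<lambda>q\<in>U. \<lambda>I'\<in>A. if I' = I then e I t q else \<zero>\<^bsub>stalk (M I') q\<^esub>)"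
    (is "frame_on X ?D U _ ?e")
  unfolding frame_on_def
proof (intro conjI ballI)
  have sec: "?e (I, t) \<in> sections ?D U" if I: "I \<in> A" and t: "t \<in> T" for I t
  proof (rule sections_direct_sumI[OF _ U])
    show "\<forall>I\<in>A. sheaf_of_modules X (M I)" using M by simp
  next
    fix I' assume I': "I' \<in> A"
    show "(\<lambda>p\<in>U. ?e (I, t) p I') \<in> sections (M I') U"
    proof (cases "I' = I")
      case True
      have "e I t \<in> extensional U"
        using sheaf_of_modulesD(2)[OF M[OF I] U frame_onD(1)[OF fr[OF I] t]] by (simp add: PiE_def)
      then have "(\<lambda>p\<in>U. ?e (I, t) p I') = e I t"
        using I True by (intro extensionalityI[of _ U]) auto
      then show ?thesis using frame_onD(1)[OF fr[OF I] t] True by simp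
    next
      case False
      have "(\<lambda>p\<in>U. ?e (I, t) p I') = (\<lambda>p\<in>U. \<zero>\<^bsub>stalk (M I') p\<^esub>)"
        using False I' by (intro restrict_ext) simp
      then show ?thesis using sheaf_of_modulesD(3)[OF M[OF I'] U] by simp
    qed
  qed auto
  then show "?e It \<in> sections ?D U" if "It \<in> A \<times> T" for It using that by auto
  fix q x assume q: "q \<in> U" and x: "x \<in> carrier (stalk ?D q)"
  let ?R = "str_stalk X q"
  have qX: "q \<in> topspace (space_top X)" using openin_subset[OF U] q by blast
  note modI = sheaf_of_modulesD(1)[OF M qX]
  have modD: "Module.module ?R (stalk ?D q)"
    unfolding stalk_direct_sum by (rule module_dsum[OF cr[OF qX] modI])
  interpret D: Module.module ?R "stalk ?D q" by (rule modD)
  have eD: "?e It q \<in> carrier (stalk ?D q)" if "It \<in> A \<times> T" for It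
    using sec[of "fst It" "snd It"] that q by (auto simp: sections_direct_sum)
  have ec: "e I t q \<in> carrier (stalk (M I) q)" if "I \<in> A" "t \<in> T" for I t
    using PiE_mem[OF sheaf_of_modulesD(2)[OF M[OF that(1)] U frame_onD(1)[OF fr[OF that(1)] that(2)]] q] .
  \<comment> \<open>The component at I sees only the pairs whose first entry is I.\<close>
  have comp: "(\<Oplus>\<^bsub>stalk ?D q\<^esub>It\<in>A \<times> T. b It \<odot>\<^bsub>stalk ?D q\<^esub> ?e It q) I = (\<Oplus>\<^bsub>stalk (M I) q\<^esub>t\<in>T. b (I, t) \<odot>\<^bsub>stalk (M I) q\<^esub> e I t q)"
    if b: "\<And>It. It \<in> A \<times> T \<Longrightarrow> b It \<in> carrier ?R" and I: "I \<in> A" for b I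
  proof -
    interpret N: Module.module ?R "stalk (M I) q" by (rule modI[OF I])
    let ?g = "\<lambda>It. b It \<odot>\<^bsub>stalk (M I) q\<^esub> (if I = fst It then e I (snd It) q else \<zero>\<^bsub>stalk (M I) q\<^esub>)"
    have g: "?g It \<in> carrier (stalk (M I) q)" if "It \<in> A \<times> T" for It
      using b[OF that] that ec I by auto
    have "(\<Oplus>\<^bsub>stalk ?D q\<^esub>It\<in>A \<times> T. b It \<odot>\<^bsub>stalk ?D q\<^esub> ?e It q) I = (\<Oplus>\<^bsub>stalk (M I) q\<^esub>It\<in>A \<times> T. (b It \<odot>\<^bsub>stalk ?D q\<^esub> ?e It q) I)"
    proof -
      have sc: "b It \<odot>\<^bsub>dsum A (\<lambda>I. stalk (M I) q)\<^esub> ?e It q \<in> carrier (dsum A (\<lambda>I. stalk (M I) q))" if "It \<in> A \<times> T" for It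
        using D.smult_closed[OF b[OF that] eD[OF that]] unfolding stalk_direct_sum .
      show ?thesis
        unfolding stalk_direct_sum
        by (rule finsum_dsum[OF cr[OF qX]], erule modI, rule finite_cartesian_product[OF A T], erule sc, rule I)
    qed
    also have "\<dots> = (\<Oplus>\<^bsub>stalk (M I) q\<^esub>It\<in>A \<times> T. ?g It)"
      using g I q by (intro N.M.finsum_cong') (auto simp: stalk_direct_sum split: prod.splits)
    also have "\<dots> = (\<Oplus>\<^bsub>stalk (M I) q\<^esub>It\<in>Pair I ` T. b It \<odot>\<^bsub>stalk (M I) q\<^esub> e I (snd It) q)"
      using A T I g b by (intro N.M.add.finprod_mono_neutral_cong_right) auto
    also have "\<dots> = (\<Oplus>\<^bsub>stalk (M I) q\<^esub>t\<in>T. b (I, t) \<odot>\<^bsub>stalk (M I) q\<^esub> e I t q)"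
      using b ec I by (subst N.M.finsum_reindex) (auto simp: inj_on_def)
    finally show ?thesis .
  qed
  have xI: "x I \<in> carrier (stalk (M I) q)" if "I \<in> A" for I
    using x that by (auto simp: stalk_direct_sum)
  note ex1 = frame_onD(2)[OF fr q xI]
  have "\<forall>I\<in>A. \<exists>a. a \<in> (\<Pi>\<^sub>E t\<in>T. carrier ?R) \<and> x I = (\<Oplus>\<^bsub>stalk (M I) q\<^esub>t\<in>T. a t \<odot>\<^bsub>stalk (M I) q\<^esub> e I t q)"
    using ex1 by blast
  from bchoice[OF this] obtain a where a: "\<And>I. I \<in> A \<Longrightarrow> a I \<in> (\<Pi>\<^sub>E t\<in>T. carrier ?R)"
    "\<And>I. I \<in> A \<Longrightarrow> x I = (\<Oplus>\<^bsub>stalk (M I) q\<^esub>t\<in>T. a I t \<odot>\<^bsub>stalk (M I) q\<^esub> e I t q)" by blast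
  let ?a = "\<lambda>It\<in>A \<times> T. a (fst It) (snd It)"
  have aR: "?a It \<in> carrier ?R" if "It \<in> A \<times> T" for It
    using a(1)[of "fst It"] that by auto
  have ext: "x \<in> extensional A" using x by (auto simp: stalk_direct_sum PiE_def)
  have sumext: "(\<Oplus>\<^bsub>stalk ?D q\<^esub>It\<in>A \<times> T. b It \<odot>\<^bsub>stalk ?D q\<^esub> ?e It q) \<in> extensional A"
    if "\<And>It. It \<in> A \<times> T \<Longrightarrow> b It \<in> carrier ?R" for b
  proof -
    have "(\<Oplus>\<^bsub>stalk ?D q\<^esub>It\<in>A \<times> T. b It \<odot>\<^bsub>stalk ?D q\<^esub> ?e It q) \<in> carrier (stalk ?D q)"
      by (intro D.M.finsum_closed Pi_I D.smult_closed that eD)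
    then show ?thesis unfolding stalk_direct_sum by (auto simp: PiE_def)
  qed
  show "\<exists>!a. a \<in> (\<Pi>\<^sub>E t\<in>A \<times> T. carrier ?R) \<and> x = (\<Oplus>\<^bsub>stalk ?D q\<^esub>t\<in>A \<times> T. a t \<odot>\<^bsub>stalk ?D q\<^esub> ?e t q)"
  proof (rule ex1I[of _ ?a])
    have xeq: "x = (\<Oplus>\<^bsub>stalk ?D q\<^esub>It\<in>A \<times> T. ?a It \<odot>\<^bsub>stalk ?D q\<^esub> ?e It q)"
    proof (rule extensionalityI[OF ext sumext[OF aR]])
      fix I assume I: "I \<in> A"
      interpret N: Module.module ?R "stalk (M I) q" by (rule modI[OF I])
      show "x I = (\<Oplus>\<^bsub>stalk ?D q\<^esub>It\<in>A \<times> T. ?a It \<odot>\<^bsub>stalk ?D q\<^esub> ?e It q) I"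
      proof -
        have "(\<Oplus>\<^bsub>stalk ?D q\<^esub>It\<in>A \<times> T. ?a It \<odot>\<^bsub>stalk ?D q\<^esub> ?e It q) I
          = (\<Oplus>\<^bsub>stalk (M I) q\<^esub>t\<in>T. ?a (I, t) \<odot>\<^bsub>stalk (M I) q\<^esub> e I t q)"
          by (rule comp[OF _ I], erule aR)
        also have "\<dots> = (\<Oplus>\<^bsub>stalk (M I) q\<^esub>t\<in>T. a I t \<odot>\<^bsub>stalk (M I) q\<^esub> e I t q)"
          using a(1)[OF I] ec[OF I] I by (intro N.M.finsum_cong') auto
        finally show ?thesis using a(2)[OF I] by (simp only:)
      qed
    qed
    have aP: "?a \<in> (\<Pi>\<^sub>E t\<in>A \<times> T. carrier ?R)"
      by (rule PiE_I, erule aR) simp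
    show "?a \<in> (\<Pi>\<^sub>E t\<in>A \<times> T. carrier ?R) \<and> x = (\<Oplus>\<^bsub>stalk ?D q\<^esub>t\<in>A \<times> T. ?a t \<odot>\<^bsub>stalk ?D q\<^esub> ?e t q)"
      by (rule conjI[OF aP xeq])
    fix b assume b: "b \<in> (\<Pi>\<^sub>E t\<in>A \<times> T. carrier ?R) \<and> x = (\<Oplus>\<^bsub>stalk ?D q\<^esub>t\<in>A \<times> T. b t \<odot>\<^bsub>stalk ?D q\<^esub> ?e t q)"
    have bR: "b It \<in> carrier ?R" if "It \<in> A \<times> T" for It by (rule PiE_mem[OF conjunct1[OF b] that])
    have "b (I, t) = a I t" if I: "I \<in> A" and t: "t \<in> T" for I t
    proof -
      interpret N: Module.module ?R "stalk (M I) q" by (rule modI[OF I])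
      have "x I = (\<Oplus>\<^bsub>stalk (M I) q\<^esub>t\<in>T. b (I, t) \<odot>\<^bsub>stalk (M I) q\<^esub> e I t q)"
      proof -
        have "(\<Oplus>\<^bsub>stalk ?D q\<^esub>It\<in>A \<times> T. b It \<odot>\<^bsub>stalk ?D q\<^esub> ?e It q) I
          = (\<Oplus>\<^bsub>stalk (M I) q\<^esub>t\<in>T. b (I, t) \<odot>\<^bsub>stalk (M I) q\<^esub> e I t q)"
          by (rule comp[OF _ I], erule bR)
        then show ?thesis using b by (simp only:)
      qed
      also have "\<dots> = (\<Oplus>\<^bsub>stalk (M I) q\<^esub>t\<in>T. (\<lambda>t\<in>T. b (I, t)) t \<odot>\<^bsub>stalk (M I) q\<^esub> e I t q)"
        using bR ec[OF I] I by (intro N.M.finsum_cong') auto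
      finally have "(\<lambda>t\<in>T. b (I, t)) \<in> (\<Pi>\<^sub>E t\<in>T. carrier ?R) \<and> x I = (\<Oplus>\<^bsub>stalk (M I) q\<^esub>t\<in>T. (\<lambda>t\<in>T. b (I, t)) t \<odot>\<^bsub>stalk (M I) q\<^esub> e I t q)"
        using bR I by auto
      with ex1[OF I I] a[OF I] have "(\<lambda>t\<in>T. b (I, t)) = a I" by metis
      from fun_cong[OF this, of t] t show ?thesis by simp
    qed
    then show "b = ?a"
      using b by (intro extensionalityI[of _ "A \<times> T"]) (auto simp: PiE_def)
  qed
qed

section \<open>Frames of Ker delta and local freeness of the Koszul terms\<close>

context ci
begin

lemma cring_str_X: "p \<in> Zl \<Longrightarrow> cring (str_stalk XX p)"
proof -
  assume "p \<in> Zl"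
  then interpret ci_point N c d P p by (rule ci_point)
  show ?thesis using cring_B str_stalk_X[OF \<open>p \<in> Zl\<close>] by simp
qed

text \<open>The frame consists of the X_r^n z^t with t free of Y_r. It generates by
  \<open>taylor\<close>, and it is independent modulo the ideal because the coefficients of a
  combination can be read off at these monomials.\<close>

lemma frame_ker_X:
  assumes U: "openin (space_top XX) U" and ch: "\<And>q. q \<in> U \<Longrightarrow> chart N q r"
  shows "frame_on XX (ker_delta_X N c d P m n) U {t \<in> mons N m. Poly_Mapping.lookup t r = 0}
    (\<lambda>t. \<lambda>q\<in>U. cs (bihom_ideal N c d P m n q) (cst (fr (var r) powi n) * zpow r t))"
    (is "frame_on _ ?M _ ?T ?e")
  unfolding frame_on_def
proof (intro conjI ballI)
  have UZ: "q \<in> Zl" if "q \<in> U" for q using openin_X_subset[OF U] that by blast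
  have kd: "cst (fr (var r) powi n) * zpow r t \<in> ker_delta N m n q" if "q \<in> U" "t \<in> ?T" for q t
  proof -
    interpret ci_chart N c d P q r by (rule ci_chart[OF UZ ch]) (fact that)+
    show ?thesis using kd_cst_mult[OF X_power zpow_kd, of t m n] that by simp
  qed
  show "?e t \<in> sections ?M U" if t: "t \<in> ?T" for t
    unfolding sections_ker_X[OF openin_X_subset[OF U]]
  proof (rule coset_sectionsI)
    fix q assume q: "q \<in> U"
    show "\<exists>F. nearby N q (\<lambda>q. q \<in> Zl \<longrightarrow> q \<in> U \<and> F \<in> ker_delta N m n q \<and> ?e t q = cs (bihom_ideal N c d P m n q) F)"
      by (rule exI[of _ "cst (fr (var r) powi n) * zpow r t"], rule nearby_mono[OF openin_X_nearby[OF U q]])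
        (use kd[OF _ t] in auto)
  qed auto
  fix q x assume q: "q \<in> U" and x: "x \<in> carrier (stalk ?M q)"
  interpret ci_chart N c d P q r by (rule ci_chart[OF UZ ch]) (fact q)+
  interpret Q: coset_module "germs 0" "J 0" "kd m n" "H m n" "\<lambda>a F. cst a * F"
    by (rule coset_module_ker[OF UZ[OF q]])
  note st = stalk_ker_X[OF UZ[OF q], of m n] str_stalk_X[OF UZ[OF q]]
  have T: "?T = mons0 m" by (simp add: mons0_def)
  have comb: "(\<Oplus>\<^bsub>stalk ?M q\<^esub>t\<in>?T. cs (J 0) (b t) \<odot>\<^bsub>stalk ?M q\<^esub> ?e t q) = cs (H m n) (\<Sum>t\<in>mons0 m. cst (b t * X powi n) * zpow r t)"
    if b: "\<And>t. t \<in> ?T \<Longrightarrow> b t \<in> germs 0" for b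
  proof -
    interpret QM: Module.module B Q.Q by (rule Q.module_Q)
    have "cs (J 0) (b t) \<odot>\<^bsub>stalk ?M q\<^esub> ?e t q = cs (H m n) (cst (b t * X powi n) * zpow r t)" if "t \<in> ?T" for t
      unfolding st using Q.smult_cs[OF b[OF that] kd[OF q that]] q by (simp add: cst_mult mult.assoc)
    moreover have V: "cst (b t * X powi n) * zpow r t \<in> kd m n" if "t \<in> ?T" for t
      using Q.V(2)[OF b[OF that] kd[OF q that]] by (simp add: cst_mult mult.assoc)
    ultimately have "(\<Oplus>\<^bsub>stalk ?M q\<^esub>t\<in>?T. cs (J 0) (b t) \<odot>\<^bsub>stalk ?M q\<^esub> ?e t q) = (\<Oplus>\<^bsub>Q.Q\<^esub>t\<in>?T. cs (H m n) (cst (b t * X powi n) * zpow r t))"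
      unfolding st by (intro QM.M.finsum_cong') auto
    also have "\<dots> = cs (H m n) (\<Sum>t\<in>?T. cst (b t * X powi n) * zpow r t)"
      by (rule Q.finsum_Q[OF V])
    finally show ?thesis by (simp only: T)
  qed
  from x st obtain F where F: "F \<in> kd m n" "x = cs (H m n) F" by auto
  have Fl: "Poly_Mapping.lookup F t \<in> germs n" for t using kd_bihom[OF F(1)] by (simp add: bihom_iff)
  define b where "b t = Poly_Mapping.lookup F t * X powi (- n)" for t
  have b: "b t \<in> germs 0" for t
    using germs_mult[OF Fl X_power, of t "-n"] by (simp add: b_def)
  have bX: "b t * X powi n = Poly_Mapping.lookup F t" for t
    by (simp add: b_def mult.assoc X_power_cancel)
  have Fsum: "(\<Sum>t\<in>mons0 m. cst (b t * X powi n) * zpow r t) = F"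
    unfolding bX using taylor[OF F(1)] zsubst_mons0 by simp
  have carr: "carrier (str_stalk XX q) = cs (J 0) ` germs 0"
    using B_carrier st(2) by simp
  show "\<exists>!a. a \<in> (\<Pi>\<^sub>E t\<in>?T. carrier (str_stalk XX q)) \<and> x = (\<Oplus>\<^bsub>stalk ?M q\<^esub>t\<in>?T. a t \<odot>\<^bsub>stalk ?M q\<^esub> ?e t q)"
  proof (rule ex1I[of _ "\<lambda>t\<in>?T. cs (J 0) (b t)"])
    interpret QM: Module.module "str_stalk XX q" "stalk ?M q" using Q.module_Q st by simp
    have eC: "?e t q \<in> carrier (stalk ?M q)" if "t \<in> ?T" for t
      using kd[OF q that] q st by auto
    have "(\<Oplus>\<^bsub>stalk ?M q\<^esub>t\<in>?T. (\<lambda>t\<in>?T. cs (J 0) (b t)) t \<odot>\<^bsub>stalk ?M q\<^esub> ?e t q) = (\<Oplus>\<^bsub>stalk ?M q\<^esub>t\<in>?T. cs (J 0) (b t) \<odot>\<^bsub>stalk ?M q\<^esub> ?e t q)"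
      using b eC by (intro QM.M.finsum_cong' QM.smult_closed Pi_I refl) (simp_all add: carr)
    then show "(\<lambda>t\<in>?T. cs (J 0) (b t)) \<in> (\<Pi>\<^sub>E t\<in>?T. carrier (str_stalk XX q))
      \<and> x = (\<Oplus>\<^bsub>stalk ?M q\<^esub>t\<in>?T. (\<lambda>t\<in>?T. cs (J 0) (b t)) t \<odot>\<^bsub>stalk ?M q\<^esub> ?e t q)"
      using comb[OF b] Fsum F(2) b carr by auto
    fix a assume a: "a \<in> (\<Pi>\<^sub>E t\<in>?T. carrier (str_stalk XX q)) \<and> x = (\<Oplus>\<^bsub>stalk ?M q\<^esub>t\<in>?T. a t \<odot>\<^bsub>stalk ?M q\<^esub> ?e t q)"
    then have "\<forall>t\<in>?T. \<exists>g. g \<in> germs 0 \<and> a t = cs (J 0) g" using carr by blast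
    from bchoice[OF this] obtain g where g: "\<And>t. t \<in> ?T \<Longrightarrow> g t \<in> germs 0" "\<And>t. t \<in> ?T \<Longrightarrow> a t = cs (J 0) (g t)" by blast
    have "(\<Oplus>\<^bsub>stalk ?M q\<^esub>t\<in>?T. a t \<odot>\<^bsub>stalk ?M q\<^esub> ?e t q) = (\<Oplus>\<^bsub>stalk ?M q\<^esub>t\<in>?T. cs (J 0) (g t) \<odot>\<^bsub>stalk ?M q\<^esub> ?e t q)"
      using g eC by (intro QM.M.finsum_cong' QM.smult_closed Pi_I refl) (simp_all add: carr)
    then have "cs (H m n) F = cs (H m n) (\<Sum>t\<in>mons0 m. cst (g t * X powi n) * zpow r t)"
      using a comb[OF g(1)] F(2) by simp
    then have "F - (\<Sum>t\<in>mons0 m. cst (g t * X powi n) * zpow r t) \<in> H m n"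
      by (simp add: cs_eq_iff[OF addsub_H])
    \<comment> \<open>At a monomial free of Y_r the combination has the corresponding scalar as its
      coefficient, so equality of cosets compares the scalars modulo the ideal.\<close>
    then have FgJ: "Poly_Mapping.lookup F t - g t * X powi n \<in> J n" if "t \<in> ?T" for t
      using H_D(2)[of "F - (\<Sum>t\<in>mons0 m. cst (g t * X powi n) * zpow r t)" m n t] that
        lookup_zpow_comb[of t m "\<lambda>t. g t * X powi n"] by (simp add: lookup_minus T)
    have "g t - b t \<in> J 0" if "t \<in> ?T" for t
    proof -
      have "(Poly_Mapping.lookup F t - g t * X powi n) * X powi (- n) \<in> J 0"
        using J_mult_right[OF FgJ[OF that] X_power[of "- n"]] by simp
      moreover have "(Poly_Mapping.lookup F t - g t * X powi n) * X powi (- n) = b t - g t"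
        by (simp add: b_def left_diff_distrib mult.assoc X_power_cancel)
      ultimately show ?thesis using addsubD(3)[OF addsub_J, of "b t - g t" 0] by simp
    qed
    then have "a t = cs (J 0) (b t)" if "t \<in> ?T" for t
      using g(2)[OF that] that by (simp add: cs_eq_iff[OF addsub_J])
    then show "a = (\<lambda>t\<in>?T. cs (J 0) (b t))"
      using a by (intro extensionalityI[of _ ?T]) (auto simp: PiE_def)
  qed
qed

lemma finite_koszul_index: "finite (koszul_index c k)"
  unfolding koszul_index_def by (rule finite_subset[of _ "Pow {1..c}"]) auto

lemma sheaf_koszul_term: "sheaf_of_modules XX (koszul_term N c d P m n k)"
  unfolding koszul_term_def
  by (rule sheaf_direct_sum[OF _ finite_koszul_index sheaf_ker_X]) (simp add: topspace_X cring_str_X)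

text \<open>The degree \<open>m - k\<close> is the same for all summands, so one set of monomials
  serves them all; the twist enters only through the power of X_r.\<close>

lemma locally_free_koszul_term: "locally_free XX (koszul_term N c d P m n k)"
proof (rule locally_freeI[OF sheaf_koszul_term])
  fix p assume "p \<in> topspace (space_top XX)"
  then have pZ: "p \<in> Zl" by (simp add: topspace_X)
  then obtain r where "ci_chart N c d P p r" using ex_ci_chart by blast
  then interpret ci_chart N c d P p r .
  from nearby_openin_X[OF chart_nearby pZ] obtain U where U: "openin (space_top XX) U" "p \<in> U" "\<And>q. q \<in> U \<Longrightarrow> chart N q r"
    by blast
  let ?T = "{t \<in> mons N (m - k). Poly_Mapping.lookup t r = 0}"
  let ?e = "\<lambda>I t. \<lambda>q\<in>U. cs (bihom_ideal N c d P (m - k) (koszul_shift d n I) q) (cst (fr (var r) powi koszul_shift d n I) * zpow r t)"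
  have T: "finite ?T" using finite_mons by simp
  have fr: "frame_on XX (koszul_term N c d P m n k) U (koszul_index c k \<times> ?T)
    (\<lambda>(I, t). \<lambda>q\<in>U. \<lambda>I'\<in>koszul_index c k. if I' = I then ?e I t q else \<zero>\<^bsub>stalk (ker_delta_X N c d P (m - k) (koszul_shift d n I')) q\<^esub>)"
    unfolding koszul_term_def
    by (rule frame_direct_sum[OF _ finite_koszul_index sheaf_ker_X U(1) T frame_ker_X[OF U(1,3)]])
      (simp add: topspace_X cring_str_X)
  show "\<exists>U (T :: (nat set \<times> (nat \<Rightarrow>\<^sub>0 nat)) set) e. finite T \<and> openin (space_top XX) U \<and> p \<in> U \<and> frame_on XX (koszul_term N c d P m n k) U T e"
    by (intro exI conjI, rule finite_cartesian_product[OF finite_koszul_index[of k] T], rule U(1), rule U(2), rule fr)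
qed

end

section \<open>The Koszul differentials as maps of sheaves\<close>

lemma restrict_eq_iff: "restrict f A = restrict g A \<longleftrightarrow> (\<forall>x\<in>A. f x = g x)"
proof
  assume eq: "restrict f A = restrict g A"
  show "\<forall>x\<in>A. f x = g x"
  proof
    fix x assume "x \<in> A"
    with fun_cong[OF eq, of x] show "f x = g x" by simp
  qed
qed (auto intro: restrict_ext)

context ci
begin

abbreviation "Hc m n q \<equiv> bihom_ideal N c d P m n q"
abbreviation "sh n I \<equiv> koszul_shift d n I"
abbreviation "kosg \<equiv> koszul_map c (\<lambda>i. alpha_poly N (d i) (P i))"

lemma carrier_koszul_term:
  assumes "p \<in> Zl"
  shows "carrier (stalk (koszul_term N c d P m n k) p)
    = (\<Pi>\<^sub>E I\<in>koszul_index c k. cs (Hc (m - k) (sh n I) p) ` ker_delta N (m - k) (sh n I) p)"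
  unfolding koszul_term_def stalk_direct_sum by (simp add: stalk_ker_X[OF assms])

lemma koszul_term_elem:
  assumes "p \<in> Zl" "s \<in> carrier (stalk (koszul_term N c d P m n k) p)"
  obtains x where "\<forall>I\<in>koszul_index c k. x I \<in> ker_delta N (m - k) (sh n I) p"
    "s = (\<lambda>I\<in>koszul_index c k. cs (Hc (m - k) (sh n I) p) (x I))"
proof -
  have s: "s \<in> (\<Pi>\<^sub>E I\<in>koszul_index c k. cs (Hc (m - k) (sh n I) p) ` ker_delta N (m - k) (sh n I) p)"
    using assms(2) unfolding carrier_koszul_term[OF assms(1)] .
  have "\<exists>x. x \<in> ker_delta N (m - k) (sh n I) p \<and> s I = cs (Hc (m - k) (sh n I) p) x" if "I \<in> koszul_index c k" for I
    using PiE_mem[OF s that] by (elim imageE) (intro exI conjI)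
  then have "\<forall>I\<in>koszul_index c k. \<exists>x. x \<in> ker_delta N (m - k) (sh n I) p \<and> s I = cs (Hc (m - k) (sh n I) p) x"
    by (intro ballI)
  from bchoice[OF this] obtain x
    where x: "\<forall>I\<in>koszul_index c k. x I \<in> ker_delta N (m - k) (sh n I) p \<and> s I = cs (Hc (m - k) (sh n I) p) (x I)" ..
  have "s = (\<lambda>I\<in>koszul_index c k. cs (Hc (m - k) (sh n I) p) (x I))"
    using s x by (intro extensionalityI[of _ "koszul_index c k"]) (simp_all add: PiE_def)
  with x show ?thesis by (intro that) simp_all
qed

lemma koszul_term_elemI:
  assumes "p \<in> Zl" "\<forall>I\<in>koszul_index c k. x I \<in> ker_delta N (m - k) (sh n I) p"
  shows "(\<lambda>I\<in>koszul_index c k. cs (Hc (m - k) (sh n I) p) (x I)) \<in> carrier (stalk (koszul_term N c d P m n k) p)"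
  unfolding carrier_koszul_term[OF assms(1)] restrict_PiE_iff using assms(2) by simp

lemma koszul_term_add:
  assumes "p \<in> Zl"
  shows "(\<lambda>I\<in>koszul_index c k. cs (Hc (m - k) (sh n I) p) (x I)) \<oplus>\<^bsub>stalk (koszul_term N c d P m n k) p\<^esub>
      (\<lambda>I\<in>koszul_index c k. cs (Hc (m - k) (sh n I) p) (y I))
    = (\<lambda>I\<in>koszul_index c k. cs (Hc (m - k) (sh n I) p) (x I + y I))"
  unfolding koszul_term_def stalk_direct_sum dsum_simps
  by (rule restrict_ext)
    (simp add: stalk_ker_X[OF assms] cosmod_add[OF coset_module.H(1)[OF coset_module_ker[OF assms]]])

lemma koszul_term_smult:
  assumes "p \<in> Zl" "a \<in> twist_germs N 0 p" "\<forall>I\<in>koszul_index c k. x I \<in> ker_delta N (m - k) (sh n I) p"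
  shows "cs (J_germs N c d P 0 p) a \<odot>\<^bsub>stalk (koszul_term N c d P m n k) p\<^esub>
      (\<lambda>I\<in>koszul_index c k. cs (Hc (m - k) (sh n I) p) (x I))
    = (\<lambda>I\<in>koszul_index c k. cs (Hc (m - k) (sh n I) p) (cst a * x I))"
  unfolding koszul_term_def stalk_direct_sum dsum_simps
  by (rule restrict_ext)
    (simp add: stalk_ker_X[OF assms(1)] coset_module.smult_cs[OF coset_module_ker[OF assms(1)] assms(2)] assms(3))

lemma koszul_index_insert:
  assumes "J \<in> koszul_index c (k - 1)" "1 \<le> k" "i \<in> {1..c} - J"
  shows "insert i J \<in> koszul_index c k" "sh n (insert i J) = sh n J - (int (d i) - 1)"
proof -
  have fin: "finite J" using assms(1) finite_subset by (auto simp: koszul_index_def)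
  show "insert i J \<in> koszul_index c k"
    using assms fin by (auto simp: koszul_index_def)
  show "sh n (insert i J) = sh n J - (int (d i) - 1)"
    using assms(3) fin by (intro koszul_shift_insert) auto
qed

text \<open>Multiplication by \<alpha>(P_i) is computed on representatives, but its result leaves
  Ker delta. The products with \<open>ak i\<close> represent the same cosets and stay in it. The two
  descriptions are used side by side.\<close>

lemma koszul_diff_cs:
  assumes ch: "ci_chart N c d P p r" and pZ: "p \<in> Zl" and k: "1 \<le> k" "k \<le> c" "c \<le> m"
    and x: "\<forall>I\<in>koszul_index c k. x I \<in> ker_delta N (m - k) (sh n I) p"
  shows "koszul_diff N c d P m n k p (\<lambda>I\<in>koszul_index c k. cs (Hc (m - k) (sh n I) p) (x I))
    = (\<lambda>J\<in>koszul_index c (k - 1). cs (Hc (m - (k - 1)) (sh n J) p) (kosg x J))"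
    and "J \<in> koszul_index c (k - 1) \<Longrightarrow> koszul_map c (ci_chart.ak N d P r) x J \<in> ker_delta N (m - (k - 1)) (sh n J) p"
    and "J \<in> koszul_index c (k - 1) \<Longrightarrow> koszul_map c (ci_chart.ak N d P r) x J - kosg x J \<in> Hc (m - (k - 1)) (sh n J) p"
proof -
  interpret ci_chart N c d P p r by (rule ch)
  have step: "koszul_sign i J * (ak i * x (insert i J)) \<in> kd (m - (k - 1)) (sh n J)"
    "koszul_sign i J * (ak i * x (insert i J)) - koszul_sign i J * (al i * x (insert i J)) \<in> H (m - (k - 1)) (sh n J)"
    if J: "J \<in> koszul_index c (k - 1)" and i: "i \<in> {1..c} - J" for i J
  proof -
    note ins = koszul_index_insert[OF J k(1) i]
    have i': "i \<in> {1..c}" using i by simp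
    have m: "1 + (m - k) = m - (k - 1)" "Suc (m - k) = m - (k - 1)" using k by auto
    have s: "int (d i) - 1 + sh n (insert i J) = sh n J" "sh n (insert i J) + (int (d i) - 1) = sh n J"
      using ins(2) by simp_all
    have "ak i * x (insert i J) \<in> kd (m - (k - 1)) (sh n J)"
      using kd_mult[OF ak_kd[OF i'] bspec[OF x ins(1)]] unfolding m s .
    then show "koszul_sign i J * (ak i * x (insert i J)) \<in> kd (m - (k - 1)) (sh n J)"
      by (rule koszul_sign_closed[OF addsub_kd])
    have "al i * x (insert i J) - ak i * x (insert i J) \<in> H (m - (k - 1)) (sh n J)"
      using al_ak[OF i' kd_bihom[OF bspec[OF x ins(1)]]] unfolding m s .
    from koszul_sign_closed[OF addsub_H addsubD(3)[OF addsub_H this], of i J]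
    show "koszul_sign i J * (ak i * x (insert i J)) - koszul_sign i J * (al i * x (insert i J)) \<in> H (m - (k - 1)) (sh n J)"
      by (simp add: right_diff_distrib)
  qed
  show kd: "koszul_map c ak x J \<in> kd (m - (k - 1)) (sh n J)" if J: "J \<in> koszul_index c (k - 1)" for J
    unfolding koszul_map_def by (rule addsub_sum[OF addsub_kd]) (rule step(1)[OF J])
  show diff: "koszul_map c ak x J - kosg x J \<in> H (m - (k - 1)) (sh n J)" if J: "J \<in> koszul_index c (k - 1)" for J
    unfolding koszul_map_def sum_subtractf[symmetric] by (rule addsub_sum[OF addsub_H]) (rule step(2)[OF J])
  show "koszul_diff N c d P m n k p (\<lambda>I\<in>koszul_index c k. cs (H (m - k) (sh n I)) (x I))
    = (\<lambda>J\<in>koszul_index c (k - 1). cs (H (m - (k - 1)) (sh n J)) (kosg x J))"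
    unfolding koszul_diff_def
  proof (rule restrict_ext)
    fix J assume J: "J \<in> koszul_index c (k - 1)"
    interpret Q: coset_module "germs 0" "J_germs N c d P 0 p" "kd (m - (k - 1)) (sh n J)" "H (m - (k - 1)) (sh n J)" "\<lambda>a F. cst a * F"
      by (rule coset_module_ker[OF pZ])
    interpret QM: Module.module B Q.Q by (rule Q.module_Q)
    let ?w = "\<lambda>i. koszul_sign i J * (ak i * x (insert i J))"
    have mult: "mult_X N c d P (m - (k - 1)) (sh n J) ((-1) ^ card {j\<in>J. j < i} * alpha_poly N (d i) (P i)) p
        ((\<lambda>I\<in>koszul_index c k. cs (H (m - k) (sh n I)) (x I)) (insert i J)) = cs (H (m - (k - 1)) (sh n J)) (?w i)"
      if i: "i \<in> {1..c} - J" for i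
    proof -
      note ins = koszul_index_insert[OF J k(1) i]
      have i': "i \<in> {1..c}" using i by simp
      have m: "1 + (m - k) = m - (k - 1)" using k by auto
      have s: "int (d i) - 1 + sh n (insert i J) = sh n J" using ins(2) by simp
      \<comment> \<open>Every F in the coset leads to the same result, so the union in
        \<open>mult_X\<close> is a single coset.\<close>
      have eq: "cs (H (m - (k - 1)) (sh n J)) (koszul_sign i J * al i * F) = cs (H (m - (k - 1)) (sh n J)) (?w i)"
        if F: "F \<in> cs (H (m - k) (sh n (insert i J))) (x (insert i J))" for F
      proof -
        have "al i * (F - x (insert i J)) \<in> H (m - (k - 1)) (sh n J)"
          using H_mult[OF al_bihom[OF i'] F[unfolded mem_cs]] unfolding m s .
        then have "koszul_sign i J * (al i * (F - x (insert i J))) \<in> H (m - (k - 1)) (sh n J)"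
          by (rule koszul_sign_closed[OF addsub_H])
        from addsubD(4)[OF addsub_H this step(2)[OF J i]]
        have "koszul_sign i J * al i * F - ?w i \<in> H (m - (k - 1)) (sh n J)"
          by (simp add: right_diff_distrib mult.assoc)
        then show ?thesis by (simp add: cs_eq_iff[OF addsub_H])
      qed
      have "mult_X N c d P (m - (k - 1)) (sh n J) ((-1) ^ card {j\<in>J. j < i} * alpha_poly N (d i) (P i)) p
        ((\<lambda>I\<in>koszul_index c k. cs (H (m - k) (sh n I)) (x I)) (insert i J))
        = (\<Union>F\<in>cs (H (m - k) (sh n (insert i J))) (x (insert i J)). cs (H (m - (k - 1)) (sh n J)) (koszul_sign i J * al i * F))"
        using ins(1) by (simp add: mult_X_def rcos_plus bihom_sheaf_def koszul_sign_def)
      also have "\<dots> = (\<Union>F\<in>cs (H (m - k) (sh n (insert i J))) (x (insert i J)). cs (H (m - (k - 1)) (sh n J)) (?w i))"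
        by (intro SUP_cong refl eq)
      also have "\<dots> = cs (H (m - (k - 1)) (sh n J)) (?w i)"
        using cs_self[OF addsub_H, of "x (insert i J)" "m - k" "sh n (insert i J)"] by blast
      finally show ?thesis .
    qed
    have "(\<Oplus>\<^bsub>stalk (ker_delta_X N c d P (m - (k - 1)) (sh n J)) p\<^esub>i\<in>{1..c} - J.
        mult_X N c d P (m - (k - 1)) (sh n J) ((-1) ^ card {j\<in>J. j < i} * alpha_poly N (d i) (P i)) p
        ((\<lambda>I\<in>koszul_index c k. cs (H (m - k) (sh n I)) (x I)) (insert i J)))
      = (\<Oplus>\<^bsub>Q.Q\<^esub>i\<in>{1..c} - J. cs (H (m - (k - 1)) (sh n J)) (?w i))"
      unfolding stalk_ker_X[OF pZ] by (rule QM.M.finsum_cong') (use mult step(1)[OF J] in auto)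
    also have "\<dots> = cs (H (m - (k - 1)) (sh n J)) (koszul_map c ak x J)"
      unfolding koszul_map_def by (rule Q.finsum_Q) (rule step(1)[OF J])
    also have "\<dots> = cs (H (m - (k - 1)) (sh n J)) (kosg x J)"
      using diff[OF J] by (simp add: cs_eq_iff[OF addsub_H])
    finally show "(\<Oplus>\<^bsub>stalk (ker_delta_X N c d P (m - (k - 1)) (sh n J)) p\<^esub>i\<in>{1..c} - J.
        mult_X N c d P (m - (k - 1)) (sh n J) ((-1) ^ card {j\<in>J. j < i} * alpha_poly N (d i) (P i)) p
        ((\<lambda>I\<in>koszul_index c k. cs (H (m - k) (sh n I)) (x I)) (insert i J))) = cs (H (m - (k - 1)) (sh n J)) (kosg x J)" .
  qed
qed

lemma koszul_diff_cs':
  assumes ch: "ci_chart N c d P p r" and pZ: "p \<in> Zl" and k: "1 \<le> k" "k \<le> c" "c \<le> m"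
    and x: "\<forall>I\<in>koszul_index c k. x I \<in> ker_delta N (m - k) (sh n I) p"
  shows "koszul_diff N c d P m n k p (\<lambda>I\<in>koszul_index c k. cs (Hc (m - k) (sh n I) p) (x I))
    = (\<lambda>J\<in>koszul_index c (k - 1). cs (Hc (m - (k - 1)) (sh n J) p) (koszul_map c (ci_chart.ak N d P r) x J))"
  unfolding koszul_diff_cs(1)[OF ch pZ k x]
proof (rule restrict_ext)
  interpret ci_chart N c d P p r by (rule ch)
  fix J assume J: "J \<in> koszul_index c (k - 1)"
  have "koszul_map c ak x J - kosg x J \<in> H (m - (k - 1)) (sh n J)"
    by (rule koszul_diff_cs(3)[OF ch pZ k x J])
  then have "cs (H (m - (k - 1)) (sh n J)) (koszul_map c ak x J) = cs (H (m - (k - 1)) (sh n J)) (kosg x J)"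
    by (simp only: cs_eq_iff[OF addsub_H])
  then show "cs (H (m - (k - 1)) (sh n J)) (kosg x J) = cs (H (m - (k - 1)) (sh n J)) (koszul_map c ak x J)" ..
qed

lemma koszul_diff_hom:
  assumes pZ: "p \<in> Zl" and k: "1 \<le> k" "k \<le> c" "c \<le> m"
  shows "koszul_diff N c d P m n k p \<in> module_hom (str_stalk XX p) (stalk (koszul_term N c d P m n k) p)
    (stalk (koszul_term N c d P m n (k - 1)) p)"
proof -
  from ex_ci_chart[OF pZ] obtain r where ch: "ci_chart N c d P p r" ..
  interpret ci_chart N c d P p r by (rule ch)
  let ?K = "stalk (koszul_term N c d P m n k) p" and ?L = "stalk (koszul_term N c d P m n (k - 1)) p"
  let ?D = "koszul_diff N c d P m n k p"
  let ?e = "\<lambda>x. \<lambda>I\<in>koszul_index c k. cs (H (m - k) (sh n I)) (x I)"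
  note dc = koszul_diff_cs(1)[OF ch pZ k] and dc' = koszul_diff_cs'[OF ch pZ k] and dk = koszul_diff_cs(2)[OF ch pZ k]
  show ?thesis
    unfolding module_hom_def
  proof (intro CollectI conjI ballI funcsetI)
    fix s assume "s \<in> carrier ?K"
    then obtain x where x: "\<forall>I\<in>koszul_index c k. x I \<in> kd (m - k) (sh n I)" "s = ?e x"
      by (rule koszul_term_elem[OF pZ])
    show "?D s \<in> carrier ?L"
      unfolding x(2) dc'[OF x(1)] by (rule koszul_term_elemI[OF pZ]) (rule ballI, rule dk[OF x(1)])
    {
      fix t assume "t \<in> carrier ?K"
      then obtain y where y: "\<forall>I\<in>koszul_index c k. y I \<in> kd (m - k) (sh n I)" "t = ?e y"
        by (rule koszul_term_elem[OF pZ])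
      have xy: "\<forall>I\<in>koszul_index c k. x I + y I \<in> kd (m - k) (sh n I)"
        using x(1) y(1) addsubD(2)[OF addsub_kd] by simp
      have kos_add: "kosg (\<lambda>I. x I + y I) J = kosg x J + kosg y J" for J
        by (simp add: koszul_map_def distrib_left sum.distrib)
      show "?D (s \<oplus>\<^bsub>?K\<^esub> t) = ?D s \<oplus>\<^bsub>?L\<^esub> ?D t"
        unfolding x(2) y(2) koszul_term_add[OF pZ] dc[OF x(1)] dc[OF y(1)] dc[OF xy] kos_add ..
    }
    {
      fix a assume "a \<in> carrier (str_stalk XX p)"
      then obtain b where b: "b \<in> germs 0" "a = cs (J_germs N c d P 0 p) b"
        using B_carrier str_stalk_X[OF pZ] by auto
      have bx: "\<forall>I\<in>koszul_index c k. cst b * x I \<in> kd (m - k) (sh n I)"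
        using kd_cst_mult[OF b(1) bspec[OF x(1)]] by simp
      have dk': "\<forall>J\<in>koszul_index c (k - 1). koszul_map c ak x J \<in> kd (m - (k - 1)) (sh n J)"
        by (rule ballI, rule dk[OF x(1)])
      \<comment> \<open>\<open>koszul_term_smult\<close> wants representatives in Ker delta, hence
        the differential in the form with \<open>ak\<close>.\<close>
      have kos_smult: "koszul_map c ak (\<lambda>I. cst b * x I) J = cst b * koszul_map c ak x J" for J
        by (simp add: koszul_map_def sum_distrib_left mult.left_commute)
      show "?D (a \<odot>\<^bsub>?K\<^esub> s) = a \<odot>\<^bsub>?L\<^esub> ?D s"
        unfolding x(2) b(2) koszul_term_smult[OF pZ b(1) x(1)] dc'[OF x(1)] dc'[OF bx] kos_smult
          koszul_term_smult[OF pZ b(1) dk'] ..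
    }
  qed
qed

lemma koszul_diff_sheaf_hom:
  assumes k: "1 \<le> k" "k \<le> c" "c \<le> m"
  shows "koszul_diff N c d P m n k \<in> sheaf_hom XX (koszul_term N c d P m n k) (koszul_term N c d P m n (k - 1))"
  unfolding sheaf_hom_def topspace_X
proof (intro CollectI conjI ballI allI impI)
  fix p assume "p \<in> Zl"
  then show "koszul_diff N c d P m n k p \<in> module_hom (str_stalk XX p) (stalk (koszul_term N c d P m n k) p)
    (stalk (koszul_term N c d P m n (k - 1)) p)"
    by (rule koszul_diff_hom[OF _ k])
next
  fix U s assume U: "openin (space_top XX) U" and s: "s \<in> sections (koszul_term N c d P m n k) U"
  note UZ = openin_X_subset[OF U, THEN subsetD]
  let ?t = "\<lambda>p\<in>U. koszul_diff N c d P m n k p (s p)"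
  have sI: "(\<lambda>p\<in>U. s p I) \<in> coset_sections N Zl (ker_delta N (m - k) (sh n I)) (Hc (m - k) (sh n I)) U" if "I \<in> koszul_index c k" for I
    using s that unfolding koszul_term_def sections_direct_sum sections_ker_X[OF openin_X_subset[OF U]] by simp
  have sp: "s q \<in> carrier (stalk (koszul_term N c d P m n k) q)" if "q \<in> U" for q
    using s that unfolding koszul_term_def sections_direct_sum by auto
  have tp: "?t q \<in> carrier (stalk (koszul_term N c d P m n (k - 1)) q)" if "q \<in> U" for q
  proof -
    have "koszul_diff N c d P m n k q \<in> carrier (stalk (koszul_term N c d P m n k) q) \<rightarrow> carrier (stalk (koszul_term N c d P m n (k - 1)) q)"
      using koszul_diff_hom[OF UZ[OF that] k, of n] unfolding module_hom_def by (elim CollectE conjE)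
    from funcset_mem[OF this sp[OF that]] that show ?thesis by simp
  qed
  show "?t \<in> sections (koszul_term N c d P m n (k - 1)) U"
    unfolding koszul_term_def sections_direct_sum
  proof (intro CollectI conjI ballI)
    show "?t \<in> (\<Pi>\<^sub>E p\<in>U. carrier (stalk (direct_sum_sheaf (koszul_index c (k - 1)) (\<lambda>I. ker_delta_X N c d P (m - (k - 1)) (sh n I))) p))"
      using tp unfolding koszul_term_def by (intro PiE_I) auto
    fix J assume J: "J \<in> koszul_index c (k - 1)"
    show "(\<lambda>p\<in>U. ?t p J) \<in> sections (ker_delta_X N c d P (m - (k - 1)) (sh n J)) U"
      unfolding sections_ker_X[OF openin_X_subset[OF U]]
    proof (rule coset_sectionsI)
      fix p assume p: "p \<in> U"
      from ex_ci_chart[OF UZ[OF p]] obtain r where ch: "ci_chart N c d P p r" ..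
      then interpret pc: ci_chart N c d P p r .
      have "\<forall>I\<in>koszul_index c k. \<exists>F. nearby N p (\<lambda>q. q \<in> Zl \<longrightarrow> q \<in> U \<and> F \<in> ker_delta N (m - k) (sh n I) q
          \<and> (\<lambda>p\<in>U. s p I) q = cs (Hc (m - k) (sh n I) q) F)"
        using coset_sectionsD(1)[OF sI p] by (intro ballI)
      from bchoice[OF this] obtain x where x: "\<forall>I\<in>koszul_index c k. nearby N p (\<lambda>q. q \<in> Zl \<longrightarrow> q \<in> U \<and> x I \<in> ker_delta N (m - k) (sh n I) q
          \<and> (\<lambda>p\<in>U. s p I) q = cs (Hc (m - k) (sh n I) q) (x I))" ..
      \<comment> \<open>There are finitely many summands, so one neighbourhood serves all the local
        representatives.\<close>
      have "nearby N p (\<lambda>q. \<forall>I\<in>koszul_index c k. q \<in> Zl \<longrightarrow> q \<in> U \<and> x I \<in> ker_delta N (m - k) (sh n I) q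
          \<and> (\<lambda>p\<in>U. s p I) q = cs (Hc (m - k) (sh n I) q) (x I))"
        by (rule nearby_ball[OF finite_koszul_index Zl_proj[OF UZ[OF p]]]) (rule bspec[OF x])
      from nearby_conj[OF this nearby_conj[OF pc.chart_nearby openin_X_nearby[OF U p]]]
      have "nearby N p (\<lambda>q. q \<in> Zl \<longrightarrow> q \<in> U \<and> koszul_map c (ci_chart.ak N d P r) x J \<in> ker_delta N (m - (k - 1)) (sh n J) q
          \<and> (\<lambda>p\<in>U. ?t p J) q = cs (Hc (m - (k - 1)) (sh n J) q) (koszul_map c (ci_chart.ak N d P r) x J))"
      proof (rule nearby_mono, intro impI)
        fix q assume q: "q \<in> Zl" and *: "(\<forall>I\<in>koszul_index c k. q \<in> Zl \<longrightarrow> q \<in> U \<and> x I \<in> ker_delta N (m - k) (sh n I) q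
          \<and> (\<lambda>p\<in>U. s p I) q = cs (Hc (m - k) (sh n I) q) (x I)) \<and> chart N q r \<and> (q \<in> Zl \<longrightarrow> q \<in> U)"
        then have qU: "q \<in> U" and chq: "ci_chart N c d P q r" using ci_chart by auto
        have xk: "\<forall>I\<in>koszul_index c k. x I \<in> ker_delta N (m - k) (sh n I) q"
          using * q by simp
        have "s q = (\<lambda>I\<in>koszul_index c k. cs (Hc (m - k) (sh n I) q) (x I))"
        proof (rule extensionalityI[of _ "koszul_index c k"])
          show "s q \<in> extensional (koszul_index c k)"
            using sp[OF qU] unfolding carrier_koszul_term[OF q] by (simp add: PiE_def)
          show "s q I = (\<lambda>I\<in>koszul_index c k. cs (Hc (m - k) (sh n I) q) (x I)) I" if "I \<in> koszul_index c k" for I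
            using * q qU that by simp
        qed simp
        then have "?t q = (\<lambda>J\<in>koszul_index c (k - 1). cs (Hc (m - (k - 1)) (sh n J) q) (koszul_map c (ci_chart.ak N d P r) x J))"
          using koszul_diff_cs'[OF chq q k xk] qU by simp
        then show "q \<in> U \<and> koszul_map c (ci_chart.ak N d P r) x J \<in> ker_delta N (m - (k - 1)) (sh n J) q
          \<and> (\<lambda>p\<in>U. ?t p J) q = cs (Hc (m - (k - 1)) (sh n J) q) (koszul_map c (ci_chart.ak N d P r) x J)"
          using koszul_diff_cs(2)[OF chq q k xk J] qU J by simp
      qed
      then show "\<exists>F. nearby N p (\<lambda>q. q \<in> Zl \<longrightarrow> q \<in> U \<and> F \<in> ker_delta N (m - (k - 1)) (sh n J) q
          \<and> (\<lambda>p\<in>U. ?t p J) q = cs (Hc (m - (k - 1)) (sh n J) q) F)" ..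
    qed simp
  qed
qed

section \<open>Exactness on stalks in positive degree\<close>

lemma zero_koszul_term:
  "p \<in> Zl \<Longrightarrow> \<zero>\<^bsub>stalk (koszul_term N c d P m n k) p\<^esub> = (\<lambda>I\<in>koszul_index c k. Hc (m - k) (sh n I) p)"
  unfolding koszul_term_def stalk_direct_sum by (auto simp: stalk_ker_X intro!: restrict_ext)

text \<open>Cycles are boundaries by \<open>koszul_stalk\<close>. Conversely, the differential
  formed with \<open>ak\<close> squares to zero exactly, and returning to \<alpha>(P_i) changes it
  only by the ideal.\<close>

theorem koszul_stalk_exact:
  assumes pZ: "p \<in> Zl" and k: "1 \<le> k" "k \<le> c" "c \<le> m"
  shows "(if k < c then koszul_diff N c d P m n (Suc k) p ` carrier (stalk (koszul_term N c d P m n (Suc k)) p)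
          else {\<zero>\<^bsub>stalk (koszul_term N c d P m n k) p\<^esub>})
    = {s\<in>carrier (stalk (koszul_term N c d P m n k) p). koszul_diff N c d P m n k p s = \<zero>\<^bsub>stalk (koszul_term N c d P m n (k - 1)) p\<^esub>}"
    (is "?im = ?ker")
proof -
  from ex_ci_chart[OF pZ] obtain r where ch: "ci_chart N c d P p r" ..
  interpret ci_chart N c d P p r by (rule ch)
  note dc = koszul_diff_cs(1)[OF ch pZ k]
  have eq0: "cs (H m' n') F = H m' n' \<longleftrightarrow> F \<in> H m' n'" for m' n' F by (rule cs_eq_self[OF addsub_H])
  have ker: "koszul_diff N c d P m n k p (\<lambda>I\<in>koszul_index c k. cs (H (m - k) (sh n I)) (x I)) = \<zero>\<^bsub>stalk (koszul_term N c d P m n (k - 1)) p\<^esub>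
      \<longleftrightarrow> (\<forall>J\<in>koszul_index c (k - 1). kosg x J \<in> H (m - (k - 1)) (sh n J))"
    if x: "\<forall>I\<in>koszul_index c k. x I \<in> kd (m - k) (sh n I)" for x
  proof -
    have "(\<lambda>J\<in>koszul_index c (k - 1). cs (H (m - (k - 1)) (sh n J)) (kosg x J)) = (\<lambda>J\<in>koszul_index c (k - 1). H (m - (k - 1)) (sh n J))
      \<longleftrightarrow> (\<forall>J\<in>koszul_index c (k - 1). cs (H (m - (k - 1)) (sh n J)) (kosg x J) = H (m - (k - 1)) (sh n J))"
      by (rule restrict_eq_iff)
    then show ?thesis
      unfolding dc[OF x] zero_koszul_term[OF pZ] by (simp only: eq0)
  qed
  show ?thesis
  proof (rule equalityI; rule subsetI)
    fix s assume s: "s \<in> ?ker"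
    then have "s \<in> carrier (stalk (koszul_term N c d P m n k) p)" by simp
    then obtain x where x: "\<forall>I\<in>koszul_index c k. x I \<in> kd (m - k) (sh n I)"
      and sx: "s = (\<lambda>I\<in>koszul_index c k. cs (H (m - k) (sh n I)) (x I))"
      by (rule koszul_term_elem[OF pZ])
    have cyc: "kosg x J \<in> H (m - (k - 1)) (sh n J)" if "J \<in> koszul_index c (k - 1)" for J
      using s ker[OF x] that unfolding sx by simp
    have "\<exists>y. (\<forall>I\<in>koszul_index c (Suc k). y I \<in> kd (m - Suc k) (sh n I)) \<and> (\<forall>J\<in>koszul_index c k. x J - kosg y J \<in> H (m - k) (sh n J))"
      by (rule koszul_stalk[OF k], erule bspec[OF x], erule cyc)
    then obtain y
      where y: "\<forall>I\<in>koszul_index c (Suc k). y I \<in> kd (m - Suc k) (sh n I)"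
      and xy: "\<forall>J\<in>koszul_index c k. x J - kosg y J \<in> H (m - k) (sh n J)" by (elim exE conjE) (rule that)
    show "s \<in> ?im"
    proof (cases "k < c")
      case True
      have "s = koszul_diff N c d P m n (Suc k) p (\<lambda>I\<in>koszul_index c (Suc k). cs (H (m - Suc k) (sh n I)) (y I))"
      proof -
        have Sk: "1 \<le> Suc k" "Suc k \<le> c" using True by auto
        have "(\<lambda>I\<in>koszul_index c k. cs (H (m - k) (sh n I)) (x I)) = (\<lambda>J\<in>koszul_index c k. cs (H (m - k) (sh n J)) (kosg y J))"
          by (rule restrict_ext) (simp add: cs_eq_iff[OF addsub_H] xy)
        then show ?thesis
          using koszul_diff_cs(1)[OF ch pZ Sk k(3) y] unfolding sx by (simp only: diff_Suc_1)
      qed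
      then show ?thesis
        using True koszul_term_elemI[OF pZ y] by simp
    next
      case False
      \<comment> \<open>For k = c the only index is the full set, to which nothing can be added. The
        bounding term is an empty sum, so the cycle is zero: injectivity at the left end.\<close>
      have "x J \<in> H (m - k) (sh n J)" if J: "J \<in> koszul_index c k" for J
      proof -
        have "J = {1..c}"
          using J False k by (intro card_subset_eq) (auto simp: koszul_index_def)
        then have "kosg y J = 0" by (simp add: koszul_map_def)
        with bspec[OF xy J] show ?thesis by simp
      qed
      then have "s = \<zero>\<^bsub>stalk (koszul_term N c d P m n k) p\<^esub>"
        unfolding sx zero_koszul_term[OF pZ] by (intro restrict_ext) (simp add: eq0)
      then show ?thesis using False by simp
    qed
  next
    fix s assume s: "s \<in> ?im"
    show "s \<in> ?ker"
    proof (cases "k < c")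
      case True
      with s obtain t where t: "t \<in> carrier (stalk (koszul_term N c d P m n (Suc k)) p)" "s = koszul_diff N c d P m n (Suc k) p t" by auto
      from t(1) obtain y where y: "\<forall>I\<in>koszul_index c (Suc k). y I \<in> kd (m - Suc k) (sh n I)"
        and ty: "t = (\<lambda>I\<in>koszul_index c (Suc k). cs (H (m - Suc k) (sh n I)) (y I))"
        by (rule koszul_term_elem[OF pZ])
      let ?x = "koszul_map c ak y"
      have Sk: "1 \<le> Suc k" "Suc k \<le> c" using True by auto
      have xk: "\<forall>J\<in>koszul_index c k. ?x J \<in> kd (m - k) (sh n J)"
        using koszul_diff_cs(2)[OF ch pZ Sk k(3) y] by simp
      have sx: "s = (\<lambda>I\<in>koszul_index c k. cs (H (m - k) (sh n I)) (?x I))"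
        unfolding t(2) ty using koszul_diff_cs'[OF ch pZ Sk k(3) y] by simp
      have "koszul_map c ak ?x J = 0" if "J \<in> koszul_index c (k - 1)" for J
        using that by (intro koszul_map_twice) (simp add: koszul_index_def)
      moreover have "koszul_map c ak ?x J - kosg ?x J \<in> H (m - (k - 1)) (sh n J)" if "J \<in> koszul_index c (k - 1)" for J
        by (rule koszul_diff_cs(3)[OF ch pZ k xk that])
      ultimately have "kosg ?x J \<in> H (m - (k - 1)) (sh n J)" if "J \<in> koszul_index c (k - 1)" for J
        using addsubD(3)[OF addsub_H] that by fastforce
      then show ?thesis
        using ker[OF xk] koszul_term_elemI[OF pZ xk] unfolding sx by simp
    next
      case False
      with s have s0: "s = (\<lambda>I\<in>koszul_index c k. cs (H (m - k) (sh n I)) 0)"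
        by (simp add: zero_koszul_term[OF pZ])
      have z: "\<forall>I\<in>koszul_index c k. (0 :: ratfun mpoly) \<in> kd (m - k) (sh n I)" using addsubD(1)[OF addsub_kd] by simp
      have "kosg (\<lambda>_. 0) J = 0" for J by (simp add: koszul_map_def)
      then show ?thesis
        using ker[of "\<lambda>_. 0", OF z] koszul_term_elemI[OF pZ, of k "\<lambda>_. 0" m n, OF z] addsubD(1)[OF addsub_H]
        unfolding s0 by simp
    qed
  qed
qed

end

section \<open>Modules given by generators and relations\<close>

lemma module_homD:
  assumes "h \<in> module_hom R M N"
  shows "x \<in> carrier M \<Longrightarrow> h x \<in> carrier N"
    and "x \<in> carrier M \<Longrightarrow> y \<in> carrier M \<Longrightarrow> h (x \<oplus>\<^bsub>M\<^esub> y) = h x \<oplus>\<^bsub>N\<^esub> h y"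
    and "a \<in> carrier R \<Longrightarrow> x \<in> carrier M \<Longrightarrow> h (a \<odot>\<^bsub>M\<^esub> x) = a \<odot>\<^bsub>N\<^esub> h x"
  using assms by (auto simp: module_hom_def)

lemma module_homI:
  assumes "\<And>x. x \<in> carrier M \<Longrightarrow> h x \<in> carrier N"
    and "\<And>x y. x \<in> carrier M \<Longrightarrow> y \<in> carrier M \<Longrightarrow> h (x \<oplus>\<^bsub>M\<^esub> y) = h x \<oplus>\<^bsub>N\<^esub> h y"
    and "\<And>a x. a \<in> carrier R \<Longrightarrow> x \<in> carrier M \<Longrightarrow> h (a \<odot>\<^bsub>M\<^esub> x) = a \<odot>\<^bsub>N\<^esub> h x"
  shows "h \<in> module_hom R M N"
  using assms by (auto simp: module_hom_def)

lemma module_hom_zero: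
  assumes "Module.module R M" "Module.module R N" "h \<in> module_hom R M N"
  shows "h \<zero>\<^bsub>M\<^esub> = \<zero>\<^bsub>N\<^esub>"
proof -
  interpret M: Module.module R M by fact
  interpret N: Module.module R N by fact
  have "h (\<zero>\<^bsub>R\<^esub> \<odot>\<^bsub>M\<^esub> \<zero>\<^bsub>M\<^esub>) = \<zero>\<^bsub>R\<^esub> \<odot>\<^bsub>N\<^esub> h \<zero>\<^bsub>M\<^esub>"
    by (rule module_homD(3)[OF assms(3)]) auto
  then show ?thesis using module_homD(1)[OF assms(3), of "\<zero>\<^bsub>M\<^esub>"] by simp
qed

lemma module_hom_minus:
  assumes "Module.module R M" "Module.module R N" "h \<in> module_hom R M N"
    and x: "x \<in> carrier M" "y \<in> carrier M"
  shows "h (x \<ominus>\<^bsub>M\<^esub> y) = h x \<ominus>\<^bsub>N\<^esub> h y"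
proof -
  interpret M: Module.module R M by fact
  interpret N: Module.module R N by fact
  have "h (\<ominus>\<^bsub>M\<^esub> y) \<oplus>\<^bsub>N\<^esub> h y = \<zero>\<^bsub>N\<^esub>"
    using x module_homD(2)[OF assms(3), of "\<ominus>\<^bsub>M\<^esub> y" y] module_hom_zero[OF assms(1-3)] by (simp add: M.M.l_neg)
  then have "\<ominus>\<^bsub>N\<^esub> h y = h (\<ominus>\<^bsub>M\<^esub> y)"
    using x by (intro N.M.minus_equality) (auto intro: module_homD(1)[OF assms(3)])
  then show ?thesis
    using x module_homD(2)[OF assms(3), of x "\<ominus>\<^bsub>M\<^esub> y"] by (simp add: a_minus_def)
qed

lemma module_hom_finsum:
  assumes "Module.module R M" "Module.module R N" "h \<in> module_hom R M N"
    and "finite T" "\<And>t. t \<in> T \<Longrightarrow> f t \<in> carrier M"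
  shows "h (\<Oplus>\<^bsub>M\<^esub>t\<in>T. f t) = (\<Oplus>\<^bsub>N\<^esub>t\<in>T. h (f t))"
  using assms(4,5)
proof (induction T)
  interpret M: Module.module R M by fact
  interpret N: Module.module R N by fact
  {
    case empty
    then show ?case using module_hom_zero[OF assms(1-3)] by simp
  next
    case (insert t T)
    have "(\<Oplus>\<^bsub>M\<^esub>t\<in>insert t T. f t) = f t \<oplus>\<^bsub>M\<^esub> (\<Oplus>\<^bsub>M\<^esub>t\<in>T. f t)"
      using insert by (intro M.M.finsum_insert) auto
    moreover have "(\<Oplus>\<^bsub>N\<^esub>t\<in>insert t T. h (f t)) = h (f t) \<oplus>\<^bsub>N\<^esub> (\<Oplus>\<^bsub>N\<^esub>t\<in>T. h (f t))"
      using insert by (intro N.M.finsum_insert) (auto intro: module_homD(1)[OF assms(3)])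
    moreover have "(\<Oplus>\<^bsub>M\<^esub>t\<in>T. f t) \<in> carrier M"
      using insert by (intro M.M.finsum_closed) auto
    ultimately show ?case using insert module_homD(2)[OF assms(3)] by simp
  }
qed

locale rmod = Module.module R M for R :: "'a ring" (structure) and M :: "('a, 'b) module" (structure)

lemma (in rmod) minus_eq_zero: "x \<in> carrier M \<Longrightarrow> y \<in> carrier M \<Longrightarrow> x \<ominus>\<^bsub>M\<^esub> y = \<zero>\<^bsub>M\<^esub> \<longleftrightarrow> x = y"
  unfolding a_minus_def by (metis M.minus_equality M.minus_minus M.r_neg M.a_inv_closed)

lemma (in rmod) submodule_kernel:
  assumes "Module.module R N" "h \<in> module_hom R M N"
  shows "submodule {x \<in> carrier M. h x = \<zero>\<^bsub>N\<^esub>} R M"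
proof -
  interpret N: rmod R N by (rule rmod.intro) fact
  have mod: "Module.module R M" by unfold_locales
  note z = module_hom_zero[OF mod assms]
  show ?thesis
  proof (rule submoduleI)
    fix x assume x: "x \<in> {x \<in> carrier M. h x = \<zero>\<^bsub>N\<^esub>}"
    have "h (\<zero>\<^bsub>M\<^esub> \<ominus>\<^bsub>M\<^esub> x) = \<zero>\<^bsub>N\<^esub>"
      using x module_hom_minus[OF mod assms M.zero_closed, of x] z N.minus_eq_zero by simp
    then show "\<ominus>\<^bsub>M\<^esub> x \<in> {x \<in> carrier M. h x = \<zero>\<^bsub>N\<^esub>}"
      using x by (simp add: a_minus_def)
  qed (use z module_homD[OF assms(2)] in auto)
qed

context rmod
begin

lemma span_submodule:
  assumes "S \<subseteq> carrier M"
  shows "submodule (span_submodule R M S) R M" "S \<subseteq> span_submodule R M S"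
    "\<And>H. submodule H R M \<Longrightarrow> S \<subseteq> H \<Longrightarrow> span_submodule R M S \<subseteq> H"
proof -
  have mod: "Module.module R M" by unfold_locales
  have "submodule (carrier M) R M"
    by (rule submoduleI) auto
  then have sub: "span_submodule R M S \<subseteq> carrier M"
    using assms unfolding span_submodule_def by blast
  show "submodule (span_submodule R M S) R M"
  proof (rule submoduleI[OF sub])
    show "\<zero>\<^bsub>M\<^esub> \<in> span_submodule R M S"
      unfolding span_submodule_def by (auto dest: subgroup.one_closed[OF submodule.axioms(1)])
    show "\<ominus>\<^bsub>M\<^esub> x \<in> span_submodule R M S" if "x \<in> span_submodule R M S" for x
      using that submoduleE(3) unfolding span_submodule_def by blast
    show "x \<oplus>\<^bsub>M\<^esub> y \<in> span_submodule R M S" if "x \<in> span_submodule R M S" "y \<in> span_submodule R M S" for x y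
      using that submoduleE(5) unfolding span_submodule_def by blast
    show "a \<odot>\<^bsub>M\<^esub> x \<in> span_submodule R M S" if "a \<in> carrier R" "x \<in> span_submodule R M S" for a x
      using that submoduleE(4) unfolding span_submodule_def by blast
  qed
  show "S \<subseteq> span_submodule R M S" unfolding span_submodule_def by blast
  show "span_submodule R M S \<subseteq> H" if "submodule H R M" "S \<subseteq> H" for H
    using that unfolding span_submodule_def by blast
qed

lemma abelian_subgroup_submodule: "submodule H R M \<Longrightarrow> abelian_subgroup H M"
  by (rule abelian_subgroupI3[OF additive_subgroup.intro[OF submodule.axioms(1)] M.abelian_group_axioms])

lemma rcos_eq_iff:
  assumes H: "submodule H R M" and x: "x \<in> carrier M" "y \<in> carrier M"
  shows "H +>\<^bsub>M\<^esub> x = H +>\<^bsub>M\<^esub> y \<longleftrightarrow> x \<ominus>\<^bsub>M\<^esub> y \<in> H"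
proof -
  interpret H: abelian_subgroup H M by (rule abelian_subgroup_submodule[OF H])
  have xy: "x \<in> H +>\<^bsub>M\<^esub> y \<longleftrightarrow> x \<ominus>\<^bsub>M\<^esub> y \<in> H"
    using H.a_rcos_module[OF x(2,1)] by (simp add: a_minus_def)
  show ?thesis
  proof
    assume "H +>\<^bsub>M\<^esub> x = H +>\<^bsub>M\<^esub> y"
    then show "x \<ominus>\<^bsub>M\<^esub> y \<in> H" using H.a_rcos_self[OF x(1)] xy by simp
  next
    assume "x \<ominus>\<^bsub>M\<^esub> y \<in> H"
    then show "H +>\<^bsub>M\<^esub> x = H +>\<^bsub>M\<^esub> y" using xy H.a_repr_independence'[OF _ x(2)] by simp
  qed
qed

lemma quot_module_simps:
  assumes H: "submodule H R M"
  shows "carrier (quot_module M H) = (\<lambda>x. H +>\<^bsub>M\<^esub> x) ` carrier M"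
    and "x \<in> carrier M \<Longrightarrow> y \<in> carrier M \<Longrightarrow> (H +>\<^bsub>M\<^esub> x) \<oplus>\<^bsub>quot_module M H\<^esub> (H +>\<^bsub>M\<^esub> y) = H +>\<^bsub>M\<^esub> (x \<oplus>\<^bsub>M\<^esub> y)"
    and "a \<in> carrier R \<Longrightarrow> x \<in> carrier M \<Longrightarrow> a \<odot>\<^bsub>quot_module M H\<^esub> (H +>\<^bsub>M\<^esub> x) = H +>\<^bsub>M\<^esub> (a \<odot>\<^bsub>M\<^esub> x)"
    and "\<zero>\<^bsub>quot_module M H\<^esub> = H +>\<^bsub>M\<^esub> \<zero>\<^bsub>M\<^esub>"
proof -
  interpret H: abelian_subgroup H M by (rule abelian_subgroup_submodule[OF H])
  show "carrier (quot_module M H) = (\<lambda>x. H +>\<^bsub>M\<^esub> x) ` carrier M"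
    by (auto simp: quot_module_def A_RCOSETS_defs a_r_coset_def[symmetric])
  show "x \<in> carrier M \<Longrightarrow> y \<in> carrier M \<Longrightarrow> (H +>\<^bsub>M\<^esub> x) \<oplus>\<^bsub>quot_module M H\<^esub> (H +>\<^bsub>M\<^esub> y) = H +>\<^bsub>M\<^esub> (x \<oplus>\<^bsub>M\<^esub> y)"
    using H.a_rcos_sum by (simp add: quot_module_def)
  show "\<zero>\<^bsub>quot_module M H\<^esub> = H +>\<^bsub>M\<^esub> \<zero>\<^bsub>M\<^esub>"
    using H.a_subset M.a_coset_add_zero by (simp add: quot_module_def)
  assume a: "a \<in> carrier R" and x: "x \<in> carrier M"
  have eq: "H +>\<^bsub>M\<^esub> (a \<odot>\<^bsub>M\<^esub> y) = H +>\<^bsub>M\<^esub> (a \<odot>\<^bsub>M\<^esub> x)" if y: "y \<in> H +>\<^bsub>M\<^esub> x" for y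
  proof -
    from y obtain h where h: "h \<in> H" "y = h \<oplus>\<^bsub>M\<^esub> x" by (auto simp: a_r_coset_def r_coset_def)
    have hM: "h \<in> carrier M" using h(1) H.a_subset by blast
    have "a \<odot>\<^bsub>M\<^esub> y \<ominus>\<^bsub>M\<^esub> a \<odot>\<^bsub>M\<^esub> x = a \<odot>\<^bsub>M\<^esub> h"
      using a x hM h(2) by (simp add: smult_r_distr a_minus_def M.a_assoc M.r_neg)
    then show ?thesis
      using a x hM h submoduleE(4)[OF H] by (subst rcos_eq_iff[OF H]) auto
  qed
  have "a \<odot>\<^bsub>quot_module M H\<^esub> (H +>\<^bsub>M\<^esub> x) = (\<Union>y\<in>H +>\<^bsub>M\<^esub> x. H +>\<^bsub>M\<^esub> (a \<odot>\<^bsub>M\<^esub> y))"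
    by (simp add: quot_module_def)
  also have "\<dots> = (\<Union>y\<in>H +>\<^bsub>M\<^esub> x. H +>\<^bsub>M\<^esub> (a \<odot>\<^bsub>M\<^esub> x))"
    by (intro SUP_cong refl eq)
  also have "\<dots> = H +>\<^bsub>M\<^esub> (a \<odot>\<^bsub>M\<^esub> x)"
    using H.a_rcos_self[OF x] by blast
  finally show "a \<odot>\<^bsub>quot_module M H\<^esub> (H +>\<^bsub>M\<^esub> x) = H +>\<^bsub>M\<^esub> (a \<odot>\<^bsub>M\<^esub> x)" .
qed

lemma module_quot:
  assumes H: "submodule H R M"
  shows "Module.module R (quot_module M H)"
proof -
  note qs = quot_module_simps[OF H]
  show ?thesis
  proof (rule moduleI[OF is_cring abelian_groupI])
    fix x assume "x \<in> carrier (quot_module M H)"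
    then obtain v where v: "v \<in> carrier M" "x = H +>\<^bsub>M\<^esub> v" by (auto simp: qs(1))
    then have "(H +>\<^bsub>M\<^esub> \<ominus>\<^bsub>M\<^esub> v) \<oplus>\<^bsub>quot_module M H\<^esub> x = \<zero>\<^bsub>quot_module M H\<^esub>"
      by (simp add: qs M.l_neg)
    with v show "\<exists>y\<in>carrier (quot_module M H). y \<oplus>\<^bsub>quot_module M H\<^esub> x = \<zero>\<^bsub>quot_module M H\<^esub>"
      by (intro bexI[of _ "H +>\<^bsub>M\<^esub> \<ominus>\<^bsub>M\<^esub> v"]) (auto simp: qs(1))
  qed (auto simp: qs M.a_assoc M.a_comm M.a_lcomm smult_l_distr smult_r_distr smult_assoc1)
qed

lemma quot_hom:
  assumes H: "submodule H R M" and N: "Module.module R N" and h: "h \<in> module_hom R M N"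
    and null: "\<And>x. x \<in> H \<Longrightarrow> h x = \<zero>\<^bsub>N\<^esub>"
  shows "\<exists>g\<in>module_hom R (quot_module M H) N. \<forall>x\<in>carrier M. g (H +>\<^bsub>M\<^esub> x) = h x"
proof -
  interpret N: rmod R N by (rule rmod.intro) fact
  note qs = quot_module_simps[OF H]
  have mod: "Module.module R M" by unfold_locales
  define g where "g C = h (SOME x. x \<in> carrier M \<and> C = H +>\<^bsub>M\<^esub> x)" for C
  have g: "g (H +>\<^bsub>M\<^esub> x) = h x" if x: "x \<in> carrier M" for x
  proof -
    let ?y = "SOME y. y \<in> carrier M \<and> H +>\<^bsub>M\<^esub> x = H +>\<^bsub>M\<^esub> y"
    have y: "?y \<in> carrier M \<and> H +>\<^bsub>M\<^esub> x = H +>\<^bsub>M\<^esub> ?y"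
      by (rule someI[of _ x]) (simp add: x)
    then have "x \<ominus>\<^bsub>M\<^esub> ?y \<in> H" using rcos_eq_iff[OF H x, of ?y] by simp
    then have "h x \<ominus>\<^bsub>N\<^esub> h ?y = \<zero>\<^bsub>N\<^esub>"
      using null module_hom_minus[OF mod N h x, of ?y] y by simp
    then have "h x = h ?y"
      using N.minus_eq_zero[OF module_homD(1)[OF h x] module_homD(1)[OF h conjunct1[OF y]]] by simp
    then show ?thesis by (simp only: g_def)
  qed
  have "g \<in> module_hom R (quot_module M H) N"
    by (rule module_homI) (auto simp: qs g module_homD[OF h])
  with g show ?thesis by blast
qed

end

section \<open>Free modules\<close>

lemma free_module_simps:
  "\<zero>\<^bsub>free_module R A\<^esub> = (\<lambda>_. \<zero>\<^bsub>R\<^esub>)" "f \<oplus>\<^bsub>free_module R A\<^esub> g = (\<lambda>b. f b \<oplus>\<^bsub>R\<^esub> g b)"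
  "a \<odot>\<^bsub>free_module R A\<^esub> f = (\<lambda>b. a \<otimes>\<^bsub>R\<^esub> f b)"
  by (simp_all add: free_module_def)

lemma free_module_carrier:
  "f \<in> carrier (free_module R A) \<longleftrightarrow> (\<forall>b. f b \<in> carrier R) \<and> finite {b. f b \<noteq> \<zero>\<^bsub>R\<^esub>} \<and> {b. f b \<noteq> \<zero>\<^bsub>R\<^esub>} \<subseteq> A"
  by (simp add: free_module_def)

locale rcring = cring R for R :: "'a ring" (structure)
begin

lemma module_free: "Module.module R (free_module R A)"
proof (rule moduleI[OF is_cring abelian_groupI])
  fix f g assume f: "f \<in> carrier (free_module R A)" and g: "g \<in> carrier (free_module R A)"
  have "{b. f b \<oplus> g b \<noteq> \<zero>} \<subseteq> {b. f b \<noteq> \<zero>} \<union> {b. g b \<noteq> \<zero>}" by auto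
  then show "f \<oplus>\<^bsub>free_module R A\<^esub> g \<in> carrier (free_module R A)"
    using f g by (auto simp: free_module_carrier free_module_simps intro: finite_subset)
next
  fix f assume f: "f \<in> carrier (free_module R A)"
  have fb: "f b \<in> carrier R" for b using f by (simp add: free_module_carrier)
  have "{b. \<ominus> f b \<noteq> \<zero>} \<subseteq> {b. f b \<noteq> \<zero>}" by auto
  then have "(\<lambda>b. \<ominus> f b) \<in> carrier (free_module R A)"
    using f by (auto simp: free_module_carrier intro: finite_subset)
  then show "\<exists>g\<in>carrier (free_module R A). g \<oplus>\<^bsub>free_module R A\<^esub> f = \<zero>\<^bsub>free_module R A\<^esub>"
    using fb by (intro bexI[of _ "\<lambda>b. \<ominus> f b"]) (simp_all add: free_module_simps l_neg)
next
  fix a f assume a: "a \<in> carrier R" and f: "f \<in> carrier (free_module R A)"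
  have "{b. a \<otimes> f b \<noteq> \<zero>} \<subseteq> {b. f b \<noteq> \<zero>}" using a by auto
  then show "a \<odot>\<^bsub>free_module R A\<^esub> f \<in> carrier (free_module R A)"
    using a f by (auto simp: free_module_carrier free_module_simps intro: finite_subset)
qed (auto simp: free_module_carrier free_module_simps a_assoc a_comm a_lcomm l_distr r_distr m_assoc)

lemma free_gen_carrier: "b \<in> A \<Longrightarrow> free_gen R b \<in> carrier (free_module R A)"
proof -
  assume "b \<in> A"
  moreover have "{b'. free_gen R b b' \<noteq> \<zero>} \<subseteq> {b}" by (auto simp: free_gen_def)
  ultimately show ?thesis
    by (auto simp: free_module_carrier free_gen_def intro: finite_subset)
qed

lemma free_generated:
  assumes H: "submodule H R (free_module R A)" and gen: "\<And>b. b \<in> A \<Longrightarrow> free_gen R b \<in> H"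
  shows "carrier (free_module R A) \<subseteq> H"
proof
  interpret F: Module.module R "free_module R A" by (rule module_free)
  fix f assume "f \<in> carrier (free_module R A)"
  then have f: "\<And>b. f b \<in> carrier R" "finite {b. f b \<noteq> \<zero>}" "{b. f b \<noteq> \<zero>} \<subseteq> A"
    by (auto simp: free_module_carrier)
  have "(\<lambda>b. if b \<in> S then f b else \<zero>) \<in> H" if "finite S" "S \<subseteq> A" for S
    using that
  proof (induction S)
    case empty
    then show ?case using F.submoduleE(2,4)[OF H] subgroup.one_closed[OF submodule.axioms(1)[OF H]] by (simp add: free_module_simps)
  next
    case (insert x S)
    have "f x \<odot>\<^bsub>free_module R A\<^esub> free_gen R x \<oplus>\<^bsub>free_module R A\<^esub> (\<lambda>b. if b \<in> S then f b else \<zero>) \<in> H"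
      using insert gen f(1) by (intro F.submoduleE(5)[OF H] F.submoduleE(4)[OF H]) auto
    moreover have "f x \<odot>\<^bsub>free_module R A\<^esub> free_gen R x \<oplus>\<^bsub>free_module R A\<^esub> (\<lambda>b. if b \<in> S then f b else \<zero>) = (\<lambda>b. if b \<in> insert x S then f b else \<zero>)"
      using insert.hyps f(1) by (auto simp: free_module_simps free_gen_def)
    ultimately show ?case by simp
  qed
  from this[OF f(2,3)] have "(\<lambda>b. if b \<in> {b. f b \<noteq> \<zero>} then f b else \<zero>) \<in> H" .
  moreover have "(\<lambda>b. if b \<in> {b. f b \<noteq> \<zero>} then f b else \<zero>) = f" by auto
  ultimately show "f \<in> H" by (simp only:)
qed

lemma free_universal:
  assumes N: "Module.module R N" and g: "\<And>b. b \<in> A \<Longrightarrow> g b \<in> carrier N"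
  shows "\<exists>h\<in>module_hom R (free_module R A) N. \<forall>b\<in>A. h (free_gen R b) = g b"
proof -
  interpret N: rmod R N by (rule rmod.intro) fact
  define h where "h f = (\<Oplus>\<^bsub>N\<^esub>b\<in>{b. f b \<noteq> \<zero>}. f b \<odot>\<^bsub>N\<^esub> g b)" for f
  \<comment> \<open>The sum may run over any finite subset of \<open>A\<close> that contains the
    support, so that two functions can be compared over a common set.\<close>
  have h: "h f = (\<Oplus>\<^bsub>N\<^esub>b\<in>S. f b \<odot>\<^bsub>N\<^esub> g b)"
    if "f \<in> carrier (free_module R A)" "finite S" "S \<subseteq> A" "{b. f b \<noteq> \<zero>} \<subseteq> S" for f S
    unfolding h_def using that g
    by (intro N.M.add.finprod_mono_neutral_cong_left) (auto simp: free_module_carrier subset_iff)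
  have "h \<in> module_hom R (free_module R A) N"
  proof (rule module_homI)
    interpret F: Module.module R "free_module R A" by (rule module_free)
    fix f assume f: "f \<in> carrier (free_module R A)"
    show "h f \<in> carrier N"
      unfolding h_def using f g by (intro N.M.finsum_closed) (auto simp: free_module_carrier subset_iff)
    {
      fix f' assume f': "f' \<in> carrier (free_module R A)"
      let ?S = "{b. f b \<noteq> \<zero>} \<union> {b. f' b \<noteq> \<zero>}"
      have S: "finite ?S" "?S \<subseteq> A" using f f' by (auto simp: free_module_carrier)
      have c: "f b \<odot>\<^bsub>N\<^esub> g b \<in> carrier N" "f' b \<odot>\<^bsub>N\<^esub> g b \<in> carrier N" if "b \<in> ?S" for b
        using f f' g S that by (auto simp: free_module_carrier subset_iff)
      have "{b. (f \<oplus>\<^bsub>free_module R A\<^esub> f') b \<noteq> \<zero>} \<subseteq> ?S" by (auto simp: free_module_simps)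
      then have "h (f \<oplus>\<^bsub>free_module R A\<^esub> f') = (\<Oplus>\<^bsub>N\<^esub>b\<in>?S. (f \<oplus>\<^bsub>free_module R A\<^esub> f') b \<odot>\<^bsub>N\<^esub> g b)"
        using f f' S by (intro h) auto
      also have "\<dots> = (\<Oplus>\<^bsub>N\<^esub>b\<in>?S. f b \<odot>\<^bsub>N\<^esub> g b \<oplus>\<^bsub>N\<^esub> f' b \<odot>\<^bsub>N\<^esub> g b)"
        using f f' g S c by (intro N.M.finsum_cong') (auto simp: free_module_carrier free_module_simps subset_iff intro!: N.smult_l_distr)
      also have "\<dots> = (\<Oplus>\<^bsub>N\<^esub>b\<in>?S. f b \<odot>\<^bsub>N\<^esub> g b) \<oplus>\<^bsub>N\<^esub> (\<Oplus>\<^bsub>N\<^esub>b\<in>?S. f' b \<odot>\<^bsub>N\<^esub> g b)"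
        using c by (intro N.M.finsum_addf) auto
      also have "\<dots> = h f \<oplus>\<^bsub>N\<^esub> h f'" using h[OF f S] h[OF f' S] by simp
      finally show "h (f \<oplus>\<^bsub>free_module R A\<^esub> f') = h f \<oplus>\<^bsub>N\<^esub> h f'" .
    }
    fix a assume a: "a \<in> carrier R"
    let ?S = "{b. f b \<noteq> \<zero>}"
    have S: "finite ?S" "?S \<subseteq> A" using f by (auto simp: free_module_carrier)
    have c: "f b \<odot>\<^bsub>N\<^esub> g b \<in> carrier N" if "b \<in> ?S" for b
      using f g S that by (auto simp: free_module_carrier subset_iff)
    have "{b. (a \<odot>\<^bsub>free_module R A\<^esub> f) b \<noteq> \<zero>} \<subseteq> ?S" using a by (auto simp: free_module_simps)
    then have "h (a \<odot>\<^bsub>free_module R A\<^esub> f) = (\<Oplus>\<^bsub>N\<^esub>b\<in>?S. (a \<odot>\<^bsub>free_module R A\<^esub> f) b \<odot>\<^bsub>N\<^esub> g b)"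
      using a f S by (intro h) auto
    also have "\<dots> = (\<Oplus>\<^bsub>N\<^esub>b\<in>?S. a \<odot>\<^bsub>N\<^esub> (f b \<odot>\<^bsub>N\<^esub> g b))"
      using a f g S c by (intro N.M.finsum_cong') (auto simp: free_module_carrier free_module_simps subset_iff intro!: N.smult_assoc1)
    also have "\<dots> = a \<odot>\<^bsub>N\<^esub> h f"
      unfolding h_def using a S c by (intro N.finsum_smult_ldistr[symmetric]) auto
    finally show "h (a \<odot>\<^bsub>free_module R A\<^esub> f) = a \<odot>\<^bsub>N\<^esub> h f" .
  qed
  moreover have "h (free_gen R b) = g b" if b: "b \<in> A" for b
  proof -
    have "h (free_gen R b) = (\<Oplus>\<^bsub>N\<^esub>b'\<in>{b}. free_gen R b b' \<odot>\<^bsub>N\<^esub> g b')"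
      using b by (intro h free_gen_carrier) (auto simp: free_gen_def)
    also have "\<dots> = g b" using g[OF b] by (simp add: free_gen_def)
    finally show ?thesis .
  qed
  ultimately show ?thesis by blast
qed

end

text \<open>The common form of Kaehler modules, symmetric powers and tensor products: a free module
  modulo the span of relations. What is used of it is generation by the classes of the basis and the
  universal property.\<close>

locale presented = R: rcring R for R :: "'a ring" (structure) +
  fixes A :: "'b set" and rel :: "('b \<Rightarrow> 'a) set"
  assumes rel: "rel \<subseteq> carrier (free_module R A)"
begin

abbreviation "F \<equiv> free_module R A"
abbreviation "Null \<equiv> span_submodule R F rel"
abbreviation "Q \<equiv> quot_module F Null"
abbreviation "pc f \<equiv> Null +>\<^bsub>F\<^esub> f"
abbreviation "gen b \<equiv> pc (free_gen R b)"

sublocale F: rmod R F by (rule rmod.intro[OF R.module_free])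

lemma Null: "submodule Null R F" "rel \<subseteq> Null"
  using F.span_submodule[OF rel] by auto

sublocale Q: rmod R Q by (rule rmod.intro[OF F.module_quot[OF Null(1)]])

lemma module_Q: "Module.module R Q"
  by (unfold_locales)

lemmas cos_simps = F.quot_module_simps[OF Null(1)]

lemma cos_hom: "pc \<in> module_hom R F Q"
  by (rule module_homI) (auto simp: cos_simps)

lemma gen_closed: "b \<in> A \<Longrightarrow> gen b \<in> carrier Q"
  by (rule module_homD(1)[OF cos_hom R.free_gen_carrier])

lemma pc_rel: "x \<ominus>\<^bsub>F\<^esub> y \<in> rel \<Longrightarrow> x \<in> carrier F \<Longrightarrow> y \<in> carrier F \<Longrightarrow> pc x = pc y"
  using F.rcos_eq_iff[OF Null(1), of x y] Null(2) by blast

lemma pc_rel0: "x \<in> rel \<Longrightarrow> pc x = \<zero>\<^bsub>Q\<^esub>"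
proof -
  assume x: "x \<in> rel"
  then have "x \<in> carrier F" using rel by blast
  moreover have "x \<ominus>\<^bsub>F\<^esub> \<zero>\<^bsub>F\<^esub> = x"
    using \<open>x \<in> carrier F\<close> F.M.minus_equality[of "\<zero>\<^bsub>F\<^esub>" "\<zero>\<^bsub>F\<^esub>"] by (simp add: a_minus_def)
  ultimately show ?thesis using pc_rel[of x "\<zero>\<^bsub>F\<^esub>"] x by (simp add: cos_simps(4))
qed

text \<open>The elements of the free module whose class lies in \<open>K\<close> form a submodule
  containing the basis.\<close>

lemma generated:
  assumes K: "submodule K R Q" and gen: "\<And>b. b \<in> A \<Longrightarrow> gen b \<in> K"
  shows "carrier Q \<subseteq> K"
proof -
  let ?H = "{f \<in> carrier F. pc f \<in> K}"
  have "submodule ?H R F"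
  proof (rule F.submoduleI)
    show "\<zero>\<^bsub>F\<^esub> \<in> ?H"
      using subgroup.one_closed[OF submodule.axioms(1)[OF K]] by (simp add: cos_simps(4)[symmetric])
    fix a assume a: "a \<in> ?H"
    have "pc (\<ominus>\<^bsub>F\<^esub> a) = \<ominus>\<^bsub>Q\<^esub> pc a"
      using a by (intro Q.M.minus_equality[symmetric]) (auto simp: cos_simps F.M.l_neg)
    then show "\<ominus>\<^bsub>F\<^esub> a \<in> ?H" using a Q.submoduleE(3)[OF K] by simp
    show "a \<oplus>\<^bsub>F\<^esub> b \<in> ?H" if "b \<in> ?H" for b
      using a that Q.submoduleE(5)[OF K, of "pc a" "pc b"] by (simp add: cos_simps)
    show "r \<odot>\<^bsub>F\<^esub> a \<in> ?H" if "r \<in> carrier R" for r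
      using a that Q.submoduleE(4)[OF K, of r "pc a"] by (simp add: cos_simps)
  qed auto
  then have "carrier F \<subseteq> ?H"
    by (rule R.free_generated) (use gen R.free_gen_carrier in auto)
  then show ?thesis by (auto simp: cos_simps(1))
qed

text \<open>The condition \<open>null\<close> is stated for every linear extension of
  \<open>g\<close>, so that it can be verified on the relations without knowing which extension is
  chosen.\<close>

lemma universal:
  assumes N: "Module.module R N" and g: "\<And>b. b \<in> A \<Longrightarrow> g b \<in> carrier N"
    and null: "\<And>h x. h \<in> module_hom R F N \<Longrightarrow> (\<And>b. b \<in> A \<Longrightarrow> h (free_gen R b) = g b) \<Longrightarrow> x \<in> rel \<Longrightarrow> h x = \<zero>\<^bsub>N\<^esub>"
  shows "\<exists>h\<in>module_hom R Q N. \<forall>b\<in>A. h (gen b) = g b"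
proof -
  have "\<exists>h\<in>module_hom R F N. \<forall>b\<in>A. h (free_gen R b) = g b"
    by (rule R.free_universal[OF N], erule g)
  then obtain h where h: "h \<in> module_hom R F N" and hg: "\<forall>b\<in>A. h (free_gen R b) = g b"
    by (elim bexE) (rule that)
  have "rel \<subseteq> {x \<in> carrier F. h x = \<zero>\<^bsub>N\<^esub>}"
  proof
    fix x assume x: "x \<in> rel"
    have "h x = \<zero>\<^bsub>N\<^esub>" by (rule null[OF h _ x]) (use hg in simp)
    then show "x \<in> {x \<in> carrier F. h x = \<zero>\<^bsub>N\<^esub>}" using x rel by auto
  qed
  from F.span_submodule(3)[OF rel F.submodule_kernel[OF N h] this]
  have nullN: "h x = \<zero>\<^bsub>N\<^esub>" if "x \<in> Null" for x using that by auto
  have "\<exists>k\<in>module_hom R Q N. \<forall>x\<in>carrier F. k (pc x) = h x"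
    by (rule F.quot_hom[OF Null(1) N h], erule nullN)
  then obtain k where k: "k \<in> module_hom R Q N" "\<forall>x\<in>carrier F. k (pc x) = h x"
    by (elim bexE) (rule that)
  show ?thesis
  proof (rule bexI[OF _ k(1)], rule ballI)
    fix b assume b: "b \<in> A"
    show "k (gen b) = g b"
      using bspec[OF k(2) R.free_gen_carrier[OF b]] bspec[OF hg b] by (rule trans)
  qed
qed

end

lemma (in rmod) submodule_vimage:
  assumes "Module.module R N" "h \<in> module_hom R M N" "submodule K R N"
  shows "submodule {x \<in> carrier M. h x \<in> K} R M"
proof -
  interpret N: rmod R N by (rule rmod.intro) fact
  have mod: "Module.module R M" by unfold_locales
  have z: "h \<zero>\<^bsub>M\<^esub> \<in> K"
    using subgroup.one_closed[OF submodule.axioms(1)[OF assms(3)]] module_hom_zero[OF mod assms(1,2)] by simp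
  show ?thesis
  proof (rule submoduleI)
    fix x assume x: "x \<in> {x \<in> carrier M. h x \<in> K}"
    have "h (\<zero>\<^bsub>M\<^esub> \<ominus>\<^bsub>M\<^esub> x) = \<ominus>\<^bsub>N\<^esub> h x"
      using x module_hom_minus[OF mod assms(1,2) M.zero_closed, of x] module_hom_zero[OF mod assms(1,2)] module_homD(1)[OF assms(2)]
      by (simp add: a_minus_def)
    then show "\<ominus>\<^bsub>M\<^esub> x \<in> {x \<in> carrier M. h x \<in> K}"
      using x N.submoduleE(3)[OF assms(3)] by (simp add: a_minus_def)
  qed (use z module_homD[OF assms(2)] N.submoduleE[OF assms(3)] in auto)
qed

context presented
begin

lemma rel_add:
  "x \<ominus>\<^bsub>F\<^esub> (y \<oplus>\<^bsub>F\<^esub> z) \<in> rel \<Longrightarrow> x \<in> carrier F \<Longrightarrow> y \<in> carrier F \<Longrightarrow> z \<in> carrier F \<Longrightarrow> pc x = pc y \<oplus>\<^bsub>Q\<^esub> pc z"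
  using pc_rel[of x "y \<oplus>\<^bsub>F\<^esub> z"] by (simp add: cos_simps)

lemma rel_smult:
  "x \<ominus>\<^bsub>F\<^esub> (a \<odot>\<^bsub>F\<^esub> y) \<in> rel \<Longrightarrow> a \<in> carrier R \<Longrightarrow> x \<in> carrier F \<Longrightarrow> y \<in> carrier F \<Longrightarrow> pc x = a \<odot>\<^bsub>Q\<^esub> pc y"
  using pc_rel[of x "a \<odot>\<^bsub>F\<^esub> y"] by (simp add: cos_simps)

end

lemma (in rmod) hom_null:
  assumes "Module.module R N" "h \<in> module_hom R M N" "x \<in> carrier M" "y \<in> carrier M" "h x = h y"
  shows "h (x \<ominus>\<^bsub>M\<^esub> y) = \<zero>\<^bsub>N\<^esub>"
proof -
  interpret N: rmod R N by (rule rmod.intro) fact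
  have mod: "Module.module R M" by unfold_locales
  show ?thesis
    using module_hom_minus[OF mod assms(1-4)] N.minus_eq_zero[of "h x" "h y"] assms module_homD(1)[OF assms(2)] by simp
qed

section \<open>Differentials, symmetric powers and tensor products\<close>

locale kaehler_mod = rcring B for B :: "'a ring" (structure) + fixes k :: "'a set"
  assumes k: "k \<subseteq> carrier B"
begin

sublocale pk: presented B "carrier B" "kaehler_relations B k"
proof
  interpret F: rmod B "free_module B (carrier B)" by (rule rmod.intro[OF module_free])
  show "kaehler_relations B k \<subseteq> carrier (free_module B (carrier B))"
    unfolding kaehler_relations_def Let_def
    using k by (auto intro!: F.M.minus_closed F.M.a_closed F.smult_closed free_gen_carrier)
qed

abbreviation "\<Omega> \<equiv> kaehler B k"
abbreviation "d b \<equiv> kaehler_d B k b"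

lemma kaehler_eq: "\<Omega> = pk.Q" and d_eq: "d b = pk.gen b"
  by (simp_all add: kaehler_def kaehler_d_def kaehler_null_def)

lemma module_kaehler: "Module.module B \<Omega>"
  unfolding kaehler_eq by (rule pk.module_Q)

lemma d_closed: "b \<in> carrier B \<Longrightarrow> d b \<in> carrier \<Omega>"
  unfolding kaehler_eq d_eq by (rule pk.gen_closed)

lemma d_add:
  assumes "a \<in> carrier B" "b \<in> carrier B" shows "d (a \<oplus> b) = d a \<oplus>\<^bsub>\<Omega>\<^esub> d b"
  unfolding kaehler_eq d_eq
  by (rule pk.rel_add) (use assms in \<open>auto simp: kaehler_relations_def Let_def intro!: free_gen_carrier\<close>)

lemma d_mult:
  assumes "a \<in> carrier B" "b \<in> carrier B" shows "d (a \<otimes> b) = a \<odot>\<^bsub>\<Omega>\<^esub> d b \<oplus>\<^bsub>\<Omega>\<^esub> b \<odot>\<^bsub>\<Omega>\<^esub> d a"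
proof -
  note c = free_gen_carrier[of _ "carrier B"]
  have "pk.gen (a \<otimes> b) = pk.pc (a \<odot>\<^bsub>pk.F\<^esub> free_gen B b) \<oplus>\<^bsub>pk.Q\<^esub> pk.pc (b \<odot>\<^bsub>pk.F\<^esub> free_gen B a)"
    by (rule pk.rel_add)
      (use assms c in \<open>auto simp: kaehler_relations_def Let_def intro!: pk.F.smult_closed\<close>)
  then show ?thesis
    unfolding kaehler_eq d_eq using assms c by (simp add: pk.cos_simps(3))
qed

lemma d_const: "a \<in> k \<Longrightarrow> d a = \<zero>\<^bsub>\<Omega>\<^esub>"
  unfolding kaehler_eq d_eq by (rule pk.pc_rel0) (auto simp: kaehler_relations_def Let_def)

lemma kaehler_generated: "submodule K B \<Omega> \<Longrightarrow> (\<And>b. b \<in> carrier B \<Longrightarrow> d b \<in> K) \<Longrightarrow> carrier \<Omega> \<subseteq> K"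
  unfolding kaehler_eq d_eq by (rule pk.generated)

lemma kaehler_universal:
  assumes N: "Module.module B N" and g: "\<And>b. b \<in> carrier B \<Longrightarrow> g b \<in> carrier N"
    and add: "\<And>a b. a \<in> carrier B \<Longrightarrow> b \<in> carrier B \<Longrightarrow> g (a \<oplus> b) = g a \<oplus>\<^bsub>N\<^esub> g b"
    and mult: "\<And>a b. a \<in> carrier B \<Longrightarrow> b \<in> carrier B \<Longrightarrow> g (a \<otimes> b) = a \<odot>\<^bsub>N\<^esub> g b \<oplus>\<^bsub>N\<^esub> b \<odot>\<^bsub>N\<^esub> g a"
    and const: "\<And>a. a \<in> k \<Longrightarrow> g a = \<zero>\<^bsub>N\<^esub>"
  shows "\<exists>h\<in>module_hom B \<Omega> N. \<forall>b\<in>carrier B. h (d b) = g b"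
  unfolding kaehler_eq d_eq
proof (rule pk.universal[OF N g])
  note c = free_gen_carrier[of _ "carrier B"]
  fix h x assume h: "h \<in> module_hom B pk.F N" and hg: "\<And>b. b \<in> carrier B \<Longrightarrow> h (free_gen B b) = g b"
    and "x \<in> kaehler_relations B k"
  then consider (add) a b where "a \<in> carrier B" "b \<in> carrier B"
      "x = free_gen B (a \<oplus> b) \<ominus>\<^bsub>pk.F\<^esub> (free_gen B a \<oplus>\<^bsub>pk.F\<^esub> free_gen B b)"
    | (mult) a b where "a \<in> carrier B" "b \<in> carrier B"
      "x = free_gen B (a \<otimes> b) \<ominus>\<^bsub>pk.F\<^esub> (a \<odot>\<^bsub>pk.F\<^esub> free_gen B b \<oplus>\<^bsub>pk.F\<^esub> b \<odot>\<^bsub>pk.F\<^esub> free_gen B a)"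
    | (const) a where "a \<in> k" "x = free_gen B a"
    unfolding kaehler_relations_def Let_def by blast
  then show "h x = \<zero>\<^bsub>N\<^esub>"
  proof cases
    case add
    show ?thesis unfolding add(3)
      by (rule pk.F.hom_null[OF N h]) (use add(1,2) c assms(3) in \<open>auto simp: module_homD[OF h] hg\<close>)
  next
    case mult
    show ?thesis unfolding mult(3)
      by (rule pk.F.hom_null[OF N h]) (use mult(1,2) c assms(4) in \<open>auto simp: module_homD[OF h] hg\<close>)
  next
    case const
    then show ?thesis using hg k assms(5) by auto
  qed
qed

end

section \<open>Symmetric powers\<close>

locale sym_mod = rcring R + M: rmod R M for R :: "'a ring" (structure) and M :: "('a, 'b) module" (structure) +
  fixes m :: nat
begin

abbreviation "gens \<equiv> sym_gens M m"

lemma gens_update: "xs \<in> gens \<Longrightarrow> x \<in> carrier M \<Longrightarrow> xs[i := x] \<in> gens"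
  unfolding sym_gens_def using set_update_subset_insert[of xs i x] by auto

lemma gens_mset: "xs \<in> gens \<Longrightarrow> mset xs = mset ys \<Longrightarrow> ys \<in> gens"
  unfolding sym_gens_def by (auto dest: mset_eq_length mset_eq_setD)

sublocale ps: presented R gens "sym_relations R M m"
proof
  interpret F: rmod R "free_module R gens" by (rule rmod.intro[OF module_free])
  show "sym_relations R M m \<subseteq> carrier (free_module R gens)"
    unfolding sym_relations_def Let_def
    by (auto intro!: F.M.minus_closed F.M.a_closed F.smult_closed free_gen_carrier gens_update M.smult_closed M.M.a_closed)
qed

abbreviation "S \<equiv> sym_module R M m"
abbreviation "sp xs \<equiv> sym_product R M m xs"

lemma sym_eq: "S = ps.Q" and sp_eq: "sp xs = ps.gen xs"
  by (simp_all add: sym_module_def sym_product_def sym_null_def)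

lemma module_sym: "Module.module R S"
  unfolding sym_eq by (rule ps.module_Q)

lemma sp_closed: "xs \<in> gens \<Longrightarrow> sp xs \<in> carrier S"
  unfolding sym_eq sp_eq by (rule ps.gen_closed)

lemma sp_add:
  assumes "xs \<in> gens" "i < m" "x \<in> carrier M" "y \<in> carrier M"
  shows "sp (xs[i := x \<oplus>\<^bsub>M\<^esub> y]) = sp (xs[i := x]) \<oplus>\<^bsub>S\<^esub> sp (xs[i := y])"
  unfolding sym_eq sp_eq
proof (rule ps.rel_add)
  show "free_gen R (xs[i := x \<oplus>\<^bsub>M\<^esub> y]) \<ominus>\<^bsub>ps.F\<^esub> (free_gen R (xs[i := x]) \<oplus>\<^bsub>ps.F\<^esub> free_gen R (xs[i := y])) \<in> sym_relations R M m"
    unfolding sym_relations_def Let_def using assms by blast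
qed (use assms in \<open>auto intro!: free_gen_carrier gens_update\<close>)

lemma sp_smult:
  assumes "xs \<in> gens" "i < m" "a \<in> carrier R" "x \<in> carrier M"
  shows "sp (xs[i := a \<odot>\<^bsub>M\<^esub> x]) = a \<odot>\<^bsub>S\<^esub> sp (xs[i := x])"
  unfolding sym_eq sp_eq
proof (rule ps.rel_smult)
  show "free_gen R (xs[i := a \<odot>\<^bsub>M\<^esub> x]) \<ominus>\<^bsub>ps.F\<^esub> a \<odot>\<^bsub>ps.F\<^esub> free_gen R (xs[i := x]) \<in> sym_relations R M m"
    unfolding sym_relations_def Let_def using assms by blast
qed (use assms in \<open>auto intro!: free_gen_carrier gens_update\<close>)

lemma sp_mset:
  assumes "xs \<in> gens" "mset xs = mset ys"
  shows "sp xs = sp ys"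
  unfolding sp_eq
proof (rule ps.pc_rel)
  show "free_gen R xs \<ominus>\<^bsub>ps.F\<^esub> free_gen R ys \<in> sym_relations R M m"
    unfolding sym_relations_def Let_def using assms gens_mset by blast
qed (use assms gens_mset in \<open>auto intro!: free_gen_carrier\<close>)

text \<open>Linearity in one slot allows statements on symmetric products to be reduced one factor
  at a time.\<close>

lemma sp_slot_hom: "xs \<in> gens \<Longrightarrow> i < m \<Longrightarrow> (\<lambda>x. sp (xs[i := x])) \<in> module_hom R M S"
  by (rule module_homI) (auto simp: sp_add sp_smult intro: sp_closed gens_update)

lemma sym_generated: "submodule K R S \<Longrightarrow> (\<And>xs. xs \<in> gens \<Longrightarrow> sp xs \<in> K) \<Longrightarrow> carrier S \<subseteq> K"
  unfolding sym_eq sp_eq by (rule ps.generated)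

lemma sym_universal:
  assumes N: "Module.module R N" and g: "\<And>xs. xs \<in> gens \<Longrightarrow> g xs \<in> carrier N"
    and add: "\<And>xs i x y. xs \<in> gens \<Longrightarrow> i < m \<Longrightarrow> x \<in> carrier M \<Longrightarrow> y \<in> carrier M \<Longrightarrow>
      g (xs[i := x \<oplus>\<^bsub>M\<^esub> y]) = g (xs[i := x]) \<oplus>\<^bsub>N\<^esub> g (xs[i := y])"
    and smult: "\<And>xs i a x. xs \<in> gens \<Longrightarrow> i < m \<Longrightarrow> a \<in> carrier R \<Longrightarrow> x \<in> carrier M \<Longrightarrow>
      g (xs[i := a \<odot>\<^bsub>M\<^esub> x]) = a \<odot>\<^bsub>N\<^esub> g (xs[i := x])"
    and perm: "\<And>xs ys. xs \<in> gens \<Longrightarrow> ys \<in> gens \<Longrightarrow> mset xs = mset ys \<Longrightarrow> g xs = g ys"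
  shows "\<exists>h\<in>module_hom R S N. \<forall>xs\<in>gens. h (sp xs) = g xs"
  unfolding sym_eq sp_eq
proof (rule ps.universal[OF N g])
  note c = free_gen_carrier[of _ gens]
  fix h x assume h: "h \<in> module_hom R ps.F N" and hg: "\<And>b. b \<in> gens \<Longrightarrow> h (free_gen R b) = g b"
    and "x \<in> sym_relations R M m"
  then consider (add) xs i u v where "xs \<in> gens" "i < m" "u \<in> carrier M" "v \<in> carrier M"
      "x = free_gen R (xs[i := u \<oplus>\<^bsub>M\<^esub> v]) \<ominus>\<^bsub>ps.F\<^esub> (free_gen R (xs[i := u]) \<oplus>\<^bsub>ps.F\<^esub> free_gen R (xs[i := v]))"
    | (smult) xs i a u where "xs \<in> gens" "i < m" "a \<in> carrier R" "u \<in> carrier M"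
      "x = free_gen R (xs[i := a \<odot>\<^bsub>M\<^esub> u]) \<ominus>\<^bsub>ps.F\<^esub> (a \<odot>\<^bsub>ps.F\<^esub> free_gen R (xs[i := u]))"
    | (perm) xs ys where "xs \<in> gens" "ys \<in> gens" "mset xs = mset ys" "x = free_gen R xs \<ominus>\<^bsub>ps.F\<^esub> free_gen R ys"
    unfolding sym_relations_def Let_def by blast
  then show "h x = \<zero>\<^bsub>N\<^esub>"
  proof cases
    case add
    then have "xs[i := u] \<in> gens" "xs[i := v] \<in> gens" "xs[i := u \<oplus>\<^bsub>M\<^esub> v] \<in> gens" by (auto intro!: gens_update)
    then show ?thesis unfolding add(5)
      by (intro ps.F.hom_null[OF N h]) (use add(1-4) c assms(3) in \<open>auto simp: module_homD[OF h] hg\<close>)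
  next
    case smult
    then have "xs[i := u] \<in> gens" "xs[i := a \<odot>\<^bsub>M\<^esub> u] \<in> gens" by (auto intro!: gens_update)
    then show ?thesis unfolding smult(5)
      by (intro ps.F.hom_null[OF N h]) (use smult(1-4) c assms(4) in \<open>auto simp: module_homD[OF h] hg\<close>)
  next
    case perm
    then show ?thesis unfolding perm(4)
      by (intro ps.F.hom_null[OF N h] c) (simp_all add: hg assms(5)[OF perm(1-3)])
  qed
qed

end

section \<open>Tensor products\<close>

locale tensor_mod = rcring R + M: rmod R M + N: rmod R N
  for R :: "'a ring" (structure) and M :: "('a, 'b) module" and N :: "('a, 'c) module"
begin

sublocale pt: presented R "carrier M \<times> carrier N" "tensor_relations R M N"
proof
  interpret F: rmod R "free_module R (carrier M \<times> carrier N)" by (rule rmod.intro[OF module_free])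
  show "tensor_relations R M N \<subseteq> carrier (free_module R (carrier M \<times> carrier N))"
    unfolding tensor_relations_def Let_def
    by (auto intro!: F.M.minus_closed F.M.a_closed F.smult_closed free_gen_carrier)
qed

abbreviation "T \<equiv> tensor_module R M N"
abbreviation "te x y \<equiv> tensor_elem R M N x y"

lemma tensor_eq: "T = pt.Q" and te_eq: "te x y = pt.gen (x, y)"
  by (simp_all add: tensor_module_def tensor_elem_def tensor_null_def)

lemma module_tensor: "Module.module R T"
  unfolding tensor_eq by (rule pt.module_Q)

lemma te_closed: "x \<in> carrier M \<Longrightarrow> y \<in> carrier N \<Longrightarrow> te x y \<in> carrier T"
  unfolding tensor_eq te_eq by (rule pt.gen_closed) simp

lemma te_hom_left:
  assumes y: "y \<in> carrier N" shows "(\<lambda>x. te x y) \<in> module_hom R M T"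
  unfolding tensor_eq te_eq
proof (rule module_homI)
  fix x assume x: "x \<in> carrier M"
  show "pt.gen (x, y) \<in> carrier pt.Q" using x y by (intro pt.gen_closed) simp
  show "pt.gen (x \<oplus>\<^bsub>M\<^esub> x', y) = pt.gen (x, y) \<oplus>\<^bsub>pt.Q\<^esub> pt.gen (x', y)" if x': "x' \<in> carrier M" for x'
  proof (rule pt.rel_add)
    show "free_gen R (x \<oplus>\<^bsub>M\<^esub> x', y) \<ominus>\<^bsub>pt.F\<^esub> (free_gen R (x, y) \<oplus>\<^bsub>pt.F\<^esub> free_gen R (x', y)) \<in> tensor_relations R M N"
      unfolding tensor_relations_def Let_def using x y x' by blast
  qed (use x y x' in \<open>auto intro!: free_gen_carrier\<close>)
  show "pt.gen (a \<odot>\<^bsub>M\<^esub> x, y) = a \<odot>\<^bsub>pt.Q\<^esub> pt.gen (x, y)" if a: "a \<in> carrier R" for a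
  proof (rule pt.rel_smult)
    show "free_gen R (a \<odot>\<^bsub>M\<^esub> x, y) \<ominus>\<^bsub>pt.F\<^esub> a \<odot>\<^bsub>pt.F\<^esub> free_gen R (x, y) \<in> tensor_relations R M N"
      unfolding tensor_relations_def Let_def using x y a by blast
  qed (use x y a in \<open>auto intro!: free_gen_carrier\<close>)
qed

lemma te_smult_right:
  assumes x: "x \<in> carrier M" and y: "y \<in> carrier N" and a: "a \<in> carrier R"
  shows "te x (a \<odot>\<^bsub>N\<^esub> y) = a \<odot>\<^bsub>T\<^esub> te x y"
  unfolding tensor_eq te_eq
proof (rule pt.rel_smult)
  show "free_gen R (x, a \<odot>\<^bsub>N\<^esub> y) \<ominus>\<^bsub>pt.F\<^esub> a \<odot>\<^bsub>pt.F\<^esub> free_gen R (x, y) \<in> tensor_relations R M N"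
    unfolding tensor_relations_def Let_def using x y a by blast
qed (use x y a in \<open>auto intro!: free_gen_carrier\<close>)

lemma tensor_generated:
  assumes "submodule K R T" "\<And>x y. x \<in> carrier M \<Longrightarrow> y \<in> carrier N \<Longrightarrow> te x y \<in> K"
  shows "carrier T \<subseteq> K"
  using assms unfolding tensor_eq te_eq by (intro pt.generated) auto

lemma tensor_universal:
  assumes Q: "Module.module R Q" and g: "\<And>x y. x \<in> carrier M \<Longrightarrow> y \<in> carrier N \<Longrightarrow> g x y \<in> carrier Q"
    and hom: "\<And>y. y \<in> carrier N \<Longrightarrow> (\<lambda>x. g x y) \<in> module_hom R M Q"
    and hom': "\<And>x. x \<in> carrier M \<Longrightarrow> (\<lambda>y. g x y) \<in> module_hom R N Q"
  shows "\<exists>h\<in>module_hom R T Q. \<forall>x\<in>carrier M. \<forall>y\<in>carrier N. h (te x y) = g x y"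
proof -
  have "\<exists>h\<in>module_hom R pt.Q Q. \<forall>b\<in>carrier M \<times> carrier N. h (pt.gen b) = (case b of (x, y) \<Rightarrow> g x y)"
  proof (rule pt.universal[OF Q])
    show "(case b of (x, y) \<Rightarrow> g x y) \<in> carrier Q" if "b \<in> carrier M \<times> carrier N" for b using g that by auto
    note c = free_gen_carrier[of _ "carrier M \<times> carrier N"]
    fix h x assume h: "h \<in> module_hom R pt.F Q"
      and hg: "\<And>b. b \<in> carrier M \<times> carrier N \<Longrightarrow> h (free_gen R b) = (case b of (x, y) \<Rightarrow> g x y)"
      and x: "x \<in> tensor_relations R M N"
    have a1: "h (free_gen R (u \<oplus>\<^bsub>M\<^esub> u', v) \<ominus>\<^bsub>pt.F\<^esub> (free_gen R (u, v) \<oplus>\<^bsub>pt.F\<^esub> free_gen R (u', v))) = \<zero>\<^bsub>Q\<^esub>"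
      if "u \<in> carrier M" "u' \<in> carrier M" "v \<in> carrier N" for u u' v
      by (rule pt.F.hom_null[OF Q h]) (use that c module_homD(2)[OF hom] in \<open>auto simp: module_homD[OF h] hg\<close>)
    have a2: "h (free_gen R (u, v \<oplus>\<^bsub>N\<^esub> v') \<ominus>\<^bsub>pt.F\<^esub> (free_gen R (u, v) \<oplus>\<^bsub>pt.F\<^esub> free_gen R (u, v'))) = \<zero>\<^bsub>Q\<^esub>"
      if "u \<in> carrier M" "v \<in> carrier N" "v' \<in> carrier N" for u v v'
      by (rule pt.F.hom_null[OF Q h]) (use that c module_homD(2)[OF hom'] in \<open>auto simp: module_homD[OF h] hg\<close>)
    have s1: "h (free_gen R (a \<odot>\<^bsub>M\<^esub> u, v) \<ominus>\<^bsub>pt.F\<^esub> (a \<odot>\<^bsub>pt.F\<^esub> free_gen R (u, v))) = \<zero>\<^bsub>Q\<^esub>"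
      if "a \<in> carrier R" "u \<in> carrier M" "v \<in> carrier N" for a u v
      by (rule pt.F.hom_null[OF Q h]) (use that c module_homD(3)[OF hom] in \<open>auto simp: module_homD[OF h] hg\<close>)
    have s2: "h (free_gen R (u, a \<odot>\<^bsub>N\<^esub> v) \<ominus>\<^bsub>pt.F\<^esub> (a \<odot>\<^bsub>pt.F\<^esub> free_gen R (u, v))) = \<zero>\<^bsub>Q\<^esub>"
      if "a \<in> carrier R" "u \<in> carrier M" "v \<in> carrier N" for a u v
      by (rule pt.F.hom_null[OF Q h]) (use that c module_homD(3)[OF hom'] in \<open>auto simp: module_homD[OF h] hg\<close>)
    from x show "h x = \<zero>\<^bsub>Q\<^esub>"
      unfolding tensor_relations_def Let_def
      by (elim UnE CollectE exE conjE) (simp_all only: a1 a2 s1 s2)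
  qed
  then obtain h where h: "h \<in> module_hom R pt.Q Q"
    "\<forall>b\<in>carrier M \<times> carrier N. h (pt.gen b) = (case b of (x, y) \<Rightarrow> g x y)"
    by (elim bexE) (rule that)
  have "h (pt.gen (x, y)) = g x y" if "x \<in> carrier M" "y \<in> carrier N" for x y
    using bspec[OF h(2), of "(x, y)"] that by simp
  then show ?thesis unfolding tensor_eq te_eq by (intro bexI[OF _ h(1)] ballI)
qed

end

section \<open>Linear combinations and derivations\<close>

lemma module_hom_comp:
  "g \<in> module_hom R M N \<Longrightarrow> h \<in> module_hom R N Q \<Longrightarrow> (\<lambda>x. h (g x)) \<in> module_hom R M Q"
  by (auto simp: module_hom_def Pi_def)

context coset_ring
begin

text \<open>The coefficients are taken in \<open>A\<close> and not in the quotient ring, so that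
  they can be computed as germs.\<close>

definition lc :: "('a set, 'c) module \<Rightarrow> 't set \<Rightarrow> ('t \<Rightarrow> 'c) \<Rightarrow> ('t \<Rightarrow> 'a) \<Rightarrow> 'c" where
  "lc M T v a = (\<Oplus>\<^bsub>M\<^esub>t\<in>T. cs J (a t) \<odot>\<^bsub>M\<^esub> v t)"

lemma cs_B: "x \<in> A \<Longrightarrow> cs J x \<in> carrier B"
  by (simp add: B_carrier)

context
  fixes M :: "('a set, 'c) module" and T :: "'t set" and v :: "'t \<Rightarrow> 'c"
  assumes M: "Module.module B M" and T: "finite T" and v_all: "\<forall>t\<in>T. v t \<in> carrier M"
begin

lemmas lc_v = bspec[OF v_all]

interpretation M: Module.module B M by (rule M)

lemma lc_term: "t \<in> T \<Longrightarrow> x \<in> A \<Longrightarrow> cs J x \<odot>\<^bsub>M\<^esub> v t \<in> carrier M"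
  using lc_v cs_B by simp

lemma lc_closed: "(\<And>t. t \<in> T \<Longrightarrow> a t \<in> A) \<Longrightarrow> lc M T v a \<in> carrier M"
  unfolding lc_def by (rule M.M.finsum_closed) (use lc_term in auto)

lemma lc_add:
  assumes "\<And>t. t \<in> T \<Longrightarrow> a t \<in> A" "\<And>t. t \<in> T \<Longrightarrow> b t \<in> A"
  shows "lc M T v (\<lambda>t. a t + b t) = lc M T v a \<oplus>\<^bsub>M\<^esub> lc M T v b"
proof -
  have "lc M T v (\<lambda>t. a t + b t) = (\<Oplus>\<^bsub>M\<^esub>t\<in>T. cs J (a t) \<odot>\<^bsub>M\<^esub> v t \<oplus>\<^bsub>M\<^esub> cs J (b t) \<odot>\<^bsub>M\<^esub> v t)"
    unfolding lc_def using assms lc_v lc_term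
    by (intro M.M.finsum_cong') (auto simp: B_add[symmetric] M.smult_l_distr cs_B)
  also have "\<dots> = lc M T v a \<oplus>\<^bsub>M\<^esub> lc M T v b"
    unfolding lc_def using assms lc_term by (intro M.M.finsum_addf) auto
  finally show ?thesis .
qed

lemma lc_smult:
  assumes "x \<in> A" "\<And>t. t \<in> T \<Longrightarrow> a t \<in> A"
  shows "lc M T v (\<lambda>t. x * a t) = cs J x \<odot>\<^bsub>M\<^esub> lc M T v a"
proof -
  have "lc M T v (\<lambda>t. x * a t) = (\<Oplus>\<^bsub>M\<^esub>t\<in>T. cs J x \<odot>\<^bsub>M\<^esub> (cs J (a t) \<odot>\<^bsub>M\<^esub> v t))"
    unfolding lc_def using assms lc_v lc_term A(3)
    by (intro M.M.finsum_cong') (auto simp: B_mult[symmetric] M.smult_assoc1 cs_B)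
  also have "\<dots> = cs J x \<odot>\<^bsub>M\<^esub> lc M T v a"
    unfolding lc_def using assms lc_term T cs_B by (intro M.finsum_smult_ldistr[symmetric]) auto
  finally show ?thesis .
qed

text \<open>Coefficients matter only modulo \<open>J\<close>, and not at all at vanishing vectors.
  The second point takes care of dx_r and of the monomials containing Y_r.\<close>

lemma lc_cong:
  assumes "\<And>t. t \<in> T \<Longrightarrow> a t \<in> A" "\<And>t. t \<in> T \<Longrightarrow> b t \<in> A"
    and "\<And>t. t \<in> T \<Longrightarrow> v t \<noteq> \<zero>\<^bsub>M\<^esub> \<Longrightarrow> a t - b t \<in> J"
  shows "lc M T v a = lc M T v b"
proof -
  have "cs J (a t) \<odot>\<^bsub>M\<^esub> v t = cs J (b t) \<odot>\<^bsub>M\<^esub> v t" if "t \<in> T" for t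
  proof (cases "v t = \<zero>\<^bsub>M\<^esub>")
    case True
    then show ?thesis using assms(1,2)[OF that] cs_B by simp
  next
    case False
    then have "cs J (a t) = cs J (b t)" using assms(3)[OF that] by (simp add: cs_eq_iff[OF J(1)])
    then show ?thesis by simp
  qed
  then show ?thesis
    unfolding lc_def using lc_term assms by (intro M.M.finsum_cong') auto
qed

lemma lc_zero: "lc M T v (\<lambda>_. 0) = \<zero>\<^bsub>M\<^esub>"
proof -
  have "lc M T v (\<lambda>_. 0) = (\<Oplus>\<^bsub>M\<^esub>t\<in>T. \<zero>\<^bsub>M\<^esub>)"
    unfolding lc_def using lc_v M.smult_l_null by (intro M.M.finsum_cong') (auto simp: B_zero)
  then show ?thesis by simp
qed

lemma lc_null:
  assumes "\<And>t. t \<in> T \<Longrightarrow> a t \<in> J"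
  shows "lc M T v a = \<zero>\<^bsub>M\<^esub>"
  using lc_cong[of a "\<lambda>_. 0"] assms J(2) addsubD(1)[OF A(1)] lc_zero by auto

lemma lc_single:
  assumes s: "s \<in> T" and x: "x \<in> A"
  shows "lc M T v (\<lambda>t. if t = s then x else 0) = cs J x \<odot>\<^bsub>M\<^esub> v s"
proof -
  have "lc M T v (\<lambda>t. if t = s then x else 0) = (\<Oplus>\<^bsub>M\<^esub>t\<in>T. if s = t then cs J x \<odot>\<^bsub>M\<^esub> v t else \<zero>\<^bsub>M\<^esub>)"
    unfolding lc_def using lc_v x lc_term M.smult_l_null
    by (intro M.M.finsum_cong') (auto simp: B_zero)
  also have "\<dots> = cs J x \<odot>\<^bsub>M\<^esub> v s"
    using s T x lc_term by (intro M.M.finsum_singleton) auto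
  finally show ?thesis .
qed

lemma lc_hom:
  assumes N: "Module.module B N" and h: "h \<in> module_hom B M N" and a: "\<And>t. t \<in> T \<Longrightarrow> a t \<in> A"
  shows "h (lc M T v a) = lc N T (\<lambda>t. h (v t)) a"
proof -
  interpret N: Module.module B N by (rule N)
  have "h (lc M T v a) = (\<Oplus>\<^bsub>N\<^esub>t\<in>T. h (cs J (a t) \<odot>\<^bsub>M\<^esub> v t))"
    unfolding lc_def using lc_term a by (intro module_hom_finsum[OF M N h T]) auto
  also have "\<dots> = lc N T (\<lambda>t. h (v t)) a"
    unfolding lc_def using a lc_v cs_B module_homD[OF h]
    by (intro N.M.finsum_cong') auto
  finally show ?thesis .
qed

lemma lc_submodule:
  assumes K: "submodule K B M" and vK: "\<And>t. t \<in> T \<Longrightarrow> v t \<in> K" and a: "\<And>t. t \<in> T \<Longrightarrow> a t \<in> A"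
  shows "lc M T v a \<in> K"
proof -
  have "(\<Oplus>\<^bsub>M\<^esub>t\<in>S. cs J (a t) \<odot>\<^bsub>M\<^esub> v t) \<in> K" if "finite S" "S \<subseteq> T" for S
    using that
  proof (induction S)
    case empty
    then show ?case using subgroup.one_closed[OF submodule.axioms(1)[OF K]] by simp
  next
    case (insert t S)
    have "(\<Oplus>\<^bsub>M\<^esub>t\<in>insert t S. cs J (a t) \<odot>\<^bsub>M\<^esub> v t) = cs J (a t) \<odot>\<^bsub>M\<^esub> v t \<oplus>\<^bsub>M\<^esub> (\<Oplus>\<^bsub>M\<^esub>t\<in>S. cs J (a t) \<odot>\<^bsub>M\<^esub> v t)"
      using insert lc_term a by (intro M.M.finsum_insert) auto
    moreover have "cs J (a t) \<odot>\<^bsub>M\<^esub> v t \<in> K"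
      using insert vK a cs_B by (intro M.submoduleE(4)[OF K]) auto
    ultimately show ?case
      using insert M.submoduleE(5)[OF K] by simp
  qed
  from this[OF T] show ?thesis unfolding lc_def by simp
qed

lemma lc_reindex:
  assumes "finite I" and s: "\<And>i. i \<in> I \<Longrightarrow> s i \<in> T" and a: "\<And>i. i \<in> I \<Longrightarrow> a i \<in> A"
  shows "lc M T v (\<lambda>t. \<Sum>i\<in>I. if t = s i then a i else 0) = lc M I (\<lambda>i. v (s i)) a"
  using assms
proof (induction I)
  case empty
  then show ?case using lc_zero by (simp add: lc_def)
next
  case (insert i I)
  have A0: "(if t = s j then a j else 0) \<in> A" if "j \<in> insert i I" for j t
    using insert.prems(2)[OF that] addsubD(1)[OF A(1)] by simp
  have "lc M T v (\<lambda>t. \<Sum>i\<in>insert i I. if t = s i then a i else 0)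
    = lc M T v (\<lambda>t. (if t = s i then a i else 0) + (\<Sum>i\<in>I. if t = s i then a i else 0))"
    using insert.hyps by simp
  also have "\<dots> = lc M T v (\<lambda>t. if t = s i then a i else 0) \<oplus>\<^bsub>M\<^esub> lc M T v (\<lambda>t. \<Sum>i\<in>I. if t = s i then a i else 0)"
    using A0 by (intro lc_add addsub_sum[OF A(1)]) auto
  also have "\<dots> = cs J (a i) \<odot>\<^bsub>M\<^esub> v (s i) \<oplus>\<^bsub>M\<^esub> lc M I (\<lambda>i. v (s i)) a"
    using insert by (simp add: lc_single)
  also have "\<dots> = lc M (insert i I) (\<lambda>i. v (s i)) a"
    unfolding lc_def using insert lc_term by (intro M.M.finsum_insert[symmetric]) auto
  finally show ?case .
qed

end

end

section \<open>Derivations of the local ring\<close>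

context ci_point
begin

text \<open>Derivations of the local ring of projective space, with values in a module over the
  local ring of X. Functions are thus differentiated before they are restricted to X.\<close>

definition der :: "(ratfun set, 'c) module \<Rightarrow> (ratfun \<Rightarrow> 'c) \<Rightarrow> bool" where
  "der M \<delta> \<longleftrightarrow> (\<forall>f\<in>germs 0. \<delta> f \<in> carrier M)
     \<and> (\<forall>f\<in>germs 0. \<forall>g\<in>germs 0. \<delta> (f + g) = \<delta> f \<oplus>\<^bsub>M\<^esub> \<delta> g)
     \<and> (\<forall>f\<in>germs 0. \<forall>g\<in>germs 0. \<delta> (f * g) = cs (J 0) f \<odot>\<^bsub>M\<^esub> \<delta> g \<oplus>\<^bsub>M\<^esub> cs (J 0) g \<odot>\<^bsub>M\<^esub> \<delta> f)"

lemma derD: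
  assumes "der M \<delta>"
  shows "f \<in> germs 0 \<Longrightarrow> \<delta> f \<in> carrier M"
    and "f \<in> germs 0 \<Longrightarrow> g \<in> germs 0 \<Longrightarrow> \<delta> (f + g) = \<delta> f \<oplus>\<^bsub>M\<^esub> \<delta> g"
    and "f \<in> germs 0 \<Longrightarrow> g \<in> germs 0 \<Longrightarrow> \<delta> (f * g) = cs (J 0) f \<odot>\<^bsub>M\<^esub> \<delta> g \<oplus>\<^bsub>M\<^esub> cs (J 0) g \<odot>\<^bsub>M\<^esub> \<delta> f"
  using assms by (simp_all add: der_def)

lemma csB: "f \<in> germs 0 \<Longrightarrow> cs (J 0) f \<in> carrier B"
  by (rule cs_B)

end

context ci_chart
begin

text \<open>The local ring is a localisation of the polynomials in x_j = X_j/X_r. Equality spreads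
  from constants and coordinates to monomials, then to forms divided by a power of X_r, then to
  quotients of these.\<close>

lemma der_eq:
  assumes M: "Module.module B M" and D: "der M \<delta>" and D': "der M \<delta>'"
    and const: "\<And>z. \<delta> (fr (cst z)) = \<delta>' (fr (cst z))"
    and xs: "\<And>j. j \<le> N \<Longrightarrow> \<delta> (x_germ j) = \<delta>' (x_germ j)" and f: "f \<in> germs 0"
  shows "\<delta> f = \<delta>' f"
proof -
  interpret M: Module.module B M by (rule M)
  note DD = derD[OF D] and DD' = derD[OF D']
  have mult: "\<delta> (f * g) = \<delta>' (f * g)" if "f \<in> germs 0" "g \<in> germs 0" "\<delta> f = \<delta>' f" "\<delta> g = \<delta>' g" for f g
    using that DD(3) DD'(3) by simp
  have X: "fr (var r) ^ e \<noteq> 0" for e using X_nz by simp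
  have mon: "fr (prod_list (map var js)) / X ^ length js \<in> germs 0
      \<and> \<delta> (fr (prod_list (map var js)) / X ^ length js) = \<delta>' (fr (prod_list (map var js)) / X ^ length js)"
    if "set js \<subseteq> {..N}" for js
    using that
  proof (induction js)
    case Nil
    show ?case using const[of 1] germs_1 by simp
  next
    case (Cons j js)
    have eq: "fr (prod_list (map var (j # js))) / X ^ length (j # js) = x_germ j * (fr (prod_list (map var js)) / X ^ length js)"
      by (simp add: fr_mult)
    show ?case unfolding eq
      using Cons by (intro conjI mult germs_mult0 x_germ xs) auto
  qed
  have form: "fr a / X ^ e \<in> germs 0 \<and> \<delta> (fr a / X ^ e) = \<delta>' (fr a / X ^ e)" if a: "a \<in> hpoly N e" for a e
  proof -
    have "(fr (\<Sum>t\<in>S. Poly_Mapping.single t (Poly_Mapping.lookup a t)) / X ^ e) \<in> germs 0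
        \<and> \<delta> (fr (\<Sum>t\<in>S. Poly_Mapping.single t (Poly_Mapping.lookup a t)) / X ^ e) = \<delta>' (fr (\<Sum>t\<in>S. Poly_Mapping.single t (Poly_Mapping.lookup a t)) / X ^ e)"
      if "finite S" "S \<subseteq> Poly_Mapping.keys a" for S
      using that
    proof (induction S)
      case empty
      show ?case using const[of 0] by simp
    next
      case (insert t S)
      have t: "Poly_Mapping.keys t \<subseteq> {..N}" "mdeg t = e" using insert a by (auto simp: hpoly_def)
      define mt where "mt = fr (prod_list (map var (mlist t))) / X ^ length (mlist t)"
      have m: "mt \<in> germs 0 \<and> \<delta> mt = \<delta>' mt" unfolding mt_def by (rule mon) (simp add: set_mlist t)
      have "Poly_Mapping.single t (Poly_Mapping.lookup a t) = cst (Poly_Mapping.lookup a t) * prod_list (map var (mlist t))"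
        by (simp add: prod_list_var expo_mlist mult_single)
      then have eq: "fr (\<Sum>t\<in>insert t S. Poly_Mapping.single t (Poly_Mapping.lookup a t)) / X ^ e
        = fr (cst (Poly_Mapping.lookup a t)) * mt + fr (\<Sum>t\<in>S. Poly_Mapping.single t (Poly_Mapping.lookup a t)) / X ^ e"
        using insert.hyps t by (simp add: fr_add fr_mult mt_def length_mlist add_divide_distrib)
      have "fr (cst (Poly_Mapping.lookup a t)) * mt \<in> germs 0"
        "\<delta> (fr (cst (Poly_Mapping.lookup a t)) * mt) = \<delta>' (fr (cst (Poly_Mapping.lookup a t)) * mt)"
        using m by (auto intro!: germs_mult0 mult const)
      with insert show ?case unfolding eq by (simp add: DD(2) DD'(2) germs_add)
    qed
    from this[OF finite_keys subset_refl] show ?thesis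
      using mpoly_expand[of a] by simp
  qed
  obtain a b e where ab: "f = Fract a b" "b \<in> forms N (int e)" "b \<notin> p" "a \<in> forms N (0 + int e)"
    using germsE[OF f] by blast
  define u w where "u = fr a / X ^ e" and "w = fr b / X ^ e"
  have b0: "fr b \<noteq> 0" using notin_p_nz[OF ab(3)] by simp
  have u: "u \<in> germs 0" "\<delta> u = \<delta>' u" and w: "w \<in> germs 0" "\<delta> w = \<delta>' w"
    using form[of a e] form[of b e] ab unfolding u_def w_def by (auto simp: forms_hpoly)
  have uw: "u = w * f" unfolding u_def w_def ab(1) Fract_fr using b0 by simp
  have "var r ^ e \<in> forms N (int e)" using forms_power[OF forms_var[OF r(1)], of e] by simp
  then have q: "X ^ e / fr b \<in> germs 0"
    using germsI[OF ab(2,3), of "var r ^ e" 0] by (simp add: Fract_fr fr_power)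
  have ww: "X ^ e / fr b * w = 1" unfolding w_def using b0 X by simp
  \<comment> \<open>Both derivations are applied to u = w f, where their values at u and w are known
    to agree; afterwards the unit w is cancelled.\<close>
  have eqw: "cs (J 0) w \<odot>\<^bsub>M\<^esub> \<delta> f = cs (J 0) w \<odot>\<^bsub>M\<^esub> \<delta>' f"
  proof -
    have "cs (J 0) w \<odot>\<^bsub>M\<^esub> \<delta> f \<oplus>\<^bsub>M\<^esub> cs (J 0) f \<odot>\<^bsub>M\<^esub> \<delta> w = cs (J 0) w \<odot>\<^bsub>M\<^esub> \<delta>' f \<oplus>\<^bsub>M\<^esub> cs (J 0) f \<odot>\<^bsub>M\<^esub> \<delta>' w"
      using u(2) DD(3)[OF w(1) f] DD'(3)[OF w(1) f] unfolding uw by simp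
    then show ?thesis
      using w f DD(1) DD'(1) csB by (simp add: M.M.a_comm)
  qed
  have asc: "cs (J 0) (q * w) \<odot>\<^bsub>M\<^esub> g = cs (J 0) q \<odot>\<^bsub>M\<^esub> (cs (J 0) w \<odot>\<^bsub>M\<^esub> g)"
    if "q \<in> germs 0" "g \<in> carrier M" for q g
    using that w(1) csB by (simp add: B_mult[symmetric] M.smult_assoc1)
  have "cs (J 0) (X ^ e / fr b * w) \<odot>\<^bsub>M\<^esub> \<delta> f = cs (J 0) (X ^ e / fr b * w) \<odot>\<^bsub>M\<^esub> \<delta>' f"
    unfolding asc[OF q DD(1)[OF f]] asc[OF q DD'(1)[OF f]] eqw ..
  then show ?thesis
    unfolding ww B_one[symmetric] using DD(1)[OF f] DD'(1)[OF f] by simp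
qed

end

section \<open>Differentials of germs as polynomials in \<open>Y\<close>\<close>

text \<open>The differential of a rational function, with dX_j written as Y_j.\<close>

definition dY :: "nat \<Rightarrow> ratfun \<Rightarrow> ratfun mpoly" where
  "dY N f = (\<Sum>j\<le>N. cst (rderiv j f) * var j)"

lemma dY_add: "dY N (f + g) = dY N f + dY N g"
  by (simp add: dY_def rderiv_add single_add distrib_right sum.distrib)

lemma dY_mult: "dY N (f * g) = cst f * dY N g + cst g * dY N f"
  by (simp add: dY_def rderiv_mult single_add distrib_right sum.distrib sum_distrib_left cst_mult algebra_simps)

lemma dY_0 [simp]: "dY N 0 = 0"
  by (simp add: dY_def)

lemma dY_sum: "dY N (sum f A) = (\<Sum>a\<in>A. dY N (f a))"
  by (induction A rule: infinite_finite_induct) (simp_all add: dY_add)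

lemma dY_const: "dY N (fr (cst z)) = 0"
  by (simp add: dY_def rderiv_fr)

lemma (in proj_point) dY_bihom: "f \<in> germs k \<Longrightarrow> dY N f \<in> bihom 1 (k - 1)"
  unfolding dY_def using bihom_cst_mult[OF rderiv_germs bihom_var] by (intro bihom_sum) auto

text \<open>\<open>delta\<close> turns the differential into Euler's expression, which vanishes in
  degree 0.\<close>

lemma (in proj_point) dY_kd:
  assumes "f \<in> germs 0" shows "dY N f \<in> kd 1 (- 1)"
proof -
  have "delta N (dY N f) = cst (\<Sum>j\<le>N. fr (var j) * rderiv j f)"
    unfolding dY_def delta_sum delta_cst_mult cst_sum
    by (intro sum.cong refl) (simp add: delta_var mult_single mult.commute)
  also have "(\<Sum>j\<le>N. fr (var j) * rderiv j f) = 0"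
    using euler_germs[OF assms] by simp
  finally show ?thesis using dY_bihom[OF assms] by (simp add: ker_delta_def)
qed

lemma (in chart) X_rderiv:
  "X * rderiv i (x_germ j) = fr (partial i (var j)) - fr (partial i (var r)) * x_germ j"
proof -
  have "rderiv i (X * x_germ j) = X * rderiv i (x_germ j) + x_germ j * rderiv i X"
    unfolding rderiv_mult by (simp add: algebra_simps)
  moreover have "X * x_germ j = fr (var j)" using X_nz by simp
  ultimately show ?thesis by (simp add: rderiv_fr algebra_simps)
qed

text \<open>X_r d(X_j/X_r) = dX_j - (X_j/X_r) dX_r, which is z_j when dX is written as Y.\<close>

lemma (in chart) dY_x:
  assumes "j \<le> N" shows "dY N (x_germ j) = cst (inverse X) * zv r j"
proof -
  have c: "rderiv i (x_germ j) = inverse X * (fr (partial i (var j)) - fr (partial i (var r)) * x_germ j)" for i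
    unfolding X_rderiv[symmetric] using X_nz by (simp add: mult.assoc[symmetric])
  have "(\<Sum>i\<le>N. cst (fr (partial i (var k))) * var i) = var k" if "k \<le> N" for k
    by (subst sum.mono_neutral_right[of "{..N}" "{k}"]) (use that in \<open>auto simp: partial_var\<close>)
  note vs = this
  have tm: "cst (a - b * x) * v = cst a * v - cst x * (cst b * v)" for a b x :: ratfun and v
    by (simp add: single_diff cst_mult algebra_simps)
  have "(\<Sum>i\<le>N. cst (fr (partial i (var j)) - fr (partial i (var r)) * x_germ j) * var i) = zv r j"
    unfolding tm sum_subtractf sum_distrib_left[symmetric] vs[OF assms] vs[OF r(1)] zv_def by simp
  then show ?thesis
    unfolding dY_def c cst_mult mult.assoc sum_distrib_left[symmetric] by simp
qed

section \<open>The augmentation on stalks\<close>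

lemma (in proj_point) prod_list_kd:
  "\<forall>F\<in>set Fs. F \<in> kd 1 (- 1) \<Longrightarrow> prod_list Fs \<in> kd (length Fs) (- int (length Fs))"
proof (induction Fs)
  case Nil
  then show ?case using kd_cst[of 1 0] by simp
next
  case (Cons F Fs)
  then show ?case using kd_mult[of F 1 "- 1" "prod_list Fs" "length Fs" "- int (length Fs)"] by (simp add: algebra_simps)
qed

context ci_point
begin

text \<open>Zero for \<open>m = 0\<close>, where the subtraction \<open>m - 1\<close> would be truncated.\<close>

definition kpred :: "nat \<Rightarrow> int \<Rightarrow> ratfun mpoly set" where
  "kpred m n = (if m = 0 then {0} else kd (m - 1) n)"

text \<open>The image of the last Koszul differential plus the ideal multiple. The cosets of Ker
  delta modulo \<open>Im\<close> are the cokernel in degree 0.\<close>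

definition Im :: "nat \<Rightarrow> int \<Rightarrow> ratfun mpoly set" where
  "Im m n = {F. \<exists>G. (\<forall>i\<in>{1..c}. G i \<in> kpred m (n - (int (d i) - 1))) \<and> F - (\<Sum>i\<in>{1..c}. al i * G i) \<in> H m n}"

lemma addsub_kpred: "addsub (kpred m n)"
  by (simp add: kpred_def addsub_kd) (simp add: addsub_def)

lemma kpred_mult: "F \<in> kd m' n' \<Longrightarrow> G \<in> kpred m n \<Longrightarrow> F * G \<in> kpred (m' + m) (n' + n)"
  using kd_mult[of F m' n' G "m - 1" n] addsubD(1)[OF addsub_kd] by (cases m) (simp_all add: kpred_def)

lemma H_Im: "F \<in> H m n \<Longrightarrow> F \<in> Im m n"
  unfolding Im_def using addsubD(1)[OF addsub_kpred] by (intro CollectI exI[of _ "\<lambda>_. 0"]) simp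

lemma addsub_Im: "addsub (Im m n)"
  unfolding addsub_def
proof (intro conjI ballI)
  show "0 \<in> Im m n" by (rule H_Im) (rule addsubD(1)[OF addsub_H])
next
  fix F F' assume "F \<in> Im m n" "F' \<in> Im m n"
  then obtain G G' where "\<forall>i\<in>{1..c}. G i \<in> kpred m (n - (int (d i) - 1))" "F - (\<Sum>i\<in>{1..c}. al i * G i) \<in> H m n"
    "\<forall>i\<in>{1..c}. G' i \<in> kpred m (n - (int (d i) - 1))" "F' - (\<Sum>i\<in>{1..c}. al i * G' i) \<in> H m n"
    unfolding Im_def by (elim CollectE exE conjE) (rule that)
  then show "F + F' \<in> Im m n"
    unfolding Im_def using addsubD(2)[OF addsub_H, of "F - (\<Sum>i\<in>{1..c}. al i * G i)" m n "F' - (\<Sum>i\<in>{1..c}. al i * G' i)"]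
    by (intro CollectI exI[of _ "\<lambda>i. G i + G' i"])
      (simp add: addsubD(2)[OF addsub_kpred] distrib_left sum.distrib algebra_simps)
next
  fix F assume "F \<in> Im m n"
  then obtain G where "\<forall>i\<in>{1..c}. G i \<in> kpred m (n - (int (d i) - 1))" "F - (\<Sum>i\<in>{1..c}. al i * G i) \<in> H m n"
    unfolding Im_def by (elim CollectE exE conjE) (rule that)
  then show "- F \<in> Im m n"
    unfolding Im_def using addsubD(3)[OF addsub_H, of "F - (\<Sum>i\<in>{1..c}. al i * G i)" m n]
    by (intro CollectI exI[of _ "\<lambda>i. - G i"])
      (simp add: addsubD(3)[OF addsub_kpred] sum_negf algebra_simps)
qed

lemma Im_mult:
  assumes E: "E \<in> kd m' n'" and F: "F \<in> Im m n"
  shows "E * F \<in> Im (m' + m) (n' + n)"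
proof -
  from F obtain G where G: "\<forall>i\<in>{1..c}. G i \<in> kpred m (n - (int (d i) - 1))" "F - (\<Sum>i\<in>{1..c}. al i * G i) \<in> H m n"
    unfolding Im_def by (elim CollectE exE conjE) (rule that)
  have "E * F - (\<Sum>i\<in>{1..c}. al i * (E * G i)) = E * (F - (\<Sum>i\<in>{1..c}. al i * G i))"
    by (simp add: right_diff_distrib sum_distrib_left mult.left_commute)
  then have "E * F - (\<Sum>i\<in>{1..c}. al i * (E * G i)) \<in> H (m' + m) (n' + n)"
    using H_mult[OF kd_bihom[OF E] G(2)] by simp
  moreover have "E * G i \<in> kpred (m' + m) (n' + n - (int (d i) - 1))" if "i \<in> {1..c}" for i
    using kpred_mult[OF E bspec[OF G(1) that]] by (simp add: algebra_simps)
  ultimately show ?thesis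
    unfolding Im_def by (intro CollectI exI[of _ "\<lambda>i. E * G i"]) simp
qed

lemma Im_mult_right: "F \<in> Im m n \<Longrightarrow> E \<in> kd m' n' \<Longrightarrow> F * E \<in> Im (m + m') (n + n')"
  using Im_mult[of E m' n' F m n] by (simp add: mult.commute add.commute)

lemma coset_module_Im: "coset_module (germs 0) (J 0) (kd m n) (Im m n) (\<lambda>a F. cst a * F)"
proof unfold_locales
  show "cst a * x \<in> kd m n" if "a \<in> germs 0" "x \<in> kd m n" for a x
    using kd_cst_mult[OF that] by simp
  show "cst a * x \<in> Im m n" if "a \<in> germs 0" "x \<in> Im m n" for a x
    using Im_mult[OF kd_cst[OF that(1)] that(2)] by simp
  show "cst a * x \<in> Im m n" if "a \<in> J 0" "x \<in> kd m n" for a x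
    using H_mult_right[OF H_cst[OF that(1)] kd_bihom[OF that(2)]] by (intro H_Im) simp
qed (auto simp: addsub_kd addsub_Im single_add cst_mult algebra_simps)

text \<open>For f = sum of a_i P_i the product rule gives the terms a_i dP_i with dP_i = d_i
  \<alpha>(P_i), and the terms P_i da_i in the ideal multiple. Hence, modulo \<open>Im\<close>,
  differentiation descends to the local ring of X.\<close>

lemma dY_J:
  assumes "f \<in> J 0" shows "dY N f \<in> Im 1 (- 1)"
proof -
  from assms obtain a where a: "f = (\<Sum>i\<in>{1..c}. a i * fr (P i))" "\<forall>i\<in>{1..c}. a i \<in> germs (0 - int (d i))"
    unfolding J_germs_def by blast
  have dP: "dY N (fr (P i)) = cst (of_nat (d i)) * al i" if "i \<in> {1..c}" for i
    unfolding al_eq dY_def sum_distrib_left rderiv_fr mult.assoc[symmetric] cst_mult[symmetric]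
    using of_nat_ratfun_nz[of "d i"] d_pos[OF that] by simp
  have "dY N f - (\<Sum>i\<in>{1..c}. al i * cst (a i * of_nat (d i))) = (\<Sum>i\<in>{1..c}. cst (fr (P i)) * dY N (a i))"
    unfolding a(1) dY_sum sum_subtractf[symmetric]
    by (intro sum.cong refl) (simp add: dY_mult dP cst_mult algebra_simps)
  also have "\<dots> \<in> H 1 (- 1)"
  proof (rule addsub_sum[OF addsub_H])
    fix i assume i: "i \<in> {1..c}"
    show "cst (fr (P i)) * dY N (a i) \<in> H 1 (- 1)"
      using H_mult_right[OF H_cst[OF P_J[OF i]] dY_bihom[OF bspec[OF a(2) i]]] by simp
  qed
  finally have *: "dY N f - (\<Sum>i\<in>{1..c}. al i * cst (a i * of_nat (d i))) \<in> H 1 (- 1)" .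
  have "cst (a i * of_nat (d i)) \<in> kpred 1 (- 1 - (int (d i) - 1))" if i: "i \<in> {1..c}" for i
    using kd_cst[OF germs_mult[OF bspec[OF a(2) i] germs_of_nat]] by (simp add: kpred_def)
  with * show ?thesis
    unfolding Im_def by (intro CollectI exI[of _ "\<lambda>i. cst (a i * of_nat (d i))"]) simp
qed

text \<open>The image of the complex numbers in the local ring of X; \<open>kX\<close> identifies it
  with the constants in \<open>cotangent_X\<close>.\<close>

definition kc :: "ratfun set set" where "kc = range (\<lambda>z. cs (J 0) (fr (cst z)))"

end

section \<open>The inverse of the augmentation\<close>

locale ci_tens = ci_point N c d P p for N c d P p + fixes m :: nat and n :: int
begin

sublocale Km: kaehler_mod B kc
  by (intro kaehler_mod.intro rcring.intro cring_B kaehler_mod_axioms.intro) (auto simp: kc_def intro!: csB)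

sublocale Sm: sym_mod B Km.\<Omega> m
  by (intro sym_mod.intro rcring.intro cring_B rmod.intro Km.module_kaehler)

sublocale Lm: coset_module "germs 0" "J 0" "germs (int m + n)" "J (int m + n)" "(*)"
  by unfold_locales (use J_mult[of _ 0] J_mult_right[of _ 0] in \<open>auto simp: addsub_germs addsub_J germs_mult0 algebra_simps\<close>)

sublocale Tm: tensor_mod B Sm.S Lm.Q
  by (intro tensor_mod.intro rcring.intro cring_B rmod.intro Sm.module_sym Lm.module_Q)

sublocale Qm: coset_module "germs 0" "J 0" "kd m n" "Im m n" "\<lambda>a F. cst a * F"
  by (rule coset_module_Im)

abbreviation dd :: "ratfun \<Rightarrow> (ratfun set \<Rightarrow> ratfun set) set" where
  "dd f \<equiv> kaehler_d B kc (cs (J 0) f)"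

lemma dd_closed: "f \<in> germs 0 \<Longrightarrow> dd f \<in> carrier Km.\<Omega>"
  by (rule Km.d_closed[OF csB])

lemma der_dd: "der Km.\<Omega> dd"
  unfolding der_def using Km.d_add[OF csB csB] Km.d_mult[OF csB csB]
  by (simp add: dd_closed B_add B_mult)

text \<open>The inverse of the augmentation, characterised by its values on generators without reference to a chart.\<close>

definition spec :: "((_ \<times> ratfun set \<Rightarrow> ratfun set) set \<Rightarrow> ratfun mpoly set) \<Rightarrow> bool" where
  "spec \<psi> \<longleftrightarrow> \<psi> \<in> module_hom B Tm.T Qm.Q \<and> (\<forall>fs u. set fs \<subseteq> germs 0 \<longrightarrow> length fs = m \<longrightarrow> u \<in> germs (int m + n) \<longrightarrow>
     \<psi> (Tm.te (Sm.sp (map dd fs)) (cs (J (int m + n)) u)) = cs (Im m n) (cst u * prod_list (map (dY N) fs)))"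

text \<open>The map is a composite: dividing by a generator of O(m + n) removes the tensor factor,
  and the universal property of the symmetric power is then applied to products of lifts, multiplied
  by the same generator. The generator cancels, so it is absent from the resulting formula.\<close>

lemma ex_spec: "\<exists>\<psi>. spec \<psi>"
proof -
  interpret Q1: coset_module "germs 0" "J 0" "kd 1 (- 1)" "Im 1 (- 1)" "\<lambda>a F. cst a * F"
    by (rule coset_module_Im)
  \<comment> \<open>A lift from the local ring of X to germs on projective space; by
    \<open>dY_J\<close> the choice does not matter modulo \<open>Im\<close>.\<close>
  define ch where "ch b = (SOME f. f \<in> germs 0 \<and> cs (J 0) f = b)" for b
  have ch: "ch b \<in> germs 0 \<and> cs (J 0) (ch b) = b" if "b \<in> carrier B" for b
    unfolding ch_def by (rule someI_ex) (use that in \<open>auto simp: B_carrier\<close>)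
  have g: "cs (Im 1 (- 1)) (dY N (ch (cs (J 0) f))) = cs (Im 1 (- 1)) (dY N f)" if f: "f \<in> germs 0" for f
  proof -
    have "ch (cs (J 0) f) - f \<in> J 0" using ch[OF csB[OF f]] cs_eq_iff[OF addsub_J] by blast
    from dY_J[OF this] have "dY N (ch (cs (J 0) f)) - dY N f \<in> Im 1 (- 1)"
      using dY_add[of N "ch (cs (J 0) f) - f" f] by simp
    then show ?thesis by (simp add: cs_eq_iff[OF addsub_Im])
  qed
  have "\<exists>h\<in>module_hom B Km.\<Omega> Q1.Q. \<forall>b\<in>carrier B. h (Km.d b) = cs (Im 1 (- 1)) (dY N (ch b))"
  proof (rule Km.kaehler_universal[OF Q1.module_Q])
    fix b assume b: "b \<in> carrier B"
    show "cs (Im 1 (- 1)) (dY N (ch b)) \<in> carrier Q1.Q" using dY_kd ch[OF b] by simp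
    fix b' assume b': "b' \<in> carrier B"
    define f f' where "f = ch b" and "f' = ch b'"
    have f: "f \<in> germs 0" "b = cs (J 0) f" and f': "f' \<in> germs 0" "b' = cs (J 0) f'"
      using ch[OF b] ch[OF b'] by (simp_all add: f_def f'_def)
    show "cs (Im 1 (- 1)) (dY N (ch (b \<oplus>\<^bsub>B\<^esub> b'))) = cs (Im 1 (- 1)) (dY N (ch b)) \<oplus>\<^bsub>Q1.Q\<^esub> cs (Im 1 (- 1)) (dY N (ch b'))"
      using f(1) f'(1) unfolding f(2) f'(2) by (simp only: g B_add germs_add dY_add Q1.Q_add)
    show "cs (Im 1 (- 1)) (dY N (ch (b \<otimes>\<^bsub>B\<^esub> b'))) = b \<odot>\<^bsub>Q1.Q\<^esub> cs (Im 1 (- 1)) (dY N (ch b')) \<oplus>\<^bsub>Q1.Q\<^esub> b' \<odot>\<^bsub>Q1.Q\<^esub> cs (Im 1 (- 1)) (dY N (ch b))"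
      using f(1) f'(1) unfolding f(2) f'(2) by (simp only: g B_mult germs_mult0 dY_mult Q1.Q_add Q1.smult_cs dY_kd)
  next
    fix b assume "b \<in> kc"
    then obtain z where b: "b = cs (J 0) (fr (cst z))" by (auto simp: kc_def)
    show "cs (Im 1 (- 1)) (dY N (ch b)) = \<zero>\<^bsub>Q1.Q\<^esub>"
      unfolding b g[OF germs_const] dY_const by simp
  qed
  then obtain h1 where h1: "h1 \<in> module_hom B Km.\<Omega> Q1.Q" "\<forall>b\<in>carrier B. h1 (Km.d b) = cs (Im 1 (- 1)) (dY N (ch b))"
    by (elim bexE) (rule that)
  \<comment> \<open>Representatives in Ker delta of the images of differentials, so that several of
    them can be multiplied as polynomials.\<close>
  define rp where "rp x = (SOME F. F \<in> kd 1 (- 1) \<and> h1 x = cs (Im 1 (- 1)) F)" for x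
  have rp: "rp x \<in> kd 1 (- 1) \<and> h1 x = cs (Im 1 (- 1)) (rp x)" if "x \<in> carrier Km.\<Omega>" for x
    unfolding rp_def by (rule someI_ex) (use module_homD(1)[OF h1(1) that] in auto)
  \<comment> \<open>A generator of the stalk of O(m + n); a power of X_r in any chart shows that one
    exists.\<close>
  define w where "w = (SOME u :: ratfun. u \<in> germs (int m + n) \<and> u \<noteq> 0 \<and> inverse u \<in> germs (- (int m + n)))"
  have "\<exists>u :: ratfun. u \<in> germs (int m + n) \<and> u \<noteq> 0 \<and> inverse u \<in> germs (- (int m + n))"
  proof -
    obtain r where "chart N p r" by (rule ex_X)
    then interpret chart N p r .
    show ?thesis
      by (rule exI[of _ "X powi (int m + n)"]) (use X_power X_nz in \<open>auto simp: power_int_minus[symmetric]\<close>)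
  qed
  from someI_ex[OF this] have w: "w \<in> germs (int m + n)" "w \<noteq> 0" "inverse w \<in> germs (- (int m + n))"
    unfolding w_def by auto
  define gg where "gg xs = cst w * prod_list (map rp xs)" for xs
  \<comment> \<open>The factor in slot i is separated from the product R of all the others, so that
    a congruence for one factor can be multiplied by R.\<close>
  have slot: "\<exists>R. \<forall>x. (x \<in> carrier Km.\<Omega> \<longrightarrow> gg (xs[i := x]) = R * rp x) \<and> R \<in> kd (m - 1) (n + 1)"
    if xs: "xs \<in> Sm.gens" "i < m" for xs i
  proof -
    have l: "length xs = m" "set xs \<subseteq> carrier Km.\<Omega>" using xs by (auto simp: sym_gens_def)
    define R where "R = cst w * prod_list (map rp (take i xs @ drop (Suc i) xs))"
    have eq: "gg (xs[i := x]) = R * rp x" for x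
      using xs(2) l(1) by (simp add: gg_def R_def upd_conv_take_nth_drop mult_ac)
    have "\<forall>F\<in>set (map rp (take i xs @ drop (Suc i) xs)). F \<in> kd 1 (- 1)"
      using l(2) rp by (auto dest!: in_set_takeD in_set_dropD)
    from kd_mult[OF kd_cst[OF w(1)] prod_list_kd[OF this]] xs(2) l(1)
    have "R \<in> kd (m - 1) (n + 1)" by (simp add: R_def min_def of_nat_diff)
    with eq show ?thesis by (intro exI[of _ R]) simp
  qed
  have ggkd: "gg xs \<in> kd m n" if "xs \<in> Sm.gens" for xs
  proof -
    have l: "length xs = m" "set xs \<subseteq> carrier Km.\<Omega>" using that by (auto simp: sym_gens_def)
    have "\<forall>F\<in>set (map rp xs). F \<in> kd 1 (- 1)" using l(2) rp by auto
    from kd_mult[OF kd_cst[OF w(1)] prod_list_kd[OF this]] l(1) show ?thesis by (simp add: gg_def)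
  qed
  \<comment> \<open>The assumption \<open>i < m\<close> makes m positive, so that 1 + (m - 1) =
    m.\<close>
  have ImR: "R * F \<in> Im m n" if "R \<in> kd (m - 1) (n + 1)" "F \<in> Im 1 (- 1)" "i < m" for R F i
    using Im_mult[OF that(1,2)] that(3) by simp
  have "\<exists>h\<in>module_hom B Sm.S Qm.Q. \<forall>xs\<in>Sm.gens. h (Sm.sp xs) = cs (Im m n) (gg xs)"
  proof (rule Sm.sym_universal[OF Qm.module_Q])
    show "cs (Im m n) (gg xs) \<in> carrier Qm.Q" if "xs \<in> Sm.gens" for xs using ggkd[OF that] by simp
    fix xs i assume xs: "xs \<in> Sm.gens" "i < m"
    from slot[OF xs] obtain R where R: "\<And>x. x \<in> carrier Km.\<Omega> \<Longrightarrow> gg (xs[i := x]) = R * rp x" "R \<in> kd (m - 1) (n + 1)"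
      by blast
    fix x assume x: "x \<in> carrier Km.\<Omega>"
    {
      fix y assume y: "y \<in> carrier Km.\<Omega>"
      have xy: "x \<oplus>\<^bsub>Km.\<Omega>\<^esub> y \<in> carrier Km.\<Omega>" using x y Sm.M.M.a_closed by blast
      have "cs (Im 1 (- 1)) (rp (x \<oplus>\<^bsub>Km.\<Omega>\<^esub> y)) = cs (Im 1 (- 1)) (rp x + rp y)"
        unfolding Q1.Q_add[symmetric] conjunct2[OF rp[OF x], symmetric] conjunct2[OF rp[OF y], symmetric] conjunct2[OF rp[OF xy], symmetric]
        by (rule module_homD(2)[OF h1(1) x y])
      then have "R * (rp (x \<oplus>\<^bsub>Km.\<Omega>\<^esub> y) - (rp x + rp y)) \<in> Im m n"
        using ImR[OF R(2) _ xs(2)] by (simp add: cs_eq_iff[OF addsub_Im])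
      then show "cs (Im m n) (gg (xs[i := x \<oplus>\<^bsub>Km.\<Omega>\<^esub> y])) = cs (Im m n) (gg (xs[i := x])) \<oplus>\<^bsub>Qm.Q\<^esub> cs (Im m n) (gg (xs[i := y]))"
        unfolding R(1)[OF x] R(1)[OF y] R(1)[OF xy] Qm.Q_add cs_eq_iff[OF addsub_Im] by (simp add: algebra_simps)
    }
    fix a assume a: "a \<in> carrier B"
    have ax: "a \<odot>\<^bsub>Km.\<Omega>\<^esub> x \<in> carrier Km.\<Omega>" using a x Sm.M.smult_closed by blast
    have cha: "ch a \<in> germs 0" "cs (J 0) (ch a) = a" using ch[OF a] by auto
    have "cs (Im 1 (- 1)) (rp (a \<odot>\<^bsub>Km.\<Omega>\<^esub> x)) = cs (Im 1 (- 1)) (cst (ch a) * rp x)"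
      unfolding Q1.smult_cs[OF cha(1) conjunct1[OF rp[OF x]], symmetric] cha(2) conjunct2[OF rp[OF x], symmetric] conjunct2[OF rp[OF ax], symmetric]
      by (rule module_homD(3)[OF h1(1) a x])
    then have "R * (rp (a \<odot>\<^bsub>Km.\<Omega>\<^esub> x) - cst (ch a) * rp x) \<in> Im m n"
      using ImR[OF R(2) _ xs(2)] by (simp add: cs_eq_iff[OF addsub_Im])
    moreover have "a \<odot>\<^bsub>Qm.Q\<^esub> cs (Im m n) (gg (xs[i := x])) = cs (Im m n) (cst (ch a) * gg (xs[i := x]))"
      using Qm.smult_cs[OF cha(1) ggkd[OF Sm.gens_update[OF xs(1) x]], of i] by (simp add: cha(2))
    ultimately show "cs (Im m n) (gg (xs[i := a \<odot>\<^bsub>Km.\<Omega>\<^esub> x])) = a \<odot>\<^bsub>Qm.Q\<^esub> cs (Im m n) (gg (xs[i := x]))"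
      unfolding R(1)[OF x] R(1)[OF ax] by (simp add: cs_eq_iff[OF addsub_Im] algebra_simps)
  next
    fix xs ys :: "(ratfun set \<Rightarrow> ratfun set) set list" assume "mset xs = mset ys"
    then have "prod_mset (mset (map rp xs)) = prod_mset (mset (map rp ys))" by simp
    then show "cs (Im m n) (gg xs) = cs (Im m n) (gg ys)" unfolding gg_def by (simp only: prod_mset_prod_list)
  qed
  then obtain h2 where h2: "h2 \<in> module_hom B Sm.S Qm.Q" "\<forall>xs\<in>Sm.gens. h2 (Sm.sp xs) = cs (Im m n) (gg xs)"
    by (elim bexE) (rule that)
  define ru where "ru y = (SOME u. u \<in> germs (int m + n) \<and> cs (J (int m + n)) u = y)" for y
  have ru: "ru y \<in> germs (int m + n) \<and> cs (J (int m + n)) (ru y) = y" if "y \<in> carrier Lm.Q" for y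
    unfolding ru_def by (rule someI_ex) (use that in auto)
  have iw: "inverse w * u \<in> germs 0" if "u \<in> germs (int m + n)" for u
    using germs_mult[OF w(3) that] by simp
  have wcs: "cs (J 0) (inverse w * ru (cs (J (int m + n)) u)) = cs (J 0) (inverse w * u)" if u: "u \<in> germs (int m + n)" for u
  proof -
    have uL: "cs (J (int m + n)) u \<in> carrier Lm.Q" using u by simp
    have "ru (cs (J (int m + n)) u) - u \<in> J (int m + n)" using ru[OF uL] cs_eq_iff[OF addsub_J] by blast
    from J_mult[OF w(3) this] show ?thesis by (simp add: cs_eq_iff[OF addsub_J] right_diff_distrib)
  qed
  \<comment> \<open>The second tensor factor has rank one with generator w; dividing by w turns it
    into a scalar.\<close>
  have "\<exists>h\<in>module_hom B Tm.T Sm.S. \<forall>s\<in>carrier Sm.S. \<forall>y\<in>carrier Lm.Q. h (Tm.te s y) = cs (J 0) (inverse w * ru y) \<odot>\<^bsub>Sm.S\<^esub> s"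
  proof (rule Tm.tensor_universal[OF Sm.module_sym])
    fix y assume y: "y \<in> carrier Lm.Q"
    have yB: "cs (J 0) (inverse w * ru y) \<in> carrier B" using iw ru[OF y] csB by blast
    show "(\<lambda>s. cs (J 0) (inverse w * ru y) \<odot>\<^bsub>Sm.S\<^esub> s) \<in> module_hom B Sm.S Sm.S"
    proof (rule module_homI)
      fix a s assume "a \<in> carrier B" "s \<in> carrier Sm.S"
      with yB show "cs (J 0) (inverse w * ru y) \<odot>\<^bsub>Sm.S\<^esub> (a \<odot>\<^bsub>Sm.S\<^esub> s) = a \<odot>\<^bsub>Sm.S\<^esub> (cs (J 0) (inverse w * ru y) \<odot>\<^bsub>Sm.S\<^esub> s)"
        by (simp add: Tm.M.smult_assoc1[symmetric] Km.m_comm)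
    qed (use yB in \<open>simp_all add: Tm.M.smult_r_distr\<close>)
    show "cs (J 0) (inverse w * ru y) \<odot>\<^bsub>Sm.S\<^esub> s \<in> carrier Sm.S" if "s \<in> carrier Sm.S" for s using yB that by simp
  next
    fix s assume s: "s \<in> carrier Sm.S"
    show "(\<lambda>y. cs (J 0) (inverse w * ru y) \<odot>\<^bsub>Sm.S\<^esub> s) \<in> module_hom B Lm.Q Sm.S"
    proof (rule module_homI)
      fix y assume y: "y \<in> carrier Lm.Q"
      then obtain u where u: "u \<in> germs (int m + n)" "y = cs (J (int m + n)) u" by auto
      show "cs (J 0) (inverse w * ru y) \<odot>\<^bsub>Sm.S\<^esub> s \<in> carrier Sm.S"
        unfolding u(2) wcs[OF u(1)] using csB[OF iw[OF u(1)]] s by simp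
      {
        fix y' assume "y' \<in> carrier Lm.Q"
        then obtain u' where u': "u' \<in> germs (int m + n)" "y' = cs (J (int m + n)) u'" by auto
        have e: "cs (J 0) (inverse w * (u + u')) = cs (J 0) (inverse w * u) \<oplus>\<^bsub>B\<^esub> cs (J 0) (inverse w * u')"
          by (simp add: B_add distrib_left)
        show "cs (J 0) (inverse w * ru (y \<oplus>\<^bsub>Lm.Q\<^esub> y')) \<odot>\<^bsub>Sm.S\<^esub> s = cs (J 0) (inverse w * ru y) \<odot>\<^bsub>Sm.S\<^esub> s \<oplus>\<^bsub>Sm.S\<^esub> cs (J 0) (inverse w * ru y') \<odot>\<^bsub>Sm.S\<^esub> s"
          unfolding u(2) u'(2) Lm.Q_add wcs[OF u(1)] wcs[OF u'(1)] wcs[OF germs_add[OF u(1) u'(1)]] e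
          by (rule Tm.M.smult_l_distr[OF csB[OF iw[OF u(1)]] csB[OF iw[OF u'(1)]] s])
      }
      fix a assume "a \<in> carrier B"
      then obtain b where b: "b \<in> germs 0" "a = cs (J 0) b" by (auto simp: B_carrier)
      have e: "cs (J 0) (inverse w * (b * u)) = cs (J 0) b \<otimes>\<^bsub>B\<^esub> cs (J 0) (inverse w * u)"
        by (simp add: B_mult b iw u mult.left_commute)
      show "cs (J 0) (inverse w * ru (a \<odot>\<^bsub>Lm.Q\<^esub> y)) \<odot>\<^bsub>Sm.S\<^esub> s = a \<odot>\<^bsub>Sm.S\<^esub> (cs (J 0) (inverse w * ru y) \<odot>\<^bsub>Sm.S\<^esub> s)"
        unfolding u(2) b(2) Lm.smult_cs[OF b(1) u(1)] wcs[OF u(1)] wcs[OF germs_mult0[OF b(1) u(1)]] e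
        by (rule Tm.M.smult_assoc1[OF csB[OF b(1)] csB[OF iw[OF u(1)]] s])
    qed
  qed
  then obtain h3 where h3: "h3 \<in> module_hom B Tm.T Sm.S"
    "\<forall>s\<in>carrier Sm.S. \<forall>y\<in>carrier Lm.Q. h3 (Tm.te s y) = cs (J 0) (inverse w * ru y) \<odot>\<^bsub>Sm.S\<^esub> s"
    by (elim bexE) (rule that)
  have "h2 (h3 (Tm.te (Sm.sp (map dd fs)) (cs (J (int m + n)) u))) = cs (Im m n) (cst u * prod_list (map (dY N) fs))"
    if fs: "set fs \<subseteq> germs 0" "length fs = m" and u: "u \<in> germs (int m + n)" for fs u
  proof -
    have gens: "map dd fs \<in> Sm.gens" using fs dd_closed by (auto simp: sym_gens_def)
    have spc: "Sm.sp (map dd fs) \<in> carrier Sm.S" by (rule Sm.sp_closed[OF gens])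
    have uL: "cs (J (int m + n)) u \<in> carrier Lm.Q" using u by simp
    have 3: "h3 (Tm.te (Sm.sp (map dd fs)) (cs (J (int m + n)) u)) = cs (J 0) (inverse w * u) \<odot>\<^bsub>Sm.S\<^esub> Sm.sp (map dd fs)"
      using bspec[OF bspec[OF h3(2) spc] uL] unfolding wcs[OF u] .
    have "h2 (h3 (Tm.te (Sm.sp (map dd fs)) (cs (J (int m + n)) u))) = cs (J 0) (inverse w * u) \<odot>\<^bsub>Qm.Q\<^esub> cs (Im m n) (gg (map dd fs))"
      unfolding 3 module_homD(3)[OF h2(1) csB[OF iw[OF u]] spc] bspec[OF h2(2) gens] ..
    also have "\<dots> = cs (Im m n) (cst (inverse w * u) * gg (map dd fs))"
      by (rule Qm.smult_cs[OF iw[OF u] ggkd[OF gens]])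
    also have "cst (inverse w * u) * gg (map dd fs) = cst u * prod_list (map rp (map dd fs))"
      unfolding gg_def mult.assoc[symmetric] cst_mult[symmetric] using w(2) by (simp add: field_simps)
    also have "cs (Im m n) (cst u * prod_list (map rp (map dd fs))) = cs (Im m n) (cst u * prod_list (map (dY N) fs))"
    proof -
      have dif: "rp (dd f) - dY N f \<in> Im 1 (- 1)" if "f \<in> germs 0" for f
        using rp[OF dd_closed[OF that]] bspec[OF h1(2) csB[OF that]] g[OF that] cs_eq_iff[OF addsub_Im] by metis
      \<comment> \<open>Products of congruent factors are congruent, by exchanging one factor at a
        time.\<close>
      have "prod_list (map rp (map dd fs)) - prod_list (map (dY N) fs) \<in> Im (length fs) (- int (length fs))"
        if "set fs \<subseteq> germs 0" for fs
        using that
      proof (induction fs)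
        case Nil
        show ?case using addsubD(1)[OF addsub_Im] by simp
      next
        case (Cons f fs)
        let ?a = "prod_list (map rp (map dd fs))" and ?b = "prod_list (map (dY N) fs)"
        have f: "f \<in> germs 0" "set fs \<subseteq> germs 0" using Cons.prems by auto
        have "\<forall>F\<in>set (map rp (map dd fs)). F \<in> kd 1 (- 1)" using f(2) rp dd_closed by auto
        from Im_mult_right[OF dif[OF f(1)] prod_list_kd[OF this]]
        have 1: "(rp (dd f) - dY N f) * ?a \<in> Im (Suc (length fs)) (- 1 - int (length fs))" by simp
        have 2: "dY N f * (?a - ?b) \<in> Im (Suc (length fs)) (- 1 - int (length fs))"
          using Im_mult[OF dY_kd[OF f(1)] Cons.IH[OF f(2)]] by simp
        have "rp (dd f) * ?a - dY N f * ?b = (rp (dd f) - dY N f) * ?a + dY N f * (?a - ?b)"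
          by (simp add: algebra_simps)
        with addsubD(2)[OF addsub_Im 1 2] show ?case by simp
      qed
      from Im_mult[OF kd_cst[OF u] this[OF fs(1)]] fs(2)
      show ?thesis by (simp add: cs_eq_iff[OF addsub_Im] right_diff_distrib)
    qed
    finally show ?thesis .
  qed
  then show ?thesis
    unfolding spec_def by (intro exI[of _ "\<lambda>t. h2 (h3 t)"] conjI module_hom_comp[OF h3(1) h2(1)]) simp
qed

end

section \<open>The augmentation in a chart\<close>

locale ci_aug = ci_tens N c d P p m n + ci_chart N c d P p r for N c d P p m n r
begin

abbreviation dx :: "nat \<Rightarrow> (ratfun set \<Rightarrow> ratfun set) set" where "dx j \<equiv> dd (x_germ j)"

definition wL :: "ratfun set" where "wL = cs (J (int m + n)) (X powi (int m + n))"

text \<open>The image of X_r^n Y^t: each Y_j becomes X_r dx_j, and the powers of X_r are collected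
  in \<open>wL\<close>.\<close>

definition ev :: "(nat \<Rightarrow>\<^sub>0 nat) \<Rightarrow> (_ \<times> ratfun set \<Rightarrow> ratfun set) set" where
  "ev t = Tm.te (Sm.sp (map (\<lambda>j. dx j) (mlist t))) wL"

text \<open>Formally Y_j goes to X_r dx_j. The domain is not restricted to Ker delta, so that the
  map can be applied to multiples of \<alpha>(P_i).\<close>

definition eps :: "ratfun mpoly \<Rightarrow> (_ \<times> ratfun set \<Rightarrow> ratfun set) set" where
  "eps F = lc Tm.T (mons N m) ev (\<lambda>t. X powi (- n) * Poly_Mapping.lookup F t)"

lemma dd_const: "dd (fr (cst z)) = \<zero>\<^bsub>Km.\<Omega>\<^esub>"
  by (rule Km.d_const) (simp add: kc_def)

lemma dx_r: "dx r = \<zero>\<^bsub>Km.\<Omega>\<^esub>"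
  using dd_const[of 1] X_nz by simp

lemma dx_closed: "j \<in> {..N} \<Longrightarrow> dx j \<in> carrier Km.\<Omega>"
  by (rule dd_closed[OF x_germ]) simp

lemma dx_all: "\<forall>j\<in>{..N}. dx j \<in> carrier Km.\<Omega>"
  using dx_closed by blast

text \<open>The total differential in affine coordinates: for j different from r, X_r times the
  derivative by X_j is the derivative by x_j = X_j/X_r on functions of degree 0, and the term j = r
  drops out since dx_r = 0.\<close>

definition tot :: "ratfun \<Rightarrow> (ratfun set \<Rightarrow> ratfun set) set" where
  "tot f = lc Km.\<Omega> {..N} (\<lambda>j. dx j) (\<lambda>j. X * rderiv j f)"

lemmas om_lc_closed = lc_closed[OF Km.module_kaehler finite_atMost dx_all]
lemmas om_lc_add = lc_add[OF Km.module_kaehler finite_atMost dx_all]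
lemmas om_lc_smult = lc_smult[OF Km.module_kaehler finite_atMost dx_all]
lemmas om_lc_cong = lc_cong[OF Km.module_kaehler finite_atMost dx_all]
lemmas om_lc_zero = lc_zero[OF Km.module_kaehler finite_atMost dx_all]
lemmas om_lc_single = lc_single[OF Km.module_kaehler finite_atMost dx_all]
lemmas om_lc_hom = lc_hom[OF Km.module_kaehler finite_atMost dx_all]
lemmas om_lc_submodule = lc_submodule[OF Km.module_kaehler finite_atMost dx_all]

lemma X_rderiv_germs: "f \<in> germs 0 \<Longrightarrow> X * rderiv j f \<in> germs 0"
  using germs_mult[OF germs_poly[OF forms_var[OF r(1)]] rderiv_germs, of f 0 j] by simp

lemma der_tot: "der Km.\<Omega> tot"
  unfolding der_def
proof (intro conjI ballI)
  fix f assume f: "f \<in> germs 0"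
  show "tot f \<in> carrier Km.\<Omega>"
    unfolding tot_def by (rule om_lc_closed) (rule X_rderiv_germs[OF f])
  fix g assume g: "g \<in> germs 0"
  show "tot (f + g) = tot f \<oplus>\<^bsub>Km.\<Omega>\<^esub> tot g"
    unfolding tot_def rderiv_add distrib_left by (rule om_lc_add) (rule X_rderiv_germs[OF f], rule X_rderiv_germs[OF g])
  have eq: "X * rderiv j (f * g) = f * (X * rderiv j g) + g * (X * rderiv j f)" for j
    unfolding rderiv_mult by (simp add: algebra_simps)
  show "tot (f * g) = cs (J 0) f \<odot>\<^bsub>Km.\<Omega>\<^esub> tot g \<oplus>\<^bsub>Km.\<Omega>\<^esub> cs (J 0) g \<odot>\<^bsub>Km.\<Omega>\<^esub> tot f"
    unfolding tot_def eq om_lc_smult[OF f X_rderiv_germs[OF g], symmetric] om_lc_smult[OF g X_rderiv_germs[OF f], symmetric]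
    by (rule om_lc_add) (rule germs_mult0[OF f X_rderiv_germs[OF g]], rule germs_mult0[OF g X_rderiv_germs[OF f]])
qed

lemma dd_tot: "f \<in> germs 0 \<Longrightarrow> dd f = tot f"
proof (rule der_eq[OF Km.module_kaehler der_dd der_tot])
  fix z show "dd (fr (cst z)) = tot (fr (cst z))"
    unfolding dd_const tot_def rderiv_fr by (simp add: om_lc_zero)
next
  fix j assume j: "j \<le> N"
  have "tot (x_germ j) = lc Km.\<Omega> {..N} (\<lambda>j. dx j) (\<lambda>i. if i = j then 1 else 0)"
    unfolding tot_def
  proof (rule om_lc_cong)
    show "X * rderiv i (x_germ j) \<in> germs 0" for i by (rule X_rderiv_germs[OF x_germ[OF j]])
    show "(if i = j then 1 else 0) \<in> germs 0" for i by simp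
    \<comment> \<open>For i different from r the coefficient is that of a coordinate function. At i
      = r it is not, but the vector dx_r is zero.\<close>
    fix i assume "dx i \<noteq> \<zero>\<^bsub>Km.\<Omega>\<^esub>"
    then have "i \<noteq> r" using dx_r by blast
    then show "X * rderiv i (x_germ j) - (if i = j then 1 else 0) \<in> J 0"
      unfolding X_rderiv using addsubD(1)[OF addsub_J] by (auto simp: partial_var)
  qed
  also have "\<dots> = cs (J 0) 1 \<odot>\<^bsub>Km.\<Omega>\<^esub> dx j"
    by (rule om_lc_single) (use j in auto)
  also have "\<dots> = dx j"
    unfolding B_one[symmetric] using j by (intro Sm.M.smult_one dx_closed) simp
  finally show "dd (x_germ j) = tot (x_germ j)" ..
qed

lemma dx_gens: "set js \<subseteq> {..N} \<Longrightarrow> length js = m \<Longrightarrow> map (\<lambda>j. dx j) js \<in> Sm.gens"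
  using dx_closed by (auto simp: sym_gens_def)

lemma mons_mlist: "t \<in> mons N m \<Longrightarrow> set (mlist t) \<subseteq> {..N} \<and> length (mlist t) = m"
  by (simp add: mons_def set_mlist length_mlist)

lemma wL_closed: "wL \<in> carrier Lm.Q"
  using X_power by (simp add: wL_def)

lemma te_wL: "(\<lambda>s. Tm.te s wL) \<in> module_hom B Sm.S Tm.T"
  by (rule Tm.te_hom_left[OF wL_closed])

lemma ev_closed: "t \<in> mons N m \<Longrightarrow> ev t \<in> carrier Tm.T"
  unfolding ev_def using mons_mlist by (intro Tm.te_closed Sm.sp_closed dx_gens wL_closed) auto

lemma ev_all: "\<forall>t\<in>mons N m. ev t \<in> carrier Tm.T"
  using ev_closed by blast

lemma ev_expo: "set js \<subseteq> {..N} \<Longrightarrow> length js = m \<Longrightarrow> ev (expo js) = Tm.te (Sm.sp (map (\<lambda>j. dx j) js)) wL"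
proof -
  assume js: "set js \<subseteq> {..N}" "length js = m"
  have "mset (map (\<lambda>j. dx j) js) = mset (map (\<lambda>j. dx j) (mlist (expo js)))"
    unfolding mset_map mset_mlist_expo ..
  from Sm.sp_mset[OF dx_gens[OF js] this] show ?thesis unfolding ev_def by simp
qed

text \<open>The symmetric product contains the factor dx_r = 0.\<close>

lemma ev_zero:
  assumes t: "t \<in> mons N m" and tr: "Poly_Mapping.lookup t r \<noteq> 0"
  shows "ev t = \<zero>\<^bsub>Tm.T\<^esub>"
proof -
  have "r \<in> set (mlist t)" using tr by (simp add: set_mlist in_keys_iff)
  then obtain i where i: "i < length (mlist t)" "mlist t ! i = r" by (auto simp: in_set_conv_nth)
  let ?xs = "map (\<lambda>j. dx j) (mlist t)"
  have g: "?xs \<in> Sm.gens" using mons_mlist[OF t] by (intro dx_gens) auto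
  have im: "i < m" using i mons_mlist[OF t] by simp
  have "?xs ! i = \<zero>\<^bsub>Km.\<Omega>\<^esub>" using i dx_r by simp
  then have "?xs = ?xs[i := \<zero>\<^bsub>Km.\<Omega>\<^esub>]" by (metis list_update_id)
  then have "Sm.sp ?xs = Sm.sp (?xs[i := \<zero>\<^bsub>Km.\<Omega>\<^esub>])" by (rule arg_cong)
  also have "\<dots> = \<zero>\<^bsub>Sm.S\<^esub>"
    by (rule module_hom_zero[OF Km.module_kaehler Sm.module_sym Sm.sp_slot_hom[OF g im]])
  finally show ?thesis
    unfolding ev_def using module_hom_zero[OF Sm.module_sym Tm.module_tensor te_wL] by simp
qed

abbreviation cf :: "ratfun mpoly \<Rightarrow> bool" where "cf F \<equiv> \<forall>t. Poly_Mapping.lookup F t \<in> germs n"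

lemmas t_lc_closed = lc_closed[OF Tm.module_tensor finite_mons ev_all]
lemmas t_lc_add = lc_add[OF Tm.module_tensor finite_mons ev_all]
lemmas t_lc_smult = lc_smult[OF Tm.module_tensor finite_mons ev_all]
lemmas t_lc_cong = lc_cong[OF Tm.module_tensor finite_mons ev_all]
lemmas t_lc_null = lc_null[OF Tm.module_tensor finite_mons ev_all]
lemmas t_lc_single = lc_single[OF Tm.module_tensor finite_mons ev_all]
lemmas t_lc_hom = lc_hom[OF Tm.module_tensor finite_mons ev_all]
lemmas t_lc_reindex = lc_reindex[OF Tm.module_tensor finite_mons ev_all]

lemma coeff_germ: "a \<in> germs n \<Longrightarrow> X powi (- n) * a \<in> germs 0"
  using germs_mult[OF X_power[of "- n"], of a n] by simp

lemma coeff_J: "a \<in> J n \<Longrightarrow> X powi (- n) * a \<in> J 0"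
  using J_mult[OF X_power[of "- n"], of a n] by simp

lemma eps_closed: "cf F \<Longrightarrow> eps F \<in> carrier Tm.T"
  unfolding eps_def by (intro t_lc_closed coeff_germ) simp

lemma eps_add: "cf F \<Longrightarrow> cf G \<Longrightarrow> eps (F + G) = eps F \<oplus>\<^bsub>Tm.T\<^esub> eps G"
  unfolding eps_def lookup_add distrib_left by (intro t_lc_add coeff_germ) simp_all

lemma eps_smult: "a \<in> germs 0 \<Longrightarrow> cf F \<Longrightarrow> eps (cst a * F) = cs (J 0) a \<odot>\<^bsub>Tm.T\<^esub> eps F"
  unfolding eps_def lookup_const_mult mult.left_commute[of _ a] by (intro t_lc_smult coeff_germ) simp_all

text \<open>By \<open>ev_zero\<close> only coefficients at monomials free of Y_r are seen. In
  particular, replacing Y by z does not change the image.\<close>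

lemma eps_cong:
  assumes "cf F" "cf G" "\<And>t. t \<in> mons N m \<Longrightarrow> Poly_Mapping.lookup t r = 0 \<Longrightarrow> Poly_Mapping.lookup F t = Poly_Mapping.lookup G t"
  shows "eps F = eps G"
  unfolding eps_def
proof (rule t_lc_cong)
  fix t assume t: "t \<in> mons N m" "ev t \<noteq> \<zero>\<^bsub>Tm.T\<^esub>"
  then have "Poly_Mapping.lookup t r = 0" using ev_zero by blast
  then show "X powi (- n) * Poly_Mapping.lookup F t - X powi (- n) * Poly_Mapping.lookup G t \<in> J 0"
    using assms(3)[OF t(1)] addsubD(1)[OF addsub_J] by simp
qed (use assms coeff_germ in auto)

lemma eps_0: "eps 0 = \<zero>\<^bsub>Tm.T\<^esub>"
  unfolding eps_def by (rule t_lc_null) (simp add: addsubD(1)[OF addsub_J])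

lemma eps_single:
  assumes t: "t \<in> mons N m" and a: "a \<in> germs n"
  shows "eps (Poly_Mapping.single t a) = cs (J 0) (X powi (- n) * a) \<odot>\<^bsub>Tm.T\<^esub> ev t"
proof -
  have "(\<lambda>s. X powi (- n) * Poly_Mapping.lookup (Poly_Mapping.single t a) s) = (\<lambda>s. if s = t then X powi (- n) * a else 0)"
    by (auto simp: lookup_single when_def)
  then show ?thesis unfolding eps_def by (simp only: t_lc_single[OF t coeff_germ[OF a]])
qed

text \<open>Not intersected with Ker delta, since the products of \<alpha>(P_i) occurring in
  \<open>Im\<close> need not lie there.\<close>

definition kern :: "ratfun mpoly set" where "kern = {F. cf F \<and> eps F = \<zero>\<^bsub>Tm.T\<^esub>}"

interpretation TM: Module.module B Tm.T by (rule Tm.module_tensor)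

lemma addsub_kern: "addsub kern"
  unfolding addsub_def
proof (intro conjI ballI)
  show "0 \<in> kern" by (simp add: kern_def eps_0)
  fix F assume F: "F \<in> kern"
  show "F + G \<in> kern" if "G \<in> kern" for G
    using F that by (simp add: kern_def eps_add lookup_add germs_add)
  have cF: "cf F" "cf (- F)" and e0: "eps F = \<zero>\<^bsub>Tm.T\<^esub>" using F by (auto simp: kern_def germs_uminus)
  have "eps (- F + F) = eps (- F) \<oplus>\<^bsub>Tm.T\<^esub> eps F" by (rule eps_add[OF cF(2,1)])
  then have "eps (- F) = \<zero>\<^bsub>Tm.T\<^esub>" unfolding e0 using eps_closed[OF cF(2)] by (simp add: eps_0)
  with cF show "- F \<in> kern" by (simp add: kern_def)
qed

lemma H_kern: "F \<in> H m n \<Longrightarrow> F \<in> kern"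
  unfolding kern_def eps_def
  by (intro CollectI conjI t_lc_null coeff_J) (auto dest: H_D simp: bihom_iff)

lemma rderiv_X_power: "j \<noteq> r \<Longrightarrow> rderiv j (X ^ k) = 0"
  by (induction k) (simp_all add: rderiv_mult rderiv_fr partial_var)

text \<open>A monomial multiplier fills all slots of the symmetric product but one. The remaining
  slot receives a multiple of the differential of P_i/X_r^(d_i), a function whose class on X is
  zero.\<close>

lemma al_single_kern:
  assumes i: "i \<in> {1..c}" and u: "u \<in> mons N k" and m: "m = Suc k" and b: "b \<in> germs (n - (int (d i) - 1))"
  shows "al i * Poly_Mapping.single u b \<in> kern"
proof -
  define a where "a j = fr (partial j (P i)) / of_nat (d i)" for j
  have ab: "a j * b \<in> germs n" for j using germs_mult[OF al_coeff[OF i, of j] b] unfolding a_def by simp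
  define s where "s j = Poly_Mapping.single j 1 + u" for j
  have s: "s j \<in> mons N m" if "j \<in> {..N}" for j
    using u that m unfolding s_def mons_def by (auto simp: mdeg_add dest: subsetD[OF keys_add])
  have lk: "Poly_Mapping.lookup (al i * Poly_Mapping.single u b) t = (\<Sum>j\<in>{..N}. if t = s j then a j * b else 0)" for t
  proof -
    have "al i * Poly_Mapping.single u b = (\<Sum>j\<le>N. Poly_Mapping.single (s j) (a j * b))"
      unfolding al_eq sum_distrib_right
      by (intro sum.cong refl) (simp add: var_def mult_single s_def a_def)
    then show ?thesis
      by (auto simp: lookup_sum lookup_single when_def intro!: sum.cong)
  qed
  have cfF: "cf (al i * Poly_Mapping.single u b)"
    unfolding lk using ab by (intro allI germs_sum) simp
  define hu where "hu x = Tm.te (Sm.sp (x # map (\<lambda>j. dx j) (mlist u))) wL" for x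
  have ul: "set (mlist u) \<subseteq> {..N}" "length (mlist u) = k" using u by (auto simp: mons_def set_mlist length_mlist)
  have hu: "hu \<in> module_hom B Km.\<Omega> Tm.T"
  proof -
    \<comment> \<open>The head 0 is a placeholder for the slot that \<open>hu\<close>
      overwrites.\<close>
    have g: "map (\<lambda>j. dx j) (0 # mlist u) \<in> Sm.gens" using ul m by (intro dx_gens) auto
    show ?thesis
      using module_hom_comp[OF Sm.sp_slot_hom[OF g, of 0] te_wL] m unfolding hu_def by simp
  qed
  have evs: "ev (s j) = hu (dx j)" if "j \<in> {..N}" for j
  proof -
    have "s j = expo (j # mlist u)" by (simp add: expo_Cons expo_mlist s_def)
    then show ?thesis using ev_expo[of "j # mlist u"] ul m that by (simp add: hu_def)
  qed
  let ?q = "\<lambda>j. X powi (- n) * (a j * b)"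
  have q: "?q j \<in> germs 0" for j by (rule coeff_germ[OF ab])
  have "eps (al i * Poly_Mapping.single u b) = lc Tm.T (mons N m) ev (\<lambda>t. \<Sum>j\<in>{..N}. if t = s j then ?q j else 0)"
    unfolding eps_def lk sum_distrib_left by (simp add: if_distrib[of "\<lambda>x. _ * x"] cong: if_cong)
  also have "\<dots> = lc Tm.T {..N} (\<lambda>j. ev (s j)) ?q"
    by (rule t_lc_reindex) (use s q in auto)
  also have "\<dots> = lc Tm.T {..N} (\<lambda>j. hu (dx j)) ?q"
    unfolding lc_def using evs ev_closed[OF s] csB[OF q] by (intro TM.M.finsum_cong') auto
  also have "\<dots> = hu (lc Km.\<Omega> {..N} (\<lambda>j. dx j) ?q)"
    by (rule om_lc_hom[OF Tm.module_tensor hu q, symmetric])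
  also have "lc Km.\<Omega> {..N} (\<lambda>j. dx j) ?q = \<zero>\<^bsub>Km.\<Omega>\<^esub>"
  proof -
    define f where "f = fr (P i) / X ^ d i"
    \<comment> \<open>The factor that turns the coefficients X_r times the derivatives of
      P_i/X_r^(d_i) into those of \<alpha>(P_i) b, moved to twist 0.\<close>
    define y where "y = X powi (- n) * (X powi (int (d i) - 1) * (b * inverse (of_nat (d i))))"
    have fJ: "f \<in> J 0"
      using J_mult_right[OF P_J[OF i] X_power[of "- int (d i)"]] by (simp add: f_def divide_inverse power_int_minus)
    have f0: "f \<in> germs 0" using fJ J_subset by blast
    have y: "y \<in> germs 0"
      using germs_mult[OF X_power[of "- n"] germs_mult[OF X_power[of "int (d i) - 1"] germs_mult[OF b germs_inverse_of_nat]]]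
      unfolding y_def by simp
    have Xd: "X powi (int (d i) - 1) * X = X ^ d i"
      using power_int_add[of X "int (d i) - 1" 1] X_nz by simp
    have "lc Km.\<Omega> {..N} (\<lambda>j. dx j) ?q = lc Km.\<Omega> {..N} (\<lambda>j. dx j) (\<lambda>j. y * (X * rderiv j f))"
    proof (rule om_lc_cong)
      show "?q j \<in> germs 0" for j by (rule q)
      show "y * (X * rderiv j f) \<in> germs 0" for j by (rule germs_mult0[OF y X_rderiv_germs[OF f0]])
      fix j assume "dx j \<noteq> \<zero>\<^bsub>Km.\<Omega>\<^esub>"
      \<comment> \<open>Away from r the denominator X_r^(d_i) is constant for the derivative; at r
        the vector dx_r vanishes.\<close>
      then have jr: "j \<noteq> r" using dx_r by blast
      have "fr (P i) = f * X ^ d i" using X_nz by (simp add: f_def)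
      then have "fr (partial j (P i)) = rderiv j (f * X ^ d i)" using rderiv_fr[of j "P i"] by simp
      then have pj: "fr (partial j (P i)) = rderiv j f * X ^ d i" by (simp add: rderiv_mult rderiv_X_power[OF jr])
      have "y * (X * rderiv j f) = X powi (- n) * ((X powi (int (d i) - 1) * X) * rderiv j f * inverse (of_nat (d i)) * b)"
        unfolding y_def by (simp add: mult_ac)
      also have "\<dots> = ?q j" unfolding Xd a_def pj by (simp add: divide_inverse mult_ac)
      finally show "?q j - y * (X * rderiv j f) \<in> J 0" using addsubD(1)[OF addsub_J] by simp
    qed
    also have "\<dots> = cs (J 0) y \<odot>\<^bsub>Km.\<Omega>\<^esub> dd f"
      unfolding dd_tot[OF f0] tot_def by (rule om_lc_smult[OF y X_rderiv_germs[OF f0]])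
    also have "dd f = \<zero>\<^bsub>Km.\<Omega>\<^esub>"
    proof -
      have "cs (J 0) f = cs (J 0) (fr (cst 0))" using fJ by (simp add: cs_eq_self[OF addsub_J])
      then show ?thesis using dd_const[of 0] by simp
    qed
    finally show ?thesis using csB[OF y] by simp
  qed
  also have "hu \<zero>\<^bsub>Km.\<Omega>\<^esub> = \<zero>\<^bsub>Tm.T\<^esub>" by (rule module_hom_zero[OF Km.module_kaehler Tm.module_tensor hu])
  finally show ?thesis using cfF by (simp add: kern_def)
qed

lemma Im_kern:
  assumes "F \<in> Im m n" shows "F \<in> kern"
proof -
  from assms obtain G where G: "\<forall>i\<in>{1..c}. G i \<in> kpred m (n - (int (d i) - 1))" "F - (\<Sum>i\<in>{1..c}. al i * G i) \<in> H m n"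
    unfolding Im_def by (elim CollectE exE conjE) (rule that)
  have "al i * G i \<in> kern" if i: "i \<in> {1..c}" for i
  proof (cases m)
    case 0
    then show ?thesis using bspec[OF G(1) i] addsubD(1)[OF addsub_kern] by (simp add: kpred_def)
  next
    case (Suc k)
    then have "G i \<in> bihom k (n - (int (d i) - 1))" using bspec[OF G(1) i] by (simp add: kpred_def kd_bihom)
    then have Gi: "G i \<in> hpoly N k" "\<And>u. Poly_Mapping.lookup (G i) u \<in> germs (n - (int (d i) - 1))" by (auto simp: bihom_iff)
    have "al i * G i = (\<Sum>u\<in>mons N k. al i * Poly_Mapping.single u (Poly_Mapping.lookup (G i) u))"
      by (subst hpoly_expand[OF Gi(1)]) (rule sum_distrib_left)
    also have "\<dots> \<in> kern"
      by (rule addsub_sum[OF addsub_kern]) (rule al_single_kern[OF i _ Suc Gi(2)])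
    finally show ?thesis .
  qed
  then have "(\<Sum>i\<in>{1..c}. al i * G i) \<in> kern" by (rule addsub_sum[OF addsub_kern])
  from addsubD(2)[OF addsub_kern H_kern[OF G(2)] this] show ?thesis by simp
qed

lemma kd_cf: "F \<in> kd m n \<Longrightarrow> cf F"
  by (auto dest!: kd_bihom simp: bihom_iff)

text \<open>Each of the m factors dx_j becomes z_j/X_r, and these powers of X_r reduce the exponent
  m + n to n.\<close>

lemma psi_ev:
  assumes "spec \<psi>" and t: "t \<in> mons N m"
  shows "\<psi> (ev t) = cs (Im m n) (cst (X powi n) * zpow r t)"
proof -
  let ?fs = "map (\<lambda>j. x_germ j) (mlist t)"
  have fs: "set ?fs \<subseteq> germs 0" "length ?fs = m" using mons_mlist[OF t] x_germ by auto
  have "\<psi> (Tm.te (Sm.sp (map dd ?fs)) (cs (J (int m + n)) (X powi (int m + n)))) = cs (Im m n) (cst (X powi (int m + n)) * prod_list (map (dY N) ?fs))"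
    using assms(1) fs X_power unfolding spec_def by blast
  then have 1: "\<psi> (ev t) = cs (Im m n) (cst (X powi (int m + n)) * prod_list (map (dY N) ?fs))"
    unfolding ev_def wL_def by (simp add: comp_def)
  have "prod_list (map (dY N) (map (\<lambda>j. x_germ j) js)) = cst (inverse X ^ length js) * prod_list (map (zv r) js)"
    if "set js \<subseteq> {..N}" for js
    using that
  proof (induction js)
    case (Cons j js)
    then show ?case by (simp add: dY_x cst_mult mult_ac)
  qed simp
  from this[of "mlist t"] mons_mlist[OF t]
  have 2: "prod_list (map (dY N) ?fs) = cst (inverse X ^ m) * zpow r t" by (simp add: zpow_def)
  have "X powi (int m + n) * inverse X ^ m = X powi n"
    using power_int_add[of X "int m" n] X_nz by (simp add: power_inverse)
  then show ?thesis unfolding 1 2 mult.assoc[symmetric] cst_mult[symmetric] by simp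
qed

text \<open>Inserting the values on monomials produces the substitution of z for Y in F, which is F
  itself on Ker delta. So the augmentation is injective modulo \<open>Im\<close>.\<close>

lemma psi_eps:
  assumes sp: "spec \<psi>" and F: "F \<in> kd m n"
  shows "\<psi> (eps F) = cs (Im m n) F"
proof -
  interpret QM: Module.module B Qm.Q by (rule Qm.module_Q)
  have h: "\<psi> \<in> module_hom B Tm.T Qm.Q" using sp by (simp add: spec_def)
  have co: "X powi (- n) * Poly_Mapping.lookup F t \<in> germs 0" for t using kd_cf[OF F] by (intro coeff_germ) simp
  have zk: "cst (X powi n) * zpow r t \<in> kd m n" if "t \<in> mons N m" for t
    using kd_cst_mult[OF X_power zpow_kd[OF that]] by simp
  have "\<psi> (eps F) = lc Qm.Q (mons N m) (\<lambda>t. \<psi> (ev t)) (\<lambda>t. X powi (- n) * Poly_Mapping.lookup F t)"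
    unfolding eps_def by (rule t_lc_hom[OF Qm.module_Q h co])
  also have "\<dots> = (\<Oplus>\<^bsub>Qm.Q\<^esub>t\<in>mons N m. cs (Im m n) (cst (Poly_Mapping.lookup F t) * zpow r t))"
    unfolding lc_def
  proof (rule QM.M.finsum_cong')
    fix t assume t: "t \<in> mons N m"
    have e: "cst (X powi (- n) * Poly_Mapping.lookup F t) * (cst (X powi n) * zpow r t) = cst (Poly_Mapping.lookup F t) * zpow r t"
      unfolding mult.assoc[symmetric] cst_mult[symmetric] using X_power_cancel[of n] by (simp add: mult_ac)
    show "cs (J 0) (X powi (- n) * Poly_Mapping.lookup F t) \<odot>\<^bsub>Qm.Q\<^esub> \<psi> (ev t) = cs (Im m n) (cst (Poly_Mapping.lookup F t) * zpow r t)"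
      unfolding psi_ev[OF sp t] Qm.smult_cs[OF co zk[OF t]] by (rule arg_cong[OF e])
  next
    show "(\<lambda>t. cs (Im m n) (cst (Poly_Mapping.lookup F t) * zpow r t)) \<in> mons N m \<rightarrow> carrier Qm.Q"
      using kd_cst_mult[OF _ zpow_kd, of _ n _ m] kd_cf[OF F] by auto
  qed simp
  also have "\<dots> = cs (Im m n) (zsubst N r m F)"
    unfolding zsubst_def using kd_cst_mult[OF _ zpow_kd, of _ n _ m] kd_cf[OF F] by (intro Qm.finsum_Q) auto
  also have "zsubst N r m F = F" by (rule taylor[OF F])
  finally show ?thesis .
qed

lemma eps_image: "submodule (eps ` kd m n) B Tm.T"
proof (rule TM.submoduleI)
  show "eps ` kd m n \<subseteq> carrier Tm.T" using eps_closed kd_cf by blast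
  show "\<zero>\<^bsub>Tm.T\<^esub> \<in> eps ` kd m n" using imageI[OF addsubD(1)[OF addsub_kd], of eps] by (simp add: eps_0)
  fix x assume "x \<in> eps ` kd m n"
  then obtain F where F: "F \<in> kd m n" "x = eps F" by blast
  have mF: "- F \<in> kd m n" using addsubD(3)[OF addsub_kd F(1)] .
  have "eps (- F) \<oplus>\<^bsub>Tm.T\<^esub> eps F = \<zero>\<^bsub>Tm.T\<^esub>"
    using eps_add[OF kd_cf[OF mF] kd_cf[OF F(1)]] by (simp add: eps_0)
  from TM.M.minus_equality[OF this eps_closed[OF kd_cf[OF F(1)]] eps_closed[OF kd_cf[OF mF]]]
  show "\<ominus>\<^bsub>Tm.T\<^esub> x \<in> eps ` kd m n" using mF unfolding F(2) by simp
  show "x \<oplus>\<^bsub>Tm.T\<^esub> y \<in> eps ` kd m n" if "y \<in> eps ` kd m n" for y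
  proof -
    from that obtain G where G: "G \<in> kd m n" "y = eps G" by blast
    show ?thesis unfolding F(2) G(2) eps_add[OF kd_cf[OF F(1)] kd_cf[OF G(1)], symmetric]
      by (rule imageI[OF addsubD(2)[OF addsub_kd F(1) G(1)]])
  qed
  show "a \<odot>\<^bsub>Tm.T\<^esub> x \<in> eps ` kd m n" if a: "a \<in> carrier B" for a
  proof -
    from a obtain b where b: "b \<in> germs 0" "a = cs (J 0) b" by (auto simp: B_carrier)
    have "cst b * F \<in> kd m n" using kd_cst_mult[OF b(1) F(1)] by simp
    from imageI[OF this, of eps] show ?thesis unfolding F(2) b(2) eps_smult[OF b(1) kd_cf[OF F(1)]] .
  qed
qed

lemma ev_image:
  assumes js: "set js \<subseteq> {..N}" "length js = m"
  shows "Tm.te (Sm.sp (map (\<lambda>j. dx j) js)) wL \<in> eps ` kd m n"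
proof -
  let ?t = "expo js" and ?G = "Poly_Mapping.single (expo js) (X powi n) :: ratfun mpoly"
  have t: "?t \<in> mons N m" using js by (simp add: mons_def keys_expo mdeg_expo)
  have cG: "cf ?G" using X_power[of n] by (simp add: lookup_single when_def)
  \<comment> \<open>The monomial itself need not lie in Ker delta. Its substitution does, and it has
    the same image because the two differ by a multiple of Y_r.\<close>
  have F: "zsubst N r m ?G \<in> kd m n" using cG by (intro zsubst_kd) simp
  have hG: "?G \<in> hpoly N m" using t by (intro hpoly_single) (auto simp: mons_def)
  have "eps (zsubst N r m ?G) = eps ?G"
  proof (rule eps_cong[OF kd_cf[OF F] cG])
    fix s :: "nat \<Rightarrow>\<^sub>0 nat" assume "Poly_Mapping.lookup s r = 0"
    from var_dvd_lookup[OF zsubst_dvd[OF hG, of r] this] show "Poly_Mapping.lookup (zsubst N r m ?G) s = Poly_Mapping.lookup ?G s"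
      by (simp add: lookup_minus)
  qed
  also have "\<dots> = ev ?t"
    unfolding eps_single[OF t X_power] X_power_cancel B_one[symmetric] using ev_closed[OF t] by (rule TM.smult_one)
  finally have "ev ?t \<in> eps ` kd m n" using imageI[OF F, of eps] by simp
  then show ?thesis unfolding ev_expo[OF js] .
qed

text \<open>The differentials in \<open>as\<close> are arbitrary, the later ones are of the form
  dx_j. By linearity in the first slot and the chain rule, the head of \<open>as\<close> is reduced
  to the dx_j and moved to the end.\<close>

lemma sp_image:
  assumes "set as \<subseteq> carrier Km.\<Omega>" "set js \<subseteq> {..N}" "length as + length js = m"
  shows "Tm.te (Sm.sp (as @ map (\<lambda>j. dx j) js)) wL \<in> eps ` kd m n"
  using assms
proof (induction as arbitrary: js)
  case Nil
  then show ?case using ev_image by simp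
next
  case (Cons a as)
  have a: "a \<in> carrier Km.\<Omega>" using Cons.prems by simp
  let ?h = "\<lambda>x. Tm.te (Sm.sp (x # as @ map (\<lambda>j. dx j) js)) wL"
  have g: "a # as @ map (\<lambda>j. dx j) js \<in> Sm.gens"
    using Cons.prems dx_closed by (auto simp: sym_gens_def)
  have h: "?h \<in> module_hom B Km.\<Omega> Tm.T"
    using module_hom_comp[OF Sm.sp_slot_hom[OF g, of 0] te_wL] Cons.prems(3) by simp
  have K: "submodule {x \<in> carrier Km.\<Omega>. ?h x \<in> eps ` kd m n} B Km.\<Omega>"
    by (rule Sm.M.submodule_vimage[OF Tm.module_tensor h eps_image])
  have dxK: "dx j \<in> {x \<in> carrier Km.\<Omega>. ?h x \<in> eps ` kd m n}" if j: "j \<in> {..N}" for j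
  proof -
    have "Tm.te (Sm.sp (as @ map (\<lambda>j. dx j) (j # js))) wL \<in> eps ` kd m n"
      using Cons.prems j by (intro Cons.IH) auto
    moreover have "Sm.sp (dx j # as @ map (\<lambda>j. dx j) js) = Sm.sp (as @ map (\<lambda>j. dx j) (j # js))"
      using Cons.prems dx_closed j by (intro Sm.sp_mset) (auto simp: sym_gens_def)
    ultimately show ?thesis using dx_closed[OF j] by simp
  qed
  have "carrier Km.\<Omega> \<subseteq> {x \<in> carrier Km.\<Omega>. ?h x \<in> eps ` kd m n}"
  proof (rule Km.kaehler_generated[OF K])
    fix b assume "b \<in> carrier B"
    then obtain f where f: "f \<in> germs 0" "b = cs (J 0) f" by (auto simp: B_carrier)
    have "tot f \<in> {x \<in> carrier Km.\<Omega>. ?h x \<in> eps ` kd m n}"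
      unfolding tot_def by (rule om_lc_submodule[OF K dxK X_rderiv_germs[OF f(1)]])
    then show "Km.d b \<in> {x \<in> carrier Km.\<Omega>. ?h x \<in> eps ` kd m n}"
      unfolding f(2) dd_tot[OF f(1)] .
  qed
  with a show ?case by auto
qed

lemma eps_surj: "eps ` kd m n = carrier Tm.T"
proof
  show "eps ` kd m n \<subseteq> carrier Tm.T" using eps_closed kd_cf by blast
  have K: "submodule {s \<in> carrier Sm.S. Tm.te s wL \<in> eps ` kd m n} B Sm.S"
    by (rule Tm.M.submodule_vimage[OF Tm.module_tensor te_wL eps_image])
  have "carrier Sm.S \<subseteq> {s \<in> carrier Sm.S. Tm.te s wL \<in> eps ` kd m n}"
  proof (rule Sm.sym_generated[OF K])
    fix xs assume xs: "xs \<in> Sm.gens"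
    then have "Tm.te (Sm.sp xs) wL \<in> eps ` kd m n"
      using sp_image[of xs "[]"] by (simp add: sym_gens_def)
    then show "Sm.sp xs \<in> {s \<in> carrier Sm.S. Tm.te s wL \<in> eps ` kd m n}" using Sm.sp_closed[OF xs] by simp
  qed
  then have sK: "Tm.te s wL \<in> eps ` kd m n" if "s \<in> carrier Sm.S" for s using that by blast
  show "carrier Tm.T \<subseteq> eps ` kd m n"
  proof (rule Tm.tensor_generated[OF eps_image])
    fix s y assume s: "s \<in> carrier Sm.S" and "y \<in> carrier Lm.Q"
    then obtain u where u: "u \<in> germs (int m + n)" "y = cs (J (int m + n)) u" by auto
    \<comment> \<open>Since \<open>wL\<close> generates the rank one factor, any second tensor
      factor is a scalar times \<open>wL\<close>.\<close>
    let ?b = "X powi (- (int m + n)) * u"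
    have b: "?b \<in> germs 0" using germs_mult[OF X_power[of "- (int m + n)"] u(1)] by simp
    have "?b * X powi (int m + n) = u"
      using X_power_cancel[of "int m + n"] by (metis mult.assoc mult.commute mult_1)
    then have "y = cs (J 0) ?b \<odot>\<^bsub>Lm.Q\<^esub> wL"
      unfolding wL_def u(2) Lm.smult_cs[OF b X_power] by (rule arg_cong[OF sym])
    then have "Tm.te s y = cs (J 0) ?b \<odot>\<^bsub>Tm.T\<^esub> Tm.te s wL"
      using Tm.te_smult_right[OF s wL_closed csB[OF b]] by simp
    then show "Tm.te s y \<in> eps ` kd m n"
      using TM.submoduleE(4)[OF eps_image csB[OF b] sK[OF s]] by simp
  qed
qed

text \<open>The kernel is pinned from both sides: the inverse map bounds it by \<open>Im\<close>,
  and \<open>Im_kern\<close> gives the converse.\<close>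

lemma eps_eq_iff:
  assumes F: "F \<in> kd m n" "G \<in> kd m n"
  shows "eps F = eps G \<longleftrightarrow> F - G \<in> Im m n"
proof
  obtain \<psi> where sp: "spec \<psi>" using ex_spec ..
  assume "eps F = eps G"
  then have "cs (Im m n) F = cs (Im m n) G" using psi_eps[OF sp F(1)] psi_eps[OF sp F(2)] by simp
  then show "F - G \<in> Im m n" by (simp add: cs_eq_iff[OF addsub_Im])
next
  assume "F - G \<in> Im m n"
  then have FG: "cf (F - G)" "eps (F - G) = \<zero>\<^bsub>Tm.T\<^esub>" using Im_kern by (auto simp: kern_def)
  then show "eps F = eps G"
    using eps_add[OF FG(1) kd_cf[OF F(2)]] eps_closed[OF kd_cf[OF F(2)]] by simp
qed

end

section \<open>Independence of the chart\<close>

context ci_tens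
begin

text \<open>Described through the inverse map, so that the choice of a chart does not enter.\<close>

definition aug :: "ratfun mpoly set \<Rightarrow> (_ \<times> ratfun set \<Rightarrow> ratfun set) set" where
  "aug x = (THE t. t \<in> carrier Tm.T \<and> (\<exists>F\<in>kd m n. x = cs (H m n) F \<and> (SOME \<psi>. spec \<psi>) t = cs (Im m n) F))"

text \<open>Existence is \<open>psi_eps\<close>. For uniqueness, surjectivity writes any candidate
  as \<open>eps G\<close>, and the inverse map determines G modulo \<open>Im\<close>, hence
  \<open>eps G\<close>. The description of \<open>aug\<close> contains no r, so all charts give the
  same value.\<close>

lemma aug_eps:
  assumes ch: "chart N p r" and F: "F \<in> kd m n"
  shows "aug (cs (H m n) F) = ci_aug.eps N c d P p m n r F"
proof -
  interpret chart N p r by (rule ch)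
  interpret ci_aug N c d P p m n r by unfold_locales
  have sp: "spec (SOME \<psi>. spec \<psi>)" using someI_ex[OF ex_spec] .
  show ?thesis
    unfolding aug_def
  proof (rule the_equality)
    show "eps F \<in> carrier Tm.T \<and> (\<exists>F'\<in>kd m n. cs (H m n) F = cs (H m n) F' \<and> (SOME \<psi>. spec \<psi>) (eps F) = cs (Im m n) F')"
      using eps_closed[OF kd_cf[OF F]] F psi_eps[OF sp F] by blast
    fix t assume "t \<in> carrier Tm.T \<and> (\<exists>F'\<in>kd m n. cs (H m n) F = cs (H m n) F' \<and> (SOME \<psi>. spec \<psi>) t = cs (Im m n) F')"
    then obtain F' where t: "t \<in> carrier Tm.T" and F': "F' \<in> kd m n" "cs (H m n) F = cs (H m n) F'" "(SOME \<psi>. spec \<psi>) t = cs (Im m n) F'"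
      by blast
    from t obtain G where G: "G \<in> kd m n" "t = eps G" using eps_surj by blast
    have "cs (Im m n) G = cs (Im m n) F'" using psi_eps[OF sp G(1)] F'(3) unfolding G(2) by simp
    then have "G - F' \<in> Im m n" by (simp add: cs_eq_iff[OF addsub_Im])
    moreover have "F - F' \<in> Im m n" using F'(2) by (intro H_Im) (simp add: cs_eq_iff[OF addsub_H])
    ultimately have "G - F \<in> Im m n" using addsubD(4)[OF addsub_Im] by fastforce
    then show "t = eps F" unfolding G(2) eps_eq_iff[OF G(1) F] .
  qed
qed

end

section \<open>The augmentation as a map of sheaves\<close>

text \<open>A generator is a combination of length one whose coefficient is the unit
  section.\<close>

lemma generated_sections_generator:
  assumes V: "openin (space_top X) V" and g: "g \<in> G V" "g \<in> (\<Pi>\<^sub>E q\<in>V. carrier (M q))"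
    and M: "\<And>q. q \<in> V \<Longrightarrow> Module.module (str_stalk X q) (M q)"
    and one: "(\<lambda>q\<in>V. \<one>\<^bsub>str_stalk X q\<^esub>) \<in> str_sections X V"
  shows "g \<in> generated_sections X M G V"
  unfolding generated_sections_def
proof (intro CollectI conjI ballI g(2))
  fix p assume p: "p \<in> V"
  have "g q = (\<Oplus>\<^bsub>M q\<^esub>j\<in>{..<1::nat}. (\<lambda>q\<in>V. \<one>\<^bsub>str_stalk X q\<^esub>) q \<odot>\<^bsub>M q\<^esub> g q)" if q: "q \<in> V" for q
  proof -
    interpret M: Module.module "str_stalk X q" "M q" by (rule M[OF q])
    have c: "g q \<in> carrier (M q)" by (rule PiE_mem[OF g(2) q])
    have "(\<Oplus>\<^bsub>M q\<^esub>j\<in>insert (0::nat) {}. g q) = g q \<oplus>\<^bsub>M q\<^esub> (\<Oplus>\<^bsub>M q\<^esub>j\<in>({} :: nat set). g q)"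
      using c by (intro M.M.finsum_insert) auto
    moreover have "{..<1} = {0 :: nat}" by auto
    ultimately show ?thesis using q c by simp
  qed
  note sum = this
  show "\<exists>W (r::nat) a h. openin (space_top X) W \<and> p \<in> W \<and> W \<subseteq> V \<and> (\<forall>j<r. a j \<in> str_sections X W \<and> h j \<in> G W)
      \<and> (\<forall>q\<in>W. g q = (\<Oplus>\<^bsub>M q\<^esub>j\<in>{..<r}. a j q \<odot>\<^bsub>M q\<^esub> h j q))"
    by (rule exI[of _ V], rule exI[of _ "1::nat"], rule exI[of _ "\<lambda>_. \<lambda>q\<in>V. \<one>\<^bsub>str_stalk X q\<^esub>"], rule exI[of _ "\<lambda>_. g"])
      (intro conjI V p subset_refl allI impI one g(1) ballI sum)
qed

lemma koszul_index_0: "koszul_index c 0 = {{}}"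
  by (auto simp: koszul_index_def dest: finite_subset)

lemma koszul_shift_empty [simp]: "koszul_shift d n {} = n"
  by (simp add: koszul_shift_def)

section \<open>Stalks and sections of the twisted symmetric power of the cotangent sheaf\<close>

context ci
begin

abbreviation "Jc n q \<equiv> J_germs N c d P n q"
abbreviation "kX q \<equiv> {ideal_germs N c d P q +>\<^bsub>str_stalk (proj_space N) q\<^esub> Fract (Poly_Mapping.single 0 z) 1 | z. True}"
abbreviation "Bq q \<equiv> conc_ring (twist_germs N 0 q) Quot Jc 0 q"
abbreviation "cotX \<equiv> cotangent_X N c d P"
abbreviation "symX m \<equiv> sym_power_sheaf XX m cotX"
abbreviation "tX m n \<equiv> twist_X N c d P (symX m) (int m + n)"

lemma kX: "q \<in> Zl \<Longrightarrow> kX q = ci_point.kc N c d P q"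
proof -
  assume "q \<in> Zl"
  then interpret ci_point N c d P q by (rule ci_point)
  show ?thesis by (auto simp: kc_def rcos_plus str_stalk_proj J_ideal_germs fr_def)
qed

lemma stalk_cot: "q \<in> Zl \<Longrightarrow> stalk cotX q = kaehler (Bq q) (ci_point.kc N c d P q)"
  unfolding cotangent_X_def cotangent_sheaf_def mod_sheaf.select_convs by (simp only: str_stalk_X kX)

lemma stalk_symX: "q \<in> Zl \<Longrightarrow> stalk (symX m) q = sym_module (Bq q) (kaehler (Bq q) (ci_point.kc N c d P q)) m"
  unfolding sym_power_sheaf_def mod_sheaf.select_convs by (simp only: str_stalk_X stalk_cot)

lemma stalk_tX: "q \<in> Zl \<Longrightarrow> stalk (tX m n) q = tensor_module (Bq q) (sym_module (Bq q) (kaehler (Bq q) (ci_point.kc N c d P q)) m)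
    (cosmod (twist_germs N (int m + n) q) (Jc (int m + n) q) (*))"
  unfolding twist_X_def tensor_sheaf_def mod_sheaf.select_convs by (simp only: str_stalk_X stalk_symX stalk_twist_X)

lemma const_section:
  assumes V: "openin (space_top XX) V" and f: "\<And>q. q \<in> V \<Longrightarrow> f \<in> twist_germs N 0 q"
  shows "(\<lambda>q\<in>V. cs (Jc 0 q) f) \<in> str_sections XX V"
  unfolding str_sections_X[OF V]
proof (rule coset_sectionsI)
  fix p assume p: "p \<in> V"
  show "\<exists>F. nearby N p (\<lambda>q. q \<in> Zl \<longrightarrow> q \<in> V \<and> F \<in> twist_germs N 0 q \<and> (\<lambda>q\<in>V. cs (Jc 0 q) f) q = cs (Jc 0 q) F)"
    by (rule exI[of _ f], rule nearby_mono[OF openin_X_nearby[OF V p]]) (use f in auto)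
qed simp

lemma const_twist_section:
  assumes V: "openin (space_top XX) V" and f: "\<And>q. q \<in> V \<Longrightarrow> f \<in> twist_germs N k q"
  shows "(\<lambda>q\<in>V. cs (Jc k q) f) \<in> sections (restrict_to_X N c d P (twisting_sheaf N k)) V"
  unfolding sections_twist[OF openin_X_subset[OF V]]
proof (rule coset_sectionsI)
  fix p assume p: "p \<in> V"
  show "\<exists>F. nearby N p (\<lambda>q. q \<in> Zl \<longrightarrow> q \<in> V \<and> F \<in> twist_germs N k q \<and> (\<lambda>q\<in>V. cs (Jc k q) f) q = cs (Jc k q) F)"
    by (rule exI[of _ f], rule nearby_mono[OF openin_X_nearby[OF V p]]) (use f in auto)
qed simp

lemma one_section:
  assumes V: "openin (space_top XX) V"
  shows "(\<lambda>q\<in>V. \<one>\<^bsub>str_stalk XX q\<^esub>) \<in> str_sections XX V"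
proof -
  have "\<one>\<^bsub>str_stalk XX q\<^esub> = cs (Jc 0 q) 1 \<and> 1 \<in> twist_germs N 0 q" if q: "q \<in> V" for q
  proof -
    have qZ: "q \<in> Zl" using openin_X_subset[OF V] q by blast
    interpret ci_point N c d P q by (rule ci_point[OF qZ])
    show ?thesis unfolding str_stalk_X[OF qZ] B_one by simp
  qed
  moreover from this have "(\<lambda>q\<in>V. cs (Jc 0 q) 1) \<in> str_sections XX V" by (intro const_section[OF V]) simp
  moreover have "(\<lambda>q\<in>V. \<one>\<^bsub>str_stalk XX q\<^esub>) = (\<lambda>q\<in>V. cs (Jc 0 q) 1)"
    using calculation(1) by (intro restrict_ext) simp
  ultimately show ?thesis by simp
qed

lemma cot_section:
  assumes V: "openin (space_top XX) V" and f: "\<And>q. q \<in> V \<Longrightarrow> f \<in> twist_germs N 0 q"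
  shows "(\<lambda>q\<in>V. kaehler_d (Bq q) (ci_point.kc N c d P q) (cs (Jc 0 q) f)) \<in> sections cotX V"
proof -
  have VZ: "q \<in> Zl" if "q \<in> V" for q using openin_X_subset[OF V] that by blast
  have "(\<lambda>q\<in>V. kaehler_d (Bq q) (ci_point.kc N c d P q) (cs (Jc 0 q) f))
    \<in> generated_sections XX (\<lambda>p. kaehler (str_stalk XX p) (kX p)) (\<lambda>V. {\<lambda>p\<in>V. kaehler_d (str_stalk XX p) (kX p) (g p) | g. g \<in> str_sections XX V}) V"
  proof (rule generated_sections_generator[OF V _ _ _ one_section[OF V]])
    show "(\<lambda>q\<in>V. kaehler_d (Bq q) (ci_point.kc N c d P q) (cs (Jc 0 q) f)) \<in> {\<lambda>p\<in>V. kaehler_d (str_stalk XX p) (kX p) (g p) | g. g \<in> str_sections XX V}"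
      by (rule CollectI, rule exI[of _ "\<lambda>q\<in>V. cs (Jc 0 q) f"], rule conjI[OF _ const_section[OF V f]], rule restrict_ext)
        (simp_all only: str_stalk_X kX VZ restrict_apply' if_True)
    fix q assume q: "q \<in> V"
    interpret ci_point N c d P q by (rule ci_point[OF VZ[OF q]])
    interpret ci_tens N c d P q 0 0 by unfold_locales
    show "Module.module (str_stalk XX q) (kaehler (str_stalk XX q) (kX q))"
      unfolding str_stalk_X[OF VZ[OF q]] kX[OF VZ[OF q]] by (rule Km.module_kaehler)
  next
    have "kaehler_d (Bq q) (ci_point.kc N c d P q) (cs (Jc 0 q) f) \<in> carrier (kaehler (str_stalk XX q) (kX q))" if q: "q \<in> V" for q
    proof -
      interpret ci_point N c d P q by (rule ci_point[OF VZ[OF q]])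
      interpret ci_tens N c d P q 0 0 by unfold_locales
      show ?thesis unfolding str_stalk_X[OF VZ[OF q]] kX[OF VZ[OF q]] by (rule dd_closed[OF f[OF q]])
    qed
    then show "(\<lambda>q\<in>V. kaehler_d (Bq q) (ci_point.kc N c d P q) (cs (Jc 0 q) f)) \<in> (\<Pi>\<^sub>E q\<in>V. carrier (kaehler (str_stalk XX q) (kX q)))"
      by (intro restrict_PiE_iff[THEN iffD2] ballI)
  qed
  then show ?thesis unfolding cotangent_X_def cotangent_sheaf_def mod_sheaf.select_convs .
qed

lemma sym_section:
  assumes V: "openin (space_top XX) V" and fs: "\<And>q f. q \<in> V \<Longrightarrow> f \<in> set fs \<Longrightarrow> f \<in> twist_germs N 0 q" and l: "length fs = m"
  shows "(\<lambda>q\<in>V. sym_product (Bq q) (kaehler (Bq q) (ci_point.kc N c d P q)) m (map (\<lambda>f. kaehler_d (Bq q) (ci_point.kc N c d P q) (cs (Jc 0 q) f)) fs))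
    \<in> sections (symX m) V" (is "?s \<in> _")
proof -
  have VZ: "q \<in> Zl" if "q \<in> V" for q using openin_X_subset[OF V] that by blast
  define ss where "ss = map (\<lambda>f. \<lambda>q\<in>V. kaehler_d (Bq q) (ci_point.kc N c d P q) (cs (Jc 0 q) f)) fs"
  have ss: "set ss \<subseteq> sections cotX V"
    unfolding ss_def using cot_section[OF V fs] by auto
  have mss: "map (\<lambda>s. s q) ss = map (\<lambda>f. kaehler_d (Bq q) (ci_point.kc N c d P q) (cs (Jc 0 q) f)) fs" if "q \<in> V" for q
    unfolding ss_def using that by simp
  have "?s \<in> generated_sections XX (\<lambda>p. sym_module (str_stalk XX p) (stalk cotX p) m)
      (\<lambda>V. {\<lambda>p\<in>V. sym_product (str_stalk XX p) (stalk cotX p) m (map (\<lambda>s. s p) ss) | ss. length ss = m \<and> set ss \<subseteq> sections cotX V}) V"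
  proof (rule generated_sections_generator[OF V _ _ _ one_section[OF V]])
    have "?s = (\<lambda>p\<in>V. sym_product (str_stalk XX p) (stalk cotX p) m (map (\<lambda>s. s p) ss))"
      by (rule restrict_ext) (simp only: str_stalk_X stalk_cot VZ mss)
    moreover have "length ss = m" using l by (simp add: ss_def)
    ultimately show "?s \<in> {\<lambda>p\<in>V. sym_product (str_stalk XX p) (stalk cotX p) m (map (\<lambda>s. s p) ss) | ss. length ss = m \<and> set ss \<subseteq> sections cotX V}"
      using ss by (intro CollectI exI[of _ ss] conjI)
    fix q assume q: "q \<in> V"
    interpret ci_point N c d P q by (rule ci_point[OF VZ[OF q]])
    interpret ci_tens N c d P q m 0 by unfold_locales
    show "Module.module (str_stalk XX q) (sym_module (str_stalk XX q) (stalk cotX q) m)"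
      unfolding str_stalk_X[OF VZ[OF q]] stalk_cot[OF VZ[OF q]] by (rule Sm.module_sym)
  next
    have "sym_product (Bq q) (kaehler (Bq q) (ci_point.kc N c d P q)) m (map (\<lambda>f. kaehler_d (Bq q) (ci_point.kc N c d P q) (cs (Jc 0 q) f)) fs)
        \<in> carrier (sym_module (str_stalk XX q) (stalk cotX q) m)" if q: "q \<in> V" for q
    proof -
      interpret ci_point N c d P q by (rule ci_point[OF VZ[OF q]])
      interpret ci_tens N c d P q m 0 by unfold_locales
      show ?thesis unfolding str_stalk_X[OF VZ[OF q]] stalk_cot[OF VZ[OF q]]
        by (rule Sm.sp_closed) (use dd_closed fs[OF q] l in \<open>auto simp: sym_gens_def\<close>)
    qed
    then show "?s \<in> (\<Pi>\<^sub>E q\<in>V. carrier (sym_module (str_stalk XX q) (stalk cotX q) m))"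
      by (intro restrict_PiE_iff[THEN iffD2] ballI)
  qed
  then show ?thesis unfolding sym_power_sheaf_def mod_sheaf.select_convs .
qed

section \<open>The augmentation on the Koszul term of degree 0\<close>

definition augX :: "nat \<Rightarrow> int \<Rightarrow> cpoly set \<Rightarrow> (nat set \<Rightarrow> ratfun mpoly set) \<Rightarrow> (_ \<times> ratfun set \<Rightarrow> ratfun set) set" where
  "augX m n p s = ci_tens.aug N c d P p m n (s {})"

text \<open>In degree 0 the only index is the empty set. The expressions \<open>m - 0\<close> and
  \<open>sh n I\<close> are left unevaluated so that the facts on \<open>koszul_term\<close> apply
  literally.\<close>

abbreviation "e0 m n p F \<equiv> (\<lambda>I\<in>koszul_index c 0. cs (Hc (m - 0) (sh n I) p) F)"

lemma e0_cases:
  assumes "p \<in> Zl" "s \<in> carrier (stalk (koszul_term N c d P m n 0) p)"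
  obtains F where "F \<in> ker_delta N m n p" "s = e0 m n p F"
proof -
  obtain x where x: "\<forall>I\<in>koszul_index c 0. x I \<in> ker_delta N (m - 0) (sh n I) p"
    "s = (\<lambda>I\<in>koszul_index c 0. cs (Hc (m - 0) (sh n I) p) (x I))"
    using assms by (rule koszul_term_elem)
  have "x {} \<in> ker_delta N m n p" using x(1) by (simp add: koszul_index_0)
  moreover have "s = e0 m n p (x {})" unfolding x(2) by (rule restrict_ext) (simp add: koszul_index_0)
  ultimately show ?thesis by (rule that)
qed

lemma e0_carrier: "p \<in> Zl \<Longrightarrow> F \<in> ker_delta N m n p \<Longrightarrow> e0 m n p F \<in> carrier (stalk (koszul_term N c d P m n 0) p)"
  by (rule koszul_term_elemI) (auto simp: koszul_index_0)

lemma augX_e0: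
  assumes "p \<in> Zl" "chart N p r" "F \<in> ker_delta N m n p"
  shows "augX m n p (e0 m n p F) = ci_aug.eps N c d P p m n r F"
proof -
  interpret ci_point N c d P p by (rule ci_point) fact
  interpret ci_tens N c d P p m n by unfold_locales
  show ?thesis using aug_eps[OF assms(2,3)] by (simp add: augX_def koszul_index_0)
qed

lemma augX_hom:
  assumes pZ: "p \<in> Zl"
  shows "augX m n p \<in> module_hom (str_stalk XX p) (stalk (koszul_term N c d P m n 0) p) (stalk (tX m n) p)"
proof -
  interpret ci_point N c d P p by (rule ci_point[OF pZ])
  obtain r where ch: "chart N p r" by (rule ex_X)
  interpret chart N p r by (rule ch)
  interpret ci_aug N c d P p m n r by unfold_locales
  note au = augX_e0[OF pZ ch]
  show ?thesis
  proof (rule module_homI)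
    fix s assume "s \<in> carrier (stalk (koszul_term N c d P m n 0) p)"
    then obtain F where F: "F \<in> kd m n" "s = e0 m n p F" using e0_cases[OF pZ] by blast
    show "augX m n p s \<in> carrier (stalk (tX m n) p)"
      unfolding F(2) au[OF F(1)] stalk_tX[OF pZ] by (rule eps_closed[OF kd_cf[OF F(1)]])
    {
      fix t assume "t \<in> carrier (stalk (koszul_term N c d P m n 0) p)"
      then obtain G where G: "G \<in> kd m n" "t = e0 m n p G" using e0_cases[OF pZ] by blast
      show "augX m n p (s \<oplus>\<^bsub>stalk (koszul_term N c d P m n 0) p\<^esub> t) = augX m n p s \<oplus>\<^bsub>stalk (tX m n) p\<^esub> augX m n p t"
        unfolding F(2) G(2) koszul_term_add[OF pZ] au[OF F(1)] au[OF G(1)] au[OF addsubD(2)[OF addsub_kd F(1) G(1)]] stalk_tX[OF pZ]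
        by (rule eps_add[OF kd_cf[OF F(1)] kd_cf[OF G(1)]])
    }
    fix a assume "a \<in> carrier (str_stalk XX p)"
    then obtain b where b: "b \<in> germs 0" "a = cs (Jc 0 p) b"
      using B_carrier str_stalk_X[OF pZ] by auto
    have bF: "cst b * F \<in> kd m n" using kd_cst_mult[OF b(1) F(1)] by simp
    have F': "\<forall>I\<in>koszul_index c 0. F \<in> ker_delta N (m - 0) (sh n I) p" using F(1) by (simp add: koszul_index_0)
    show "augX m n p (a \<odot>\<^bsub>stalk (koszul_term N c d P m n 0) p\<^esub> s) = a \<odot>\<^bsub>stalk (tX m n) p\<^esub> augX m n p s"
      unfolding F(2) b(2) koszul_term_smult[OF pZ b(1) F'] au[OF F(1)] au[OF bF] stalk_tX[OF pZ]
      by (rule eps_smult[OF b(1) kd_cf[OF F(1)]])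
  qed
qed

lemma augX_surj:
  assumes pZ: "p \<in> Zl"
  shows "augX m n p ` carrier (stalk (koszul_term N c d P m n 0) p) = carrier (stalk (tX m n) p)"
proof (rule equalityI; rule subsetI)
  fix t assume "t \<in> augX m n p ` carrier (stalk (koszul_term N c d P m n 0) p)"
  then show "t \<in> carrier (stalk (tX m n) p)" using module_homD(1)[OF augX_hom[OF pZ]] by blast
next
  interpret ci_point N c d P p by (rule ci_point[OF pZ])
  obtain r where ch: "chart N p r" by (rule ex_X)
  interpret chart N p r by (rule ch)
  interpret ci_aug N c d P p m n r by unfold_locales
  fix t assume "t \<in> carrier (stalk (tX m n) p)"
  then have "t \<in> eps ` kd m n" unfolding stalk_tX[OF pZ] eps_surj .
  then obtain F where F: "F \<in> kd m n" "t = eps F" by blast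
  show "t \<in> augX m n p ` carrier (stalk (koszul_term N c d P m n 0) p)"
    unfolding F(2) augX_e0[OF pZ ch F(1), symmetric] by (rule imageI[OF e0_carrier[OF pZ F(1)]])
qed

text \<open>The differential from degree 1 is the sum of the \<alpha>(P_i) G_i over singletons, so
  its image corresponds to \<open>Im\<close>. For c = 0 the sum is empty and \<open>Im\<close> is
  the ideal multiple, that is, the zero coset.\<close>

lemma augX_kernel:
  assumes pZ: "p \<in> Zl" and cm: "c \<le> m"
  shows "(if 0 < c then koszul_diff N c d P m n (Suc 0) p ` carrier (stalk (koszul_term N c d P m n (Suc 0)) p)
          else {\<zero>\<^bsub>stalk (koszul_term N c d P m n 0) p\<^esub>})
    = {s\<in>carrier (stalk (koszul_term N c d P m n 0) p). augX m n p s = \<zero>\<^bsub>stalk (tX m n) p\<^esub>}"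
    (is "?im = ?ker")
proof -
  interpret ci_point N c d P p by (rule ci_point[OF pZ])
  obtain r where ch: "chart N p r" by (rule ex_X)
  interpret chart N p r by (rule ch)
  interpret ci_aug N c d P p m n r by unfold_locales
  have ker: "augX m n p (e0 m n p F) = \<zero>\<^bsub>stalk (tX m n) p\<^esub> \<longleftrightarrow> F \<in> Im m n" if F: "F \<in> kd m n" for F
    unfolding augX_e0[OF pZ ch F] stalk_tX[OF pZ] eps_0[symmetric]
    using eps_eq_iff[OF F addsubD(1)[OF addsub_kd]] by simp
  have e0_eq: "e0 m n p F = e0 m n p G \<longleftrightarrow> F - G \<in> H m n" for F G
    unfolding restrict_eq_iff by (simp add: koszul_index_0 cs_eq_iff[OF addsub_H])
  show ?thesis
  proof (cases "0 < c")
    case False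
    have im: "?im = {e0 m n p 0}"
      using False zero_koszul_term[OF pZ, of m n 0] by simp
    have HI: "F \<in> Im m n \<longleftrightarrow> F \<in> H m n" for F using False unfolding Im_def by simp
    show ?thesis unfolding im
    proof (rule equalityI; rule subsetI)
      have 0: "0 \<in> kd m n" "0 \<in> Im m n" using addsubD(1)[OF addsub_kd] addsubD(1)[OF addsub_Im] by auto
      fix s assume "s \<in> {e0 m n p 0}"
      then show "s \<in> ?ker" using ker[OF 0(1)] 0(2) e0_carrier[OF pZ 0(1)] by simp
    next
      fix s assume s: "s \<in> ?ker"
      then obtain F where F: "F \<in> kd m n" "s = e0 m n p F" using e0_cases[OF pZ] by blast
      with s ker[OF F(1)] HI have "F \<in> H m n" by simp
      then show "s \<in> {e0 m n p 0}" unfolding F(2) using e0_eq[of F 0] by simp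
    qed
  next
    case True
    \<comment> \<open>With an equation present m is positive, so \<open>kpred\<close> is Ker delta
      in degree m - 1 and not its default value.\<close>
    have m0: "m \<noteq> 0" using True cm by simp
    have k1: "1 \<le> Suc 0" "Suc 0 \<le> c" using True by auto
    have single: "I \<in> koszul_index c (Suc 0) \<longleftrightarrow> (\<exists>i\<in>{1..c}. I = {i})" for I
      unfolding koszul_index_def by (auto simp: card_Suc_eq)
    have shi: "sh n {i} = n - (int (d i) - 1)" for i by (simp add: koszul_shift_def)
    have D: "koszul_diff N c d P m n (Suc 0) p (\<lambda>I\<in>koszul_index c (Suc 0). cs (H (m - Suc 0) (sh n I)) (x I))
       = e0 m n p (\<Sum>i\<in>{1..c}. al i * x {i})"
      if x: "\<forall>I\<in>koszul_index c (Suc 0). x I \<in> kd (m - Suc 0) (sh n I)" for x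
    proof -
      have "kosg x {} = (\<Sum>i\<in>{1..c}. al i * x {i})"
        by (simp add: koszul_map_def koszul_sign_def)
      then have kx: "kosg x J = (\<Sum>i\<in>{1..c}. al i * x {i})" if "J \<in> koszul_index c 0" for J
        using that by (simp only: koszul_index_0 singleton_iff)
      have idx: "Suc 0 - 1 = 0" by simp
      show ?thesis
        unfolding koszul_diff_cs(1)[OF ci_chart[OF pZ ch] pZ k1 cm x] idx
        by (rule restrict_ext) (simp only: kx)
    qed
    show ?thesis
    proof (rule equalityI; rule subsetI)
      fix s assume "s \<in> ?im"
      then obtain s' where s': "s' \<in> carrier (stalk (koszul_term N c d P m n (Suc 0)) p)" "s = koszul_diff N c d P m n (Suc 0) p s'"
        using True by auto
      obtain x where x: "\<forall>I\<in>koszul_index c (Suc 0). x I \<in> kd (m - Suc 0) (sh n I)"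
        "s' = (\<lambda>I\<in>koszul_index c (Suc 0). cs (H (m - Suc 0) (sh n I)) (x I))"
        using pZ s'(1) by (rule koszul_term_elem)
      have "koszul_diff N c d P m n (Suc 0) p \<in> module_hom (str_stalk XX p) (stalk (koszul_term N c d P m n (Suc 0)) p) (stalk (koszul_term N c d P m n (Suc 0 - 1)) p)"
        by (rule koszul_diff_hom[OF pZ k1 cm])
      from module_homD(1)[OF this s'(1)] have sc: "s \<in> carrier (stalk (koszul_term N c d P m n 0) p)" by (simp add: s'(2))
      then obtain F where F: "F \<in> kd m n" "s = e0 m n p F" using e0_cases[OF pZ] by blast
      have "F - (\<Sum>i\<in>{1..c}. al i * x {i}) \<in> H m n"
        using D[OF x(1)] unfolding x(2)[symmetric] s'(2)[symmetric] F(2) e0_eq .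
      moreover have "\<forall>i\<in>{1..c}. x {i} \<in> kpred m (n - (int (d i) - 1))"
        using x(1) m0 by (auto simp: single kpred_def shi[symmetric])
      ultimately have "F \<in> Im m n" unfolding Im_def by (intro CollectI exI[of _ "\<lambda>i. x {i}"] conjI)
      then show "s \<in> ?ker" using sc ker[OF F(1)] unfolding F(2) by simp
    next
      fix s assume s: "s \<in> ?ker"
      then obtain F where F: "F \<in> kd m n" "s = e0 m n p F" using e0_cases[OF pZ] by blast
      with s ker[OF F(1)] have "F \<in> Im m n" by simp
      then obtain G where G: "\<forall>i\<in>{1..c}. G i \<in> kpred m (n - (int (d i) - 1))" "F - (\<Sum>i\<in>{1..c}. al i * G i) \<in> H m n"
        unfolding Im_def by (elim CollectE exE conjE) (rule that)
      \<comment> \<open>A family over the indices i is turned into one over the singletons.\<close>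
      define x where "x I = G (the_elem I)" for I
      have x: "\<forall>I\<in>koszul_index c (Suc 0). x I \<in> kd (m - Suc 0) (sh n I)"
        using G(1) m0 by (auto simp: single kpred_def shi x_def)
      have "s = koszul_diff N c d P m n (Suc 0) p (\<lambda>I\<in>koszul_index c (Suc 0). cs (H (m - Suc 0) (sh n I)) (x I))"
        unfolding D[OF x] F(2) e0_eq using G(2) by (simp add: x_def)
      then have "s \<in> koszul_diff N c d P m n (Suc 0) p ` carrier (stalk (koszul_term N c d P m n (Suc 0)) p)"
        by (rule image_eqI[OF _ koszul_term_elemI[OF pZ x]])
      then show "s \<in> ?im" using True by simp
    qed
  qed
qed

text \<open>Near a point one element F represents the section and one chart covers a neighbourhood.
  By independence of the chart, the coefficients of F give the augmentation at all nearby points as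
  a single finite combination of products of sections.\<close>

lemma augX_section:
  assumes U: "openin (space_top XX) U" and s: "s \<in> sections (koszul_term N c d P m n 0) U"
  shows "(\<lambda>p\<in>U. augX m n p (s p)) \<in> sections (tX m n) U"
proof -
  note UZ = openin_X_subset[OF U, THEN subsetD]
  let ?M = "\<lambda>p. tensor_module (str_stalk XX p) (stalk (symX m) p) (stalk (restrict_to_X N c d P (twisting_sheaf N (int m + n))) p)"
  let ?te = "\<lambda>p. tensor_elem (str_stalk XX p) (stalk (symX m) p) (stalk (restrict_to_X N c d P (twisting_sheaf N (int m + n))) p)"
  let ?G = "\<lambda>V. {\<lambda>p\<in>V. ?te p (s p) (t p) | s t. s \<in> sections (symX m) V \<and> t \<in> sections (restrict_to_X N c d P (twisting_sheaf N (int m + n))) V}"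
  have sp: "s q \<in> carrier (stalk (koszul_term N c d P m n 0) q)" if "q \<in> U" for q
    using s that unfolding koszul_term_def sections_direct_sum by auto
  have "{} \<in> koszul_index c 0" by (simp add: koszul_index_0)
  then have s0: "(\<lambda>p\<in>U. s p {}) \<in> coset_sections N Zl (ker_delta N m n) (Hc m n) U"
    using s unfolding koszul_term_def sections_direct_sum sections_ker_X[OF openin_X_subset[OF U]] by fastforce
  have "(\<lambda>p\<in>U. augX m n p (s p)) \<in> generated_sections XX ?M ?G U"
    unfolding generated_sections_def
  proof (intro CollectI conjI ballI)
    have "augX m n q (s q) \<in> carrier (?M q)" if q: "q \<in> U" for q
      using module_homD(1)[OF augX_hom[OF UZ[OF q]] sp[OF q]] unfolding twist_X_def tensor_sheaf_def by simp
    then show "(\<lambda>p\<in>U. augX m n p (s p)) \<in> (\<Pi>\<^sub>E p\<in>U. carrier (?M p))"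
      by (intro restrict_PiE_iff[THEN iffD2] ballI)
    fix p assume p: "p \<in> U"
    interpret pc: ci_point N c d P p by (rule ci_point[OF UZ[OF p]])
    obtain r where ch: "chart N p r" by (rule pc.ex_X)
    interpret pch: chart N p r by (rule ch)
    from coset_sectionsD(1)[OF s0 p] obtain F where
      F: "nearby N p (\<lambda>q. q \<in> Zl \<longrightarrow> q \<in> U \<and> F \<in> ker_delta N m n q \<and> (\<lambda>p\<in>U. s p {}) q = cs (Hc m n q) F)" ..
    from nearby_openin_X[OF nearby_conj[OF F pch.chart_nearby] UZ[OF p]]
    obtain V where V: "openin (space_top XX) V" "p \<in> V"
      and Vq: "\<forall>q\<in>V. (q \<in> Zl \<longrightarrow> q \<in> U \<and> F \<in> ker_delta N m n q \<and> (\<lambda>p\<in>U. s p {}) q = cs (Hc m n q) F) \<and> chart N q r"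
      by (elim exE conjE) (rule that)
    note VZ = openin_X_subset[OF V(1), THEN subsetD]
    have Vq': "q \<in> U \<and> F \<in> ker_delta N m n q \<and> (\<lambda>p\<in>U. s p {}) q = cs (Hc m n q) F" if "q \<in> V" for q
      by (rule mp[OF conjunct1[OF bspec[OF Vq that]] VZ[OF that]])
    have VU: "q \<in> U" if "q \<in> V" for q by (rule conjunct1[OF Vq'[OF that]])
    have Fq: "F \<in> ker_delta N m n q" if "q \<in> V" for q by (rule conjunct1[OF conjunct2[OF Vq'[OF that]]])
    have sq: "s q {} = cs (Hc m n q) F" if "q \<in> V" for q
      using conjunct2[OF conjunct2[OF Vq'[OF that]]] VU[OF that] by simp
    have chq: "chart N q r" if "q \<in> V" for q by (rule conjunct2[OF bspec[OF Vq that]])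
    \<comment> \<open>The combinations in \<open>generated_sections\<close> are indexed by numbers,
      so the monomials are enumerated.\<close>
    obtain h where h: "bij_betw h {0..<card (mons N m)} (mons N m)"
      using ex_bij_betw_nat_finite[OF finite_mons] by blast
    define k where "k = card (mons N m)"
    have hm: "h j \<in> mons N m" if "j < k" for j using bij_betwE[OF h] that by (simp add: k_def)
    let ?X = "fr (var r)"
    let ?w = "?X powi (int m + n)"
    let ?x = "\<lambda>j. fr (var j) / ?X"
    define a where "a j = (\<lambda>q\<in>V. cs (Jc 0 q) (?X powi (- n) * Poly_Mapping.lookup F (h j)))" for j
    define S where "S j = (\<lambda>q\<in>V. sym_product (Bq q) (kaehler (Bq q) (ci_point.kc N c d P q)) m
      (map (\<lambda>f. kaehler_d (Bq q) (ci_point.kc N c d P q) (cs (Jc 0 q) f)) (map ?x (mlist (h j)))))" for j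
    define L where "L = (\<lambda>q\<in>V. cs (Jc (int m + n) q) ?w)"
    define g where "g j = (\<lambda>q\<in>V. ?te q (S j q) (L q))" for j
    have aV: "a j \<in> str_sections XX V" for j
      unfolding a_def
    proof (rule const_section[OF V(1)])
      fix q assume q: "q \<in> V"
      interpret ci_point N c d P q by (rule ci_point[OF VZ[OF q]])
      interpret chart N q r by (rule chq[OF q])
      interpret ci_aug N c d P q m n r by unfold_locales
      show "?X powi (- n) * Poly_Mapping.lookup F (h j) \<in> germs 0" using kd_cf[OF Fq[OF q]] by (intro coeff_germ) simp
    qed
    have LV: "L \<in> sections (restrict_to_X N c d P (twisting_sheaf N (int m + n))) V"
      unfolding L_def by (rule const_twist_section[OF V(1)]) (rule chart.X_power[OF chq])
    have SV: "S j \<in> sections (symX m) V" if j: "j < k" for j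
      unfolding S_def
    proof (rule sym_section[OF V(1)])
      show "length (map ?x (mlist (h j))) = m" using hm[OF j] by (simp add: mons_def length_mlist)
      fix q f assume q: "q \<in> V" and f: "f \<in> set (map ?x (mlist (h j)))"
      have "set (mlist (h j)) \<subseteq> {..N}" using hm[OF j] by (simp add: mons_def set_mlist)
      then show "f \<in> twist_germs N 0 q" using f chart.x_germ[OF chq[OF q]] by auto
    qed
    have gV: "g j \<in> ?G V" if "j < k" for j
      unfolding g_def using SV[OF that] LV by (intro CollectI exI[of _ "S j"] exI[of _ L] conjI refl)
    have eq: "(\<lambda>p\<in>U. augX m n p (s p)) q = (\<Oplus>\<^bsub>?M q\<^esub>j\<in>{..<k}. a j q \<odot>\<^bsub>?M q\<^esub> g j q)" if q: "q \<in> V" for q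
    proof -
      note qZ = VZ[OF q]
      interpret ci_point N c d P q by (rule ci_point[OF qZ])
      interpret chart N q r by (rule chq[OF q])
      interpret ci_aug N c d P q m n r by unfold_locales
      interpret TM: Module.module B Tm.T by (rule Tm.module_tensor)
      have Mq: "?M q = Tm.T" unfolding str_stalk_X[OF qZ] stalk_symX[OF qZ] stalk_twist_X[OF qZ] ..
      have "augX m n q (s q) = eps F"
        unfolding augX_def sq[OF q] by (rule aug_eps[OF chq[OF q] Fq[OF q]])
      also have "\<dots> = (\<Oplus>\<^bsub>Tm.T\<^esub>t\<in>h ` {..<k}. cs (J 0) (X powi (- n) * Poly_Mapping.lookup F t) \<odot>\<^bsub>Tm.T\<^esub> ev t)"
        using h unfolding eps_def lc_def k_def bij_betw_def by (simp add: atLeast0LessThan)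
      also have "\<dots> = (\<Oplus>\<^bsub>Tm.T\<^esub>j\<in>{..<k}. cs (J 0) (X powi (- n) * Poly_Mapping.lookup F (h j)) \<odot>\<^bsub>Tm.T\<^esub> ev (h j))"
      proof (rule TM.M.finsum_reindex)
        show "inj_on h {..<k}" using h unfolding k_def bij_betw_def by (simp add: atLeast0LessThan)
        show "(\<lambda>t. cs (J 0) (X powi (- n) * Poly_Mapping.lookup F t) \<odot>\<^bsub>Tm.T\<^esub> ev t) \<in> h ` {..<k} \<rightarrow> carrier Tm.T"
          using hm ev_closed csB[OF coeff_germ[OF spec[OF kd_cf[OF Fq[OF q]]]]] by auto
      qed
      also have "\<dots> = (\<Oplus>\<^bsub>Tm.T\<^esub>j\<in>{..<k}. a j q \<odot>\<^bsub>Tm.T\<^esub> g j q)"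
      proof (rule TM.M.finsum_cong')
        fix j
        have "g j q = ev (h j)"
          unfolding g_def S_def L_def ev_def wL_def str_stalk_X[OF qZ] stalk_symX[OF qZ] stalk_twist_X[OF qZ] using q by (simp add: comp_def str_stalk_X[OF qZ] stalk_symX[OF qZ] stalk_twist_X[OF qZ])
        then show 1: "cs (J 0) (X powi (- n) * Poly_Mapping.lookup F (h j)) \<odot>\<^bsub>Tm.T\<^esub> ev (h j) = a j q \<odot>\<^bsub>Tm.T\<^esub> g j q"
          unfolding a_def using q by simp
      next
        have "a j q \<odot>\<^bsub>Tm.T\<^esub> g j q \<in> carrier Tm.T" if "j < k" for j
        proof -
          have "g j q = ev (h j)"
            unfolding g_def S_def L_def ev_def wL_def using q by (simp add: comp_def str_stalk_X[OF qZ] stalk_symX[OF qZ] stalk_twist_X[OF qZ])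
          moreover have "a j q \<in> carrier B"
            unfolding a_def using q csB[OF coeff_germ[OF spec[OF kd_cf[OF Fq[OF q]]]]] by simp
          ultimately show ?thesis using ev_closed[OF hm[OF that]] by simp
        qed
        then show "(\<lambda>j. a j q \<odot>\<^bsub>Tm.T\<^esub> g j q) \<in> {..<k} \<rightarrow> carrier Tm.T" by auto
      qed simp
      finally show ?thesis unfolding Mq using VU[OF q] by simp
    qed
    show "\<exists>V (r::nat) a g. openin (space_top XX) V \<and> p \<in> V \<and> V \<subseteq> U \<and> (\<forall>j<r. a j \<in> str_sections XX V \<and> g j \<in> ?G V)
      \<and> (\<forall>q\<in>V. (\<lambda>p\<in>U. augX m n p (s p)) q = (\<Oplus>\<^bsub>?M q\<^esub>j\<in>{..<r}. a j q \<odot>\<^bsub>?M q\<^esub> g j q))"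
      by (rule exI[of _ V], rule exI[of _ k], rule exI[of _ a], rule exI[of _ g],
          intro conjI V(1,2) subsetI VU allI impI aV gV ballI eq)
  qed
  then show ?thesis unfolding twist_X_def tensor_sheaf_def mod_sheaf.select_convs .
qed

lemma augX_sheaf_hom: "augX m n \<in> sheaf_hom XX (koszul_term N c d P m n 0) (tX m n)"
  unfolding sheaf_hom_def topspace_X
  by (rule CollectI, rule conjI, rule ballI, erule augX_hom, intro allI impI ballI, erule (1) augX_section)

end

theorem theorem0p0p3:
  fixes N c m :: nat and n :: int and d :: "nat \<Rightarrow> nat" and P :: "nat \<Rightarrow> cpoly"
  assumes "2 \<le> N"
    and "smooth_complete_intersection N c d P"
    and "c \<le> m"
  shows "locally_free_resolution (scheme_X N c d P) c
           (koszul_term N c d P m n) (koszul_diff N c d P m n)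
           (twist_X N c d P (sym_power_sheaf (scheme_X N c d P) m (cotangent_X N c d P)) (int m + n))"
proof -
  interpret ci N c d P by unfold_locales (rule assms(2))
  show ?thesis
    unfolding locally_free_resolution_def topspace_X
  proof (intro conjI allI impI ballI bexI[OF _ augX_sheaf_hom])
    show "locally_free XX (koszul_term N c d P m n k)" for k by (rule locally_free_koszul_term)
    show "koszul_diff N c d P m n k \<in> sheaf_hom XX (koszul_term N c d P m n k) (koszul_term N c d P m n (k - 1))" if "k \<in> {1..c}" for k
      using that assms(3) by (intro koszul_diff_sheaf_hom) auto
    fix p assume p: "p \<in> Zl"
    show "augX m n p ` carrier (stalk (koszul_term N c d P m n 0) p) = carrier (stalk (tX m n) p)"
      by (rule augX_surj[OF p])
    fix k assume k: "k \<le> c"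
    show "(if k < c then koszul_diff N c d P m n (Suc k) p ` carrier (stalk (koszul_term N c d P m n (Suc k)) p) else {\<zero>\<^bsub>stalk (koszul_term N c d P m n k) p\<^esub>})
       = (if k = 0 then {x \<in> carrier (stalk (koszul_term N c d P m n 0) p). augX m n p x = \<zero>\<^bsub>stalk (tX m n) p\<^esub>}
          else {x \<in> carrier (stalk (koszul_term N c d P m n k) p). koszul_diff N c d P m n k p x = \<zero>\<^bsub>stalk (koszul_term N c d P m n (k - 1)) p\<^esub>})"
    proof (cases "k = 0")
      case True
      then show ?thesis using augX_kernel[OF p assms(3), of n] by (simp only: True refl if_True)
    next
      case False
      then have k1: "1 \<le> k" by simp
      show ?thesis using koszul_stalk_exact[OF p k1 k assms(3), of n] unfolding if_not_P[OF False] .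
    qed
  qed
qed

end
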